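(* Let $c>1$ and $p,q,r\ge0$ with $p+q+r=1$, $p+r>0$, $q+r>0$ be fixed and let $k\in\mathbb{Z}$. Then, as processes in $t\ge 0$, $$\{(N_t^{(k)},L_t^{(k)})\}\overset{\mathrm d}{=}\Big\{\Big(N_t^{(k-1)},\;L_t^{(k-1)}+\sum_{0<s\le t}\big(e^{-(\log c)(N_s^{(k-1)}-N_{s-}^{(k-1)})}-1\big)\big(L_s^{(k-1)}-L_{s-}^{(k-1)}\big)\Big)\Big\},$$ so that $\{((1-c^{-1})N_t^{(k)},L_t^{(k)})\}$ is equal in distribution to the process $\{(U_t,L_t)\}$ given by $$U_t=\xi_t-\sum_{0<s\le t}\big(e^{-(\xi_s-\xi_{s-})}-1+(\xi_s-\xi_{s-})\big)-t\,2^{-1}\alpha_{\xi,\xi},\qquad L_t=\eta_t+\sum_{0<s\le t}(e^{-(\xi_s-\xi_{s-})}-1)(\eta_s-\eta_{s-})-t\,\alpha_{\xi,\eta}$$ when applied with $\{(\xi_t,\eta_t)\}=\{((\log c)N_t^{(k-1)},L_t^{(k-1)})\}$, where $\alpha_{\xi,\xi}$ and $\alpha_{\xi,\eta}$ are the $(1,1)$ and $(1,2)$ elements of the Gaussian covariance matrix of $\{(\xi_t,\eta_t)\}$. The integral $\int_0^{\infty-}c^{-N_{s-}^{(k)}}\,dL_s^{(k)}$ exists as an almost sure limit, and its distribution $\mu^{(k)}$ is the unique stationary distribution of the generalized Ornstein–Uhlenbeck process associated with $\{((\log c)N_t^{(k-1)},L_t^{(k-1)})\}$; equivalently, $\mu^{(k)}$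 is the unique stationary distribution of the SDE $dV_t=-V_{t-}\,dU_t+dL_t$ driven by $\{(U_t,L_t)\}=\{((1-c^{-1})N_t^{(k)},L_t^{(k)})\}$.
   Context: For $k\in\mathbb{Z}$, $\{(N_t^{(k)},L_t^{(k)}),t\ge0\}$ is the bivariate compound Poisson process (pure jump, no drift) with $E[e^{i(z_1N_t^{(k)}+z_2L_t^{(k)})}]=\exp[t\int_{\mathbb{R}^2}(e^{i(z_1x_1+z_2x_2)}-1)\nu^{(k)}(dx)]$, where $\nu^{(k)}$ is concentrated on the points $(1,0)$, $(0,1)$, $(1,c^{-k})$ with masses $u,v,w\ge0$ respectively (the same $u,v,w$ for all $k$), and $p=u/(u+v+w)$, $q=v/(u+v+w)$, $r=w/(u+v+w)$. The improper integral $\int_0^{\infty-}$ denotes the limit of $\int_0^t$ as $t\to\infty$. The generalized Ornstein–Uhlenbeck process associated with a bivariate Lévy process $\{(\xi_t,\eta_t),t\ge0\}$ with initial condition $S$ is $V_t=e^{-\xi_t}\left(S+\int_0^te^{\xi_{s-}}\,d\eta_s\right)$, where $\{(\xi_t,\eta_t)\}$ and $S$ are independent. The SDE driven by a bivariate Lévy process $\{(U_t,L_t)\}$ is $dV_t=-V_{t-}\,dU_t+dL_t$, $t\ge0$, $V_0=S$, with $S$ independent of the driving process, the filtration being such that $\{V_t\}$ is adapted and $\{U_t\},\{L_t\}$ are semimartingales with respect to it. A distribution is a stationary distribution of such a process (or SDE) if, when $S$ has this distribution, $\{V_t\}$ is strictly stationary with it as marginal distribution. *)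

theory Defs
  imports "HOL-Probability.Probability"
begin

section \<open>Paths\<close>

text \<open>A process is a function \<open>X t \<omega>\<close> of real time; only times \<open>t \<ge> 0\<close> are ever used.\<close>

definition cadlag :: "(real \<Rightarrow> 'b::topological_space) \<Rightarrow> bool" where
  "cadlag f \<longleftrightarrow> (\<forall>t\<ge>0. continuous (at_right t) f) \<and> (\<forall>t>0. \<exists>l. (f \<longlongrightarrow> l) (at_left t))"

text \<open>The jump \<open>f(s) - f(s-)\<close>, used for \<open>s > 0\<close>.\<close>

definition jump :: "(real \<Rightarrow> 'b::real_normed_vector) \<Rightarrow> real \<Rightarrow> 'b" where
  "jump f s = f s - Lim (at_left s) f"

definition finite_variation :: "(real \<Rightarrow> real) \<Rightarrow> bool" where
  "finite_variation f \<longleftrightarrow>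
     (\<forall>t\<ge>0. \<exists>B. \<forall>m (\<tau> :: nat \<Rightarrow> real).
        \<tau> 0 = 0 \<and> \<tau> m = t \<and> (\<forall>i<m. \<tau> i \<le> \<tau> (Suc i)) \<longrightarrow>
        (\<Sum>i<m. \<bar>f (\<tau> (Suc i)) - f (\<tau> i)\<bar>) \<le> B)"

section \<open>Laws of processes\<close>

text \<open>Equality of the finite-dimensional distributions over \<open>[0,\<infinity>)\<close>.  The completion only matters
  for processes built pathwise (such as sums over jumps) from processes whose paths are cadlag
  almost surely: they need only be measurable up to null sets.\<close>

definition eq_in_law ::
  "'a measure \<Rightarrow> (real \<Rightarrow> 'a \<Rightarrow> 'c::topological_space) \<Rightarrow>
   'b measure \<Rightarrow> (real \<Rightarrow> 'b \<Rightarrow> 'c) \<Rightarrow> bool" where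
  "eq_in_law M X M' Y \<longleftrightarrow>
     (\<forall>t\<ge>0. X t \<in> borel_measurable (completion M)) \<and>
     (\<forall>t\<ge>0. Y t \<in> borel_measurable (completion M')) \<and>
     (\<forall>J. finite J \<and> J \<subseteq> {0..} \<longrightarrow>
        distr (completion M) (PiM J (\<lambda>_. borel)) (\<lambda>\<omega>. \<lambda>t\<in>J. X t \<omega>) =
        distr (completion M') (PiM J (\<lambda>_. borel)) (\<lambda>\<omega>. \<lambda>t\<in>J. Y t \<omega>))"

definition strictly_stationary ::
  "'a measure \<Rightarrow> (real \<Rightarrow> 'a \<Rightarrow> 'c::topological_space) \<Rightarrow> bool" where
  "strictly_stationary M V \<longleftrightarrow> (\<forall>h\<ge>0. eq_in_law M (\<lambda>t. V (t + h)) M V)"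

definition converges_in_prob ::
  "'a measure \<Rightarrow> (nat \<Rightarrow> 'a \<Rightarrow> real) \<Rightarrow> ('a \<Rightarrow> real) \<Rightarrow> bool" where
  "converges_in_prob M X Y \<longleftrightarrow>
     (\<forall>n. X n \<in> borel_measurable M) \<and> Y \<in> borel_measurable M \<and>
     (\<forall>\<epsilon>>0. (\<lambda>n. measure M {\<omega> \<in> space M. \<bar>X n \<omega> - Y \<omega>\<bar> > \<epsilon>}) \<longlonglongrightarrow> 0)"

section \<open>Levy processes\<close>

definition levy_process :: "'a measure \<Rightarrow> (real \<Rightarrow> 'a \<Rightarrow> 'b::euclidean_space) \<Rightarrow> bool" where
  "levy_process M X \<longleftrightarrow>
     prob_space M \<and>
     (\<forall>t\<ge>0. X t \<in> borel_measurable M) \<and>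
     (AE \<omega> in M. X 0 \<omega> = 0) \<and>
     (\<forall>n (\<tau> :: nat \<Rightarrow> real). 0 \<le> \<tau> 0 \<and> (\<forall>i<n. \<tau> i \<le> \<tau> (Suc i)) \<longrightarrow>
        prob_space.indep_vars M (\<lambda>_. borel) (\<lambda>i \<omega>. X (\<tau> (Suc i)) \<omega> - X (\<tau> i) \<omega>) {..<n}) \<and>
     (\<forall>s\<ge>0. \<forall>h\<ge>0. distr M borel (\<lambda>\<omega>. X (s + h) \<omega> - X s \<omega>) = distr M borel (X h)) \<and>
     (\<forall>t\<ge>0. \<forall>\<epsilon>>0.
        ((\<lambda>s. measure M {\<omega> \<in> space M. norm (X s \<omega> - X t \<omega>) > \<epsilon>}) \<longlongrightarrow> 0) (at t within {0..})) \<and>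
     (AE \<omega> in M. cadlag (\<lambda>t. X t \<omega>))"

definition compound_poisson ::
  "'a measure \<Rightarrow> (real \<Rightarrow> 'a \<Rightarrow> 'b::euclidean_space) \<Rightarrow> 'b measure \<Rightarrow> bool" where
  "compound_poisson M X \<nu> \<longleftrightarrow>
     levy_process M X \<and> finite_measure \<nu> \<and> sets \<nu> = sets borel \<and> emeasure \<nu> {0} = 0 \<and>
     (\<forall>t\<ge>0. \<forall>z. (CLINT \<omega>|M. iexp (z \<bullet> X t \<omega>)) =
        exp (complex_of_real t * (CLINT x|\<nu>. iexp (z \<bullet> x) - 1)))"

text \<open>\<open>\<nu>\<^sup>(\<^sup>k\<^sup>)\<close>: masses \<open>u\<close>, \<open>v\<close>, \<open>w\<close> at \<open>(1,0)\<close>, \<open>(0,1)\<close>, \<open>(1,c\<^sup>-\<^sup>k)\<close> (distinct points, as \<open>c > 0\<close>).\<close>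

definition nu :: "real \<Rightarrow> real \<Rightarrow> real \<Rightarrow> real \<Rightarrow> int \<Rightarrow> (real \<times> real) measure" where
  "nu c u v w k =
     distr (density (count_space UNIV) (\<lambda>x. ennreal
        (u * indicator {(1, 0)} x + v * indicator {(0, 1)} x + w * indicator {(1, c powi (- k))} x)))
       borel (\<lambda>x. x)"

text \<open>Levy--Khintchine triplet with truncation function \<open>indicator {x. norm x \<le> 1}\<close>.  The Gaussian
  covariance matrix is represented by the linear map \<open>A\<close>; its \<open>(i,j)\<close> element is
  \<open>e\<^sub>i \<bullet> A e\<^sub>j\<close>, and it does not depend on the truncation function.\<close>

definition levy_triplet ::
  "'a measure \<Rightarrow> (real \<Rightarrow> 'a \<Rightarrow> 'b::euclidean_space) \<Rightarrow> ('b \<Rightarrow> 'b) \<Rightarrow> 'b measure \<Rightarrow> 'b \<Rightarrow> bool" where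
  "levy_triplet M X A \<nu> \<gamma> \<longleftrightarrow>
     linear A \<and> (\<forall>x y. x \<bullet> A y = A x \<bullet> y) \<and> (\<forall>x. 0 \<le> x \<bullet> A x) \<and>
     sets \<nu> = sets borel \<and> emeasure \<nu> {0} = 0 \<and> integrable \<nu> (\<lambda>x. min 1 ((norm x)\<^sup>2)) \<and>
     (\<forall>t\<ge>0. \<forall>z. (CLINT \<omega>|M. iexp (z \<bullet> X t \<omega>)) =
        exp (complex_of_real t *
          (- complex_of_real (z \<bullet> A z) / 2
           + (CLINT x|\<nu>. iexp (z \<bullet> x) - 1
                - \<i> * complex_of_real ((z \<bullet> x) * indicator {x. norm x \<le> 1} x))
           + \<i> * complex_of_real (\<gamma> \<bullet> z))))"

definition gaussian_cov :: "'a measure \<Rightarrow> (real \<Rightarrow> 'a \<Rightarrow> 'b::euclidean_space) \<Rightarrow> 'b \<Rightarrow> 'b" where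
  "gaussian_cov M X = (THE A. \<exists>\<nu> \<gamma>. levy_triplet M X A \<nu> \<gamma>)"

definition alpha_xi_xi :: "'a measure \<Rightarrow> (real \<Rightarrow> 'a \<Rightarrow> real) \<Rightarrow> (real \<Rightarrow> 'a \<Rightarrow> real) \<Rightarrow> real" where
  "alpha_xi_xi M \<xi> \<eta> = (1, 0) \<bullet> gaussian_cov M (\<lambda>t \<omega>. (\<xi> t \<omega>, \<eta> t \<omega>)) (1, 0)"

definition alpha_xi_eta :: "'a measure \<Rightarrow> (real \<Rightarrow> 'a \<Rightarrow> real) \<Rightarrow> (real \<Rightarrow> 'a \<Rightarrow> real) \<Rightarrow> real" where
  "alpha_xi_eta M \<xi> \<eta> = (1, 0) \<bullet> gaussian_cov M (\<lambda>t \<omega>. (\<xi> t \<omega>, \<eta> t \<omega>)) (0, 1)"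

text \<open>The SDE driver \<open>(U, L)\<close> obtained from \<open>(\<xi>, \<eta>)\<close>.\<close>

definition driver_U ::
  "'a measure \<Rightarrow> (real \<Rightarrow> 'a \<Rightarrow> real) \<Rightarrow> (real \<Rightarrow> 'a \<Rightarrow> real) \<Rightarrow> real \<Rightarrow> 'a \<Rightarrow> real" where
  "driver_U M \<xi> \<eta> t \<omega> =
     \<xi> t \<omega> - (\<Sum>\<^sub>\<infinity>s\<in>{0<..t}. exp (- jump (\<lambda>r. \<xi> r \<omega>) s) - 1 + jump (\<lambda>r. \<xi> r \<omega>) s)
       - t * (1 / 2) * alpha_xi_xi M \<xi> \<eta>"

definition driver_L ::
  "'a measure \<Rightarrow> (real \<Rightarrow> 'a \<Rightarrow> real) \<Rightarrow> (real \<Rightarrow> 'a \<Rightarrow> real) \<Rightarrow> real \<Rightarrow> 'a \<Rightarrow> real" where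
  "driver_L M \<xi> \<eta> t \<omega> =
     \<eta> t \<omega> + (\<Sum>\<^sub>\<infinity>s\<in>{0<..t}. (exp (- jump (\<lambda>r. \<xi> r \<omega>) s) - 1) * jump (\<lambda>r. \<eta> r \<omega>) s)
       - t * alpha_xi_eta M \<xi> \<eta>"

section \<open>Stochastic integration\<close>

text \<open>\<open>has_left_integral M Y X I\<close>: the cadlag process \<open>I\<close> is (a version of) the stochastic integral
  \<open>I\<^sub>t = \<integral>\<^sub>0\<^sup>t Y\<^sub>s\<^sub>- dX\<^sub>s\<close> (over the half-open interval \<open>(0,t]\<close>) of the left limits of the cadlag
  process \<open>Y\<close> with respect to \<open>X\<close>, i.e. the limit in probability of the left-endpoint sums along
  all sequences of partitions of \<open>[0,t]\<close> whose mesh tends to 0.  The sums may be evaluated at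
  \<open>Y\<close> itself rather than at \<open>Y\<^sub>-\<close>: the left endpoints \<open>\<tau>\<^sub>i < s\<close> of the cells containing \<open>s\<close>
  increase to \<open>s\<close> strictly from the left, so a jump of \<open>X\<close> at \<open>s\<close> is weighted by \<open>Y\<^sub>s\<^sub>-\<close>.\<close>

definition has_left_integral ::
  "'a measure \<Rightarrow> (real \<Rightarrow> 'a \<Rightarrow> real) \<Rightarrow> (real \<Rightarrow> 'a \<Rightarrow> real) \<Rightarrow> (real \<Rightarrow> 'a \<Rightarrow> real) \<Rightarrow> bool" where
  "has_left_integral M Y X I \<longleftrightarrow>
     (\<forall>t\<ge>0. Y t \<in> borel_measurable M \<and> X t \<in> borel_measurable M \<and> I t \<in> borel_measurable M) \<and>
     (AE \<omega> in M. cadlag (\<lambda>t. Y t \<omega>) \<and> cadlag (\<lambda>t. X t \<omega>) \<and> cadlag (\<lambda>t. I t \<omega>)) \<and>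
     (\<forall>t\<ge>0. \<forall>(m :: nat \<Rightarrow> nat) (\<tau> :: nat \<Rightarrow> nat \<Rightarrow> real).
        (\<forall>n. \<tau> n 0 = 0 \<and> \<tau> n (m n) = t \<and> (\<forall>i<m n. \<tau> n i \<le> \<tau> n (Suc i))) \<and>
        (\<forall>\<delta>>0. \<forall>\<^sub>F n in sequentially. \<forall>i<m n. \<tau> n (Suc i) - \<tau> n i < \<delta>) \<longrightarrow>
        converges_in_prob M
          (\<lambda>n \<omega>. \<Sum>i<m n. Y (\<tau> n i) \<omega> * (X (\<tau> n (Suc i)) \<omega> - X (\<tau> n i) \<omega>)) (I t))"

definition has_improper_left_integral ::
  "'a measure \<Rightarrow> (real \<Rightarrow> 'a \<Rightarrow> real) \<Rightarrow> (real \<Rightarrow> 'a \<Rightarrow> real) \<Rightarrow> ('a \<Rightarrow> real) \<Rightarrow> bool" where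
  "has_improper_left_integral M Y X Z \<longleftrightarrow>
     Z \<in> borel_measurable M \<and>
     (\<exists>I. has_left_integral M Y X I \<and> (AE \<omega> in M. ((\<lambda>t. I t \<omega>) \<longlongrightarrow> Z \<omega>) at_top))"

definition adapted :: "(real \<Rightarrow> 'a measure) \<Rightarrow> (real \<Rightarrow> 'a \<Rightarrow> real) \<Rightarrow> bool" where
  "adapted F X \<longleftrightarrow> (\<forall>t\<ge>0. X t \<in> borel_measurable (F t))"

definition is_martingale :: "'a measure \<Rightarrow> (real \<Rightarrow> 'a measure) \<Rightarrow> (real \<Rightarrow> 'a \<Rightarrow> real) \<Rightarrow> bool" where
  "is_martingale M F X \<longleftrightarrow>
     adapted F X \<and> (\<forall>t\<ge>0. integrable M (X t)) \<and>
     (\<forall>s t. 0 \<le> s \<and> s \<le> t \<longrightarrow> (AE \<omega> in M. real_cond_exp M (F s) (X t) \<omega> = X s \<omega>))"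

definition local_martingale :: "'a measure \<Rightarrow> (real \<Rightarrow> 'a measure) \<Rightarrow> (real \<Rightarrow> 'a \<Rightarrow> real) \<Rightarrow> bool" where
  "local_martingale M F X \<longleftrightarrow>
     adapted F X \<and> (AE \<omega> in M. cadlag (\<lambda>t. X t \<omega>)) \<and>
     (\<exists>T :: nat \<Rightarrow> 'a \<Rightarrow> real.
        (\<forall>n. stopping_time F (T n) \<and> (\<forall>\<omega>\<in>space M. 0 \<le> T n \<omega>) \<and>
             is_martingale M F (\<lambda>t \<omega>. X (min t (T n \<omega>)) \<omega> - X 0 \<omega>)) \<and>
        (AE \<omega> in M. incseq (\<lambda>n. T n \<omega>) \<and> filterlim (\<lambda>n. T n \<omega>) at_top sequentially))"

definition semimartingale :: "'a measure \<Rightarrow> (real \<Rightarrow> 'a measure) \<Rightarrow> (real \<Rightarrow> 'a \<Rightarrow> real) \<Rightarrow> bool" where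
  "semimartingale M F X \<longleftrightarrow>
     (\<exists>Y A. local_martingale M F Y \<and>
        adapted F A \<and> (AE \<omega> in M. cadlag (\<lambda>t. A t \<omega>) \<and> finite_variation (\<lambda>t. A t \<omega>)) \<and>
        (AE \<omega> in M. \<forall>t\<ge>0. X t \<omega> = Y t \<omega> + A t \<omega>))"

section \<open>Generalized Ornstein--Uhlenbeck processes and the SDE\<close>

definition indep_initial ::
  "'a measure \<Rightarrow> ('a \<Rightarrow> real) \<Rightarrow> (real \<Rightarrow> 'a \<Rightarrow> real) \<Rightarrow> (real \<Rightarrow> 'a \<Rightarrow> real) \<Rightarrow> bool" where
  "indep_initial M S X Y \<longleftrightarrow>
     S \<in> borel_measurable M \<and>
     prob_space.indep_set M
       (sets (vimage_algebra (space M) S borel))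
       (sets (vimage_algebra (space M) (\<lambda>\<omega>. \<lambda>t\<in>{0..}. (X t \<omega>, Y t \<omega>)) (PiM {0..} (\<lambda>_. borel))))"

definition gou_process ::
  "'a measure \<Rightarrow> (real \<Rightarrow> 'a \<Rightarrow> real) \<Rightarrow> (real \<Rightarrow> 'a \<Rightarrow> real) \<Rightarrow> ('a \<Rightarrow> real) \<Rightarrow>
   (real \<Rightarrow> 'a \<Rightarrow> real) \<Rightarrow> bool" where
  "gou_process M \<xi> \<eta> S V \<longleftrightarrow>
     levy_process M (\<lambda>t \<omega>. (\<xi> t \<omega>, \<eta> t \<omega>)) \<and> indep_initial M S \<xi> \<eta> \<and>
     (\<forall>t\<ge>0. V t \<in> borel_measurable M) \<and>
     (\<exists>I. has_left_integral M (\<lambda>s \<omega>. exp (\<xi> s \<omega>)) \<eta> I \<and>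
        (AE \<omega> in M. \<forall>t\<ge>0. V t \<omega> = exp (- \<xi> t \<omega>) * (S \<omega> + I t \<omega>)))"

text \<open>\<open>dV\<^sub>t = - V\<^sub>t\<^sub>- dU\<^sub>t + dL\<^sub>t\<close>, \<open>V\<^sub>0 = S\<close>, in integrated form.\<close>

definition sde_solution ::
  "'a measure \<Rightarrow> (real \<Rightarrow> 'a measure) \<Rightarrow> (real \<Rightarrow> 'a \<Rightarrow> real) \<Rightarrow> (real \<Rightarrow> 'a \<Rightarrow> real) \<Rightarrow>
   ('a \<Rightarrow> real) \<Rightarrow> (real \<Rightarrow> 'a \<Rightarrow> real) \<Rightarrow> bool" where
  "sde_solution M F U L S V \<longleftrightarrow>
     levy_process M (\<lambda>t \<omega>. (U t \<omega>, L t \<omega>)) \<and> indep_initial M S U L \<and>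
     filtration (space M) F \<and> (\<forall>t. sets (F t) \<subseteq> sets M) \<and>
     adapted F V \<and> semimartingale M F U \<and> semimartingale M F L \<and>
     (\<exists>I. has_left_integral M V U I \<and>
        (AE \<omega> in M. \<forall>t\<ge>0. V t \<omega> = S \<omega> - I t \<omega> + (L t \<omega> - L 0 \<omega>)))"

text \<open>A pair \<open>(\<Omega>, V)\<close> realizes the process (resp. the SDE) with starting law \<open>\<mu>\<close> if \<open>\<Omega>\<close> carries a copy
  in law of the driving Levy process together with an independent starting variable of law \<open>\<mu>\<close>.
  Such a variable need not exist on the space \<open>M\<close> on which the Levy process was given; the type
  \<open>'a \<times> real\<close> provides room for it (take the product of \<open>M\<close> and \<open>\<mu>\<close>).\<close>

definition gou_realization ::
  "'a measure \<Rightarrow> (real \<Rightarrow> 'a \<Rightarrow> real) \<Rightarrow> (real \<Rightarrow> 'a \<Rightarrow> real) \<Rightarrow> real measure \<Rightarrow>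
   ('a \<times> real) measure \<Rightarrow> (real \<Rightarrow> 'a \<times> real \<Rightarrow> real) \<Rightarrow> bool" where
  "gou_realization M \<xi> \<eta> \<mu> \<Omega> V \<longleftrightarrow>
     (\<exists>\<xi>' \<eta>' S. gou_process \<Omega> \<xi>' \<eta>' S V \<and> distr \<Omega> borel S = \<mu> \<and>
        eq_in_law \<Omega> (\<lambda>t \<omega>. (\<xi>' t \<omega>, \<eta>' t \<omega>)) M (\<lambda>t \<omega>. (\<xi> t \<omega>, \<eta> t \<omega>)))"

definition sde_realization ::
  "'a measure \<Rightarrow> (real \<Rightarrow> 'a \<Rightarrow> real) \<Rightarrow> (real \<Rightarrow> 'a \<Rightarrow> real) \<Rightarrow> real measure \<Rightarrow>
   ('a \<times> real) measure \<Rightarrow> (real \<Rightarrow> 'a \<times> real \<Rightarrow> real) \<Rightarrow> bool" where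
  "sde_realization M U L \<mu> \<Omega> V \<longleftrightarrow>
     (\<exists>F U' L' S. sde_solution \<Omega> F U' L' S V \<and> distr \<Omega> borel S = \<mu> \<and>
        eq_in_law \<Omega> (\<lambda>t \<omega>. (U' t \<omega>, L' t \<omega>)) M (\<lambda>t \<omega>. (U t \<omega>, L t \<omega>)))"

definition gou_stationary_distribution ::
  "'a measure \<Rightarrow> (real \<Rightarrow> 'a \<Rightarrow> real) \<Rightarrow> (real \<Rightarrow> 'a \<Rightarrow> real) \<Rightarrow> real measure \<Rightarrow> bool" where
  "gou_stationary_distribution M \<xi> \<eta> \<mu> \<longleftrightarrow>
     prob_space \<mu> \<and> sets \<mu> = sets borel \<and>
     (\<exists>\<Omega> V. gou_realization M \<xi> \<eta> \<mu> \<Omega> V) \<and>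
     (\<forall>\<Omega> V. gou_realization M \<xi> \<eta> \<mu> \<Omega> V \<longrightarrow>
        strictly_stationary \<Omega> V \<and> (\<forall>t\<ge>0. distr \<Omega> borel (V t) = \<mu>))"

definition sde_stationary_distribution ::
  "'a measure \<Rightarrow> (real \<Rightarrow> 'a \<Rightarrow> real) \<Rightarrow> (real \<Rightarrow> 'a \<Rightarrow> real) \<Rightarrow> real measure \<Rightarrow> bool" where
  "sde_stationary_distribution M U L \<mu> \<longleftrightarrow>
     prob_space \<mu> \<and> sets \<mu> = sets borel \<and>
     (\<exists>\<Omega> V. sde_realization M U L \<mu> \<Omega> V) \<and>
     (\<forall>\<Omega> V. sde_realization M U L \<mu> \<Omega> V \<longrightarrow>
        strictly_stationary \<Omega> V \<and> (\<forall>t\<ge>0. distr \<Omega> borel (V t) = \<mu>))"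

end

theory Submission
  imports Defs
begin

text \<open>
  Jumps of \<open>L\<close> that occur together with a jump of \<open>N\<close> have size \<open>c\<^sup>-\<^sup>k\<close> for the index \<open>k\<close> and
  \<open>c\<^sup>-\<^sup>k\<^sup>+\<^sup>1\<close> for \<open>k - 1\<close>, so multiplying the jump of the latter by \<open>exp (- \<Delta>\<xi>) = c\<^sup>-\<^sup>1\<close> turns one process
  into the other. To compare laws rigorously, cut \<open>[0, t]\<close> into \<open>n\<close> cells. The probability of two or
  more jumps in a cell is \<open>O(1/n\<^sup>2)\<close>, so rescaling cell increments instead of jumps changes
  characteristic functions by \<open>O(1/n)\<close> only. The Gaussian covariance vanishes because
  the real part of the exponent at \<open>s z\<close> is \<open>o(s\<^sup>2)\<close>.

  Both the Ornstein--Uhlenbeck process and the solution of the equation have the form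
  \<open>V\<^sub>t = c\<^bsup>-N(t)\<^esup> S + B\<^sub>t\<close> with \<open>B\<^sub>t = \<Sum>\<^sub>r c\<^bsup>N(r) - N(t)\<^esup> \<Delta>L\<^sub>r\<close> for the driver \<open>(N, L)\<close> of index \<open>k\<close>. Reversing the
  order of the i.i.d. cell increments gives \<open>B\<^sub>t\<close> the law of \<open>\<integral>\<^sub>0\<^sup>t c\<^bsup>-N(s-)\<^esup> dL\<^sub>s\<close>, and this converges almost surely
  since its increments over \<open>[n, n + 1]\<close> have geometrically decreasing means. Splitting the integral at \<open>t\<close> shows that the limit law is
  invariant, and \<open>c\<^bsup>-N(t)\<^esup> S \<rightarrow> 0\<close> makes it the only one.
\<close>

section \<open>Step paths\<close>

text \<open>A compound Poisson process is given only through its characteristic function and almost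
  surely cadlag paths; that it moves by jumps of three prescribed sizes has to be recovered. Its
  values lie almost surely in a locally finite lattice, which forces the paths to be step functions,
  and increments over fine cells then identify the jumps. On step paths the stochastic integrals,
  the infinite jump sums and the linear equation become finite sums, so they are settled path by
  path. The obstacle is measurability: laws live on the product sigma-algebra over uncountably many
  times, where being a step path is not an event. Hence pathwise quantities get measurable twins,
  limits of sums along uniform partitions (\<open>pint\<close>, \<open>transf_fun\<close>,
  \<open>aff\<close>), equal to them almost surely. As X(0) = 0 holds only almost surely,
  \<open>incr X 0\<close> replaces \<open>X\<close> in statements about laws. Stationarity is a
  claim about every realization, so each realization is first reduced to an affine recursion with a
  driver of known law, and laws on different spaces are compared through path space.\<close>

definition step_path :: "(real \<Rightarrow> 'b) \<Rightarrow> bool" where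
  "step_path f \<longleftrightarrow> (\<forall>t\<ge>0. \<forall>\<^sub>F s in at_right t. f s = f t) \<and>
     (\<forall>t>0. \<exists>y. \<forall>\<^sub>F s in at_left t. f s = y)"

lemma Lim_eventually_const:
  fixes f :: "real \<Rightarrow> 'b::t2_space"
  assumes "\<forall>\<^sub>F s in at_left t. f s = y"
  shows "Lim (at_left t) f = y"
  by (rule tendsto_Lim) (simp_all add: tendsto_eventually[OF assms])

lemma step_path_right: "step_path f \<Longrightarrow> 0 \<le> t \<Longrightarrow> \<forall>\<^sub>F s in at_right t. f s = f t"
  by (auto simp: step_path_def)

lemma step_path_left:
  fixes f :: "real \<Rightarrow> 'b::t2_space"
  assumes "step_path f" "0 < t"
  shows "\<forall>\<^sub>F s in at_left t. f s = Lim (at_left t) f"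
proof -
  obtain y where y: "\<forall>\<^sub>F s in at_left t. f s = y"
    using assms by (auto simp: step_path_def)
  with Lim_eventually_const[OF y] show ?thesis by simp
qed

lemma step_path_comp:
  assumes "step_path f"
  shows "step_path (\<lambda>t. F (f t))"
  unfolding step_path_def
proof (intro conjI allI impI)
  fix t :: real assume "0 \<le> t"
  with assms have "\<forall>\<^sub>F s in at_right t. f s = f t" by (auto simp: step_path_def)
  then show "\<forall>\<^sub>F s in at_right t. F (f s) = F (f t)" by eventually_elim simp
next
  fix t :: real assume "0 < t"
  with assms obtain y where "\<forall>\<^sub>F s in at_left t. f s = y" by (auto simp: step_path_def)
  then have "\<forall>\<^sub>F s in at_left t. F (f s) = F y" by eventually_elim simp
  then show "\<exists>y. \<forall>\<^sub>F s in at_left t. F (f s) = y" by blast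
qed

lemma step_path_pair:
  assumes "step_path f" "step_path g"
  shows "step_path (\<lambda>t. (f t, g t))"
  unfolding step_path_def
proof (intro conjI allI impI)
  fix t :: real assume "0 \<le> t"
  with assms have "\<forall>\<^sub>F s in at_right t. f s = f t" "\<forall>\<^sub>F s in at_right t. g s = g t"
    by (auto simp: step_path_def)
  then show "\<forall>\<^sub>F s in at_right t. (f s, g s) = (f t, g t)" by eventually_elim simp
next
  fix t :: real assume "0 < t"
  with assms obtain y z where "\<forall>\<^sub>F s in at_left t. f s = y" "\<forall>\<^sub>F s in at_left t. g s = z"
    unfolding step_path_def by blast
  then have "\<forall>\<^sub>F s in at_left t. (f s, g s) = (y, z)" by eventually_elim simp
  then show "\<exists>y. \<forall>\<^sub>F s in at_left t. (f s, g s) = y" by blast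
qed

lemma step_path_comp2:
  assumes "step_path f" "step_path g"
  shows "step_path (\<lambda>t. F (f t) (g t))"
  using step_path_comp[OF step_path_pair[OF assms], of "\<lambda>(a, b). F a b"] by simp

lemma step_path_const: "step_path (\<lambda>_. a)"
  by (auto simp: step_path_def)

lemma Lim_step_comp:
  fixes f :: "real \<Rightarrow> 'b::t2_space" and F :: "'b \<Rightarrow> 'c::t2_space"
  assumes "step_path f" "0 < t"
  shows "Lim (at_left t) (\<lambda>s. F (f s)) = F (Lim (at_left t) f)"
  by (rule Lim_eventually_const, rule eventually_mono[OF step_path_left[OF assms]]) simp

lemma Lim_step_comp2:
  fixes f :: "real \<Rightarrow> 'b::t2_space" and g :: "real \<Rightarrow> 'c::t2_space" and F :: "'b \<Rightarrow> 'c \<Rightarrow> 'd::t2_space"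
  assumes "step_path f" "step_path g" "0 < t"
  shows "Lim (at_left t) (\<lambda>s. F (f s) (g s)) = F (Lim (at_left t) f) (Lim (at_left t) g)"
  by (rule Lim_eventually_const,
      use step_path_left[OF assms(1,3)] step_path_left[OF assms(2,3)] in eventually_elim) simp

lemma Lim_jump: "Lim (at_left s) f = f s - jump f s"
  by (simp add: jump_def)

lemma step_path_cadlag:
  fixes f :: "real \<Rightarrow> 'b::t2_space"
  assumes "step_path f"
  shows "cadlag f"
  unfolding cadlag_def
proof (intro conjI allI impI)
  fix t :: real assume "0 \<le> t"
  then show "continuous (at_right t) f"
    unfolding continuous_within by (intro tendsto_eventually step_path_right assms)
next
  fix t :: real assume "0 < t"
  then show "\<exists>l. (f \<longlongrightarrow> l) (at_left t)"
    using tendsto_eventually[OF step_path_left[OF assms]] by blast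
qed

lemma cadlag_right: "cadlag f \<Longrightarrow> 0 \<le> t \<Longrightarrow> (f \<longlongrightarrow> f t) (at_right t)"
  by (auto simp: cadlag_def continuous_within)

lemma cadlag_left:
  fixes f :: "real \<Rightarrow> 'b::t2_space"
  assumes "cadlag f" "0 < t"
  shows "(f \<longlongrightarrow> Lim (at_left t) f) (at_left t)"
proof -
  obtain l where "(f \<longlongrightarrow> l) (at_left t)" using assms by (auto simp: cadlag_def)
  then show ?thesis using tendsto_Lim[of "at_left t" f l] by simp
qed

text \<open>A local two-sided description, suitable for Bolzano's interval induction.\<close>

lemma step_path_local:
  assumes "step_path f" "0 \<le> x"
  obtains d y where "d > 0"
    "\<And>s. x \<le> s \<Longrightarrow> s < x + d \<Longrightarrow> f s = f x"
    "\<And>s. x - d < s \<Longrightarrow> s < x \<Longrightarrow> 0 \<le> s \<Longrightarrow> f s = y"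
proof -
  have "\<forall>\<^sub>F s in at_right x. f s = f x" using assms step_path_right by blast
  then obtain b where b: "b > x" "\<And>s. s > x \<Longrightarrow> s < b \<Longrightarrow> f s = f x"
    unfolding eventually_at_right_field by auto
  have "\<exists>a y. a < x \<and> (\<forall>s. a < s \<longrightarrow> s < x \<longrightarrow> 0 \<le> s \<longrightarrow> f s = y)"
  proof (cases "x = 0")
    case True
    then show ?thesis by (intro exI[of _ "-1"]) auto
  next
    case False
    then obtain y where "\<forall>\<^sub>F s in at_left x. f s = y"
      using assms by (force simp: step_path_def)
    then show ?thesis unfolding eventually_at_left_field by blast
  qed
  then obtain a y where a: "a < x" "\<And>s. a < s \<Longrightarrow> s < x \<Longrightarrow> 0 \<le> s \<Longrightarrow> f s = y" by blast
  show thesis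
  proof (rule that[of "min (b - x) (x - a)" y])
    show "f s = f x" if "x \<le> s" "s < x + min (b - x) (x - a)" for s
      using that b(2)[of s] by (cases "s = x") auto
    show "f s = y" if "x - min (b - x) (x - a) < s" "s < x" "0 \<le> s" for s
      using that a(2)[of s] by auto
  qed (use a b in auto)
qed

text \<open>Open at \<open>a\<close> and closed at \<open>b\<close>, as in integrals over (0,t], so
  that adjacent intervals have disjoint jump sets.\<close>

definition jumps :: "(real \<Rightarrow> 'b::real_normed_vector) \<Rightarrow> real \<Rightarrow> real \<Rightarrow> real set" where
  "jumps f a b = {r \<in> {a<..b}. jump f r \<noteq> 0}"

lemma jump_zero_if_locally_const:
  fixes f :: "real \<Rightarrow> 'b::real_normed_vector"
  assumes "a < r" "\<And>s. a < s \<Longrightarrow> s \<le> r \<Longrightarrow> f s = y"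
  shows "jump f r = 0"
proof -
  have "\<forall>\<^sub>F s in at_left r. f s = y"
    unfolding eventually_at_left_field using assms by (intro exI[of _ a]) auto
  then show ?thesis using Lim_eventually_const assms by (fastforce simp: jump_def)
qed

text \<open>Compactness by interval induction: on either side of a point \<open>x\<close> the path
  is locally constant, so a short interval around \<open>x\<close> contains no jump except possibly
  at \<open>x\<close>.\<close>

lemma finite_jumps:
  fixes f :: "real \<Rightarrow> 'b::real_normed_vector"
  assumes f: "step_path f" and "0 \<le> a"
  shows "finite (jumps f a b)"
proof (cases "a \<le> b")
  case True
  \<comment> \<open>The condition \<open>0 \<le> a\<close> sits inside the claim because the short
    intervals of the local case may reach below 0, where nothing is known of
    \<open>f\<close>.\<close>
  have "0 \<le> a \<longrightarrow> finite (jumps f a b)"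
    using True
  proof (induction rule: Bolzano)
    case (trans a b c)
    have "jumps f a c \<subseteq> jumps f a b \<union> jumps f b c"
      by (auto simp: jumps_def)
    then show ?case using trans by (auto intro: finite_subset)
  next
    case (local x)
    then have "0 \<le> x" using assms by linarith
    from step_path_local[OF f this] obtain d y where d: "d > 0"
      "\<And>s. x \<le> s \<Longrightarrow> s < x + d \<Longrightarrow> f s = f x"
      "\<And>s. x - d < s \<Longrightarrow> s < x \<Longrightarrow> 0 \<le> s \<Longrightarrow> f s = y" by blast
    show ?case
    proof (intro exI[of _ d] conjI allI impI)
      fix a' b' assume *: "a' \<le> x \<and> x \<le> b' \<and> b' - a' < d" "0 \<le> a'"
      have "jumps f a' b' \<subseteq> {x}"
      proof
        fix r assume r: "r \<in> jumps f a' b'"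
        have "r = x"
        proof (rule ccontr)
          assume "r \<noteq> x"
          then consider "r < x" | "x < r" by linarith
          then have "jump f r = 0"
          proof cases
            case 1
            show ?thesis
            proof (rule jump_zero_if_locally_const)
              show "a' < r" using r by (auto simp: jumps_def)
              show "f s = y" if "a' < s" "s \<le> r" for s
                by (rule d(3)) (use that 1 * in auto)
            qed
          next
            case 2
            show ?thesis
            proof (rule jump_zero_if_locally_const)
              show "x < r" by fact
              show "f s = f x" if "x < s" "s \<le> r" for s
                by (rule d(2)) (use that r * in \<open>auto simp: jumps_def\<close>)
            qed
          qed
          then show False using r by (auto simp: jumps_def)
        qed
        then show "r \<in> {x}" by simp
      qed
      then show "finite (jumps f a' b')" by (rule finite_subset) simp
    qed (use d in auto)
  qed
  then show ?thesis using assms by simp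
qed (auto simp: jumps_def)

text \<open>The counterpart of a vanishing derivative: near \<open>x\<close> the path has one value
  on the left and one from \<open>x\<close> on, and the absence of a jump at \<open>x\<close> makes
  them equal. \<open>step_path_eqI\<close> and the uniqueness for the linear equation rest on
  this.\<close>

lemma step_path_no_jumps:
  fixes f :: "real \<Rightarrow> 'b::real_normed_vector"
  assumes f: "step_path f" and "0 \<le> a" "a \<le> b" and nj: "\<And>r. a < r \<Longrightarrow> r \<le> b \<Longrightarrow> jump f r = 0"
  shows "f b = f a"
proof -
  have "0 \<le> a \<and> (\<forall>r. a < r \<and> r \<le> b \<longrightarrow> jump f r = 0) \<longrightarrow> f b = f a"
    using \<open>a \<le> b\<close>
  proof (induction rule: Bolzano)
    case (trans a b c)
    then show ?case by auto
  next
    case (local x)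
    then have "0 \<le> x" using assms by linarith
    from step_path_local[OF f this] obtain d y where d: "d > 0"
      "\<And>s. x \<le> s \<Longrightarrow> s < x + d \<Longrightarrow> f s = f x"
      "\<And>s. x - d < s \<Longrightarrow> s < x \<Longrightarrow> 0 \<le> s \<Longrightarrow> f s = y" by blast
    show ?case
    proof (intro exI[of _ d] conjI allI impI)
      fix a' b' assume *: "a' \<le> x \<and> x \<le> b' \<and> b' - a' < d"
        "0 \<le> a' \<and> (\<forall>r. a' < r \<and> r \<le> b' \<longrightarrow> jump f r = 0)"
      have "f b' = f x" by (rule d(2)) (use * in auto)
      moreover have "f a' = f x"
      proof (cases "a' = x")
        case False
        then have "f a' = y" by (intro d(3)) (use * in auto)
        moreover have "Lim (at_left x) f = y"
        proof (rule Lim_eventually_const)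
          show "\<forall>\<^sub>F s in at_left x. f s = y"
            unfolding eventually_at_left_field
          proof (intro exI[of _ a'] conjI allI impI)
            show "a' < x" using * False by auto
            show "f s = y" if "a' < s" "s < x" for s
              by (rule d(3)) (use that * in auto)
          qed
        qed
        moreover have "jump f x = 0" using * False by auto
        ultimately show ?thesis by (simp add: jump_def)
      qed simp
      ultimately show "f b' = f a'" by simp
    qed (use d in auto)
  qed
  then show ?thesis using assms by auto
qed

text \<open>A path built from prescribed jumps. Integrals and rescaled paths are brought to this
  form so that their step property and their jumps can be read off.\<close>

definition jsum :: "real set \<Rightarrow> (real \<Rightarrow> 'b::real_normed_vector) \<Rightarrow> real \<Rightarrow> 'b" where
  "jsum K h t = (\<Sum>r\<in>K \<inter> {0<..t}. h r)"

lemma jsum_0 [simp]: "jsum K h 0 = 0"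
  by (simp add: jsum_def)

context
  fixes K :: "real set"
  assumes K: "\<And>t. finite (K \<inter> {0<..t})"
begin

lemma jsum_eventually_right: "\<forall>\<^sub>F s in at_right t. K \<inter> {0<..s} = K \<inter> {0<..t}"
proof -
  have "finite ((K \<inter> {0<..t+1}) \<inter> {t<..})" using K by blast
  moreover have "\<forall>r\<in>(K \<inter> {0<..t+1}) \<inter> {t<..}. \<forall>\<^sub>F s in at_right t. s < r"
    by (auto simp: eventually_at_right_field)
  ultimately have "\<forall>\<^sub>F s in at_right t. \<forall>r\<in>(K \<inter> {0<..t+1}) \<inter> {t<..}. s < r"
    by (rule eventually_ball_finite)
  moreover have "\<forall>\<^sub>F s in at_right t. t < s \<and> s < t + 1"
    unfolding eventually_at_right_field by (intro exI[of _ "t+1"]) auto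
  ultimately show ?thesis
  proof eventually_elim
    case (elim s)
    show ?case
    proof (intro equalityI subsetI)
      fix r assume r: "r \<in> K \<inter> {0<..s}"
      have "r \<le> t"
      proof (rule ccontr)
        assume "\<not> r \<le> t"
        then have "s < r" using r elim by auto
        then show False using r by auto
      qed
      with r show "r \<in> K \<inter> {0<..t}" by auto
    qed (use elim in auto)
  qed
qed

lemma jsum_eventually_left:
  "\<forall>\<^sub>F s in at_left t. K \<inter> {0<..s} = K \<inter> {0<..t} - {t}"
proof -
  have "finite (K \<inter> {0<..t} - {t})" using K by blast
  moreover have "\<forall>r\<in>K \<inter> {0<..t} - {t}. \<forall>\<^sub>F s in at_left t. r < s"
  proof
    fix r assume "r \<in> K \<inter> {0<..t} - {t}"
    then show "\<forall>\<^sub>F s in at_left t. r < s"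
      unfolding eventually_at_left_field by (intro exI[of _ r]) auto
  qed
  ultimately have "\<forall>\<^sub>F s in at_left t. \<forall>r\<in>K \<inter> {0<..t} - {t}. r < s"
    by (rule eventually_ball_finite)
  moreover have "\<forall>\<^sub>F s in at_left t. s < t"
    unfolding eventually_at_left_field by (intro exI[of _ "t-1"]) auto
  ultimately show ?thesis
  proof eventually_elim
    case (elim s)
    show ?case
    proof (intro equalityI subsetI)
      fix r assume r: "r \<in> K \<inter> {0<..t} - {t}"
      then have "r < s" using elim by blast
      then show "r \<in> K \<inter> {0<..s}" using r by auto
    qed (use elim in auto)
  qed
qed

lemma jsum_step_path: "step_path (jsum K h)"
  unfolding step_path_def
proof (intro conjI allI impI)
  fix t :: real
  show "\<forall>\<^sub>F s in at_right t. jsum K h s = jsum K h t"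
    using jsum_eventually_right by eventually_elim (simp add: jsum_def)
  show "\<exists>y. \<forall>\<^sub>F s in at_left t. jsum K h s = y"
    using jsum_eventually_left[of t]
    by (intro exI[of _ "sum h (K \<inter> {0<..t} - {t})"], eventually_elim) (simp add: jsum_def)
qed

lemma jump_jsum:
  assumes "0 < t"
  shows "jump (jsum K h) t = (if t \<in> K then h t else 0)"
proof -
  have "Lim (at_left t) (jsum K h) = sum h (K \<inter> {0<..t} - {t})"
    by (rule Lim_eventually_const, rule eventually_mono[OF jsum_eventually_left]) (simp add: jsum_def)
  moreover have "sum h (K \<inter> {0<..t}) = (if t \<in> K then h t else 0) + sum h (K \<inter> {0<..t} - {t})"
    using K assms by (auto simp: sum.remove)
  ultimately show ?thesis by (simp add: jump_def jsum_def)
qed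

end

lemma jump_diff_step:
  fixes f g :: "real \<Rightarrow> 'b::real_normed_vector"
  assumes "step_path f" "step_path g" "0 < t"
  shows "jump (\<lambda>t. f t - g t) t = jump f t - jump g t"
  using Lim_step_comp2[OF assms, of "(-)"] by (simp add: jump_def)

text \<open>The difference of the two paths has no jumps, so \<open>step_path_no_jumps\<close>
  applies to it.\<close>

lemma step_path_eqI:
  fixes f g :: "real \<Rightarrow> 'b::real_normed_vector"
  assumes f: "step_path f" and g: "step_path g" and "0 \<le> t" "f 0 = g 0"
    and "\<And>r. 0 < r \<Longrightarrow> r \<le> t \<Longrightarrow> jump f r = jump g r"
  shows "f t = g t"
proof -
  have "f t - g t = f 0 - g 0"
    by (rule step_path_no_jumps[OF step_path_comp2[OF f g, of "(-)"]])
      (use assms in \<open>auto simp: jump_diff_step[OF f g]\<close>)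
  then show ?thesis using assms by simp
qed

lemma step_path_eq_jsum:
  fixes f :: "real \<Rightarrow> 'b::real_normed_vector"
  assumes f: "step_path f" and K: "\<And>t. finite (K \<inter> {0<..t})" and "0 \<le> t"
    and jK: "\<And>r. 0 < r \<Longrightarrow> r \<le> t \<Longrightarrow> jump f r \<noteq> 0 \<Longrightarrow> r \<in> K"
  shows "f t = f 0 + jsum K (jump f) t"
proof -
  have "f t - f 0 = jsum K (jump f) t"
  proof (rule step_path_eqI[OF step_path_comp2[OF f step_path_const, of "(-)"] jsum_step_path[OF K]])
    fix r :: real assume "0 < r" "r \<le> t"
    then show "jump (\<lambda>t. f t - f 0) r = jump (jsum K (jump f)) r"
      using jK[of r] jump_diff_step[OF f step_path_const, of r "f 0"]
        Lim_eventually_const[of "\<lambda>_. f 0" "f 0" r]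
      by (auto simp: jump_jsum[OF K] jump_def[of "\<lambda>_. f 0"])
  qed (use assms in auto)
  then show ?thesis by (simp add: algebra_simps)
qed

lemma jumps_Int: "{r. 0 < r \<and> jump f r \<noteq> 0} \<inter> {0<..t} = jumps f 0 t"
  by (auto simp: jumps_def)

lemma step_path_eq_sum_jumps:
  fixes f :: "real \<Rightarrow> 'b::real_normed_vector"
  assumes f: "step_path f" and "0 \<le> t"
  shows "f t = f 0 + (\<Sum>r\<in>jumps f 0 t. jump f r)"
  using step_path_eq_jsum[OF f, of "{r. 0 < r \<and> jump f r \<noteq> 0}" t] assms finite_jumps[OF f, of 0]
  by (simp add: jsum_def jumps_Int)

lemma step_path_diff_eq_sum_jumps:
  fixes f :: "real \<Rightarrow> 'b::real_normed_vector"
  assumes f: "step_path f" and "0 \<le> a" "a \<le> b"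
  shows "f b - f a = (\<Sum>r\<in>jumps f a b. jump f r)"
proof -
  have "jumps f 0 b = jumps f 0 a \<union> jumps f a b" "jumps f 0 a \<inter> jumps f a b = {}"
    using assms by (auto simp: jumps_def)
  then have "(\<Sum>r\<in>jumps f 0 b. jump f r) = (\<Sum>r\<in>jumps f 0 a. jump f r) + (\<Sum>r\<in>jumps f a b. jump f r)"
    using finite_jumps[OF f] assms by (simp add: sum.union_disjoint)
  then show ?thesis
    using step_path_eq_sum_jumps[OF f, of a] step_path_eq_sum_jumps[OF f, of b] assms by simp
qed

text \<open>Reduces the sums over all times in \<open>driver_U\<close> and \<open>driver_L\<close>
  to finite ones: the summand vanishes off the finite jump set.\<close>

lemma infsum_jumps:
  fixes F :: "real \<Rightarrow> real"
  assumes f: "step_path f" and "0 \<le> t" and "\<And>s. 0 < s \<Longrightarrow> jump f s = 0 \<Longrightarrow> F s = 0"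
  shows "(\<Sum>\<^sub>\<infinity>s\<in>{0<..t}. F s) = (\<Sum>s\<in>jumps f 0 t. F s)"
proof -
  have "(\<Sum>\<^sub>\<infinity>s\<in>{0<..t}. F s) = (\<Sum>\<^sub>\<infinity>s\<in>jumps f 0 t. F s)"
    by (rule infsum_cong_neutral) (use assms in \<open>auto simp: jumps_def\<close>)
  also have "\<dots> = (\<Sum>s\<in>jumps f 0 t. F s)"
    using finite_jumps[OF f] by simp
  finally show ?thesis .
qed

section \<open>Partition sums\<close>

text \<open>The condition on partitions from \<open>has_left_integral\<close>, so that this
  definition can be applied and established through it.\<close>

definition partitions :: "real \<Rightarrow> (nat \<Rightarrow> nat) \<Rightarrow> (nat \<Rightarrow> nat \<Rightarrow> real) \<Rightarrow> bool" where
  "partitions t m \<tau> \<longleftrightarrow>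
     (\<forall>n. \<tau> n 0 = 0 \<and> \<tau> n (m n) = t \<and> (\<forall>i<m n. \<tau> n i \<le> \<tau> n (Suc i))) \<and>
     (\<forall>\<delta>>0. \<forall>\<^sub>F n in sequentially. \<forall>i<m n. \<tau> n (Suc i) - \<tau> n i < \<delta>)"

lemma partition_mono:
  fixes \<tau> :: "nat \<Rightarrow> real"
  assumes "\<forall>i<m. \<tau> i \<le> \<tau> (Suc i)" "i \<le> j" "j \<le> m"
  shows "\<tau> i \<le> \<tau> j"
  using assms(2,3)
proof (induction rule: dec_induct)
  case (step n)
  then show ?case using assms(1) by (meson Suc_leD Suc_le_lessD order_trans)
qed simp

text \<open>Telescoping: the half-open cells, some possibly empty, tile the interval, so every point
  of it is counted once.\<close>

lemma partition_sum_indicator: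
  fixes \<tau> :: "nat \<Rightarrow> real"
  assumes "\<forall>i<m. \<tau> i \<le> \<tau> (Suc i)"
  shows "(\<Sum>i<m. indicator {\<tau> i<..\<tau> (Suc i)} r) = (indicator {\<tau> 0<..\<tau> m} r :: real)"
  using assms
proof (induction m)
  case (Suc m)
  have "\<tau> 0 \<le> \<tau> m" "\<tau> m \<le> \<tau> (Suc m)"
    using partition_mono[OF Suc.prems, of 0 m] Suc.prems by auto
  then show ?case using Suc by (auto simp: indicator_def)
qed simp

text \<open>Every cell increment of \<open>f\<close> is the sum of the finitely many jumps in the
  cell. Exchanging the sums leaves one term per jump \<open>r\<close>, weighted by the
  \<open>w\<close> of the cell that contains \<open>r\<close>; convergence is therefore needed only
  at each jump separately.\<close>

lemma partition_sum_limit: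
  fixes f :: "real \<Rightarrow> real" and w :: "nat \<Rightarrow> nat \<Rightarrow> real"
  assumes f: "step_path f" and "0 \<le> t" and part: "partitions t m \<tau>"
    and w: "\<And>r \<epsilon>. 0 < r \<Longrightarrow> r \<le> t \<Longrightarrow> 0 < \<epsilon> \<Longrightarrow>
      \<forall>\<^sub>F n in sequentially. \<forall>i<m n. \<tau> n i < r \<and> r \<le> \<tau> n (Suc i) \<longrightarrow> \<bar>w n i - y r\<bar> < \<epsilon>"
  shows "(\<lambda>n. \<Sum>i<m n. w n i * (f (\<tau> n (Suc i)) - f (\<tau> n i)))
           \<longlonglongrightarrow> (\<Sum>r\<in>jumps f 0 t. y r * jump f r)"
proof -
  let ?J = "jumps f 0 t"
  let ?w = "\<lambda>n r. \<Sum>i<m n. w n i * indicator {\<tau> n i<..\<tau> n (Suc i)} r"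
  have fin: "finite ?J" using finite_jumps[OF f] by simp
  have p: "\<tau> n 0 = 0" "\<tau> n (m n) = t" "\<forall>i<m n. \<tau> n i \<le> \<tau> n (Suc i)" for n
    using part by (auto simp: partitions_def)
  have mono: "0 \<le> \<tau> n i" "\<tau> n i \<le> t" if "i \<le> m n" for n i
    using partition_mono[OF p(3), of 0 i n] partition_mono[OF p(3), of i "m n" n] p that by auto
  have eq: "(\<Sum>i<m n. w n i * (f (\<tau> n (Suc i)) - f (\<tau> n i))) = (\<Sum>r\<in>?J. ?w n r * jump f r)" for n
  proof -
    have "(\<Sum>i<m n. w n i * (f (\<tau> n (Suc i)) - f (\<tau> n i)))
        = (\<Sum>i<m n. w n i * (\<Sum>r\<in>?J. indicator {\<tau> n i<..\<tau> n (Suc i)} r * jump f r))"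
    proof (rule sum.cong[OF refl])
      fix i assume i: "i \<in> {..<m n}"
      then have "f (\<tau> n (Suc i)) - f (\<tau> n i) = (\<Sum>r\<in>jumps f (\<tau> n i) (\<tau> n (Suc i)). jump f r)"
        by (intro step_path_diff_eq_sum_jumps[OF f]) (use mono p in auto)
      also have "\<dots> = (\<Sum>r\<in>?J. indicator {\<tau> n i<..\<tau> n (Suc i)} r * jump f r)"
        using mono[of i n] mono[of "Suc i" n] i
        by (intro sum.mono_neutral_cong_left fin) (auto simp: jumps_def indicator_def)
      finally show "w n i * (f (\<tau> n (Suc i)) - f (\<tau> n i)) =
          w n i * (\<Sum>r\<in>?J. indicator {\<tau> n i<..\<tau> n (Suc i)} r * jump f r)" by simp
    qed
    also have "\<dots> = (\<Sum>i<m n. \<Sum>r\<in>?J. w n i * indicator {\<tau> n i<..\<tau> n (Suc i)} r * jump f r)"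
      by (simp add: sum_distrib_left mult.assoc)
    also have "\<dots> = (\<Sum>r\<in>?J. ?w n r * jump f r)"
      by (subst sum.swap) (simp only: sum_distrib_right)
    finally show ?thesis .
  qed
  have "(\<lambda>n. ?w n r) \<longlonglongrightarrow> y r" if r: "r \<in> ?J" for r
  proof (rule LIMSEQ_I)
    fix \<epsilon> :: real assume "0 < \<epsilon>"
    from r have r0: "0 < r" "r \<le> t" by (auto simp: jumps_def)
    from w[OF r0, of "\<epsilon> / 2"] \<open>0 < \<epsilon>\<close>
    have "\<forall>\<^sub>F n in sequentially. \<forall>i<m n. \<tau> n i < r \<and> r \<le> \<tau> n (Suc i) \<longrightarrow> \<bar>w n i - y r\<bar> < \<epsilon> / 2"
      by simp
    then have "\<forall>\<^sub>F n in sequentially. norm (?w n r - y r) < \<epsilon>"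
    proof eventually_elim
      case (elim n)
      have one: "(\<Sum>i<m n. indicator {\<tau> n i<..\<tau> n (Suc i)} r) = (1::real)"
        using partition_sum_indicator[OF p(3), of n r] p r0 by simp
      have "?w n r - y r = ?w n r - y r * (\<Sum>i<m n. indicator {\<tau> n i<..\<tau> n (Suc i)} r)"
        by (simp add: one)
      also have "\<dots> = (\<Sum>i<m n. (w n i - y r) * indicator {\<tau> n i<..\<tau> n (Suc i)} r)"
        by (simp add: sum_distrib_left sum_subtractf algebra_simps)
      finally have "norm (?w n r - y r) \<le> (\<Sum>i<m n. norm ((w n i - y r) * indicator {\<tau> n i<..\<tau> n (Suc i)} r))"
        by (simp only: norm_sum)
      also have "\<dots> \<le> (\<Sum>i<m n. \<epsilon> / 2 * indicator {\<tau> n i<..\<tau> n (Suc i)} r)"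
        by (intro sum_mono) (use elim in \<open>simp add: indicator_def abs_mult less_imp_le\<close>)
      also have "\<dots> = \<epsilon> / 2" by (simp only: sum_distrib_left[symmetric] one)
      finally show ?case using \<open>0 < \<epsilon>\<close> by simp
    qed
    then show "\<exists>no. \<forall>n\<ge>no. norm (?w n r - y r) < \<epsilon>"
      by (simp add: eventually_sequentially)
  qed
  then show ?thesis unfolding eq by (intro tendsto_intros)
qed

text \<open>Once the mesh is smaller than the neighbourhoods on which \<open>P\<close> and
  \<open>Q\<close> hold, the left end of the cell of \<open>r\<close> is strictly below
  \<open>r\<close> and inside the first, while the right end is inside the second or equal to
  \<open>r\<close>; the latter case is covered by \<open>Q r\<close>.\<close>

lemma partition_eventually_ends:
  assumes part: "partitions t m \<tau>" and l: "\<forall>\<^sub>F s in at_left r. P s" and rt: "\<forall>\<^sub>F s in at_right r. Q s"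
    and "Q r"
  shows "\<forall>\<^sub>F n in sequentially. \<forall>i<m n. \<tau> n i < r \<and> r \<le> \<tau> n (Suc i) \<longrightarrow> P (\<tau> n i) \<and> Q (\<tau> n (Suc i))"
proof -
  obtain a where a: "a < r" "\<And>s. a < s \<Longrightarrow> s < r \<Longrightarrow> P s"
    using l unfolding eventually_at_left_field by auto
  obtain b where b: "r < b" "\<And>s. r < s \<Longrightarrow> s < b \<Longrightarrow> Q s"
    using rt unfolding eventually_at_right_field by auto
  have "0 < min (r - a) (b - r)" using a b by auto
  then have "\<forall>\<^sub>F n in sequentially. \<forall>i<m n. \<tau> n (Suc i) - \<tau> n i < min (r - a) (b - r)"
    using part unfolding partitions_def by blast
  then show ?thesis
  proof eventually_elim
    case (elim n)
    show ?case
    proof (intro allI impI, elim conjE)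
      fix i assume i: "i < m n" "\<tau> n i < r" "r \<le> \<tau> n (Suc i)"
      have "\<tau> n (Suc i) - \<tau> n i < min (r - a) (b - r)" using elim i by blast
      then have "a < \<tau> n i" "\<tau> n (Suc i) < b" using i by auto
      then show "P (\<tau> n i) \<and> Q (\<tau> n (Suc i))"
        using a(2)[of "\<tau> n i"] b(2)[of "\<tau> n (Suc i)"] i \<open>Q r\<close> by (cases "\<tau> n (Suc i) = r") auto
    qed
  qed
qed

text \<open>The left end of the cell containing \<open>r\<close> is strictly below \<open>r\<close>,
  so sampling \<open>g\<close> itself still produces its left limit.\<close>

lemma left_partition_sum_limit:
  fixes f g :: "real \<Rightarrow> real"
  assumes f: "step_path f" and g: "cadlag g" and t: "0 \<le> t" and part: "partitions t m \<tau>"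
  shows "(\<lambda>n. \<Sum>i<m n. g (\<tau> n i) * (f (\<tau> n (Suc i)) - f (\<tau> n i)))
           \<longlonglongrightarrow> (\<Sum>r\<in>jumps f 0 t. Lim (at_left r) g * jump f r)"
proof (rule partition_sum_limit[OF f t part])
  fix r \<epsilon> :: real assume r: "0 < r" "r \<le> t" "0 < \<epsilon>"
  have "\<forall>\<^sub>F s in at_left r. \<bar>g s - Lim (at_left r) g\<bar> < \<epsilon>"
    using tendstoD[OF cadlag_left[OF g r(1)] r(3)] by (simp add: dist_real_def)
  from partition_eventually_ends[OF part this, of "\<lambda>_. True"]
  show "\<forall>\<^sub>F n in sequentially. \<forall>i<m n. \<tau> n i < r \<and> r \<le> \<tau> n (Suc i) \<longrightarrow>
      \<bar>g (\<tau> n i) - Lim (at_left r) g\<bar> < \<epsilon>" by (auto elim!: eventually_mono)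
qed

text \<open>At the ends of a fine enough cell around \<open>r\<close> the step path \<open>g\<close>
  equals its left limit and its value at \<open>r\<close>, so the weights are eventually constant,
  for an arbitrary \<open>G\<close>.\<close>

lemma step_partition_sum_limit:
  fixes f :: "real \<Rightarrow> real" and g :: "real \<Rightarrow> 'c::t2_space" and G :: "'c \<Rightarrow> 'c \<Rightarrow> real"
  assumes f: "step_path f" and g: "step_path g" and t: "0 \<le> t" and part: "partitions t m \<tau>"
  shows "(\<lambda>n. \<Sum>i<m n. G (g (\<tau> n i)) (g (\<tau> n (Suc i))) * (f (\<tau> n (Suc i)) - f (\<tau> n i)))
           \<longlonglongrightarrow> (\<Sum>r\<in>jumps f 0 t. G (Lim (at_left r) g) (g r) * jump f r)"
proof (rule partition_sum_limit[OF f t part])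
  fix r \<epsilon> :: real assume r: "0 < r" "r \<le> t" "0 < \<epsilon>"
  have "0 \<le> r" using r by simp
  from partition_eventually_ends[OF part step_path_left[OF g r(1)] step_path_right[OF g \<open>0 \<le> r\<close>] refl]
  show "\<forall>\<^sub>F n in sequentially. \<forall>i<m n. \<tau> n i < r \<and> r \<le> \<tau> n (Suc i) \<longrightarrow>
      \<bar>G (g (\<tau> n i)) (g (\<tau> n (Suc i))) - G (Lim (at_left r) g) (g r)\<bar> < \<epsilon>"
    using r by (auto elim!: eventually_mono)
qed

section \<open>Processes with stationary independent increments\<close>

abbreviation path_space :: "(real \<Rightarrow> 'b::euclidean_space) measure" where
  "path_space \<equiv> PiM {0..} (\<lambda>_. borel)"

text \<open>The part of \<open>levy_process\<close> that concerns increments only. Comparisons of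
  law on path space use just this, and it can be checked for the rescaled process by writing its
  increments as functionals of increments.\<close>

definition incr_process :: "'a measure \<Rightarrow> (real \<Rightarrow> 'a \<Rightarrow> 'b::euclidean_space) \<Rightarrow> bool" where
  "incr_process M X \<longleftrightarrow>
     prob_space M \<and>
     (\<forall>t\<ge>0. X t \<in> borel_measurable M) \<and>
     (\<forall>n (\<tau> :: nat \<Rightarrow> real). 0 \<le> \<tau> 0 \<and> (\<forall>i<n. \<tau> i \<le> \<tau> (Suc i)) \<longrightarrow>
        prob_space.indep_vars M (\<lambda>_. borel) (\<lambda>i \<omega>. X (\<tau> (Suc i)) \<omega> - X (\<tau> i) \<omega>) {..<n}) \<and>
     (\<forall>s\<ge>0. \<forall>h\<ge>0. distr M borel (\<lambda>\<omega>. X (s + h) \<omega> - X s \<omega>) = distr M borel (X h))"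

lemma levy_incr_process: "levy_process M X \<Longrightarrow> incr_process M X"
  by (simp add: levy_process_def incr_process_def)

lemma incr_process_indep:
  assumes "incr_process M X" "0 \<le> \<tau> 0" "\<And>i::nat. i < n \<Longrightarrow> \<tau> i \<le> \<tau> (Suc i)"
  shows "prob_space.indep_vars M (\<lambda>_. borel) (\<lambda>i \<omega>. X (\<tau> (Suc i)) \<omega> - X (\<tau> i) \<omega>) {..<n}"
  using assms by (simp add: incr_process_def)

text \<open>The restriction to nonnegative times makes this a point of \<open>path_space\<close>.
  The same holds for \<open>past\<close>, which is frozen after \<open>h\<close> and so remains a
  path over all times.\<close>

definition incr :: "(real \<Rightarrow> 'a \<Rightarrow> 'b::euclidean_space) \<Rightarrow> real \<Rightarrow> 'a \<Rightarrow> real \<Rightarrow> 'b" where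
  "incr X h \<omega> = (\<lambda>q\<in>{0..}. X (h + q) \<omega> - X h \<omega>)"

definition past :: "(real \<Rightarrow> 'a \<Rightarrow> 'b::euclidean_space) \<Rightarrow> real \<Rightarrow> 'a \<Rightarrow> real \<Rightarrow> 'b" where
  "past X h \<omega> = (\<lambda>q\<in>{0..}. X (min q h) \<omega> - X 0 \<omega>)"

lemma past_measurable:
  assumes "\<And>t. 0 \<le> t \<Longrightarrow> X t \<in> borel_measurable M" "0 \<le> h"
  shows "past X h \<in> M \<rightarrow>\<^sub>M path_space"
  unfolding past_def using assms by (intro measurable_restrict borel_measurable_diff) auto

lemma incr_measurable:
  assumes "\<And>t. 0 \<le> t \<Longrightarrow> X t \<in> borel_measurable M" "0 \<le> h"
  shows "incr X h \<in> M \<rightarrow>\<^sub>M path_space"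
  unfolding incr_def using assms by (intro measurable_restrict borel_measurable_diff) auto

lemma incr_processD:
  assumes "incr_process M X"
  shows "prob_space M" "0 \<le> t \<Longrightarrow> X t \<in> borel_measurable M"
    "0 \<le> h \<Longrightarrow> incr X h \<in> M \<rightarrow>\<^sub>M path_space"
    "0 \<le> h \<Longrightarrow> past X h \<in> M \<rightarrow>\<^sub>M path_space"
    "0 \<le> s \<Longrightarrow> s \<le> s' \<Longrightarrow> distr M borel (\<lambda>\<omega>. X s' \<omega> - X s \<omega>) = distr M borel (X (s' - s))"
proof -
  show "distr M borel (\<lambda>\<omega>. X s' \<omega> - X s \<omega>) = distr M borel (X (s' - s))" if "0 \<le> s" "s \<le> s'"
  proof -
    have "\<forall>s\<ge>0. \<forall>h\<ge>0. distr M borel (\<lambda>\<omega>. X (s + h) \<omega> - X s \<omega>) = distr M borel (X h)"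
      using assms by (simp add: incr_process_def)
    from this[rule_format, of s "s' - s"] that show ?thesis by simp
  qed
qed (use assms in \<open>auto simp: incr_process_def intro!: incr_measurable past_measurable\<close>)

lemma vimage_path_cylinder:
  fixes F :: "'a \<Rightarrow> real \<Rightarrow> 'b::euclidean_space"
  assumes "F \<in> M \<rightarrow>\<^sub>M path_space" "finite J" "J \<subseteq> {0..}" "\<And>i. i \<in> J \<Longrightarrow> A i \<in> sets borel"
  shows "F -` prod_emb {0..} (\<lambda>_. borel) J (Pi\<^sub>E J A) \<inter> space M = {\<omega> \<in> space M. \<forall>q\<in>J. F \<omega> q \<in> A q}"
proof -
  have "F \<omega> \<in> extensional {0..}" if "\<omega> \<in> space M" for \<omega>
    using measurable_space[OF assms(1) that] by (auto simp: space_PiM PiE_def)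
  then show ?thesis
    by (auto simp: prod_emb_iff restrict_PiE_iff)
qed

section \<open>Finite-dimensional laws of increments\<close>

context
  fixes T :: "real set" and n :: nat and ys :: "real list"
  assumes T: "finite T" "T \<subseteq> {0..}" "T \<noteq> {}" and n: "n = card T - 1" and ys: "ys = sorted_list_of_set T"
begin

text \<open>A finite set of times is arranged as a chain \<open>ys ! 0\<close>, ...,
  \<open>ys ! n\<close> with \<open>n\<close> gaps, the form in which independence of increments is
  available.\<close>

lemma chain_sorted:
  assumes "i \<le> j" "j \<le> n"
  shows "ys ! i \<le> ys ! j" and "ys ! i \<in> T"
proof -
  have "card T > 0" using T by (simp add: card_gt_0_iff)
  then have "j < card T" using assms n by linarith
  then show "ys ! i \<le> ys ! j"
    using assms ys by (intro sorted_nth_mono) auto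
  show "ys ! i \<in> T"
    using \<open>j < card T\<close> assms nth_mem[of i ys] T ys by simp
qed

lemma chain_index:
  assumes "q \<in> T"
  obtains j where "j \<le> n" "ys ! j = q"
proof -
  have "q \<in> set ys" using assms T ys by simp
  then obtain j where "j < card T" "ys ! j = q"
    using ys by (auto simp: in_set_conv_nth)
  then show thesis using n by (intro that[of j]) auto
qed

lemma chain_index_fun:
  assumes "J \<subseteq> T"
  obtains j where "\<And>q. q \<in> J \<Longrightarrow> j q \<le> n \<and> ys ! (j q) = q"
proof -
  have "\<exists>j. \<forall>q\<in>J. j q \<le> n \<and> ys ! (j q) = q"
    using assms chain_index by (intro bchoice) (metis subsetD)
  then show thesis using that by blast
qed

lemma chain_indep:
  assumes X: "incr_process M X" and "0 \<le> h"
  shows "prob_space.indep_vars M (\<lambda>_. borel)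
    (\<lambda>i \<omega>. X (h + ys ! Suc i) \<omega> - X (h + ys ! i) \<omega>) {..<n}"
proof -
  have "0 \<le> h + ys ! 0"
    using chain_sorted(2)[of 0 0] T assms by fastforce
  moreover have "\<forall>i<n. h + ys ! i \<le> h + ys ! Suc i"
    using chain_sorted(1) by auto
  ultimately show ?thesis
    using incr_process_indep[OF X, of "\<lambda>i. h + ys ! i" n] by simp
qed

text \<open>The values read by a cylinder event are partial sums of the gap increments, which are
  independent and stationary. The right-hand side thus depends only on one-dimensional laws and no
  longer on \<open>h\<close>.\<close>

lemma cylinder_law:
  fixes Y :: "real \<Rightarrow> 'a \<Rightarrow> 'b::euclidean_space"
  assumes Y: "incr_process M Y" and h: "0 \<le> h"
    and J: "finite J" "J \<subseteq> T" "\<And>i. i \<in> J \<Longrightarrow> A i \<in> sets borel"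
    and T01: "0 \<in> T" "1 \<in> T" and j: "\<And>q. q \<in> J \<Longrightarrow> j q \<le> n \<and> ys ! (j q) = q"
  shows "emeasure M {\<omega> \<in> space M. \<forall>q\<in>J. incr Y h \<omega> q \<in> A q} =
    emeasure (PiM {..<n} (\<lambda>i. distr M borel (Y (ys ! Suc i - ys ! i))))
      {d \<in> space (PiM {..<n} (\<lambda>_. borel)). \<forall>q\<in>J. (\<Sum>l<j q. d l) \<in> A q}"
    (is "_ = emeasure _ ?B")
proof -
  \<comment> \<open>Two distinct times give at least one gap: the product form of independence used
    below is for nonempty index sets.\<close>
  have "card {0, 1::real} \<le> card T" using T01 by (intro card_mono T) auto
  then have n0: "n > 0" by (simp add: n)
  have ys0: "ys ! 0 = 0"
  proof -
    obtain i where "i \<le> n" "ys ! i = 0" using chain_index[of 0] T01 by blast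
    then have "ys ! 0 \<le> 0" using chain_sorted(1)[of 0 i] by simp
    moreover have "0 \<le> ys ! 0" using chain_sorted(2)[of 0 0] T by auto
    ultimately show ?thesis by simp
  qed
  have B: "?B \<in> sets (PiM {..<n} (\<lambda>_. borel))"
  proof (rule sets.sets_Collect_finite_All[OF _ J(1)])
    fix q assume q: "q \<in> J"
    have "(\<lambda>d. \<Sum>l<j q. d l) \<in> borel_measurable (PiM {..<n} (\<lambda>_. borel :: 'b measure))"
      using j[OF q] by (intro borel_measurable_sum measurable_component_singleton) auto
    from measurable_sets[OF this J(3)[OF q]]
    show "{x \<in> space (PiM {..<n} (\<lambda>_. borel)). (\<Sum>l<j q. x l) \<in> A q} \<in> sets (PiM {..<n} (\<lambda>_. borel))"
      by (simp add: vimage_def Int_def conj_commute)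
  qed
  interpret prob_space M using Y by (rule incr_processD)
  define D where "D i \<omega> = Y (h + ys ! Suc i) \<omega> - Y (h + ys ! i) \<omega>" for i \<omega>
  have ind: "indep_vars (\<lambda>_. borel) D {..<n}"
    using chain_indep[OF Y h] unfolding D_def .
  have rv: "D i \<in> borel_measurable M" if "i < n" for i
    using ind that by (auto simp: indep_vars_def)
  have rv': "(\<lambda>\<omega>. \<lambda>i\<in>{..<n}. D i \<omega>) \<in> M \<rightarrow>\<^sub>M PiM {..<n} (\<lambda>_. borel)"
    using rv by (intro measurable_restrict) auto
  have dl: "distr M borel (D i) = distr M borel (Y (ys ! Suc i - ys ! i))" if "i < n" for i
  proof -
    have "0 \<le> ys ! i" using chain_sorted(2)[of i i] that T by auto
    then show ?thesis unfolding D_def[abs_def]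
      using chain_sorted(1)[of i "Suc i"] that h by (subst incr_processD(5)[OF Y]) auto
  qed
  have "{\<omega> \<in> space M. \<forall>q\<in>J. incr Y h \<omega> q \<in> A q} = (\<lambda>\<omega>. \<lambda>i\<in>{..<n}. D i \<omega>) -` ?B \<inter> space M"
  proof -
    have eq: "incr Y h \<omega> q = (\<Sum>l<j q. (\<lambda>i\<in>{..<n}. D i \<omega>) l)" if q: "q \<in> J" for \<omega> q
    proof -
      have "(\<Sum>l<j q. (\<lambda>i\<in>{..<n}. D i \<omega>) l) = (\<Sum>l<j q. D l \<omega>)"
        using j[OF q] by (intro sum.cong) auto
      also have "\<dots> = Y (h + q) \<omega> - Y h \<omega>"
        unfolding D_def using j[OF q] by (simp add: sum_lessThan_telescope[of "\<lambda>l. Y (h + ys ! l) \<omega>"] ys0)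
      finally show ?thesis using q J T by (auto simp: incr_def)
    qed
    show ?thesis
    proof (intro equalityI subsetI)
      fix \<omega> assume "\<omega> \<in> {\<omega> \<in> space M. \<forall>q\<in>J. incr Y h \<omega> q \<in> A q}"
      then show "\<omega> \<in> (\<lambda>\<omega>. \<lambda>i\<in>{..<n}. D i \<omega>) -` ?B \<inter> space M"
        using measurable_space[OF rv', of \<omega>] eq by simp
    next
      fix \<omega> assume "\<omega> \<in> (\<lambda>\<omega>. \<lambda>i\<in>{..<n}. D i \<omega>) -` ?B \<inter> space M"
      then show "\<omega> \<in> {\<omega> \<in> space M. \<forall>q\<in>J. incr Y h \<omega> q \<in> A q}"
        using eq by simp
    qed
  qed
  then have "emeasure M {\<omega> \<in> space M. \<forall>q\<in>J. incr Y h \<omega> q \<in> A q}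
      = emeasure (distr M (PiM {..<n} (\<lambda>_. borel)) (\<lambda>\<omega>. \<lambda>i\<in>{..<n}. D i \<omega>)) ?B"
    using B rv' by (simp add: emeasure_distr)
  also have "distr M (PiM {..<n} (\<lambda>_. borel)) (\<lambda>\<omega>. \<lambda>i\<in>{..<n}. D i \<omega>) = PiM {..<n} (\<lambda>i. distr M borel (D i))"
  proof -
    have "{..<n} \<noteq> {}" using n0 by auto
    from indep_vars_iff_distr_eq_PiM'[OF this, of D "\<lambda>_. borel"] ind rv show ?thesis by auto
  qed
  also have "\<dots> = PiM {..<n} (\<lambda>i. distr M borel (Y (ys ! Suc i - ys ! i)))"
    using dl by (intro PiM_cong) auto
  finally show ?thesis .
qed

end

text \<open>Cylinders generate the sigma-algebra of path space, and by \<open>cylinder_law\<close>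
  both sides reduce to the same product measure. For one process and two starting times this is
  stationarity of the increments as whole paths.\<close>

lemma incr_law_eq:
  fixes X :: "real \<Rightarrow> 'a \<Rightarrow> 'b::euclidean_space" and Y :: "real \<Rightarrow> 'c \<Rightarrow> 'b"
  assumes X: "incr_process M X" and Y: "incr_process M' Y" and h: "0 \<le> h" "0 \<le> h'"
    and eq: "\<And>t. 0 \<le> t \<Longrightarrow> distr M borel (X t) = distr M' borel (Y t)"
  shows "distr M path_space (incr X h) = distr M' path_space (incr Y h')"
proof (rule measure_eqI_PiM_infinite)
  note [measurable] = incr_processD(3)[OF X h(1)] incr_processD(3)[OF Y h(2)]
  interpret prob_space M using X by (rule incr_processD)
  show "finite_measure (distr M path_space (incr X h))"
    by (intro finite_measure_distr) simp
  fix A J assume J: "finite J" "J \<subseteq> {0..}" "\<And>i::real. i \<in> J \<Longrightarrow> A i \<in> sets (borel :: 'b measure)"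
  let ?E = "prod_emb {0..} (\<lambda>_. borel) J (Pi\<^sub>E J A)"
  have E: "?E \<in> sets path_space" using J by (intro sets_PiM_I) auto
  define T where "T = insert 0 (insert 1 J)"
  have T: "finite T" "T \<subseteq> {0..}" "T \<noteq> {}" using J by (auto simp: T_def)
  have JT: "J \<subseteq> T" "0 \<in> T" "1 \<in> T" by (auto simp: T_def)
  obtain j where j: "\<And>q. q \<in> J \<Longrightarrow> j q \<le> card T - 1 \<and> sorted_list_of_set T ! (j q) = q"
    using chain_index_fun[OF T refl refl JT(1)] by metis
  let ?ys = "sorted_list_of_set T" and ?n = "card T - 1"
  have "emeasure (distr M path_space (incr X h)) ?E = emeasure M {\<omega> \<in> space M. \<forall>q\<in>J. incr X h \<omega> q \<in> A q}"
    using E J by (simp add: emeasure_distr vimage_path_cylinder)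
  also have "\<dots> = emeasure M' {\<omega> \<in> space M'. \<forall>q\<in>J. incr Y h' \<omega> q \<in> A q}"
  proof -
    have "PiM {..<?n} (\<lambda>i. distr M borel (X (?ys ! Suc i - ?ys ! i)))
        = PiM {..<?n} (\<lambda>i. distr M' borel (Y (?ys ! Suc i - ?ys ! i)))"
      using chain_sorted(1)[OF T refl refl] by (intro PiM_cong eq) auto
    then show ?thesis
      using cylinder_law[OF T refl refl X h(1) J(1) JT(1) J(3) JT(2,3) j]
        cylinder_law[OF T refl refl Y h(2) J(1) JT(1) J(3) JT(2,3) j] by simp
  qed
  also have "\<dots> = emeasure (distr M' path_space (incr Y h')) ?E"
    using E J by (simp add: emeasure_distr vimage_path_cylinder)
  finally show "emeasure (distr M path_space (incr X h)) ?E = emeasure (distr M' path_space (incr Y h')) ?E" .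
qed auto

text \<open>Independence of finitely many increments is lifted to the two generated sigma-algebras
  by checking it on intersection-stable generators. A pair of cylinders is refined to one common
  chain of times, whose increments before \<open>h\<close> serve the past and those after
  \<open>h\<close> the future.\<close>

lemma indep_past_incr:
  fixes X :: "real \<Rightarrow> 'a \<Rightarrow> 'b::euclidean_space"
  assumes X: "incr_process M X" and h: "0 \<le> h"
  shows "prob_space.indep_var M path_space (past X h) path_space (incr X h)"
proof -
  interpret prob_space M using X by (rule incr_processD)
  have mp: "past X h \<in> M \<rightarrow>\<^sub>M path_space" and mi: "incr X h \<in> M \<rightarrow>\<^sub>M path_space"
    using incr_processD[OF X] h by auto
  let ?G = "prod_algebra {0..} (\<lambda>_. borel :: 'b measure)"
  \<comment> \<open>Pulling back commutes with generating, so preimages of cylinders generate the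
    sigma-algebra of each path variable.\<close>
  have gen: "sigma_sets (space M) {F -` A \<inter> space M |A. A \<in> sets path_space} =
      sigma_sets (space M) {F -` A \<inter> space M |A. A \<in> ?G}" if F: "F \<in> M \<rightarrow>\<^sub>M path_space" for F
  proof -
    have "F \<in> space M \<rightarrow> (\<Pi>\<^sub>E i\<in>{0..}. space borel)"
      using measurable_space[OF F] by (auto simp: space_PiM)
    from sigma_sets_vimage_commute[OF this, of ?G]
    have "{F -` A \<inter> space M |A. A \<in> sets path_space} = sigma_sets (space M) {F -` A \<inter> space M |A. A \<in> ?G}"
      by (simp add: sets_PiM)
    then show ?thesis
      by (simp only:) (rule sigma_sets_sigma_sets_eq, auto)
  qed
  have IS: "Int_stable {F -` A \<inter> space M |A. A \<in> ?G}" for F :: "'a \<Rightarrow> real \<Rightarrow> 'b"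
  proof (rule Int_stableI)
    fix a b assume "a \<in> {F -` A \<inter> space M |A. A \<in> ?G}" "b \<in> {F -` A \<inter> space M |A. A \<in> ?G}"
    then obtain A B where AB: "a = F -` A \<inter> space M" "b = F -` B \<inter> space M" "A \<in> ?G" "B \<in> ?G" by auto
    then have "A \<inter> B \<in> ?G" using Int_stable_prod_algebra by (metis Int_stableD)
    then show "a \<inter> b \<in> {F -` A \<inter> space M |A. A \<in> ?G}"
      using AB by (intro CollectI exI[of _ "A \<inter> B"]) auto
  qed
  have "indep_set {past X h -` A \<inter> space M |A. A \<in> ?G} {incr X h -` A \<inter> space M |A. A \<in> ?G}"
  proof (rule indep_setI)
    have "?G \<subseteq> sets path_space" unfolding sets_PiM by auto
    then show "{past X h -` A \<inter> space M |A. A \<in> ?G} \<subseteq> events" "{incr X h -` A \<inter> space M |A. A \<in> ?G} \<subseteq> events"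
      using mp mi by (auto intro!: measurable_sets)
  next
    fix a b assume "a \<in> {past X h -` A \<inter> space M |A. A \<in> ?G}" "b \<in> {incr X h -` A \<inter> space M |A. A \<in> ?G}"
    then obtain A' B' where A': "A' \<in> ?G" "a = past X h -` A' \<inter> space M"
      and B': "B' \<in> ?G" "b = incr X h -` B' \<inter> space M" by auto
    obtain J A where J: "A' = prod_emb {0..} (\<lambda>_. borel) J (Pi\<^sub>E J A)" "finite J" "J \<subseteq> {0..}"
      "\<And>i. i \<in> J \<Longrightarrow> A i \<in> sets borel" using prod_algebraE[OF A'(1)] by metis
    obtain K B where K: "B' = prod_emb {0..} (\<lambda>_. borel) K (Pi\<^sub>E K B)" "finite K" "K \<subseteq> {0..}"
      "\<And>i. i \<in> K \<Longrightarrow> B i \<in> sets borel" using prod_algebraE[OF B'(1)] by metis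
    \<comment> \<open>All times at which either cylinder looks at \<open>X\<close>, on the original
      time axis, together with the origin and the splitting point.\<close>
    define T where "T = {0, h} \<union> (\<lambda>q. min q h) ` J \<union> (+) h ` K"
    have T: "finite T" "T \<subseteq> {0..}" "T \<noteq> {}" using J K h by (auto simp: T_def)
    define n where "n = card T - 1"
    define ys where "ys = sorted_list_of_set T"
    note sr = chain_sorted[OF T n_def ys_def]
    obtain j where j: "\<And>q. q \<in> T \<Longrightarrow> j q \<le> n \<and> ys ! (j q) = q"
      using chain_index_fun[OF T n_def ys_def subset_refl] by metis
    define D where "D i \<omega> = X (0 + ys ! Suc i) \<omega> - X (0 + ys ! i) \<omega>" for i \<omega>
    have ind: "indep_vars (\<lambda>_. borel) D {..<n}"
      using chain_indep[OF T n_def ys_def X, of 0] by (simp add: D_def[abs_def])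
    have tel: "X t \<omega> - X s \<omega> = (\<Sum>l\<in>{j s..<j t}. D l \<omega>)" if "s \<in> T" "t \<in> T" "j s \<le> j t" for s t \<omega>
      using j that sum_Suc_diff'[of "j s" "j t" "\<lambda>l. X (ys ! l) \<omega>"] by (simp add: D_def)
    have jm: "j s \<le> j t" if "s \<in> T" "t \<in> T" "s < t" for s t
      using sr(1)[of "j t" "j s"] j that by (metis linorder_not_less nle_le)
    let ?I1 = "{..<j h}" and ?I2 = "{j h..<n}"
    have hT: "h \<in> T" "0 \<in> T" by (auto simp: T_def)
    \<comment> \<open>The chain splits at the index of \<open>h\<close> into two disjoint blocks of
      independent increments.\<close>
    have iv: "indep_var (PiM ?I1 (\<lambda>_. borel)) (\<lambda>\<omega>. restrict (\<lambda>i. D i \<omega>) ?I1) (PiM ?I2 (\<lambda>_. borel)) (\<lambda>\<omega>. restrict (\<lambda>i. D i \<omega>) ?I2)"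
      using j[OF hT(1)] by (intro indep_var_restrict[OF ind]) auto
    define A2 where "A2 = {d \<in> space (PiM ?I1 (\<lambda>_. borel :: 'b measure)). \<forall>q\<in>J. (\<Sum>l\<in>{j 0..<j (min q h)}. d l) \<in> A q}"
    define B2 where "B2 = {d \<in> space (PiM ?I2 (\<lambda>_. borel :: 'b measure)). \<forall>q\<in>K. (\<Sum>l\<in>{j h..<j (h + q)}. d l) \<in> B q}"
    have qT: "min q h \<in> T" if "q \<in> J" for q using that by (auto simp: T_def)
    have qK: "h + q \<in> T" if "q \<in> K" for q using that by (auto simp: T_def)
    have jq: "j 0 \<le> j (min q h)" "j (min q h) \<le> j h" if "q \<in> J" for q
    proof -
      have "0 \<le> min q h" using that J h by auto
      then consider "0 = min q h" | "0 < min q h" by linarith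
      then show "j 0 \<le> j (min q h)"
        by cases (simp, rule jm[OF hT(2) qT[OF that]])
      consider "min q h = h" | "min q h < h" by linarith
      then show "j (min q h) \<le> j h"
        by cases (simp, rule jm[OF qT[OF that] hT(1)])
    qed
    have jk: "j h \<le> j (h + q)" "j (h + q) \<le> n" if "q \<in> K" for q
    proof -
      have "0 \<le> q" using that K by auto
      then show "j h \<le> j (h + q)" using jm[OF hT(1) qK[OF that]] by (cases "q = 0") auto
      show "j (h + q) \<le> n" using j[OF qK[OF that]] by simp
    qed
    have mI: "{x \<in> space (PiM I (\<lambda>_. borel)). (\<Sum>l\<in>I'. x l) \<in> C} \<in> sets (PiM I (\<lambda>_. borel :: 'b measure))"
      if "I' \<subseteq> I" "C \<in> sets borel" for I I' :: "nat set" and C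
    proof -
      have "(\<lambda>d. \<Sum>l\<in>I'. d l) \<in> borel_measurable (PiM I (\<lambda>_. borel :: 'b measure))"
        using that by (intro borel_measurable_sum measurable_component_singleton) auto
      from measurable_sets[OF this that(2)] show ?thesis
        by (simp add: vimage_def Int_def conj_commute)
    qed
    have A2: "A2 \<in> sets (PiM ?I1 (\<lambda>_. borel))" unfolding A2_def
    proof (rule sets.sets_Collect_finite_All[OF mI J(2)])
      show "{j 0..<j (min q h)} \<subseteq> ?I1" if "q \<in> J" for q using jq(2)[OF that] by auto
    qed (rule J(4))
    have B2: "B2 \<in> sets (PiM ?I2 (\<lambda>_. borel))" unfolding B2_def
    proof (rule sets.sets_Collect_finite_All[OF mI K(2)])
      show "{j h..<j (h + q)} \<subseteq> ?I2" if "q \<in> K" for q using jk(2)[OF that] by auto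
    qed (rule K(4))
    have a: "a = (\<lambda>\<omega>. restrict (\<lambda>i. D i \<omega>) ?I1) -` A2 \<inter> space M"
    proof -
      have "past X h \<omega> q = (\<Sum>l\<in>{j 0..<j (min q h)}. restrict (\<lambda>i. D i \<omega>) ?I1 l)" if "q \<in> J" for q \<omega>
      proof -
        have "(\<Sum>l\<in>{j 0..<j (min q h)}. restrict (\<lambda>i. D i \<omega>) ?I1 l) = (\<Sum>l\<in>{j 0..<j (min q h)}. D l \<omega>)"
          using jq[OF that] by (intro sum.cong) auto
        also have "\<dots> = X (min q h) \<omega> - X 0 \<omega>" using tel[OF hT(2) qT[OF that] jq(1)[OF that]] by simp
        finally show ?thesis using that J by (auto simp: past_def)
      qed
      then have "(\<lambda>\<omega>. restrict (\<lambda>i. D i \<omega>) ?I1) -` A2 \<inter> space M = {\<omega> \<in> space M. \<forall>q\<in>J. past X h \<omega> q \<in> A q}"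
        unfolding A2_def by (simp add: set_eq_iff space_PiM conj_commute del: restrict_apply)
      then show ?thesis
        using vimage_path_cylinder[OF mp J(2,3,4)] A'(2) J(1) by simp
    qed
    have b: "b = (\<lambda>\<omega>. restrict (\<lambda>i. D i \<omega>) ?I2) -` B2 \<inter> space M"
    proof -
      have "incr X h \<omega> q = (\<Sum>l\<in>{j h..<j (h + q)}. restrict (\<lambda>i. D i \<omega>) ?I2 l)" if "q \<in> K" for q \<omega>
      proof -
        have "(\<Sum>l\<in>{j h..<j (h + q)}. restrict (\<lambda>i. D i \<omega>) ?I2 l) = (\<Sum>l\<in>{j h..<j (h + q)}. D l \<omega>)"
          using jk[OF that] by (intro sum.cong) auto
        also have "\<dots> = X (h + q) \<omega> - X h \<omega>" using tel[OF hT(1) qK[OF that] jk(1)[OF that]] by simp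
        finally show ?thesis using that K by (auto simp: incr_def)
      qed
      then have "(\<lambda>\<omega>. restrict (\<lambda>i. D i \<omega>) ?I2) -` B2 \<inter> space M = {\<omega> \<in> space M. \<forall>q\<in>K. incr X h \<omega> q \<in> B q}"
        unfolding B2_def by (simp add: set_eq_iff space_PiM conj_commute del: restrict_apply)
      then show ?thesis
        using vimage_path_cylinder[OF mi K(2,3,4)] B'(2) K(1) by simp
    qed
    show "prob (a \<inter> b) = prob a * prob b"
      using indep_varD[OF iv A2 B2] unfolding a b
      by (simp add: vimage_def Int_def conj_ac del: restrict_apply)
  qed
  note ind = indep_set_sigma_sets[OF this IS IS]
  show ?thesis
    unfolding indep_var_eq gen[OF mp] gen[OF mi] by (intro conjI mp mi ind)
qed

section \<open>Pathwise integrals as functionals on path space\<close>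

lemma Lim_at_left_cong:
  fixes f g :: "real \<Rightarrow> 'b::t2_space"
  assumes "0 < t" "\<And>s. 0 \<le> s \<Longrightarrow> s < t \<Longrightarrow> f s = g s"
  shows "Lim (at_left t) f = Lim (at_left t) g"
proof -
  have "\<forall>\<^sub>F s in at_left t. f s = g s"
    unfolding eventually_at_left_field using assms by (intro exI[of _ 0]) auto
  from tendsto_cong[OF this] show ?thesis unfolding t2_space_class.Lim_def by simp
qed

lemma jump_cong:
  assumes "0 < t" "\<And>s. 0 \<le> s \<Longrightarrow> s \<le> t \<Longrightarrow> f s = g s"
  shows "jump f t = jump g t"
  using Lim_at_left_cong[of t f g] assms by (simp add: jump_def)

lemma step_path_cong:
  assumes "\<And>s. 0 \<le> s \<Longrightarrow> f s = g s" "step_path g"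
  shows "step_path f"
  unfolding step_path_def
proof (intro conjI allI impI)
  fix t :: real assume "0 \<le> t"
  then have "\<forall>\<^sub>F s in at_right t. g s = g t" "\<forall>\<^sub>F s in at_right t. t < s"
    using assms by (auto simp: step_path_def eventually_at_right_field intro: gt_ex)
  then show "\<forall>\<^sub>F s in at_right t. f s = f t"
    by eventually_elim (use assms \<open>0 \<le> t\<close> in auto)
next
  fix t :: real assume "0 < t"
  then obtain y where "\<forall>\<^sub>F s in at_left t. g s = y" using assms by (auto simp: step_path_def)
  moreover have "\<forall>\<^sub>F s in at_left t. 0 < s"
    unfolding eventually_at_left_field using \<open>0 < t\<close> by (intro exI[of _ 0]) auto
  ultimately have "\<forall>\<^sub>F s in at_left t. f s = y"
    by eventually_elim (use assms in auto)
  then show "\<exists>y. \<forall>\<^sub>F s in at_left t. f s = y" ..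
qed

lemma eventually_at_left_shift:
  "(\<forall>\<^sub>F q in at_left r. P (h + q)) \<longleftrightarrow> (\<forall>\<^sub>F s in at_left (h + r). P s)" for r h :: real
proof
  assume "\<forall>\<^sub>F q in at_left r. P (h + q)"
  then obtain a where "a < r" "\<And>q. a < q \<Longrightarrow> q < r \<Longrightarrow> P (h + q)"
    unfolding eventually_at_left_field by auto
  then show "\<forall>\<^sub>F s in at_left (h + r). P s"
    unfolding eventually_at_left_field
    by (intro exI[of _ "h + a"] conjI allI impI) (auto dest: spec[of _ "_ - h"], metis add.commute diff_add_cancel less_diff_eq add_less_cancel_left)
next
  assume "\<forall>\<^sub>F s in at_left (h + r). P s"
  then obtain a where "a < h + r" "\<And>q. a < q \<Longrightarrow> q < h + r \<Longrightarrow> P q"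
    unfolding eventually_at_left_field by auto
  then show "\<forall>\<^sub>F q in at_left r. P (h + q)"
    unfolding eventually_at_left_field by (intro exI[of _ "a - h"]) auto
qed

lemma step_path_shift:
  fixes f :: "real \<Rightarrow> 'b::t2_space"
  assumes f: "step_path f" and "0 \<le> h"
  shows "step_path (\<lambda>q. f (h + q))"
  unfolding step_path_def
proof (intro conjI allI impI)
  fix t :: real assume "0 \<le> t"
  then have "\<forall>\<^sub>F s in at_right (h + t). f s = f (h + t)"
    using assms step_path_right[OF f, of "h + t"] by simp
  then obtain b where "b > h + t" "\<And>s. h + t < s \<Longrightarrow> s < b \<Longrightarrow> f s = f (h + t)"
    unfolding eventually_at_right_field by auto
  then show "\<forall>\<^sub>F q in at_right t. f (h + q) = f (h + t)"
    unfolding eventually_at_right_field by (intro exI[of _ "b - h"]) auto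
next
  fix t :: real assume "0 < t"
  then have "\<forall>\<^sub>F s in at_left (h + t). f s = Lim (at_left (h + t)) f"
    using assms step_path_left[OF f, of "h + t"] by simp
  then show "\<exists>y. \<forall>\<^sub>F q in at_left t. f (h + q) = y"
    by (subst eventually_at_left_shift) blast
qed

lemma jump_shift:
  fixes f :: "real \<Rightarrow> 'b::real_normed_vector"
  assumes f: "step_path f" and "0 \<le> h" "0 < r"
  shows "jump (\<lambda>q. f (h + q) - a) r = jump f (h + r)"
proof -
  have "\<forall>\<^sub>F s in at_left (h + r). f s = Lim (at_left (h + r)) f"
    using assms by (intro step_path_left) auto
  then have "\<forall>\<^sub>F q in at_left r. f (h + q) = Lim (at_left (h + r)) f"
    by (subst eventually_at_left_shift)
  then have "\<forall>\<^sub>F q in at_left r. f (h + q) - a = Lim (at_left (h + r)) f - a"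
    by eventually_elim simp
  from Lim_eventually_const[OF this] show ?thesis by (simp add: jump_def)
qed

lemma step_path_fst: "step_path x \<Longrightarrow> step_path (\<lambda>t. fst (x t))"
  using step_path_comp[of x fst] .

lemma step_path_snd: "step_path x \<Longrightarrow> step_path (\<lambda>t. snd (x t))"
  using step_path_comp[of x snd] .

lemma jump_pair:
  fixes x :: "real \<Rightarrow> real \<times> real"
  assumes "step_path x" "0 < t"
  shows "jump x t = (jump (\<lambda>t. fst (x t)) t, jump (\<lambda>t. snd (x t)) t)"
  using Lim_step_comp[OF assms, of fst] Lim_step_comp[OF assms, of snd]
  by (simp add: jump_def prod_eq_iff)

section \<open>Integral functionals as limits along uniform partitions\<close>

definition unif :: "real \<Rightarrow> nat \<Rightarrow> nat \<Rightarrow> real" where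
  "unif t n i = t * real i / real (Suc n)"

lemma unif_bounds:
  assumes "0 \<le> t" "i \<le> Suc n"
  shows "0 \<le> unif t n i" "unif t n i \<le> t"
proof -
  show "0 \<le> unif t n i" using assms by (simp add: unif_def)
  have "t * real i \<le> t * real (Suc n)" using assms by (intro mult_left_mono) auto
  then show "unif t n i \<le> t" unfolding unif_def by (simp add: field_simps)
qed

lemma unif_0 [simp]: "unif t n 0 = 0" and unif_end [simp]: "unif t n (Suc n) = t"
  by (simp_all add: unif_def)

lemma unif_diff: "unif t n (Suc i) - unif t n i = t / real (Suc n)"
  by (simp add: unif_def diff_divide_distrib[symmetric] distrib_left)

lemma unif_mono: "0 \<le> t \<Longrightarrow> unif t n i \<le> unif t n (Suc i)"
  using unif_diff[of t n i] by (smt (verit) divide_nonneg_nonneg of_nat_0_le_iff)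

lemma unif_partitions: "0 \<le> t \<Longrightarrow> partitions t Suc (unif t)"
  unfolding partitions_def
proof (intro conjI allI impI)
  fix \<delta> :: real assume "0 \<le> t" "0 < \<delta>"
  have "(\<lambda>n. t * inverse (real (Suc n))) \<longlonglongrightarrow> t * 0"
    by (intro tendsto_intros LIMSEQ_inverse_real_of_nat)
  then have "\<forall>\<^sub>F n in sequentially. t * inverse (real (Suc n)) < \<delta>"
    using \<open>0 < \<delta>\<close> by (intro order_tendstoD(2)) simp_all
  then show "\<forall>\<^sub>F n in sequentially. \<forall>i<Suc n. unif t n (Suc i) - unif t n i < \<delta>"
    by eventually_elim (simp only: unif_diff divide_inverse, simp)
qed (auto intro: unif_mono)

text \<open>Both cell ends and the final time enter the weight, so that one definition serves
  weights looking back to \<open>r-\<close> and weights looking ahead to \<open>t\<close>. There are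
  \<open>Suc n\<close> cells; \<open>n = 0\<close> is the single cell (0,t].\<close>

definition psum :: "(real \<Rightarrow> real \<Rightarrow> real \<Rightarrow> real) \<Rightarrow> real \<Rightarrow> nat \<Rightarrow> (real \<Rightarrow> real \<times> real) \<Rightarrow> real" where
  "psum G t n x = (\<Sum>i<Suc n. G (fst (x (unif t n i))) (fst (x (unif t n (Suc i)))) (fst (x t)) *
     (snd (x (unif t n (Suc i))) - snd (x (unif t n i))))"

text \<open>On step paths \<open>pint\<close> is the pathwise integral \<open>jint\<close>, but its measurability in the path is evident.
  The three arguments of the weight \<open>G\<close> stand for the values of \<open>N\<close> at \<open>r-\<close>, \<open>r\<close> and \<open>t\<close>.\<close>

definition pint :: "(real \<Rightarrow> real \<Rightarrow> real \<Rightarrow> real) \<Rightarrow> real \<Rightarrow> (real \<Rightarrow> real \<times> real) \<Rightarrow> real" where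
  "pint G t x = lim (\<lambda>n. psum G t n x)"

definition jint :: "(real \<Rightarrow> real \<Rightarrow> real \<Rightarrow> real) \<Rightarrow> real \<Rightarrow> (real \<Rightarrow> real \<times> real) \<Rightarrow> real" where
  "jint G t x = (\<Sum>r\<in>jumps (\<lambda>r. snd (x r)) 0 t.
     G (Lim (at_left r) (\<lambda>r. fst (x r))) (fst (x r)) (fst (x t)) * jump (\<lambda>r. snd (x r)) r)"

lemma psum_tendsto:
  assumes "step_path x" "0 \<le> t"
  shows "(\<lambda>n. psum G t n x) \<longlonglongrightarrow> jint G t x"
  unfolding psum_def jint_def
  using step_partition_sum_limit[OF step_path_snd[OF assms(1)] step_path_fst[OF assms(1)] assms(2)
      unif_partitions[OF assms(2)], of "\<lambda>a b. G a b (fst (x t))"] by simp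

lemma pint_eq_jint: "step_path x \<Longrightarrow> 0 \<le> t \<Longrightarrow> pint G t x = jint G t x"
  unfolding pint_def by (rule limI[OF psum_tendsto])

lemma psum_cong:
  assumes "\<And>s. 0 \<le> s \<Longrightarrow> s \<le> t \<Longrightarrow> x s = y s" "0 \<le> t"
  shows "psum G t n x = psum G t n y"
  unfolding psum_def using assms unif_bounds[of t _ n]
  by (intro sum.cong refl) (simp add: Suc_leI)

lemma pint_cong:
  assumes "\<And>s. 0 \<le> s \<Longrightarrow> s \<le> t \<Longrightarrow> x s = y s" "0 \<le> t"
  shows "pint G t x = pint G t y"
  unfolding pint_def using psum_cong[OF assms] by simp

lemma path_component_measurable:
  "0 \<le> t \<Longrightarrow> (\<lambda>x. x t) \<in> borel_measurable (path_space :: (real \<Rightarrow> 'b::euclidean_space) measure)"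
  by (rule measurable_component_singleton) simp

lemma psum_measurable:
  assumes [measurable]: "(\<lambda>(a, b, d). G a b d) \<in> borel_measurable borel" and t: "0 \<le> t"
  shows "psum G t n \<in> borel_measurable path_space"
proof -
  have G: "(\<lambda>x. G (f x) (g x) (h x)) \<in> borel_measurable path_space"
    if "f \<in> borel_measurable path_space" "g \<in> borel_measurable path_space" "h \<in> borel_measurable path_space"
    for f g h :: "(real \<Rightarrow> real \<times> real) \<Rightarrow> real"
    using measurable_compose[OF borel_measurable_Pair[OF that(1) borel_measurable_Pair[OF that(2,3)]] assms(1)]
    by simp
  have F: "(\<lambda>x. fst (x s)) \<in> borel_measurable (path_space :: (real \<Rightarrow> real \<times> real) measure)"
    "(\<lambda>x. snd (x s)) \<in> borel_measurable (path_space :: (real \<Rightarrow> real \<times> real) measure)" if "0 \<le> s" for s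
    using path_component_measurable[OF that, where ?'b = "real \<times> real"]
    by (rule measurable_compose, intro borel_measurable_continuous_onI continuous_intros)+
  show ?thesis
    unfolding psum_def[abs_def] using t unif_bounds(1)[OF t]
    by (intro borel_measurable_sum borel_measurable_times borel_measurable_diff G F) auto
qed

lemma pint_measurable:
  assumes "(\<lambda>(a, b, d). G a b d) \<in> borel_measurable borel" and t: "0 \<le> t"
  shows "pint G t \<in> borel_measurable path_space"
  unfolding pint_def[abs_def] using psum_measurable[OF assms]
  by (intro borel_measurable_lim_metric) auto

text \<open>On step paths \<open>wI\<close> yields the integral of c^(-N(s-)) against L, whose limit
  carries the stationary law; \<open>wB\<close> yields the inhomogeneous term of the affine
  recursion at time t; \<open>wT\<close> multiplies every jump of L by c^(-\<Delta>N).\<close>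

definition wI :: "real \<Rightarrow> real \<Rightarrow> real \<Rightarrow> real \<Rightarrow> real" where "wI c a b d = c powr (- a)"
definition wB :: "real \<Rightarrow> real \<Rightarrow> real \<Rightarrow> real \<Rightarrow> real" where "wB c a b d = c powr (b - d)"
definition wT :: "real \<Rightarrow> real \<Rightarrow> real \<Rightarrow> real \<Rightarrow> real" where "wT c a b d = c powr (a - b)"

lemma weight_measurable:
  "(\<lambda>(a, b, d). wI c a b d) \<in> borel_measurable borel"
  "(\<lambda>(a, b, d). wB c a b d) \<in> borel_measurable borel"
  "(\<lambda>(a, b, d). wT c a b d) \<in> borel_measurable borel"
  unfolding wI_def wB_def wT_def borel_prod[symmetric] by measurable

text \<open>The numbering matters for later references: 1 to 3 are the partial sums and 4 to 6 their
  limits, each in the order \<open>wI\<close>, \<open>wB\<close>, \<open>wT\<close>.\<close>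

lemmas functional_measurable =
  weight_measurable(1)[THEN psum_measurable] weight_measurable(2)[THEN psum_measurable]
  weight_measurable(3)[THEN psum_measurable] weight_measurable(1)[THEN pint_measurable]
  weight_measurable(2)[THEN pint_measurable] weight_measurable(3)[THEN pint_measurable]

subsection \<open>Paths of the compound Poisson process\<close>

text \<open>\<open>\<kappa>\<close> stands for c^(-k), the second coordinate of the third atom of
  \<open>nu\<close>; the index k - 1 corresponds to \<open>c * \<kappa>\<close>.\<close>

definition cp_path :: "real \<Rightarrow> (real \<Rightarrow> real \<times> real) \<Rightarrow> bool" where
  "cp_path \<kappa> x \<longleftrightarrow> x 0 = 0 \<and> step_path x \<and> (\<forall>t>0. jump x t \<in> {0, (1, 0), (0, 1), (1, \<kappa>)})"

lemma cp_path_cong: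
  assumes "\<And>s. 0 \<le> s \<Longrightarrow> x s = y s" "cp_path \<kappa> y"
  shows "cp_path \<kappa> x"
  using assms step_path_cong[of x y] jump_cong[of _ x y] by (auto simp: cp_path_def)

lemma cp_path_jumps:
  assumes "cp_path \<kappa> x" "0 < t"
  shows "(jump (\<lambda>t. fst (x t)) t, jump (\<lambda>t. snd (x t)) t) \<in> {0, (1, 0), (0, 1), (1, \<kappa>)}"
  using assms jump_pair[of x t] by (auto simp: cp_path_def)

lemma cp_path_step: "cp_path \<kappa> x \<Longrightarrow> step_path x"
  by (simp add: cp_path_def)

lemma finite_jump_points:
  fixes f :: "real \<Rightarrow> 'b::real_normed_vector"
  assumes "step_path f"
  shows "finite ({r. 0 < r \<and> jump f r \<noteq> 0} \<inter> {0<..t})"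
  using finite_jumps[OF assms, of 0] by (simp add: jumps_Int)

text \<open>The flow property behind the Markov character of the recursion: jumps up to
  \<open>h\<close> share the factor c^(N(h) - N(h+t)), and the later ones see only the path
  restarted at \<open>h\<close>.\<close>

lemma jint_flow:
  assumes x: "step_path x" and h: "0 \<le> h" and t: "0 \<le> t" and "c > 0"
  shows "jint (wB c) (h + t) x =
    c powr (- (fst (x (h + t)) - fst (x h))) * jint (wB c) h x + jint (wB c) t (\<lambda>q. x (h + q) - x h)"
proof -
  let ?L = "\<lambda>r. snd (x r)" and ?N = "\<lambda>r. fst (x r)"
  have sh: "jump (\<lambda>q. snd (x (h + q) - x h)) r = jump ?L (h + r)" if "0 < r" for r
    using jump_shift[OF step_path_snd[OF x] h that, of "snd (x h)"] by simp
  have J: "jumps ?L h (h + t) = (+) h ` jumps (\<lambda>q. snd (x (h + q) - x h)) 0 t"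
  proof (intro equalityI subsetI)
    fix r assume "r \<in> jumps ?L h (h + t)"
    then show "r \<in> (+) h ` jumps (\<lambda>q. snd (x (h + q) - x h)) 0 t"
      using sh[of "r - h"] by (intro image_eqI[of _ _ "r - h"]) (auto simp: jumps_def)
  qed (use sh in \<open>auto simp: jumps_def\<close>)
  have "jumps ?L 0 (h + t) = jumps ?L 0 h \<union> jumps ?L h (h + t)" "jumps ?L 0 h \<inter> jumps ?L h (h + t) = {}"
    using h t by (auto simp: jumps_def)
  then have "jint (wB c) (h + t) x = (\<Sum>r\<in>jumps ?L 0 h. c powr (?N r - ?N (h + t)) * jump ?L r)
      + (\<Sum>r\<in>jumps ?L h (h + t). c powr (?N r - ?N (h + t)) * jump ?L r)"
    using finite_jumps[OF step_path_snd[OF x]] h by (simp add: jint_def wB_def sum.union_disjoint)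
  also have "(\<Sum>r\<in>jumps ?L h (h + t). c powr (?N r - ?N (h + t)) * jump ?L r)
      = (\<Sum>q\<in>jumps (\<lambda>q. snd (x (h + q) - x h)) 0 t. c powr (?N (h + q) - ?N (h + t)) * jump ?L (h + q))"
    unfolding J by (subst sum.reindex) auto
  also have "\<dots> = jint (wB c) t (\<lambda>q. x (h + q) - x h)"
    unfolding jint_def wB_def using sh by (intro sum.cong) (auto simp: jumps_def)
  also have "(\<Sum>r\<in>jumps ?L 0 h. c powr (?N r - ?N (h + t)) * jump ?L r)
      = c powr (- (?N (h + t) - ?N h)) * jint (wB c) h x"
    unfolding jint_def wB_def sum_distrib_left using \<open>c > 0\<close>
    by (intro sum.cong) (simp_all add: mult.assoc[symmetric] powr_add[symmetric])
  finally show ?thesis .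
qed

text \<open>The jump rescaling of the theorem as a map on paths; \<open>transf_jump_snd\<close>
  shows its effect on a single jump.\<close>

definition transf :: "real \<Rightarrow> (real \<Rightarrow> real \<times> real) \<Rightarrow> real \<Rightarrow> real \<times> real" where
  "transf c x t = (fst (x t), jint (wT c) t x)"

lemma jint_wT:
  "jint (wT c) t x = jsum {r. 0 < r \<and> jump (\<lambda>r. snd (x r)) r \<noteq> 0}
     (\<lambda>r. c powr (- jump (\<lambda>r. fst (x r)) r) * jump (\<lambda>r. snd (x r)) r) t"
  by (simp add: jint_def wT_def jsum_def jumps_Int Lim_jump)

lemma transf_step_path:
  assumes x: "step_path x"
  shows "step_path (transf c x)"
  unfolding transf_def[abs_def] jint_wT[abs_def]
  by (intro step_path_pair step_path_fst[OF x] jsum_step_path finite_jump_points step_path_snd[OF x])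

lemma transf_jump_snd:
  assumes x: "step_path x" and "0 < t"
  shows "jump (\<lambda>t. snd (transf c x t)) t =
     c powr (- jump (\<lambda>r. fst (x r)) t) * jump (\<lambda>r. snd (x r)) t"
  unfolding transf_def snd_conv jint_wT[abs_def]
  by (subst jump_jsum[OF finite_jump_points[OF step_path_snd[OF x]] \<open>0 < t\<close>]) (use \<open>0 < t\<close> in simp)

text \<open>A jump (1, c \<kappa>) becomes (1, \<kappa>). The other sizes are fixed, because either
  \<Delta>N = 0 or \<Delta>L = 0.\<close>

lemma transf_cp_path:
  assumes x: "cp_path (c * \<kappa>) x" and c: "c > 0"
  shows "cp_path \<kappa> (transf c x)"
  unfolding cp_path_def
proof (intro conjI allI impI)
  note xs = cp_path_step[OF x]
  show "transf c x 0 = 0" using x by (simp add: transf_def jint_def jumps_def cp_path_def zero_prod_def)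
  show "step_path (transf c x)" using transf_step_path[OF xs] .
  fix t :: real assume t: "0 < t"
  have "fst (transf c x r) = fst (x r)" for r by (simp add: transf_def)
  then show "jump (transf c x) t \<in> {0, (1, 0), (0, 1), (1, \<kappa>)}"
    using jump_pair[OF transf_step_path[OF xs] t, of c] transf_jump_snd[OF xs t, of c] cp_path_jumps[OF x t] c
    by (auto simp: zero_prod_def powr_minus)
qed

text \<open>With N the first coordinate, c^(N(r-)) \<Delta>L = c^(N(r)) c^(-\<Delta>N) \<Delta>L,
  which is c^(N(r)) times the jump of the rescaled path. This turns the integral of the
  Ornstein--Uhlenbeck process of index k - 1 into the \<open>wB\<close> term of index k.\<close>

lemma transf_left_integral:
  assumes x: "step_path x" and t: "0 \<le> t" and c: "c > 0"
  shows "(\<Sum>r\<in>jumps (\<lambda>r. snd (x r)) 0 t. Lim (at_left r) (\<lambda>r. c powr fst (x r)) * jump (\<lambda>r. snd (x r)) r)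
    = c powr fst (x t) * jint (wB c) t (transf c x)"
proof -
  have "jumps (\<lambda>r. snd (transf c x r)) 0 t = jumps (\<lambda>r. snd (x r)) 0 t"
    using c by (auto simp: jumps_def transf_jump_snd[OF x])
  then have "c powr fst (x t) * jint (wB c) t (transf c x) =
     (\<Sum>r\<in>jumps (\<lambda>r. snd (x r)) 0 t. c powr fst (x t) * (c powr (fst (x r) - fst (x t)) * jump (\<lambda>t. snd (transf c x t)) r))"
    by (simp add: jint_def wB_def sum_distrib_left transf_def)
  also have "\<dots> = (\<Sum>r\<in>jumps (\<lambda>r. snd (x r)) 0 t. Lim (at_left r) (\<lambda>r. c powr fst (x r)) * jump (\<lambda>r. snd (x r)) r)"
  proof (intro sum.cong refl)
    fix r assume "r \<in> jumps (\<lambda>r. snd (x r)) 0 t"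
    then have r: "0 < r" by (auto simp: jumps_def)
    have "c powr fst (x t) * (c powr (fst (x r) - fst (x t)) * (c powr (- jump (\<lambda>r. fst (x r)) r) * jump (\<lambda>r. snd (x r)) r))
        = c powr (fst (x r) - jump (\<lambda>r. fst (x r)) r) * jump (\<lambda>r. snd (x r)) r"
      by (simp add: powr_add[symmetric] mult.assoc[symmetric])
    also have "fst (x r) - jump (\<lambda>r. fst (x r)) r = Lim (at_left r) (\<lambda>r. fst (x r))"
      by (simp add: Lim_jump)
    also have "c powr \<dots> = Lim (at_left r) (\<lambda>r. c powr fst (x r))"
      using Lim_step_comp[OF step_path_fst[OF x] r, of "\<lambda>a. c powr a"] by simp
    finally show "c powr fst (x t) * (c powr (fst (x r) - fst (x t)) * jump (\<lambda>t. snd (transf c x t)) r)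
        = Lim (at_left r) (\<lambda>r. c powr fst (x r)) * jump (\<lambda>r. snd (x r)) r"
      by (simp add: transf_jump_snd[OF x r])
  qed
  finally show ?thesis by simp
qed

text \<open>L is the sum of its jumps, and \<Delta>L + (c^(-\<Delta>N) - 1) \<Delta>L =
  c^(-\<Delta>N) \<Delta>L jump by jump.\<close>

lemma transf_infsum:
  assumes x: "cp_path \<kappa> x" and t: "0 \<le> t" and c: "c > 0"
  shows "snd (x t) + (\<Sum>\<^sub>\<infinity>s\<in>{0<..t}. (exp (- ln c * jump (\<lambda>r. fst (x r)) s) - 1) * jump (\<lambda>r. snd (x r)) s)
    = jint (wT c) t x"
proof -
  note xs = step_path_snd[OF cp_path_step[OF x]]
  have "snd (x t) = (\<Sum>r\<in>jumps (\<lambda>r. snd (x r)) 0 t. jump (\<lambda>r. snd (x r)) r)"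
    using step_path_eq_sum_jumps[OF xs t] x by (simp add: cp_path_def)
  then show ?thesis
    using infsum_jumps[OF xs t, of "\<lambda>s. (exp (- ln c * jump (\<lambda>r. fst (x r)) s) - 1) * jump (\<lambda>r. snd (x r)) s"] c
    by (simp add: jint_def wT_def Lim_jump powr_def sum.distrib[symmetric] algebra_simps)
qed

text \<open>Since N jumps by 1 only, the correction is linear in \<Delta>N with factor 1/c - 1 + ln
  c; subtracting it from ln c leaves 1 - 1/c.\<close>

lemma driver_U_path:
  assumes x: "cp_path \<kappa> x" and t: "0 \<le> t" and c: "c > 1"
  shows "ln c * fst (x t) - (\<Sum>\<^sub>\<infinity>s\<in>{0<..t}. exp (- jump (\<lambda>r. ln c * fst (x r)) s) - 1 + jump (\<lambda>r. ln c * fst (x r)) s)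
    = (1 - inverse c) * fst (x t)"
proof -
  note xs = step_path_fst[OF cp_path_step[OF x]]
  have j: "jump (\<lambda>r. ln c * fst (x r)) s = ln c * jump (\<lambda>r. fst (x r)) s" if "0 < s" for s
    using Lim_step_comp[OF xs that, of "\<lambda>a. ln c * a"] by (simp add: jump_def algebra_simps)
  have N: "fst (x t) = (\<Sum>r\<in>jumps (\<lambda>r. fst (x r)) 0 t. jump (\<lambda>r. fst (x r)) r)"
    using step_path_eq_sum_jumps[OF xs t] x by (simp add: cp_path_def)
  have "(\<Sum>\<^sub>\<infinity>s\<in>{0<..t}. exp (- jump (\<lambda>r. ln c * fst (x r)) s) - 1 + jump (\<lambda>r. ln c * fst (x r)) s)
     = (\<Sum>s\<in>jumps (\<lambda>r. fst (x r)) 0 t. exp (- jump (\<lambda>r. ln c * fst (x r)) s) - 1 + jump (\<lambda>r. ln c * fst (x r)) s)"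
    by (rule infsum_jumps[OF xs t]) (simp add: j)
  also have "\<dots> = (\<Sum>s\<in>jumps (\<lambda>r. fst (x r)) 0 t. (inverse c - 1 + ln c) * jump (\<lambda>r. fst (x r)) s)"
  proof (intro sum.cong refl)
    fix s assume s: "s \<in> jumps (\<lambda>r. fst (x r)) 0 t"
    then have "jump (\<lambda>r. fst (x r)) s = 1"
      using cp_path_jumps[OF x, of s] by (auto simp: jumps_def zero_prod_def)
    then show "exp (- jump (\<lambda>r. ln c * fst (x r)) s) - 1 + jump (\<lambda>r. ln c * fst (x r)) s
      = (inverse c - 1 + ln c) * jump (\<lambda>r. fst (x r)) s"
      using s c by (simp add: j jumps_def exp_minus)
  qed
  finally have e: "(\<Sum>\<^sub>\<infinity>s\<in>{0<..t}. exp (- jump (\<lambda>r. ln c * fst (x r)) s) - 1 + jump (\<lambda>r. ln c * fst (x r)) s)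
     = (inverse c - 1 + ln c) * fst (x t)" by (simp only: N sum_distrib_left[symmetric])
  show ?thesis unfolding e by (simp add: algebra_simps)
qed

subsection \<open>The linear equation\<close>

lemma jump_add_step:
  fixes f g :: "real \<Rightarrow> 'b::real_normed_vector"
  assumes "step_path f" "step_path g" "0 < t"
  shows "jump (\<lambda>t. f t + g t) t = jump f t + jump g t"
  using Lim_step_comp2[OF assms, of "(+)"] by (simp add: jump_def)

lemma jump_const_step: "0 < t \<Longrightarrow> jump (\<lambda>_. a :: 'b::real_normed_vector) t = 0"
  using Lim_eventually_const[of "\<lambda>_. a" a t] by (simp add: jump_def)

context
  fixes x :: "real \<Rightarrow> real \<times> real" and c \<kappa> S :: real
  assumes x: "cp_path \<kappa> x" and c: "c > 1"
begin

text \<open>The functions c^(-x) and 1 - (1 - 1/c) x agree at x = 0 and x = 1, the only jump sizes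
  of N. This is how the exponential discount becomes the linear coefficient of the equation.\<close>

lemma cp_factor:
  assumes "0 < r"
  shows "c powr (- jump (\<lambda>r. fst (x r)) r) = 1 - jump (\<lambda>r. (1 - inverse c) * fst (x r)) r"
proof -
  have "jump (\<lambda>r. (1 - inverse c) * fst (x r)) r = (1 - inverse c) * jump (\<lambda>r. fst (x r)) r"
    using Lim_step_comp[OF step_path_fst[OF cp_path_step[OF x]] assms, of "\<lambda>a. (1 - inverse c) * a"]
    by (simp add: jump_def algebra_simps)
  then show ?thesis using cp_path_jumps[OF x assms] c by (auto simp: zero_prod_def powr_minus)
qed

text \<open>The variation-of-constants formula for the linear equation with starting value
  \<open>S\<close>.\<close>

definition affine_path :: "real \<Rightarrow> real" where
  "affine_path t = c powr (- fst (x t)) * S + jint (wB c) t x"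

lemma affine_path_eq:
  "affine_path t = c powr (- fst (x t)) *
     (S + jsum {r. 0 < r \<and> jump (\<lambda>r. snd (x r)) r \<noteq> 0} (\<lambda>r. c powr fst (x r) * jump (\<lambda>r. snd (x r)) r) t)"
  using c by (simp add: affine_path_def jint_def wB_def jsum_def jumps_Int sum_distrib_left
      distrib_left powr_diff powr_minus divide_simps)

lemma affine_path_step: "step_path affine_path"
  unfolding affine_path_eq[abs_def]
  by (rule step_path_comp2[of "\<lambda>t. fst (x t)" _ "\<lambda>a b. c powr (- a) * (S + b)"])
    (intro step_path_fst jsum_step_path finite_jump_points step_path_snd cp_path_step[OF x])+

lemma affine_path_0: "affine_path 0 = S"
  using x c by (simp add: affine_path_eq cp_path_def)

text \<open>The equation at a single jump time: the path satisfies V(r) = c^(-\<Delta>N) V(r-) +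
  \<Delta>L, and \<open>cp_factor\<close> rewrites the coefficient through \<Delta>U.\<close>

lemma affine_path_jump:
  assumes r: "0 < r"
  shows "jump affine_path r = - Lim (at_left r) affine_path * jump (\<lambda>r. (1 - inverse c) * fst (x r)) r
     + jump (\<lambda>r. snd (x r)) r"
proof -
  let ?H = "jsum {r. 0 < r \<and> jump (\<lambda>r. snd (x r)) r \<noteq> 0} (\<lambda>r. c powr fst (x r) * jump (\<lambda>r. snd (x r)) r)"
  note fx = step_path_fst[OF cp_path_step[OF x]] and sx = step_path_snd[OF cp_path_step[OF x]]
  have H: "step_path ?H" by (intro jsum_step_path finite_jump_points sx)
  have Hr: "?H r = Lim (at_left r) ?H + c powr fst (x r) * jump (\<lambda>r. snd (x r)) r"
  proof -
    have "jump ?H r = c powr fst (x r) * jump (\<lambda>r. snd (x r)) r"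
      by (subst jump_jsum[OF finite_jump_points[OF sx] r]) (use r in simp)
    then show ?thesis by (simp add: jump_def[of ?H])
  qed
  have lim: "Lim (at_left r) affine_path = c powr (- Lim (at_left r) (\<lambda>t. fst (x t))) * (S + Lim (at_left r) ?H)"
    unfolding affine_path_eq[abs_def]
    using Lim_step_comp2[OF fx H r, of "\<lambda>a b. c powr (- a) * (S + b)"] by simp
  have "c powr (- fst (x r)) = c powr (- jump (\<lambda>r. fst (x r)) r) * c powr (- Lim (at_left r) (\<lambda>t. fst (x t)))"
    by (simp add: powr_add[symmetric] Lim_jump)
  then have "affine_path r = c powr (- jump (\<lambda>r. fst (x r)) r) * Lim (at_left r) affine_path + jump (\<lambda>r. snd (x r)) r"
    using c unfolding lim affine_path_eq[of r] Hr
    by (simp add: distrib_left mult.assoc) (simp add: mult.assoc[symmetric] powr_add[symmetric] Lim_jump)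
  then show ?thesis using cp_factor[OF r] by (simp add: jump_def[of affine_path] algebra_simps)
qed

lemma left_integral_jsum:
  "(\<Sum>r\<in>jumps (\<lambda>r. (1 - inverse c) * fst (x r)) 0 t. h r * jump (\<lambda>r. (1 - inverse c) * fst (x r)) r)
   = jsum {r. 0 < r \<and> jump (\<lambda>r. (1 - inverse c) * fst (x r)) r \<noteq> 0}
       (\<lambda>r. h r * jump (\<lambda>r. (1 - inverse c) * fst (x r)) r) t"
  by (simp add: jsum_def jumps_Int)

lemma step_path_U: "step_path (\<lambda>r. (1 - inverse c) * fst (x r))"
  using step_path_comp[OF step_path_fst[OF cp_path_step[OF x]]] by blast

text \<open>For an arbitrary \<open>V\<close> the right-hand side is a step path, because U and L
  are. Hence every solution is a step path as well.\<close>

lemma sde_rhs: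
  fixes V :: "real \<Rightarrow> real"
  defines "R \<equiv> \<lambda>t. S - (\<Sum>r\<in>jumps (\<lambda>r. (1 - inverse c) * fst (x r)) 0 t.
        Lim (at_left r) V * jump (\<lambda>r. (1 - inverse c) * fst (x r)) r) + snd (x t)"
  shows "step_path R" "R 0 = S"
    "0 < r \<Longrightarrow> jump R r = - Lim (at_left r) V * jump (\<lambda>r. (1 - inverse c) * fst (x r)) r + jump (\<lambda>r. snd (x r)) r"
proof -
  let ?U = "\<lambda>r. (1 - inverse c) * fst (x r)"
  let ?J = "jsum {r. 0 < r \<and> jump ?U r \<noteq> 0} (\<lambda>r. Lim (at_left r) V * jump ?U r)"
  have J: "step_path ?J" by (intro jsum_step_path finite_jump_points step_path_U)
  have R: "R t = (snd (x t) + S) - ?J t" for t unfolding R_def left_integral_jsum by simp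
  have sx: "step_path (\<lambda>t. snd (x t) + S)"
    by (intro step_path_comp2[OF step_path_snd[OF cp_path_step[OF x]] step_path_const, of "(+)"])
  show "step_path R" unfolding R[abs_def] by (intro step_path_comp2[OF sx J, of "(-)"])
  show "R 0 = S" unfolding R using x by (simp add: cp_path_def)
  assume r: "0 < r"
  show "jump R r = - Lim (at_left r) V * jump ?U r + jump (\<lambda>r. snd (x r)) r"
    unfolding R[abs_def] jump_diff_step[OF sx J r]
      jump_add_step[OF step_path_snd[OF cp_path_step[OF x]] step_path_const r] jump_const_step[OF r]
      jump_jsum[OF finite_jump_points[OF step_path_U] r] using r by simp
qed

lemma affine_path_solves:
  assumes "0 \<le> t"
  shows "affine_path t = S - (\<Sum>r\<in>jumps (\<lambda>r. (1 - inverse c) * fst (x r)) 0 t.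
     Lim (at_left r) affine_path * jump (\<lambda>r. (1 - inverse c) * fst (x r)) r) + snd (x t)"
  using step_path_eqI[OF affine_path_step sde_rhs(1)[of affine_path] assms]
  by (simp add: sde_rhs(2,3) affine_path_0 affine_path_jump)

text \<open>The integrating factor c^(N(t)) is applied to the difference of two solutions: by
  \<open>cp_factor\<close> the product has no jumps, and it starts at 0.\<close>

lemma affine_path_unique:
  fixes V :: "real \<Rightarrow> real"
  assumes V: "\<And>t. 0 \<le> t \<Longrightarrow> V t = S - (\<Sum>r\<in>jumps (\<lambda>r. (1 - inverse c) * fst (x r)) 0 t.
     Lim (at_left r) V * jump (\<lambda>r. (1 - inverse c) * fst (x r)) r) + snd (x t)" and t: "0 \<le> t"
  shows "V t = affine_path t"
proof -
  let ?U = "\<lambda>r. (1 - inverse c) * fst (x r)"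
  have Vs: "step_path V" by (rule step_path_cong[OF V sde_rhs(1)])
  have V0: "V 0 = S" using V[of 0] x by (simp add: jumps_def cp_path_def)
  have Vj: "jump V r = - Lim (at_left r) V * jump ?U r + jump (\<lambda>r. snd (x r)) r" if "0 < r" for r
  proof -
    have "jump V r = jump (\<lambda>t. S - (\<Sum>r\<in>jumps ?U 0 t. Lim (at_left r) V * jump ?U r) + snd (x t)) r"
      using V by (intro jump_cong[OF that]) auto
    then show ?thesis using sde_rhs(3)[OF that] by simp
  qed
  let ?f = "\<lambda>t. c powr fst (x t) * (V t - affine_path t)"
  have D: "step_path (\<lambda>t. V t - affine_path t)" by (intro step_path_comp2[OF Vs affine_path_step, of "(-)"])
  have f: "step_path ?f"
    by (intro step_path_comp2[OF step_path_fst[OF cp_path_step[OF x]] D, of "\<lambda>a b. c powr a * b"])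
  have "?f t = ?f 0"
  proof (rule step_path_no_jumps[OF f order_refl t])
    fix r :: real assume r: "0 < r" "r \<le> t"
    let ?d = "\<lambda>t. V t - affine_path t"
    have l: "Lim (at_left r) ?d = Lim (at_left r) V - Lim (at_left r) affine_path"
      using Lim_step_comp2[OF Vs affine_path_step r(1), of "(-)"] by simp
    have "?d r - Lim (at_left r) ?d = - Lim (at_left r) ?d * jump ?U r"
    proof -
      define j where "j = jump ?U r"
      have "V r - Lim (at_left r) V = - Lim (at_left r) V * j + jump (\<lambda>r. snd (x r)) r"
        using Vj[OF r(1)] by (simp only: jump_def[of V] j_def)
      moreover have "affine_path r - Lim (at_left r) affine_path =
          - Lim (at_left r) affine_path * j + jump (\<lambda>r. snd (x r)) r"
        using affine_path_jump[OF r(1)] by (simp only: jump_def[of affine_path] j_def)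
      ultimately show ?thesis unfolding l j_def[symmetric] by (simp add: algebra_simps)
    qed
    then have "?d r = Lim (at_left r) ?d * (1 - jump ?U r)" unfolding right_diff_distrib by simp
    then have "?d r = Lim (at_left r) ?d * c powr (- jump (\<lambda>r. fst (x r)) r)"
      by (simp only: cp_factor[OF r(1)])
    moreover have "Lim (at_left r) ?f = c powr (Lim (at_left r) (\<lambda>r. fst (x r))) * Lim (at_left r) ?d"
      using Lim_step_comp2[OF step_path_fst[OF cp_path_step[OF x]] D r(1), of "\<lambda>a b. c powr a * b"] by simp
    moreover have "c powr fst (x r) * c powr (- jump (\<lambda>r. fst (x r)) r) = c powr (Lim (at_left r) (\<lambda>r. fst (x r)))"
      by (simp add: powr_add[symmetric] Lim_jump)
    ultimately show "jump ?f r = 0" by (simp add: jump_def[of ?f] mult.assoc[symmetric] mult.commute)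
  qed
  then show ?thesis using V0 affine_path_0 c by simp
qed

end

section \<open>Uniqueness of characteristic functions in the plane\<close>

text \<open>The transform at 0 gives the common total mass \<open>z\<close>; after division by
  \<open>z\<close> the uniqueness theorem for probability laws applies. The case
  \<open>z = 0\<close> is separate.\<close>

lemma finite_measure_char_eq:
  fixes \<mu> \<nu> :: "real measure"
  assumes "finite_measure \<mu>" "finite_measure \<nu>" and sets [simp]: "sets \<mu> = sets borel" "sets \<nu> = sets borel"
    and eq: "\<And>t. (CLINT x|\<mu>. iexp (t * x)) = (CLINT x|\<nu>. iexp (t * x))"
  shows "\<mu> = \<nu>"
proof -
  interpret m: finite_measure \<mu> by fact
  interpret n: finite_measure \<nu> by fact
  have sp [simp]: "space \<mu> = UNIV" "space \<nu> = UNIV" using sets_eq_imp_space_eq[OF sets(1)] sets_eq_imp_space_eq[OF sets(2)] by simp_all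
  define z where "z = measure \<mu> UNIV"
  have z: "measure \<nu> UNIV = z" using eq[of 0] by (simp add: z_def)
  show ?thesis
  proof (cases "z = 0")
    case True
    have "emeasure \<mu> A = emeasure \<nu> A" if "A \<in> sets borel" for A
    proof -
      have "emeasure \<mu> A \<le> emeasure \<mu> UNIV" "emeasure \<nu> A \<le> emeasure \<nu> UNIV"
        using that by (auto intro!: emeasure_mono)
      then have "measure \<mu> A \<le> 0" "measure \<nu> A \<le> 0"
        using True z by (simp_all add: z_def m.emeasure_eq_measure n.emeasure_eq_measure)
      then have "measure \<mu> A = 0" "measure \<nu> A = 0" using measure_nonneg antisym by metis+
      then show ?thesis by (simp add: m.emeasure_eq_measure n.emeasure_eq_measure)
    qed
    then show ?thesis by (intro measure_eqI) auto
  next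
    case False
    then have zp: "z > 0" by (simp add: z_def zero_less_measure_iff)
    have *: "real_distribution (density \<rho> (\<lambda>_. ennreal (1 / z)))
        \<and> char (density \<rho> (\<lambda>_. ennreal (1 / z))) = (\<lambda>t. (CLINT x|\<rho>. iexp (t * x)) / z)"
      if "finite_measure \<rho>" "sets \<rho> = sets borel" "measure \<rho> UNIV = z" for \<rho> :: "real measure"
    proof -
      interpret r: finite_measure \<rho> by fact
      have sp: "space \<rho> = UNIV" using sets_eq_imp_space_eq[OF that(2)] by simp
      note [measurable_cong] = that(2)
      have "real_distribution (density \<rho> (\<lambda>_. ennreal (1 / z)))"
        unfolding real_distribution_def real_distribution_axioms_def
        using zp that(2,3) sp by (auto intro!: prob_spaceI simp: emeasure_density nn_integral_cmult r.emeasure_eq_measure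
            ennreal_mult[symmetric] divide_simps)
      moreover have "char (density \<rho> (\<lambda>_. ennreal (1 / z))) = (\<lambda>t. (CLINT x|\<rho>. iexp (t * x)) / z)"
        unfolding char_def using zp by (subst integral_density) (auto simp: scaleR_conv_of_real)
      ultimately show ?thesis ..
    qed
    have e: "density \<mu> (\<lambda>_. ennreal (1 / z)) = density \<nu> (\<lambda>_. ennreal (1 / z))"
      using *[of \<mu>] *[of \<nu>] z z_def eq by (intro Levy_uniqueness) (auto simp: assms)
    have dd: "density (density \<mu> (\<lambda>_. ennreal (1 / z))) (\<lambda>_. ennreal z) = \<mu>"
         "density (density \<nu> (\<lambda>_. ennreal (1 / z))) (\<lambda>_. ennreal z) = \<nu>"
      using zp by (subst density_density_eq; simp add: ennreal_mult[symmetric] density_1)+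
    show ?thesis
      by (rule trans[OF dd(1)[symmetric] trans[OF arg_cong[OF e, of "\<lambda>\<rho>. density \<rho> (\<lambda>_. ennreal z)"] dd(2)]])
  qed
qed

text \<open>The image under \<open>f\<close> of the measure with density \<open>w\<close> is a
  finite measure on the line, so one-dimensional uniqueness applies to it. Nonnegativity of
  \<open>w\<close> is what makes this density a measure.\<close>

lemma weighted_char_eq:
  fixes M N :: "'a measure" and w :: "'a \<Rightarrow> real"
  assumes fin: "finite_measure M" "finite_measure N" and sets: "sets N = sets M"
    and [measurable]: "f \<in> borel_measurable M" "w \<in> borel_measurable M"
    and w: "\<And>x. 0 \<le> w x" "\<And>x. w x \<le> K"
    and eq: "\<And>t. (CLINT x|M. w x *\<^sub>R iexp (t * f x)) = (CLINT x|N. w x *\<^sub>R iexp (t * f x))"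
    and B: "B \<in> sets borel"
  shows "(\<integral>x. w x * indicator B (f x) \<partial>M) = (\<integral>x. w x * indicator B (f x) \<partial>N)"
proof -
  note [measurable_cong] = sets
  have fm: "finite_measure (distr (density L (\<lambda>x. ennreal (w x))) borel f)"
    and ch: "(CLINT x|distr (density L (\<lambda>x. ennreal (w x))) borel f. iexp (t * x)) = (CLINT x|L. w x *\<^sub>R iexp (t * f x))"
    and me: "measure (distr (density L (\<lambda>x. ennreal (w x))) borel f) B = (\<integral>x. w x * indicator B (f x) \<partial>L)"
    if "finite_measure L" "sets L = sets M" for L t
  proof -
    interpret finite_measure L by fact
    note [measurable_cong] = that(2)
    have K: "0 \<le> K" using w order_trans by blast
    have "emeasure (density L (\<lambda>x. ennreal (w x))) (space L) = (\<integral>\<^sup>+x. ennreal (w x) \<partial>L)"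
      by (subst emeasure_density) (auto intro!: nn_integral_cong)
    also have "\<dots> \<le> (\<integral>\<^sup>+x. ennreal K \<partial>L)"
      by (intro nn_integral_mono ennreal_leI w)
    also have "\<dots> < \<infinity>" by (simp add: emeasure_eq_measure ennreal_mult[symmetric] K)
    finally have fd: "finite_measure (density L (\<lambda>x. ennreal (w x)))"
      by (intro finite_measureI) auto
    then show "finite_measure (distr (density L (\<lambda>x. ennreal (w x))) borel f)"
      by (rule finite_measure.finite_measure_distr) simp
    show "(CLINT x|distr (density L (\<lambda>x. ennreal (w x))) borel f. iexp (t * x)) = (CLINT x|L. w x *\<^sub>R iexp (t * f x))"
      using w by (subst integral_distr, simp, simp, subst integral_density) auto
    have "measure (distr (density L (\<lambda>x. ennreal (w x))) borel f) B = (\<integral>x. indicator B x \<partial>distr (density L (\<lambda>x. ennreal (w x))) borel f)"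
      using B by simp
    also have "\<dots> = (\<integral>x. w x * indicator B (f x) \<partial>L)"
      using w B by (subst integral_distr, simp, simp, subst integral_density) auto
    finally show "measure (distr (density L (\<lambda>x. ennreal (w x))) borel f) B = (\<integral>x. w x * indicator B (f x) \<partial>L)" .
  qed
  have "distr (density M (\<lambda>x. ennreal (w x))) borel f = distr (density N (\<lambda>x. ennreal (w x))) borel f"
    using fm[OF fin(1) refl] fm[OF fin(2) sets] ch[OF fin(1) refl] ch[OF fin(2) sets] eq
    by (intro finite_measure_char_eq) auto
  then show ?thesis using me[OF fin(1) refl] me[OF fin(2) sets] by metis
qed

text \<open>Applied twice: first to the second coordinate, with the nonnegative weights \<open>1 + cos (a x)\<close> and
  \<open>1 + sin (a x)\<close> in the first one, then to the first coordinate with an indicator weight.\<close>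

lemma char_eq_plane:
  fixes M N :: "(real \<times> real) measure"
  assumes "prob_space M" "prob_space N" and sM: "sets M = sets borel" and sN: "sets N = sets borel"
    and eq: "\<And>z. (CLINT x|M. iexp (z \<bullet> x)) = (CLINT x|N. iexp (z \<bullet> x))"
  shows "M = N"
proof -
  interpret M: prob_space M by fact
  interpret N: prob_space N by fact
  note [measurable_cong] = sM sN
  have fin: "finite_measure M" "finite_measure N" by unfold_locales
  have sets: "sets N = sets M" using sM sN by simp
  have [measurable]: "fst \<in> borel_measurable M" "snd \<in> borel_measurable M" "fst \<in> borel_measurable N" "snd \<in> borel_measurable N"
    by (subst measurable_cong_sets[OF sM refl] measurable_cong_sets[OF sN refl], intro borel_measurable_continuous_onI continuous_intros)+
  have int: "integrable L (\<lambda>x. g x *\<^sub>R iexp (a * fst x + b * snd x))"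
    if "L = M \<or> L = N" "g \<in> borel_measurable L" "\<And>x. \<bar>g x\<bar> \<le> K" for L g a b K
  proof -
    interpret L: prob_space L using that assms by auto
    have [measurable]: "fst \<in> borel_measurable L" "snd \<in> borel_measurable L" using that by auto
    show ?thesis using that by (intro L.integrable_const_bound[of _ K]) auto
  qed
  define E where "E a b x = iexp (a * fst x + b * snd x)" for a b and x :: "real \<times> real"
  have eq2: "integral\<^sup>L M (E a b) = integral\<^sup>L N (E a b)" for a b
    using eq[of "(a, b)"] by (simp add: inner_prod_def E_def[abs_def])
  \<comment> \<open>The weights are combinations of exponentials in the first coordinate, so the
    weighted transforms in the second coordinate are fixed by the joint transform.\<close>
  have cosE: "(1 + cos (a * fst x)) *\<^sub>R iexp (t * snd x) = E 0 t x + (E a t x + E (-a) t x) / 2" for a t x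
    by (simp add: E_def scaleR_conv_of_real distrib_left distrib_right exp_add exp_diff cos_of_real[symmetric] cos_exp_eq exp_minus field_simps)
  have sinE: "(1 + sin (a * fst x)) *\<^sub>R iexp (t * snd x) = E 0 t x + (E a t x - E (-a) t x) / (2 * \<i>)" for a t x
    by (simp add: E_def scaleR_conv_of_real distrib_left distrib_right exp_add exp_diff sin_of_real[symmetric] sin_exp_eq exp_minus field_simps)
  have I: "integrable L (E a b)" if "L = M \<or> L = N" for L a b
    using int[OF that, of "\<lambda>_. 1" 1] by (simp add: E_def[abs_def])
  have c: "(\<integral>x. (1 + cos (a * fst x)) * indicator B (snd x) \<partial>M) = (\<integral>x. (1 + cos (a * fst x)) * indicator B (snd x) \<partial>N)"
    and s: "(\<integral>x. (1 + sin (a * fst x)) * indicator B (snd x) \<partial>M) = (\<integral>x. (1 + sin (a * fst x)) * indicator B (snd x) \<partial>N)"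
    if "B \<in> sets borel" for a B
  proof -
    show "(\<integral>x. (1 + cos (a * fst x)) * indicator B (snd x) \<partial>M) = (\<integral>x. (1 + cos (a * fst x)) * indicator B (snd x) \<partial>N)"
    proof (rule weighted_char_eq[OF fin sets _ _ _ _ _ that, where K = 2])
      show "0 \<le> 1 + cos (a * fst x)" "1 + cos (a * fst x) \<le> 2" for x :: "real \<times> real"
        using cos_ge_minus_one[of "a * fst x"] cos_le_one[of "a * fst x"] by linarith+
      show "(CLINT x|M. (1 + cos (a * fst x)) *\<^sub>R iexp (t * snd x)) = (CLINT x|N. (1 + cos (a * fst x)) *\<^sub>R iexp (t * snd x))" for t
        unfolding cosE using I eq2 by simp
    qed simp_all
    show "(\<integral>x. (1 + sin (a * fst x)) * indicator B (snd x) \<partial>M) = (\<integral>x. (1 + sin (a * fst x)) * indicator B (snd x) \<partial>N)"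
    proof (rule weighted_char_eq[OF fin sets _ _ _ _ _ that, where K = 2])
      show "0 \<le> 1 + sin (a * fst x)" "1 + sin (a * fst x) \<le> 2" for x :: "real \<times> real"
        using sin_ge_minus_one[of "a * fst x"] sin_le_one[of "a * fst x"] by linarith+
      show "(CLINT x|M. (1 + sin (a * fst x)) *\<^sub>R iexp (t * snd x)) = (CLINT x|N. (1 + sin (a * fst x)) *\<^sub>R iexp (t * snd x))" for t
        unfolding sinE using I eq2 by simp
    qed simp_all
  qed
  have J: "integrable L (\<lambda>x. f (a * fst x) * indicator B (snd x))"
    if "L = M \<or> L = N" "f \<in> borel_measurable borel" "\<And>x. \<bar>f x\<bar> \<le> 1" "B \<in> sets borel" for L a B and f :: "real \<Rightarrow> real"
  proof -
    interpret L: prob_space L using that assms by auto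
    have [measurable]: "fst \<in> borel_measurable L" "snd \<in> borel_measurable L" using that by auto
    have [measurable]: "f \<in> borel_measurable borel" "B \<in> sets borel" by fact+
    show ?thesis using that by (intro L.integrable_const_bound[of _ 1]) (auto simp: indicator_def abs_mult)
  qed
  \<comment> \<open>The indicator-weighted transform is recovered from the integrals in
    \<open>c\<close> and \<open>s\<close>. The weight with 0 in place of \<open>a\<close> is
    constantly 2, so half of its integral takes away the added 1.\<close>
  have iE: "(CLINT x|L. indicator B (snd x) *\<^sub>R iexp (a * fst x)) =
      complex_of_real (\<integral>x. (1 + cos (a * fst x)) * indicator B (snd x) \<partial>L) - (\<integral>x. (1 + cos (0 * fst x)) * indicator B (snd x) \<partial>L) / 2
      + \<i> * (complex_of_real (\<integral>x. (1 + sin (a * fst x)) * indicator B (snd x) \<partial>L) - (\<integral>x. (1 + cos (0 * fst x)) * indicator B (snd x) \<partial>L) / 2)"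
    if L: "L = M \<or> L = N" and B: "B \<in> sets borel" for L a B
  proof -
    have i1: "integrable L (\<lambda>x. cos (a * fst x) * indicator B (snd x))" "integrable L (\<lambda>x. sin (a * fst x) * indicator B (snd x))"
      using J[OF L _ _ B, of cos a] J[OF L _ _ B, of sin a] by simp_all
    have i2: "integrable L (\<lambda>x. indicator B (snd x) :: real)" using J[OF L _ _ B, of "\<lambda>_. 1" a] by simp
    have "(CLINT x|L. indicator B (snd x) *\<^sub>R iexp (a * fst x)) =
      (CLINT x|L. complex_of_real (cos (a * fst x) * indicator B (snd x)) + \<i> * complex_of_real (sin (a * fst x) * indicator B (snd x)))"
    proof -
      have "iexp y = complex_of_real (cos y) + \<i> * complex_of_real (sin y)" for y
        by (simp add: exp_Euler cos_of_real sin_of_real)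
      then show ?thesis
        by (intro Bochner_Integration.integral_cong refl) (simp add: scaleR_conv_of_real algebra_simps del: of_real_mult, simp)
    qed
    also have "\<dots> = complex_of_real (\<integral>x. cos (a * fst x) * indicator B (snd x) \<partial>L) + \<i> * complex_of_real (\<integral>x. sin (a * fst x) * indicator B (snd x) \<partial>L)"
      using i1 by (subst Bochner_Integration.integral_add) (auto simp del: of_real_mult)
    finally show ?thesis using i1 i2 by (simp add: distrib_right)
  qed
  have r: "measure M (A \<times> B) = measure N (A \<times> B)" if A: "A \<in> sets borel" and B: "B \<in> sets borel" for A B
  proof -
    have [measurable]: "A \<in> sets borel" "B \<in> sets borel" by fact+
    have "(\<integral>x. indicator B (snd x) * indicator A (fst x) \<partial>M) = (\<integral>x. indicator B (snd x) * (indicator A (fst x)::real) \<partial>N)"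
    proof (rule weighted_char_eq[OF fin sets _ _ _ _ _ A, where K = 1])
      show "(CLINT x|M. indicator B (snd x) *\<^sub>R iexp (t * fst x)) = (CLINT x|N. indicator B (snd x) *\<^sub>R iexp (t * fst x))" for t
        unfolding iE[OF disjI1[OF refl] B] iE[OF disjI2[OF refl] B] c[OF B] s[OF B] by (rule refl)
    qed simp_all
    moreover have "(\<integral>x. indicator B (snd x) * (indicator A (fst x)::real) \<partial>L) = measure L (A \<times> B)" if "L = M \<or> L = N" for L
    proof -
      have "A \<times> B \<in> sets L" using that sM sN A B by (auto simp: borel_prod[symmetric])
      moreover have "(\<integral>x. indicator B (snd x) * (indicator A (fst x)::real) \<partial>L) = (\<integral>x. indicator (A \<times> B) x \<partial>L)"
        by (intro Bochner_Integration.integral_cong refl) (auto simp: indicator_def)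
      ultimately show ?thesis using sets.sets_into_space by (simp add: Int_absorb2)
    qed
    ultimately show ?thesis by simp
  qed
  have sb: "sets (borel :: (real \<times> real) measure) = sigma_sets UNIV {a \<times> b |a b. a \<in> sets (borel :: real measure) \<and> b \<in> sets (borel :: real measure)}"
    by (subst borel_prod[symmetric], subst sets_pair_measure) simp
  show ?thesis
  proof (rule measure_eqI_generator_eq[OF Int_stable_pair_measure_generator[of "borel :: real measure" "borel :: real measure"], where \<Omega> = UNIV and A = "\<lambda>_. UNIV"])
    show "sets M = sigma_sets UNIV {a \<times> b |a b. a \<in> sets (borel :: real measure) \<and> b \<in> sets (borel :: real measure)}"
      "sets N = sigma_sets UNIV {a \<times> b |a b. a \<in> sets (borel :: real measure) \<and> b \<in> sets (borel :: real measure)}"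
      using sM sN sb by simp_all
    show "range (\<lambda>_. UNIV) \<subseteq> {a \<times> b |a b. a \<in> sets (borel :: real measure) \<and> b \<in> sets (borel :: real measure)}"
      by (auto intro!: exI[of _ UNIV])
  qed (auto simp: M.emeasure_eq_measure N.emeasure_eq_measure r)
qed

section \<open>The compound Poisson law\<close>

text \<open>Rate 0 must be allowed, since the time and each of the masses may vanish.\<close>

definition pois :: "real \<Rightarrow> nat pmf" where
  "pois a = (if a = 0 then return_pmf 0 else poisson_pmf a)"

lemma pmf_pois: "0 \<le> a \<Longrightarrow> pmf (pois a) n = a ^ n / fact n * exp (- a)"
  by (cases n) (auto simp: pois_def pmf_return)

text \<open>The generating function at a complex argument: arguments on the unit circle give
  characteristic functions, and \<open>z = 2\<close> will bound the mean.\<close>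

lemma pois_generating:
  fixes z :: complex
  assumes a: "0 \<le> a"
  shows "integrable (measure_pmf (pois a)) (\<lambda>n. z ^ n)"
    and "(\<integral>n. z ^ n \<partial>measure_pmf (pois a)) = exp (a * (z - 1))"
proof -
  have e: "pmf (pois a) n *\<^sub>R z ^ n = exp (- a) *\<^sub>R ((a *\<^sub>R z) ^ n /\<^sub>R fact n)" for n
    using a by (simp add: pmf_pois scaleR_conv_of_real power_mult_distrib field_simps)
  have s: "summable (\<lambda>n. norm (pmf (pois a) n *\<^sub>R z ^ n))"
    unfolding e norm_scaleR[of "exp (- a)"] by (intro summable_mult summable_norm_exp)
  then have i: "integrable (count_space UNIV) (\<lambda>n. pmf (pois a) n *\<^sub>R z ^ n)"
    by (simp add: integrable_count_space_nat_iff)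
  show "integrable (measure_pmf (pois a)) (\<lambda>n. z ^ n)"
    unfolding measure_pmf_eq_density by (subst integrable_density) (use i in auto)
  have "(\<integral>n. z ^ n \<partial>measure_pmf (pois a)) = (\<Sum>n. pmf (pois a) n *\<^sub>R z ^ n)"
    unfolding measure_pmf_eq_density
    by (subst integral_density) (use i in \<open>auto simp: integral_count_space_nat\<close>)
  also have "\<dots> = exp (- a) *\<^sub>R (\<Sum>n. (a *\<^sub>R z) ^ n /\<^sub>R fact n)"
    unfolding e by (rule suminf_scaleR_right[OF summable_exp_generic, symmetric])
  also have "(\<Sum>n. (a *\<^sub>R z) ^ n /\<^sub>R fact n) = exp (a *\<^sub>R z)" by (simp add: exp_def)
  also have "exp (- a) *\<^sub>R exp (a *\<^sub>R z) = exp (a * (z - 1))"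
    by (simp add: scaleR_conv_of_real exp_of_real[symmetric] exp_add[symmetric] algebra_simps)
  finally show "(\<integral>n. z ^ n \<partial>measure_pmf (pois a)) = exp (a * (z - 1))" .
qed

text \<open>Independent numbers of jumps of the three kinds; \<open>pmap\<close> turns these counts
  into the position (N, L) reached. Working with counts keeps the underlying space countable, so
  that every function on it is measurable.\<close>

definition pois3 :: "real \<Rightarrow> real \<Rightarrow> real \<Rightarrow> (nat \<times> nat \<times> nat) measure" where
  "pois3 a b d = measure_pmf (pois a) \<Otimes>\<^sub>M measure_pmf (pois b) \<Otimes>\<^sub>M measure_pmf (pois d)"

definition pmap :: "real \<Rightarrow> nat \<times> nat \<times> nat \<Rightarrow> real \<times> real" where
  "pmap \<kappa> x = (real (fst x) + real (snd (snd x)), real (fst (snd x)) + \<kappa> * real (snd (snd x)))"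

definition cp_law :: "real \<Rightarrow> real \<Rightarrow> real \<Rightarrow> real \<Rightarrow> (real \<times> real) measure" where
  "cp_law \<kappa> a b d = distr (pois3 a b d) borel (pmap \<kappa>)"

lemma prob_space_pois3: "prob_space (pois3 a b d)"
  unfolding pois3_def by (intro prob_space_pair prob_space_measure_pmf)

lemma sets_pois3: "sets (pois3 a b d) = sets (count_space UNIV \<Otimes>\<^sub>M count_space UNIV \<Otimes>\<^sub>M count_space UNIV)"
  unfolding pois3_def by (intro sets_pair_measure_cong) auto

lemma space_pois3 [simp]: "space (pois3 a b d) = UNIV"
  unfolding pois3_def by (simp add: space_pair_measure)

lemma pois3_all_sets: "A \<in> sets (pois3 a b d)"
proof -
  have "sets (count_space UNIV \<Otimes>\<^sub>M count_space UNIV \<Otimes>\<^sub>M count_space (UNIV :: nat set)) =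
      sets (count_space (UNIV :: (nat \<times> nat \<times> nat) set))"
    by (subst pair_measure_countable, simp, simp, subst pair_measure_countable) auto
  then show ?thesis unfolding sets_pois3 by simp
qed

lemma pois3_measurable: "f \<in> pois3 a b d \<rightarrow>\<^sub>M N" if "\<And>x. f x \<in> space N"
  using that pois3_all_sets by (intro measurableI) auto

lemma prob_space_cp_law: "prob_space (cp_law \<kappa> a b d)"
  unfolding cp_law_def by (intro prob_space.prob_space_distr prob_space_pois3 pois3_measurable) simp

lemma cp_law_char:
  assumes "0 \<le> a" "0 \<le> b" "0 \<le> d"
  shows "(CLINT x|cp_law \<kappa> a b d. iexp (z \<bullet> x)) =
    exp (a * (iexp (fst z) - 1) + b * (iexp (snd z) - 1) + d * (iexp (fst z + \<kappa> * snd z) - 1))"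
proof -
  let ?A = "measure_pmf (pois a)" and ?B = "measure_pmf (pois b)" and ?D = "measure_pmf (pois d)"
  define X Y Z where "X = iexp (fst z)" and "Y = iexp (snd z)" and "Z = iexp (fst z + \<kappa> * snd z)"
  have n: "norm X = 1" "norm Y = 1" "norm Z = 1" by (simp_all add: X_def Y_def Z_def)
  interpret BD: pair_prob_space ?B ?D by unfold_locales
  interpret ABD: pair_prob_space ?A "?B \<Otimes>\<^sub>M ?D" by unfold_locales
  have m: "f \<in> borel_measurable (?B \<Otimes>\<^sub>M ?D)" for f :: "nat \<times> nat \<Rightarrow> complex"
  proof (rule measurableI)
    fix A :: "complex set"
    have "sets (?B \<Otimes>\<^sub>M ?D) = sets (count_space UNIV \<Otimes>\<^sub>M count_space UNIV)"
      by (intro sets_pair_measure_cong) auto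
    also have "\<dots> = UNIV" by (subst pair_measure_countable) auto
    finally show "f -` A \<inter> space (?B \<Otimes>\<^sub>M ?D) \<in> sets (?B \<Otimes>\<^sub>M ?D)" by simp
  qed simp
  have m3: "f \<in> borel_measurable (?A \<Otimes>\<^sub>M ?B \<Otimes>\<^sub>M ?D)" for f :: "nat \<times> nat \<times> nat \<Rightarrow> complex"
    using pois3_measurable[of f borel a b d] by (simp add: pois3_def)
  have "(CLINT x|cp_law \<kappa> a b d. iexp (z \<bullet> x)) = (CLINT x|pois3 a b d. iexp (z \<bullet> pmap \<kappa> x))"
    unfolding cp_law_def by (subst integral_distr) (auto intro: pois3_measurable)
  also have "\<dots> = (CLINT (i, jk)|?A \<Otimes>\<^sub>M ?B \<Otimes>\<^sub>M ?D. X ^ i * (case jk of (j, k) \<Rightarrow> Y ^ j * Z ^ k))"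
    unfolding pois3_def
    by (intro Bochner_Integration.integral_cong refl)
      (auto simp: pmap_def X_def Y_def Z_def inner_prod_def exp_of_nat_mult[symmetric] exp_add[symmetric] algebra_simps)
  also have "\<dots> = (CLINT i|?A. CLINT jk|?B \<Otimes>\<^sub>M ?D. X ^ i * (case jk of (j, k) \<Rightarrow> Y ^ j * Z ^ k))"
    by (rule ABD.integral_fst[symmetric])
       (intro ABD.P.integrable_const_bound[of _ 1] AE_I2, auto simp: norm_mult norm_power n m3 split: prod.split)
  also have "\<dots> = (CLINT i|?A. X ^ i) * (CLINT jk|?B \<Otimes>\<^sub>M ?D. (case jk of (j, k) \<Rightarrow> Y ^ j * Z ^ k))"
    by simp
  also have "(CLINT jk|?B \<Otimes>\<^sub>M ?D. (case jk of (j, k) \<Rightarrow> Y ^ j * Z ^ k)) = (CLINT j|?B. CLINT k|?D. Y ^ j * Z ^ k)"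
    by (rule BD.integral_fst[symmetric])
       (intro BD.P.integrable_const_bound[of _ 1] AE_I2, auto simp: norm_mult norm_power n m split: prod.split)
  also have "\<dots> = (CLINT j|?B. Y ^ j) * (CLINT k|?D. Z ^ k)" by simp
  finally have "(CLINT x|cp_law \<kappa> a b d. iexp (z \<bullet> x)) = exp (a * (X - 1)) * (exp (b * (Y - 1)) * exp (d * (Z - 1)))"
    using assms by (simp only: pois_generating)
  then show ?thesis by (simp only: exp_add[symmetric] X_def Y_def Z_def add.assoc)
qed

text \<open>The total count is at most 1 with probability e^(-s) (1 + s), where s = a + b + d, and
  this is at least (1 - s)(1 + s) = 1 - s^2. All later error bounds of order 1/n^2 per cell come
  from here.\<close>

lemma pois3_tail:
  assumes "0 \<le> a" "0 \<le> b" "0 \<le> d"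
  shows "measure (pois3 a b d) {x. \<not> fst x + fst (snd x) + snd (snd x) \<le> 1} \<le> (a + b + d)\<^sup>2"
proof -
  interpret prob_space "pois3 a b d" by (rule prob_space_pois3)
  let ?S = "{(0,0,0), (1,0,0), (0,1,0), (0::nat,0::nat,1::nat)}"
  have p: "prob {(i, j, k)} = pmf (pois a) i * pmf (pois b) j * pmf (pois d) k" for i j k
  proof -
    interpret BD: pair_prob_space "measure_pmf (pois b)" "measure_pmf (pois d)" by unfold_locales
    interpret ABD: pair_prob_space "measure_pmf (pois a)" "measure_pmf (pois b) \<Otimes>\<^sub>M measure_pmf (pois d)" by unfold_locales
    have "{(i, j, k)} = {i} \<times> {j} \<times> {k}" by auto
    then have "prob {(i, j, k)} = measure (pois3 a b d) ({i} \<times> {j} \<times> {k})" by simp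
    also have "\<dots> = measure (measure_pmf (pois a)) {i} * (measure (measure_pmf (pois b)) {j} * measure (measure_pmf (pois d)) {k})"
    proof -
      have "emeasure (measure_pmf (pois a) \<Otimes>\<^sub>M (measure_pmf (pois b) \<Otimes>\<^sub>M measure_pmf (pois d))) ({i} \<times> ({j} \<times> {k}))
          = emeasure (measure_pmf (pois a)) {i} * emeasure (measure_pmf (pois b) \<Otimes>\<^sub>M measure_pmf (pois d)) ({j} \<times> {k})"
      proof (rule sigma_finite_measure.emeasure_pair_measure_Times)
        show "sigma_finite_measure (measure_pmf (pois b) \<Otimes>\<^sub>M measure_pmf (pois d))"
          by (intro prob_space_imp_sigma_finite prob_space_pair prob_space_measure_pmf)
        show "{j} \<times> {k} \<in> sets (measure_pmf (pois b) \<Otimes>\<^sub>M measure_pmf (pois d))"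
          by (rule pair_measureI) simp_all
      qed simp
      also have "emeasure (measure_pmf (pois b) \<Otimes>\<^sub>M measure_pmf (pois d)) ({j} \<times> {k}) =
          emeasure (measure_pmf (pois b)) {j} * emeasure (measure_pmf (pois d)) {k}"
        by (rule sigma_finite_measure.emeasure_pair_measure_Times)
          (auto intro!: prob_space_imp_sigma_finite prob_space_measure_pmf)
      finally show ?thesis by (simp add: pois3_def measure_def enn2real_mult)
    qed
    finally show ?thesis by (simp add: pmf.rep_eq mult.assoc)
  qed
  have S: "{x. fst x + fst (snd x) + snd (snd x) \<le> 1} = ?S"
    by (auto simp: prod_eq_iff)
  have "prob ?S = (\<Sum>x\<in>?S. prob {x})"
    by (rule finite_measure_eq_sum_singleton) (auto simp: pois3_all_sets)
  also have "\<dots> = exp (- (a + b + d)) * (1 + (a + b + d))"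
    using assms by (simp add: p pmf_pois exp_add exp_diff exp_minus field_simps)
  finally have "prob ?S = exp (- (a + b + d)) * (1 + (a + b + d))" .
  moreover have "prob {x. \<not> fst x + fst (snd x) + snd (snd x) \<le> 1} = 1 - prob ?S"
    unfolding S[symmetric] using prob_compl[of "{x. fst x + fst (snd x) + snd (snd x) \<le> 1}"] pois3_all_sets
    by (simp add: Collect_neg_eq[symmetric] Compl_eq_Diff_UNIV[symmetric])
  moreover have "(1 - (a + b + d)) * (1 + (a + b + d)) \<le> exp (- (a + b + d)) * (1 + (a + b + d))"
  proof -
    have "(1 - s) * (1 + s) \<le> exp (- s) * (1 + s)" if "0 \<le> s" for s :: real
      using exp_ge_add_one_self[of "- s"] that by (intro mult_right_mono) auto
    from this[of "a + b + d"] assms show ?thesis by simp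
  qed
  ultimately show ?thesis by (simp add: power2_eq_square algebra_simps)
qed

lemma nu_integral:
  fixes f :: "real \<times> real \<Rightarrow> complex"
  assumes uvw: "0 \<le> u" "0 \<le> v" "0 \<le> w" and c: "c > 0" and f: "f \<in> borel_measurable borel"
  shows "(CLINT x|nu c u v w k. f x) = u * f (1, 0) + v * f (0, 1) + w * f (1, c powi (- k))"
proof -
  let ?g = "\<lambda>x. u * indicator {(1, 0)} x + v * indicator {(0, 1)} x + w * indicator {(1, c powi (- k))} (x :: real \<times> real)"
  let ?P = "{(1, 0), (0, 1), (1, c powi (- k))}"
  \<comment> \<open>Keeps the atoms (1,0) and (1,c^(-k)) apart, so that the finite sum really has
    three terms.\<close>
  have nz: "c powi (- k) \<noteq> 0" using c by simp
  have "(CLINT x|nu c u v w k. f x) = (\<integral>x. ?g x *\<^sub>R f x \<partial>count_space UNIV)"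
    unfolding nu_def using uvw f
    by (subst integral_distr, simp, simp, subst integral_density) auto
  also have "\<dots> = (\<Sum>x | x \<in> UNIV \<and> ?g x *\<^sub>R f x \<noteq> 0. ?g x *\<^sub>R f x)"
    by (rule lebesgue_integral_count_space_finite_support) (rule finite_subset[of _ ?P], auto simp: indicator_def split: if_splits)
  also have "\<dots> = (\<Sum>x\<in>?P. ?g x *\<^sub>R f x)"
    by (rule sum.mono_neutral_left) (auto simp: indicator_def split: if_splits)
  also have "\<dots> = u * f (1, 0) + v * f (0, 1) + w * f (1, c powi (- k))"
    using nz nz[symmetric] by (simp add: scaleR_conv_of_real)
  finally show ?thesis .
qed

lemma compound_poisson_law:
  assumes cp: "compound_poisson M X (nu c u v w k)" and uvw: "0 \<le> u" "0 \<le> v" "0 \<le> w" and c: "c > 0" and t: "0 \<le> t"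
  shows "distr M borel (X t) = cp_law (c powi (- k)) (t * u) (t * v) (t * w)"
proof -
  have X: "X t \<in> borel_measurable M" "prob_space M"
    using cp t by (auto simp: compound_poisson_def levy_process_def)
  show ?thesis
  proof (rule char_eq_plane)
    show "prob_space (distr M borel (X t))" using X by (intro prob_space.prob_space_distr) auto
    fix z :: "real \<times> real"
    have "(CLINT x|distr M borel (X t). iexp (z \<bullet> x)) = (CLINT \<omega>|M. iexp (z \<bullet> X t \<omega>))"
      using X by (subst integral_distr) auto
    also have "\<dots> = exp (complex_of_real t * (CLINT x|nu c u v w k. iexp (z \<bullet> x) - 1))"
      using cp t unfolding compound_poisson_def by blast
    also have "(CLINT x|nu c u v w k. iexp (z \<bullet> x) - 1) =
        u * (iexp (fst z) - 1) + v * (iexp (snd z) - 1) + w * (iexp (fst z + c powi (- k) * snd z) - 1)"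
      by (subst nu_integral[OF uvw c], measurable) (simp add: inner_prod_def mult.commute)
    finally show "(CLINT x|distr M borel (X t). iexp (z \<bullet> x)) = (CLINT x|cp_law (c powi (- k)) (t * u) (t * v) (t * w). iexp (z \<bullet> x))"
      using uvw t by (subst cp_law_char) (simp_all add: algebra_simps)
  qed (simp_all add: prob_space_cp_law, simp add: cp_law_def)
qed

section \<open>The paths of a compound Poisson process\<close>

text \<open>The working notion: law and almost sure path structure with the parameter
  \<open>\<kappa>\<close> free, so that the rescaled process can be shown to satisfy it too.\<close>

definition cp_process ::
  "'a measure \<Rightarrow> (real \<Rightarrow> 'a \<Rightarrow> real \<times> real) \<Rightarrow> real \<Rightarrow> real \<Rightarrow> real \<Rightarrow> real \<Rightarrow> bool" where
  "cp_process M X \<kappa> u v w \<longleftrightarrow> incr_process M X \<and>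
     (\<forall>t\<ge>0. distr M borel (X t) = cp_law \<kappa> (t * u) (t * v) (t * w)) \<and>
     (AE \<omega> in M. cp_path \<kappa> (\<lambda>t. X t \<omega>))"

lemma cp_processD:
  assumes "cp_process M X \<kappa> u v w"
  shows "incr_process M X" "prob_space M"
    "0 \<le> t \<Longrightarrow> X t \<in> borel_measurable M"
    "0 \<le> t \<Longrightarrow> distr M borel (X t) = cp_law \<kappa> (t * u) (t * v) (t * w)"
    "AE \<omega> in M. cp_path \<kappa> (\<lambda>t. X t \<omega>)"
  using assms incr_processD(1,2)[of M X] by (auto simp: cp_process_def)

section \<open>Lattice-valued cadlag paths are step paths\<close>

lemma finite_lattice_cball:
  assumes "0 \<le> \<kappa>"
  shows "finite (range (pmap \<kappa>) \<inter> cball 0 R)"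
proof -
  define n where "n = nat \<lceil>R\<rceil>"
  have "range (pmap \<kappa>) \<inter> cball 0 R \<subseteq> pmap \<kappa> ` ({..n} \<times> {..n} \<times> {..n})"
  proof
    fix x assume "x \<in> range (pmap \<kappa>) \<inter> cball 0 R"
    then obtain i j k where x: "x = pmap \<kappa> (i, j, k)" and R: "norm x \<le> R" by auto
    have "norm (fst x) \<le> R" "norm (snd x) \<le> R"
      using R norm_fst_le[of "fst x" "snd x"] norm_snd_le[of "snd x" "fst x"] by simp_all
    then have "real i + real k \<le> R" "real j + \<kappa> * real k \<le> R" using x assms by (auto simp: pmap_def)
    moreover have "0 \<le> \<kappa> * real k" using assms by simp
    ultimately have "real i \<le> R" "real j \<le> R" "real k \<le> R" by linarith+
    then have "i \<le> n" "j \<le> n" "k \<le> n" unfolding n_def by linarith+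
    then show "x \<in> pmap \<kappa> ` ({..n} \<times> {..n} \<times> {..n})" using x by auto
  qed
  then show ?thesis by (rule finite_subset) auto
qed

text \<open>The point \<open>l\<close> is arbitrary, because it will also be a left limit of the
  path that is not known to lie in the lattice.\<close>

lemma lattice_isolated:
  assumes "0 \<le> \<kappa>"
  obtains U where "open U" "l \<in> U" "range (pmap \<kappa>) \<inter> U \<subseteq> {l}"
proof -
  let ?S = "range (pmap \<kappa>) \<inter> cball 0 (norm l + 1) - {l}"
  have "finite ?S" using finite_lattice_cball[OF assms] by auto
  then have "open (ball 0 (norm l + 1) - ?S)" by (intro open_Diff finite_imp_closed) auto
  moreover have "l \<in> ball 0 (norm l + 1) - ?S" by auto
  moreover have "range (pmap \<kappa>) \<inter> (ball 0 (norm l + 1) - ?S) \<subseteq> {l}" by auto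
  ultimately show thesis by (rule that)
qed

text \<open>Convergence within a locally finite set means being eventually constant. Rational times
  are assumed because only countably many almost sure statements can be combined; right continuity
  extends them to all times.\<close>

lemma cadlag_lattice_step_path:
  assumes \<kappa>: "0 \<le> \<kappa>" and x: "cadlag x" and Q: "\<And>q. 0 \<le> q \<Longrightarrow> q \<in> \<rat> \<Longrightarrow> x q \<in> range (pmap \<kappa>)"
  shows "step_path x"
proof -
  have D: "x t \<in> range (pmap \<kappa>)" if t: "0 \<le> t" for t
  proof -
    obtain U where U: "open U" "x t \<in> U" "range (pmap \<kappa>) \<inter> U \<subseteq> {x t}"
      using lattice_isolated[OF \<kappa>] by metis
    from topological_tendstoD[OF cadlag_right[OF x t] U(1,2)]
    obtain b where b: "t < b" "\<And>s. t < s \<Longrightarrow> s < b \<Longrightarrow> x s \<in> U"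
      unfolding eventually_at_right_field by auto
    obtain q where q: "q \<in> \<rat>" "t < q" "q < b" using Rats_dense_in_real[OF b(1)] by auto
    then have "x q \<in> range (pmap \<kappa>) \<inter> U" using Q[of q] b(2)[of q] t by auto
    then have "x q = x t" using U(3) by blast
    then show ?thesis using Q[of q] q t by auto
  qed
  have ev: "\<forall>\<^sub>F s in F. x s = l" if "(x \<longlongrightarrow> l) F" "\<forall>\<^sub>F s in F. 0 \<le> s" for F l
  proof -
    obtain U where U: "open U" "l \<in> U" "range (pmap \<kappa>) \<inter> U \<subseteq> {l}"
      using lattice_isolated[OF \<kappa>] by metis
    from topological_tendstoD[OF that(1) U(1,2)] that(2) show ?thesis
      by eventually_elim (use U(3) D in blast)
  qed
  show ?thesis
    unfolding step_path_def
  proof (intro conjI allI impI)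
    fix t :: real assume "0 \<le> t"
    moreover have "\<forall>\<^sub>F s in at_right t. t < s"
      unfolding eventually_at_right_field by (intro exI[of _ "t + 1"]) auto
    then have "\<forall>\<^sub>F s in at_right t. 0 \<le> s" by eventually_elim (use \<open>0 \<le> t\<close> in auto)
    ultimately show "\<forall>\<^sub>F s in at_right t. x s = x t" by (intro ev cadlag_right[OF x])
  next
    fix t :: real assume "0 < t"
    moreover have "\<forall>\<^sub>F s in at_left t. 0 \<le> s"
      unfolding eventually_at_left_field using \<open>0 < t\<close> by (intro exI[of _ 0]) auto
    ultimately show "\<exists>y. \<forall>\<^sub>F s in at_left t. x s = y" using ev cadlag_left[OF x] by blast
  qed
qed

section \<open>Recovering the jump sizes\<close>

definition jump_marks :: "real \<Rightarrow> (real \<times> real) set" where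
  "jump_marks \<kappa> = {0, (1, 0), (0, 1), (1, \<kappa>)}"

lemma pmap_jump_marks: "i + j + k \<le> 1 \<Longrightarrow> pmap \<kappa> (i, j, k) \<in> jump_marks \<kappa>"
proof -
  assume "i + j + k \<le> 1"
  then consider "i = 0" "j = 0" "k = 0" | "i = 1" "j = 0" "k = 0" | "i = 0" "j = 1" "k = 0" | "i = 0" "j = 0" "k = 1"
    by linarith
  then show ?thesis by cases (auto simp: pmap_def jump_marks_def zero_prod_def)
qed

lemma jump_marks_borel: "jump_marks \<kappa> \<in> sets borel"
  by (intro borel_closed finite_imp_closed) (simp add: jump_marks_def)

lemma cp_law_no_mark:
  assumes "0 \<le> a" "0 \<le> b" "0 \<le> d"
  shows "measure (cp_law \<kappa> a b d) (- jump_marks \<kappa>) \<le> (a + b + d)\<^sup>2"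
proof -
  interpret prob_space "pois3 a b d" by (rule prob_space_pois3)
  have "measure (cp_law \<kappa> a b d) (- jump_marks \<kappa>) = prob (pmap \<kappa> -` (- jump_marks \<kappa>))"
    unfolding cp_law_def using jump_marks_borel
    by (subst measure_distr) (auto intro: pois3_measurable)
  also have "\<dots> \<le> prob {x. \<not> fst x + fst (snd x) + snd (snd x) \<le> 1}"
  proof (intro finite_measure_mono pois3_all_sets subsetI CollectI notI)
    fix x assume "x \<in> pmap \<kappa> -` (- jump_marks \<kappa>)" "fst x + fst (snd x) + snd (snd x) \<le> 1"
    then show False using pmap_jump_marks[of "fst x" "fst (snd x)" "snd (snd x)" \<kappa>] by simp
  qed
  finally show ?thesis using pois3_tail[OF assms] by simp
qed

lemma partition_cell:
  fixes \<tau> :: "nat \<Rightarrow> real"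
  assumes "\<forall>i<m. \<tau> i \<le> \<tau> (Suc i)" "\<tau> 0 < r" "r \<le> \<tau> m"
  obtains i where "i < m" "\<tau> i < r" "r \<le> \<tau> (Suc i)"
proof -
  have "(\<Sum>i<m. indicator {\<tau> i<..\<tau> (Suc i)} r) = (1::real)"
    using partition_sum_indicator[OF assms(1), of r] assms by simp
  then have "\<exists>i<m. r \<in> {\<tau> i<..\<tau> (Suc i)}"
    by (metis (no_types, lifting) indicator_simps(2) lessThan_iff sum.neutral zero_neq_one)
  then show thesis using that by auto
qed

context
  fixes M :: "'a measure" and X :: "real \<Rightarrow> 'a \<Rightarrow> real \<times> real" and \<kappa> u v w :: real
  assumes X: "incr_process M X" and uvw: "0 \<le> u" "0 \<le> v" "0 \<le> w" and \<kappa>: "0 \<le> \<kappa>"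
    and law: "\<And>t. 0 \<le> t \<Longrightarrow> distr M borel (X t) = cp_law \<kappa> (t * u) (t * v) (t * w)"
begin

interpretation prob_space M using X by (rule incr_processD)

lemma increment_no_mark:
  assumes "0 \<le> s" "s \<le> t"
  shows "prob {\<omega> \<in> space M. X t \<omega> - X s \<omega> \<notin> jump_marks \<kappa>} \<le> ((t - s) * (u + v + w))\<^sup>2"
proof -
  have [measurable]: "X s \<in> borel_measurable M" "X t \<in> borel_measurable M"
    using incr_processD(2)[OF X] assms by auto
  have "prob {\<omega> \<in> space M. X t \<omega> - X s \<omega> \<notin> jump_marks \<kappa>} = measure (distr M borel (\<lambda>\<omega>. X t \<omega> - X s \<omega>)) (- jump_marks \<kappa>)"
    using jump_marks_borel by (subst measure_distr) (auto intro!: arg_cong[of _ _ prob])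
  also have "distr M borel (\<lambda>\<omega>. X t \<omega> - X s \<omega>) = cp_law \<kappa> ((t - s) * u) ((t - s) * v) ((t - s) * w)"
    using incr_processD(5)[OF X assms] law[of "t - s"] assms by simp
  finally show ?thesis
    using cp_law_no_mark[of "(t - s) * u" "(t - s) * v" "(t - s) * w" \<kappa>] uvw assms
    by (simp add: distrib_left)
qed

text \<open>A union bound over \<open>Suc n\<close> cells of length T/(n+1) gives a bad partition
  probability O(1/n). That is not summable, but the event that all partitions from \<open>m\<close>
  on are bad is bounded by each of these, hence null; infinitely many good partitions
  suffice.\<close>

lemma AE_frequently_marks:
  assumes T: "0 \<le> T"
  shows "AE \<omega> in M. \<forall>m. \<exists>n\<ge>m. \<forall>i<Suc n. X (unif T n (Suc i)) \<omega> - X (unif T n i) \<omega> \<in> jump_marks \<kappa>"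
proof -
  define Bad where "Bad n = {\<omega> \<in> space M. \<exists>i<Suc n. X (unif T n (Suc i)) \<omega> - X (unif T n i) \<omega> \<notin> jump_marks \<kappa>}" for n
  have me: "{\<omega> \<in> space M. X (unif T n (Suc i)) \<omega> - X (unif T n i) \<omega> \<notin> jump_marks \<kappa>} \<in> events" if "i < Suc n" for n i
  proof -
    have [measurable]: "X (unif T n (Suc i)) \<in> borel_measurable M" "X (unif T n i) \<in> borel_measurable M" "jump_marks \<kappa> \<in> sets borel"
      using incr_processD(2)[OF X] unif_bounds(1)[OF T, of _ n] that jump_marks_borel by auto
    show ?thesis by measurable
  qed
  have Bad_eq: "Bad n = (\<Union>i<Suc n. {\<omega> \<in> space M. X (unif T n (Suc i)) \<omega> - X (unif T n i) \<omega> \<notin> jump_marks \<kappa>})" for n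
    by (auto simp: Bad_def)
  have Bad_ev: "Bad n \<in> events" for n unfolding Bad_eq using me by auto
  have Bad_le: "prob (Bad n) \<le> (T * (u + v + w))\<^sup>2 * inverse (real (Suc n))" for n
  proof -
    have "prob (Bad n) \<le> (\<Sum>i<Suc n. prob {\<omega> \<in> space M. X (unif T n (Suc i)) \<omega> - X (unif T n i) \<omega> \<notin> jump_marks \<kappa>})"
      unfolding Bad_eq using me by (intro finite_measure_subadditive_finite) auto
    also have "\<dots> \<le> (\<Sum>i<Suc n. (T / real (Suc n) * (u + v + w))\<^sup>2)"
    proof (intro sum_mono)
      fix i assume "i \<in> {..<Suc n}"
      then show "prob {\<omega> \<in> space M. X (unif T n (Suc i)) \<omega> - X (unif T n i) \<omega> \<notin> jump_marks \<kappa>} \<le> (T / real (Suc n) * (u + v + w))\<^sup>2"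
        using increment_no_mark[of "unif T n i" "unif T n (Suc i)"] unif_bounds(1)[OF T, of i n] unif_mono[OF T, of n i]
        by (simp only: unif_diff) simp
    qed
    also have "\<dots> = (T * (u + v + w))\<^sup>2 * inverse (real (Suc n))"
      by (simp add: power2_eq_square field_simps del: of_nat_Suc)
    finally show ?thesis .
  qed
  have lim: "(\<lambda>n. (T * (u + v + w))\<^sup>2 * inverse (real (Suc n))) \<longlonglongrightarrow> 0"
    using tendsto_mult[OF tendsto_const LIMSEQ_inverse_real_of_nat] by force
  have "AE \<omega> in M. \<exists>n\<ge>m. \<omega> \<notin> Bad n" for m
  proof -
    have ev: "(\<Inter>n\<in>{m..}. Bad n) \<in> events" using Bad_ev by auto
    have "prob (\<Inter>n\<in>{m..}. Bad n) \<le> (T * (u + v + w))\<^sup>2 * inverse (real (Suc n))" if "n \<ge> m" for n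
      using finite_measure_mono[of "\<Inter>n\<in>{m..}. Bad n" "Bad n"] Bad_ev Bad_le[of n] that
      by (meson INF_lower atLeast_iff order_trans)
    then have "prob (\<Inter>n\<in>{m..}. Bad n) \<le> 0"
      by (intro LIMSEQ_le_const[OF lim] exI[of _ m]) auto
    then have "(\<Inter>n\<in>{m..}. Bad n) \<in> null_sets M"
      using ev by (simp add: null_sets_def emeasure_eq_measure measure_le_0_iff)
    from AE_not_in[OF this] show ?thesis by eventually_elim auto
  qed
  then have "AE \<omega> in M. \<forall>m. \<exists>n\<ge>m. \<omega> \<notin> Bad n" by (simp add: AE_all_countable)
  with AE_space show ?thesis by eventually_elim (auto simp: Bad_def)
qed

lemma AE_lattice: "AE \<omega> in M. \<forall>q\<in>\<rat> \<inter> {0..}. X q \<omega> \<in> range (pmap \<kappa>)"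
proof -
  have "AE \<omega> in M. X q \<omega> \<in> range (pmap \<kappa>)" if q: "0 \<le> q" for q
  proof -
    have m: "range (pmap \<kappa>) \<in> sets borel" by (rule sets.countable) auto
    have "AE x in distr (pois3 (q * u) (q * v) (q * w)) borel (pmap \<kappa>). x \<in> range (pmap \<kappa>)"
      using m by (subst AE_distr_iff) (auto intro: pois3_measurable)
    then have "AE x in distr M borel (X q). x \<in> range (pmap \<kappa>)"
      unfolding law[OF q] cp_law_def .
    then show ?thesis
      using m incr_processD(2)[OF X q] by (subst (asm) AE_distr_iff) auto
  qed
  moreover have "countable (\<rat> \<inter> {0..} :: real set)" using countable_rat by blast
  ultimately show ?thesis by (subst AE_ball_countable) auto
qed

text \<open>For fine partitions the increment over the cell containing \<open>r\<close> equals the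
  jump at \<open>r\<close>, and infinitely often this increment is a mark. Integer horizons keep the
  number of exceptional null sets countable.\<close>

lemma AE_cp_path:
  assumes cl: "AE \<omega> in M. cadlag (\<lambda>t. X t \<omega>)" and X0: "AE \<omega> in M. X 0 \<omega> = 0"
  shows "AE \<omega> in M. cp_path \<kappa> (\<lambda>t. X t \<omega>)"
proof -
  have "AE \<omega> in M. \<forall>k::nat. \<forall>m. \<exists>n\<ge>m. \<forall>i<Suc n. X (unif (real k) n (Suc i)) \<omega> - X (unif (real k) n i) \<omega> \<in> jump_marks \<kappa>"
    using AE_frequently_marks by (subst AE_all_countable) simp
  with cl X0 AE_lattice show ?thesis
  proof eventually_elim
    case (elim \<omega>)
    let ?x = "\<lambda>t. X t \<omega>"
    have st: "step_path ?x"
      using elim by (intro cadlag_lattice_step_path[OF \<kappa>]) auto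
    have "jump ?x r \<in> jump_marks \<kappa>" if r: "0 < r" for r
    proof -
      obtain k :: nat where k: "r \<le> real k" using real_arch_simple by blast
      have k0: "0 \<le> real k" by simp
      have "\<forall>\<^sub>F n in sequentially. \<forall>i<Suc n. unif (real k) n i < r \<and> r \<le> unif (real k) n (Suc i) \<longrightarrow>
          ?x (unif (real k) n i) = Lim (at_left r) ?x \<and> ?x (unif (real k) n (Suc i)) = ?x r"
        using r by (intro partition_eventually_ends[OF unif_partitions[OF k0]] step_path_left[OF st] step_path_right[OF st]) auto
      then obtain m where m: "\<And>n i. n \<ge> m \<Longrightarrow> i < Suc n \<Longrightarrow> unif (real k) n i < r \<Longrightarrow> r \<le> unif (real k) n (Suc i) \<Longrightarrow>
          ?x (unif (real k) n i) = Lim (at_left r) ?x \<and> ?x (unif (real k) n (Suc i)) = ?x r"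
        unfolding eventually_sequentially by blast
      obtain n where n: "n \<ge> m" "\<forall>i<Suc n. X (unif (real k) n (Suc i)) \<omega> - X (unif (real k) n i) \<omega> \<in> jump_marks \<kappa>"
        using elim(4) by blast
      obtain i where i: "i < Suc n" "unif (real k) n i < r" "r \<le> unif (real k) n (Suc i)"
        using partition_cell[of "Suc n" "unif (real k) n" r] unif_mono[OF k0, of n] r k by auto
      show ?thesis using m[OF n(1) i] n(2)[rule_format, OF i(1)] by (simp add: jump_def)
    qed
    then show ?case using st elim(2) by (simp add: cp_path_def jump_marks_def)
  qed
qed

end

lemma levy_cp_process:
  assumes "levy_process M X" "0 \<le> u" "0 \<le> v" "0 \<le> w" "0 \<le> \<kappa>"
    and "\<And>t. 0 \<le> t \<Longrightarrow> distr M borel (X t) = cp_law \<kappa> (t * u) (t * v) (t * w)"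
  shows "cp_process M X \<kappa> u v w"
  unfolding cp_process_def
  using levy_incr_process[OF assms(1)] AE_cp_path[OF levy_incr_process[OF assms(1)] assms(2-6)] assms
  by (auto simp: levy_process_def)

lemma cp_path_mono:
  assumes x: "cp_path \<kappa> x" and "0 \<le> \<kappa>" "0 \<le> s" "s \<le> t"
  shows "fst (x s) \<le> fst (x t)" "snd (x s) \<le> snd (x t)"
proof -
  have j: "0 \<le> jump (\<lambda>t. fst (x t)) r" "0 \<le> jump (\<lambda>t. snd (x t)) r" if "0 < r" for r
    using cp_path_jumps[OF x that] assms by (auto simp: zero_prod_def)
  have "0 \<le> fst (x t) - fst (x s)"
    unfolding step_path_diff_eq_sum_jumps[OF step_path_fst[OF cp_path_step[OF x]] assms(3,4)]
    using j assms by (intro sum_nonneg) (auto simp: jumps_def)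
  then show "fst (x s) \<le> fst (x t)" by simp
  have "0 \<le> snd (x t) - snd (x s)"
    unfolding step_path_diff_eq_sum_jumps[OF step_path_snd[OF cp_path_step[OF x]] assms(3,4)]
    using j assms by (intro sum_nonneg) (auto simp: jumps_def)
  then show "snd (x s) \<le> snd (x t)" by simp
qed

lemma cp_process_law_incr:
  assumes "cp_process M X \<kappa> u v w" "cp_process M' Y \<kappa> u v w" "0 \<le> h" "0 \<le> h'"
  shows "distr M path_space (incr X h) = distr M' path_space (incr Y h')"
  using assms by (intro incr_law_eq) (auto simp: cp_process_def)

text \<open>As \<open>X 0 = 0\<close> almost surely, \<open>incr X 0\<close> is a version of the process itself.\<close>

lemma cp_process_incr0:
  assumes "cp_process M X \<kappa> u v w"
  shows "AE \<omega> in M. cp_path \<kappa> (\<lambda>t. X t \<omega>) \<and> cp_path \<kappa> (incr X 0 \<omega>) \<and> (\<forall>t\<ge>0. incr X 0 \<omega> t = X t \<omega>)"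
  using cp_processD(5)[OF assms]
proof eventually_elim
  case (elim \<omega>)
  have *: "incr X 0 \<omega> t = X t \<omega>" if "0 \<le> t" for t using elim that by (simp add: incr_def cp_path_def)
  then show ?case using elim cp_path_cong[of "incr X 0 \<omega>" "\<lambda>t. X t \<omega>"] by auto
qed

lemma cp_path_shift:
  assumes x: "cp_path \<kappa> x" and h: "0 \<le> h"
  shows "cp_path \<kappa> (\<lambda>q. x (h + q) - x h)"
  unfolding cp_path_def
proof (intro conjI allI impI)
  show "step_path (\<lambda>q. x (h + q) - x h)"
    using step_path_comp[OF step_path_shift[OF cp_path_step[OF x] h], of "\<lambda>a. a - x h"] by simp
  show "jump (\<lambda>q. x (h + q) - x h) t \<in> {0, (1, 0), (0, 1), (1, \<kappa>)}" if "0 < t" for t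
    using x h that unfolding jump_shift[OF cp_path_step[OF x] h that] by (simp add: cp_path_def)
qed simp

lemma cp_process_incr:
  assumes "cp_process M X \<kappa> u v w" and h: "0 \<le> h"
  shows "AE \<omega> in M. cp_path \<kappa> (incr X h \<omega>)"
  using cp_processD(5)[OF assms(1)]
proof eventually_elim
  case (elim \<omega>)
  show ?case
    by (rule cp_path_cong[OF _ cp_path_shift[OF elim h]]) (simp add: incr_def)
qed

section \<open>Limits of laws\<close>

lemma iexp_integral_limit:
  assumes "prob_space M" "\<And>n. U n \<in> borel_measurable M" "U' \<in> borel_measurable M"
    and lim: "AE \<omega> in M. (\<lambda>n. U n \<omega>) \<longlonglongrightarrow> (U' \<omega> :: real)"
  shows "(\<lambda>n. CLINT \<omega>|M. iexp (z * U n \<omega>)) \<longlonglongrightarrow> (CLINT \<omega>|M. iexp (z * U' \<omega>))"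
proof -
  interpret prob_space M by fact
  note [measurable] = assms(2,3)
  show ?thesis
  proof (rule integral_dominated_convergence[where w = "\<lambda>_. 1"])
    show "AE \<omega> in M. (\<lambda>n. iexp (z * U n \<omega>)) \<longlonglongrightarrow> iexp (z * U' \<omega>)"
      using lim by eventually_elim (intro tendsto_intros)
  qed simp_all
qed

text \<open>A Slutsky argument by characteristic functions: \<open>U n\<close> and
  \<open>W n\<close> live on different spaces but share their laws, \<open>V n\<close> differs from
  \<open>W n\<close> by a vanishing term, and the law of \<open>V n\<close> is the same for all
  \<open>n\<close>.\<close>

lemma law_limit:
  fixes \<Omega> :: "'b measure"
  assumes M: "prob_space M" and \<Omega>: "prob_space \<Omega>"
    and [measurable]: "\<And>n. U n \<in> borel_measurable M" "U' \<in> borel_measurable M"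
      "\<And>n. V n \<in> borel_measurable \<Omega>" "\<And>n. W n \<in> borel_measurable \<Omega>"
    and U: "AE \<omega> in M. (\<lambda>n. U n \<omega>) \<longlonglongrightarrow> (U' \<omega> :: real)"
    and VW: "AE \<omega> in \<Omega>. (\<lambda>n. V n \<omega> - W n \<omega>) \<longlonglongrightarrow> (0 :: real)"
    and UW: "\<And>n. distr M borel (U n) = distr \<Omega> borel (W n)"
    and V: "\<And>n. distr \<Omega> borel (V n) = \<rho>"
  shows "\<rho> = distr M borel U'"
proof -
  interpret M: prob_space M by fact
  interpret O: prob_space \<Omega> by fact
  have rd: "real_distribution \<rho>" "real_distribution (distr M borel U')"
    unfolding V[of 0, symmetric] real_distribution_def real_distribution_axioms_def
    by (auto intro: M.prob_space_distr O.prob_space_distr)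
  have "char \<rho> z = char (distr M borel U') z" for z
  proof -
    have c: "char \<rho> z = (CLINT \<omega>|\<Omega>. iexp (z * V n \<omega>))" for n
      unfolding V[of n, symmetric] char_def by (subst integral_distr) auto
    have w: "(CLINT \<omega>|\<Omega>. iexp (z * W n \<omega>)) = (CLINT \<omega>|M. iexp (z * U n \<omega>))" for n
    proof -
      have "(CLINT \<omega>|\<Omega>. iexp (z * W n \<omega>)) = (CLINT x|distr \<Omega> borel (W n). iexp (z * x))"
        by (subst integral_distr) auto
      also have "\<dots> = (CLINT \<omega>|M. iexp (z * U n \<omega>))"
        unfolding UW[symmetric] by (subst integral_distr) auto
      finally show ?thesis .
    qed
    have iV: "integrable \<Omega> (\<lambda>\<omega>. iexp (z * V n \<omega>))" and iW: "integrable \<Omega> (\<lambda>\<omega>. iexp (z * W n \<omega>))" for n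
      by (auto intro!: O.integrable_const_bound[of _ 1])
    have "(\<lambda>n. CLINT \<omega>|\<Omega>. iexp (z * V n \<omega>) - iexp (z * W n \<omega>)) \<longlonglongrightarrow> (CLINT \<omega>|\<Omega>. 0)"
    proof (rule integral_dominated_convergence[where w = "\<lambda>_. 2"])
      show "AE \<omega> in \<Omega>. (\<lambda>n. iexp (z * V n \<omega>) - iexp (z * W n \<omega>)) \<longlonglongrightarrow> 0"
        using VW
      proof eventually_elim
        case (elim \<omega>)
        have "(\<lambda>n. iexp (z * (V n \<omega> - W n \<omega>)) - 1) \<longlonglongrightarrow> iexp (z * 0) - 1"
          by (intro tendsto_intros elim)
        then have "(\<lambda>n. norm (iexp (z * (V n \<omega> - W n \<omega>)) - 1)) \<longlonglongrightarrow> 0"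
          by (simp add: tendsto_norm_zero)
        moreover have "norm (iexp (z * (V n \<omega> - W n \<omega>)) - 1) = norm (iexp (z * V n \<omega>) - iexp (z * W n \<omega>))" for n
        proof -
          have "iexp (z * V n \<omega>) - iexp (z * W n \<omega>) = iexp (z * W n \<omega>) * (iexp (z * (V n \<omega> - W n \<omega>)) - 1)"
            by (simp add: algebra_simps exp_add[symmetric])
          then show ?thesis by (simp add: norm_mult)
        qed
        ultimately have "(\<lambda>n. norm (iexp (z * V n \<omega>) - iexp (z * W n \<omega>))) \<longlonglongrightarrow> 0" by (simp only:)
        then show ?case by (rule tendsto_norm_zero_cancel)
      qed
      show "AE \<omega> in \<Omega>. norm (iexp (z * V n \<omega>) - iexp (z * W n \<omega>)) \<le> 2" for n
        by (intro AE_I2 order_trans[OF norm_triangle_ineq4]) simp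
    qed simp_all
    then have "(\<lambda>n. char \<rho> z - (CLINT \<omega>|M. iexp (z * U n \<omega>))) \<longlonglongrightarrow> 0"
      unfolding Bochner_Integration.integral_diff[OF iV iW] c[symmetric] w by simp
    moreover have "(\<lambda>n. CLINT \<omega>|M. iexp (z * U n \<omega>)) \<longlonglongrightarrow> (CLINT \<omega>|M. iexp (z * U' \<omega>))"
      by (rule iexp_integral_limit[OF M _ _ U]) simp_all
    ultimately have "(\<lambda>n. char \<rho> z - (CLINT \<omega>|M. iexp (z * U n \<omega>)) + (CLINT \<omega>|M. iexp (z * U n \<omega>)))
        \<longlonglongrightarrow> 0 + (CLINT \<omega>|M. iexp (z * U' \<omega>))" by (intro tendsto_add)
    then have "char \<rho> z = (CLINT \<omega>|M. iexp (z * U' \<omega>))"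
      by (simp add: LIMSEQ_const_iff)
    then show ?thesis unfolding char_def by (subst integral_distr) auto
  qed
  then show ?thesis using rd by (intro Levy_uniqueness) auto
qed

lemma law_limit_eq:
  fixes \<Omega> :: "'b measure"
  assumes M: "prob_space M" and \<Omega>: "prob_space \<Omega>"
    and [measurable]: "\<And>n. U n \<in> borel_measurable M" "U' \<in> borel_measurable M"
      "\<And>n. W n \<in> borel_measurable \<Omega>" "W' \<in> borel_measurable \<Omega>"
    and U: "AE \<omega> in M. (\<lambda>n. U n \<omega>) \<longlonglongrightarrow> (U' \<omega> :: real)"
    and W: "AE \<omega> in \<Omega>. (\<lambda>n. W n \<omega>) \<longlonglongrightarrow> (W' \<omega> :: real)"
    and UW: "\<And>n. distr M borel (U n) = distr \<Omega> borel (W n)"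
  shows "distr \<Omega> borel W' = distr M borel U'"
proof (rule law_limit[OF M \<Omega>, of U U' "\<lambda>_. W'" W])
  show "AE \<omega> in \<Omega>. (\<lambda>n. W' \<omega> - W n \<omega>) \<longlonglongrightarrow> 0"
    using W
  proof eventually_elim
    case (elim \<omega>)
    have "(\<lambda>n. W' \<omega> - W n \<omega>) \<longlonglongrightarrow> W' \<omega> - W' \<omega>" by (intro tendsto_intros elim)
    then show ?case by simp
  qed
qed (use U UW in auto)

section \<open>Time reversal\<close>

lemma (in prob_space) indep_vars_reindex:
  assumes "inj_on f I" and ind: "indep_vars M' X (f ` I)"
  shows "indep_vars (\<lambda>i. M' (f i)) (\<lambda>i. X (f i)) I"
proof -
  let ?F = "\<lambda>i. {X i -` A \<inter> space M |A. A \<in> sets (M' i)}"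
  have F: "indep_sets ?F (f ` I)" and rv: "\<And>i. i \<in> I \<Longrightarrow> random_variable (M' (f i)) (X (f i))"
    using ind by (auto simp: indep_vars_def2)
  have "indep_sets (\<lambda>i. ?F (f i)) I"
  proof (rule indep_setsI)
    show "?F (f i) \<subseteq> events" if "i \<in> I" for i using rv[OF that] by (auto intro: measurable_sets)
    fix A J assume J: "J \<noteq> {}" "J \<subseteq> I" "finite J" "\<forall>j\<in>J. A j \<in> ?F (f j)"
    have inj: "inj_on f J" using assms(1) J(2) by (rule inj_on_subset)
    let ?B = "\<lambda>k. A (the_inv_into J f k)"
    have B: "?B (f j) = A j" if "j \<in> J" for j using that by (simp add: the_inv_into_f_f[OF inj])
    have "prob (\<Inter>k\<in>f ` J. ?B k) = (\<Prod>k\<in>f ` J. prob (?B k))"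
    proof (rule indep_setsD[OF F])
      show "\<forall>k\<in>f ` J. ?B k \<in> ?F k"
      proof (rule ballI, elim imageE, hypsubst)
        fix j assume "j \<in> J"
        then show "?B (f j) \<in> ?F (f j)" unfolding B[OF \<open>j \<in> J\<close>] using J(4) by blast
      qed
    qed (use J in auto)
    then show "prob (\<Inter>j\<in>J. A j) = (\<Prod>j\<in>J. prob (A j))"
      by (simp add: prod.reindex[OF inj] B cong: INF_cong prod.cong)
  qed
  then show ?thesis using rv by (simp add: indep_vars_def2)
qed

text \<open>For every \<open>n\<close> the two partial sums already have the same law; the limit
  along uniform partitions transfers this to the integrals.\<close>

lemma time_reversal:
  assumes X: "cp_process M X \<kappa> u v w" and t: "0 \<le> t"
  shows "distr M borel (\<lambda>\<omega>. pint (wI c) t (incr X 0 \<omega>)) = distr M borel (\<lambda>\<omega>. pint (wB c) t (incr X 0 \<omega>))"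
proof -
  note iX = cp_processD(1)[OF X]
  interpret prob_space M using cp_processD(2)[OF X] .
  have m: "(\<lambda>\<omega>. f (incr X 0 \<omega>)) \<in> borel_measurable M" if "f \<in> borel_measurable path_space" for f :: "_ \<Rightarrow> real"
    using measurable_compose[OF incr_processD(3)[OF iX] that] by simp
  have lim: "AE \<omega> in M. (\<lambda>n. psum G t n (incr X 0 \<omega>)) \<longlonglongrightarrow> pint G t (incr X 0 \<omega>)" for G
    using cp_process_incr[OF X order_refl]
    by eventually_elim (use psum_tendsto pint_eq_jint cp_path_step t in fastforce)
  have law: "distr M borel (\<lambda>\<omega>. psum (wB c) t n (incr X 0 \<omega>)) = distr M borel (\<lambda>\<omega>. psum (wI c) t n (incr X 0 \<omega>))" for n
  proof -
    define D where "D i \<omega> = X (unif t n (Suc i)) \<omega> - X (unif t n i) \<omega>" for i \<omega>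
    \<comment> \<open>One function serves both sums: \<open>wI\<close> discounts cell
      \<open>i\<close> by the N-increments of the cells before it, \<open>wB\<close> by those of the
      cells after it, and the index map \<open>n - i\<close> exchanges the two.\<close>
    define F where "F d = (\<Sum>i<Suc n. c powr (- (\<Sum>j<i. fst (d j))) * snd (d i :: real \<times> real))" for d :: "nat \<Rightarrow> real \<times> real"
    let ?I = "{..<Suc n}" and ?P = "PiM {..<Suc n} (\<lambda>_. borel :: (real \<times> real) measure)"
    have ub: "0 \<le> unif t n i" if "i \<le> Suc n" for i using unif_bounds[OF t that] by simp
    have ind: "indep_vars (\<lambda>_. borel) D ?I"
      unfolding D_def using incr_process_indep[OF iX, of "unif t n" "Suc n"] unif_mono[OF t] by simp
    have ind': "indep_vars (\<lambda>_. borel) (\<lambda>i. D (n - i)) ?I"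
    proof -
      have "(\<lambda>i. n - i) ` ?I = ?I"
      proof (intro equalityI subsetI)
        fix i assume "i \<in> ?I"
        then show "i \<in> (\<lambda>i. n - i) ` ?I" by (intro image_eqI[of _ _ "n - i"]) auto
      qed auto
      moreover have "inj_on (\<lambda>i. n - i) ?I" by (auto simp: inj_on_def)
      ultimately show ?thesis
        using indep_vars_reindex[of "\<lambda>i. n - i" ?I "\<lambda>_. borel" D] ind by (simp add: comp_def)
    qed
    have rv: "D i \<in> borel_measurable M" if "i \<in> ?I" for i
      using ind that by (auto simp: indep_vars_def)
    have Dl: "distr M borel (D i) = distr M borel (X (t / real (Suc n)))" if "i \<in> ?I" for i
      unfolding D_def[abs_def] using incr_processD(5)[OF iX, of "unif t n i" "unif t n (Suc i)"] ub that unif_mono[OF t]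
      by (simp only: unif_diff) auto
    have ne: "?I \<noteq> {}" by auto
    have "distr M ?P (\<lambda>\<omega>. \<lambda>i\<in>?I. D i \<omega>) = PiM ?I (\<lambda>i. distr M borel (D i))"
      using indep_vars_iff_distr_eq_PiM'[OF ne, of D "\<lambda>_. borel"] ind rv by auto
    also have "\<dots> = PiM ?I (\<lambda>i. distr M borel (D (n - i)))"
    proof (rule PiM_cong[OF refl])
      fix i assume "i \<in> ?I"
      then have "n - i \<in> ?I" by auto
      then show "distr M borel (D i) = distr M borel (D (n - i))" using Dl[OF \<open>i \<in> ?I\<close>] Dl[of "n - i"] by simp
    qed
    also have "\<dots> = distr M ?P (\<lambda>\<omega>. \<lambda>i\<in>?I. D (n - i) \<omega>)"
      using indep_vars_iff_distr_eq_PiM'[OF ne, of "\<lambda>i. D (n - i)" "\<lambda>_. borel"] ind' rv by auto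
    finally have eq: "distr M ?P (\<lambda>\<omega>. \<lambda>i\<in>?I. D i \<omega>) = distr M ?P (\<lambda>\<omega>. \<lambda>i\<in>?I. D (n - i) \<omega>)" .
    have cm: "(\<lambda>d. f (d i)) \<in> borel_measurable ?P" if "i \<in> ?I" "f \<in> borel_measurable borel" for i and f :: "real \<times> real \<Rightarrow> real"
      using measurable_compose[OF measurable_component_singleton[OF that(1)] that(2)] .
    have fs: "fst \<in> borel_measurable (borel :: (real \<times> real) measure)" "snd \<in> borel_measurable (borel :: (real \<times> real) measure)"
      by (intro borel_measurable_continuous_onI continuous_intros)+
    have F: "F \<in> borel_measurable ?P"
      unfolding F_def
      by (intro borel_measurable_sum borel_measurable_times powr_real_measurable borel_measurable_uminus cm fs borel_measurable_const) auto
    have tel: "(\<Sum>l\<in>{i..<j}. D l \<omega>) = X (unif t n j) \<omega> - X (unif t n i) \<omega>" if "i \<le> j" for i j \<omega>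
      unfolding D_def using sum_Suc_diff'[OF that, of "\<lambda>l. X (unif t n l) \<omega>"] .
    have in0: "incr X 0 \<omega> (unif t n i) = X (unif t n i) \<omega> - X 0 \<omega>" if "i \<le> Suc n" for i \<omega>
      using ub[OF that] by (simp add: incr_def)
    have I: "psum (wI c) t n (incr X 0 \<omega>) = F (\<lambda>i\<in>?I. D i \<omega>)" for \<omega>
      unfolding psum_def F_def wI_def
    proof (intro sum.cong refl)
      fix i assume i: "i \<in> ?I"
      have "(\<Sum>j<i. fst ((\<lambda>i\<in>?I. D i \<omega>) j)) = fst (\<Sum>j\<in>{0..<i}. D j \<omega>)"
        unfolding fst_sum using i by (intro sum.cong) auto
      also have "\<dots> = fst (incr X 0 \<omega> (unif t n i))"
        using tel[of 0 i \<omega>] in0[of i \<omega>] i by simp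
      finally show "c powr - fst (incr X 0 \<omega> (unif t n i)) * (snd (incr X 0 \<omega> (unif t n (Suc i))) - snd (incr X 0 \<omega> (unif t n i)))
        = c powr - (\<Sum>j<i. fst ((\<lambda>i\<in>?I. D i \<omega>) j)) * snd ((\<lambda>i\<in>?I. D i \<omega>) i)"
        using in0[of i \<omega>] in0[of "Suc i" \<omega>] i by (simp add: D_def)
    qed
    have B: "psum (wB c) t n (incr X 0 \<omega>) = F (\<lambda>i\<in>?I. D (n - i) \<omega>)" for \<omega>
    proof -
      have "F (\<lambda>i\<in>?I. D (n - i) \<omega>) = (\<Sum>i<Suc n. c powr (- (\<Sum>j<i. fst (D (n - j) \<omega>))) * snd (D (n - i) \<omega>))"
        unfolding F_def by (intro sum.cong refl arg_cong2[where f = "(*)"] arg_cong2[where f = "(powr)"] arg_cong[where f = uminus]) auto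
      also have "\<dots> = (\<Sum>i<Suc n. c powr (- (\<Sum>j<n - i. fst (D (n - j) \<omega>))) * snd (D i \<omega>))"
        by (rule sum.reindex_bij_witness[of _ "\<lambda>i. n - i" "\<lambda>i. n - i"]) auto
      also have "\<dots> = (\<Sum>i<Suc n. wB c (fst (incr X 0 \<omega> (unif t n i))) (fst (incr X 0 \<omega> (unif t n (Suc i)))) (fst (incr X 0 \<omega> t)) *
          (snd (incr X 0 \<omega> (unif t n (Suc i))) - snd (incr X 0 \<omega> (unif t n i))))"
      proof (intro sum.cong refl)
        fix i assume i: "i \<in> ?I"
        have "(\<Sum>j<n - i. fst (D (n - j) \<omega>)) = (\<Sum>j\<in>{Suc i..<Suc n}. fst (D j \<omega>))"
          using i by (intro sum.reindex_bij_witness[of _ "\<lambda>j. n - j" "\<lambda>j. n - j"]) auto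
        also have "\<dots> = fst (X t \<omega> - X (unif t n (Suc i)) \<omega>)"
          using tel[of "Suc i" "Suc n" \<omega>] i by (simp add: fst_sum[symmetric])
        finally show "c powr (- (\<Sum>j<n - i. fst (D (n - j) \<omega>))) * snd (D i \<omega>) =
          wB c (fst (incr X 0 \<omega> (unif t n i))) (fst (incr X 0 \<omega> (unif t n (Suc i)))) (fst (incr X 0 \<omega> t)) *
          (snd (incr X 0 \<omega> (unif t n (Suc i))) - snd (incr X 0 \<omega> (unif t n i)))"
          using in0[of i \<omega>] in0[of "Suc i" \<omega>] in0[of "Suc n" \<omega>] i by (simp add: D_def wB_def)
      qed
      finally show ?thesis by (simp add: psum_def)
    qed
    have "distr M borel (\<lambda>\<omega>. psum (wB c) t n (incr X 0 \<omega>)) = distr (distr M ?P (\<lambda>\<omega>. \<lambda>i\<in>?I. D (n - i) \<omega>)) borel F"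
      unfolding B using rv F by (subst distr_distr) (auto intro!: measurable_restrict simp: comp_def)
    also have "\<dots> = distr M borel (\<lambda>\<omega>. psum (wI c) t n (incr X 0 \<omega>))"
      unfolding I eq[symmetric] using rv F by (subst distr_distr) (auto intro!: measurable_restrict simp: comp_def)
    finally show ?thesis .
  qed
  show ?thesis
    by (rule law_limit_eq[OF prob_space_axioms prob_space_axioms _ _ _ _ lim lim law])
      (intro m functional_measurable t)+
qed

section \<open>Convergence of the improper integral\<close>

text \<open>Domination by 2^n, whose integrability is the generating function at 2.\<close>

lemma pois_mean_finite:
  assumes a: "0 \<le> a"
  shows "(\<integral>\<^sup>+n. ennreal (real n) \<partial>measure_pmf (pois a)) < \<infinity>"
proof -
  have "integrable (measure_pmf (pois a)) (\<lambda>n. real n)"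
  proof (rule Bochner_Integration.integrable_bound[OF pois_generating(1)[OF a, of 2]])
    show "AE n in measure_pmf (pois a). norm (real n) \<le> norm ((2::complex) ^ n)"
      using of_nat_less_two_power[where 'a = real] by (intro AE_I2) (simp add: norm_power less_imp_le)
  qed simp
  then show ?thesis by (simp add: integrable_iff_bounded)
qed

lemma cp_law_mean_finite:
  assumes "0 \<le> a" "0 \<le> b" "0 \<le> d" "0 \<le> \<kappa>"
  shows "(\<integral>\<^sup>+x. ennreal (snd x) \<partial>cp_law \<kappa> a b d) < \<infinity>"
proof -
  let ?A = "measure_pmf (pois a)" and ?B = "measure_pmf (pois b)" and ?D = "measure_pmf (pois d)"
  have fs: "snd \<in> borel_measurable (borel :: (real \<times> real) measure)"
    by (intro borel_measurable_continuous_onI continuous_intros)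
  interpret BD: pair_prob_space ?B ?D by unfold_locales
  have sf: "sigma_finite_measure (?B \<Otimes>\<^sub>M ?D)" by (rule prob_space_imp_sigma_finite[OF BD.P.prob_space_axioms])
  have sBD: "sets (?B \<Otimes>\<^sub>M ?D) = UNIV"
  proof -
    have "sets (?B \<Otimes>\<^sub>M ?D) = sets (count_space UNIV \<Otimes>\<^sub>M count_space UNIV)"
      by (intro sets_pair_measure_cong) auto
    also have "\<dots> = UNIV" by (subst pair_measure_countable) auto
    finally show ?thesis .
  qed
  have m: "f \<in> borel_measurable (?B \<Otimes>\<^sub>M ?D)" for f :: "nat \<times> nat \<Rightarrow> ennreal"
    by (rule measurableI) (auto simp: sBD)
  have m3: "f \<in> borel_measurable (?A \<Otimes>\<^sub>M ?B \<Otimes>\<^sub>M ?D)" for f :: "nat \<times> nat \<times> nat \<Rightarrow> ennreal"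
    using pois3_measurable[of f borel a b d] by (simp add: pois3_def)
  have "(\<integral>\<^sup>+x. ennreal (snd x) \<partial>cp_law \<kappa> a b d) = (\<integral>\<^sup>+x. ennreal (snd (pmap \<kappa> x)) \<partial>pois3 a b d)"
    unfolding cp_law_def by (subst nn_integral_distr) (auto intro!: pois3_measurable measurable_compose[OF fs])
  also have "\<dots> = (\<integral>\<^sup>+i. \<integral>\<^sup>+jk. ennreal (real (fst jk) + \<kappa> * real (snd jk)) \<partial>(?B \<Otimes>\<^sub>M ?D) \<partial>?A)"
    unfolding pois3_def by (subst sigma_finite_measure.nn_integral_fst[OF sf m3, symmetric]) (simp add: pmap_def)
  also have "\<dots> = (\<integral>\<^sup>+jk. ennreal (real (fst jk) + \<kappa> * real (snd jk)) \<partial>(?B \<Otimes>\<^sub>M ?D))"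
    by (simp add: measure_pmf.emeasure_space_1)
  also have "\<dots> = (\<integral>\<^sup>+j. \<integral>\<^sup>+k. ennreal (real j + \<kappa> * real k) \<partial>?D \<partial>?B)"
    by (subst sigma_finite_measure.nn_integral_fst[OF prob_space_imp_sigma_finite[OF prob_space_measure_pmf] m, symmetric]) simp
  also have "\<dots> = (\<integral>\<^sup>+j. ennreal (real j) + ennreal \<kappa> * (\<integral>\<^sup>+k. ennreal (real k) \<partial>?D) \<partial>?B)"
    using assms by (simp add: ennreal_plus ennreal_mult nn_integral_add nn_integral_cmult measure_pmf.emeasure_space_1)
  also have "\<dots> = (\<integral>\<^sup>+j. ennreal (real j) \<partial>?B) + ennreal \<kappa> * (\<integral>\<^sup>+k. ennreal (real k) \<partial>?D)"
    by (simp add: nn_integral_add measure_pmf.emeasure_space_1)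
  also have "\<dots> < \<infinity>"
    using pois_mean_finite[OF assms(2)] pois_mean_finite[OF assms(3)] by (simp add: ennreal_mult_less_top)
  finally show ?thesis .
qed

text \<open>If the expectation were 1, N would vanish almost surely at time 1, which its
  characteristic function excludes.\<close>

lemma cp_process_discount:
  assumes X: "cp_process M X \<kappa> u v w" and uvw: "0 \<le> u" "0 \<le> v" "0 \<le> w" "0 < u + w" and c: "c > 1" and \<kappa>: "0 \<le> \<kappa>"
  shows "(\<integral>\<^sup>+\<omega>. ennreal (c powr (- fst (X 1 \<omega>))) \<partial>M) < 1"
proof -
  interpret prob_space M using cp_processD(2)[OF X] .
  have [measurable]: "X 1 \<in> borel_measurable M" using cp_processD(3)[OF X] by simp
  have fs: "fst \<in> borel_measurable (borel :: (real \<times> real) measure)"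
    by (intro borel_measurable_continuous_onI continuous_intros)
  have [measurable]: "(\<lambda>\<omega>. fst (X 1 \<omega>)) \<in> borel_measurable M" by (rule measurable_compose[OF _ fs]) simp
  have N0: "AE \<omega> in M. 0 \<le> fst (X 1 \<omega>)"
    using cp_processD(5)[OF X]
    by eventually_elim (use cp_path_mono(1)[OF _ \<kappa>, of _ 0 1] in \<open>force simp: cp_path_def\<close>)
  have le: "AE \<omega> in M. c powr (- fst (X 1 \<omega>)) \<le> 1"
    using N0 by eventually_elim (use powr_mono[of "- fst (X 1 _)" 0 c] c in simp)
  have i: "integrable M (\<lambda>\<omega>. c powr (- fst (X 1 \<omega>)))"
    using le by (intro integrable_const_bound[of _ 1]) auto
  have "expectation (\<lambda>\<omega>. c powr (- fst (X 1 \<omega>))) < 1"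
  proof (rule ccontr)
    assume "\<not> ?thesis"
    then have "expectation (\<lambda>\<omega>. 1 - c powr (- fst (X 1 \<omega>))) \<le> 0"
      using i by (simp add: prob_space)
    moreover have "0 \<le> expectation (\<lambda>\<omega>. 1 - c powr (- fst (X 1 \<omega>)))"
      using le by (intro integral_nonneg_AE) auto
    ultimately have "AE \<omega> in M. 1 - c powr (- fst (X 1 \<omega>)) = 0"
      using i le by (subst integral_nonneg_eq_0_iff_AE[symmetric]) auto
    then have z: "AE \<omega> in M. fst (X 1 \<omega>) = 0"
      by eventually_elim (use c in \<open>simp add: powr_eq_one_iff_gen\<close>)
    \<comment> \<open>At the argument (pi, 0) the two atoms with first coordinate 1 contribute e^(i
      pi) - 1 = -2 each and the atom (0,1) nothing, so the value is e^(-2(u+w)), which is below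
      1.\<close>
    have "(CLINT x|cp_law \<kappa> (1 * u) (1 * v) (1 * w). iexp ((pi, 0) \<bullet> x)) = (CLINT \<omega>|M. iexp ((pi, 0) \<bullet> X 1 \<omega>))"
      unfolding cp_processD(4)[OF X zero_le_one, symmetric] by (subst integral_distr) auto
    also have "\<dots> = (CLINT \<omega>|M. 1)"
      by (rule integral_cong_AE, simp, simp) (use z in \<open>eventually_elim, simp add: inner_prod_def\<close>)
    finally have "exp (complex_of_real (u * (-2) + w * (-2))) = 1"
      using uvw by (subst (asm) cp_law_char) (simp_all add: prob_space)
    then have "exp (u * (-2) + w * (-2)) = (1::real)"
      by (metis exp_of_real of_real_eq_1_iff)
    then show False using uvw by simp
  qed
  moreover have "(\<integral>\<^sup>+\<omega>. ennreal (c powr (- fst (X 1 \<omega>))) \<partial>M) = ennreal (expectation (\<lambda>\<omega>. c powr (- fst (X 1 \<omega>))))"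
    using i by (intro nn_integral_eq_integral) auto
  ultimately show ?thesis by (simp add: ennreal_less_one_iff)
qed

lemma jint_wI_mono:
  assumes x: "cp_path \<kappa> x" and \<kappa>: "0 \<le> \<kappa>"
  shows "mono (\<lambda>t. jint (wI c) t x)"
proof (rule monoI)
  fix s t :: real assume "s \<le> t"
  then show "jint (wI c) s x \<le> jint (wI c) t x"
    unfolding jint_def wI_def using cp_path_jumps[OF x] \<kappa> finite_jumps[OF step_path_snd[OF cp_path_step[OF x]]]
    by (intro sum_mono2) (auto simp: jumps_def zero_prod_def, force+)
qed

text \<open>N is nondecreasing, so on (n, n+1] the discount c^(-N(r-)) is at most c^(-N(n)).\<close>

lemma jint_wI_bound:
  assumes x: "cp_path \<kappa> x" and \<kappa>: "0 \<le> \<kappa>" and c: "c > 1"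
  shows "jint (wI c) (real n) x \<le> (\<Sum>i<n. c powr (- fst (x (real i))) * (snd (x (real (Suc i))) - snd (x (real i))))"
proof (induction n)
  case 0
  show ?case by (simp add: jint_def jumps_def)
next
  case (Suc n)
  let ?L = "\<lambda>r. snd (x r)" and ?N = "\<lambda>r. fst (x r)"
  let ?J = "jumps ?L (real n) (real (Suc n))"
  note xs = cp_path_step[OF x]
  have "jumps ?L 0 (real (Suc n)) = jumps ?L 0 (real n) \<union> ?J" "jumps ?L 0 (real n) \<inter> ?J = {}"
    by (auto simp: jumps_def)
  then have "jint (wI c) (real (Suc n)) x = jint (wI c) (real n) x + (\<Sum>r\<in>?J. c powr (- Lim (at_left r) ?N) * jump ?L r)"
    using finite_jumps[OF step_path_snd[OF xs]] by (simp add: jint_def wI_def sum.union_disjoint)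
  also have "(\<Sum>r\<in>?J. c powr (- Lim (at_left r) ?N) * jump ?L r) \<le> (\<Sum>r\<in>?J. c powr (- ?N (real n)) * jump ?L r)"
  proof (intro sum_mono mult_right_mono)
    fix r assume "r \<in> ?J"
    then have r: "real n < r" by (auto simp: jumps_def)
    then have r0: "0 < r" by (meson of_nat_0_le_iff order_le_less_trans)
    show "0 \<le> jump ?L r" using cp_path_jumps[OF x r0] \<kappa> by (auto simp: zero_prod_def)
    obtain a where a: "a < r" "\<And>s. a < s \<Longrightarrow> s < r \<Longrightarrow> ?N s = Lim (at_left r) ?N"
      using step_path_left[OF step_path_fst[OF xs] r0] unfolding eventually_at_left_field by auto
    obtain s where s: "max a (real n) < s" "s < r" using dense[of "max a (real n)" r] a r by auto
    then have "?N (real n) \<le> Lim (at_left r) ?N"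
      using cp_path_mono(1)[OF x \<kappa>, of "real n" s] a(2)[of s] by auto
    then show "c powr (- Lim (at_left r) ?N) \<le> c powr (- ?N (real n))" using c by (intro powr_mono) auto
  qed
  also have "(\<Sum>r\<in>?J. c powr (- ?N (real n)) * jump ?L r) = c powr (- ?N (real n)) * (?L (real (Suc n)) - ?L (real n))"
    by (subst step_path_diff_eq_sum_jumps[OF step_path_snd[OF xs]]) (auto simp: sum_distrib_left)
  finally show ?case using Suc by simp
qed

text \<open>The integral is nondecreasing in t and bounded at integer times by an almost surely
  convergent series, so the limit along integers is the limit along all times. Writing it as a
  \<open>lim\<close> of \<open>pint\<close> makes it a measurable variable.\<close>

lemma improper_converges:
  assumes X: "cp_process M X \<kappa> u v w" and uvw: "0 \<le> u" "0 \<le> v" "0 \<le> w" "0 < u + w" and c: "c > 1" and \<kappa>: "0 \<le> \<kappa>"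
  shows "AE \<omega> in M. ((\<lambda>t. jint (wI c) t (incr X 0 \<omega>)) \<longlongrightarrow> lim (\<lambda>n. pint (wI c) (real n) (incr X 0 \<omega>))) at_top"
proof -
  note iX = cp_processD(1)[OF X]
  interpret prob_space M using cp_processD(2)[OF X] .
  have fs: "fst \<in> borel_measurable (borel :: (real \<times> real) measure)" "snd \<in> borel_measurable (borel :: (real \<times> real) measure)"
    by (intro borel_measurable_continuous_onI continuous_intros)+
  define D where "D i \<omega> = X (real (Suc i)) \<omega> - X (real i) \<omega>" for i \<omega>
  have [measurable]: "D i \<in> borel_measurable M" for i
    unfolding D_def[abs_def] using cp_processD(3)[OF X] by (intro borel_measurable_diff) auto
  define \<theta> where "\<theta> = (\<integral>\<^sup>+\<omega>. ennreal (c powr (- fst (X 1 \<omega>))) \<partial>M)"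
  define m where "m = (\<integral>\<^sup>+\<omega>. ennreal (snd (X 1 \<omega>)) \<partial>M)"
  have X1: "X 1 \<in> borel_measurable M" using cp_processD(3)[OF X] by simp
  have \<theta>: "\<theta> < 1" unfolding \<theta>_def by (rule cp_process_discount[OF X uvw c \<kappa>])
  have m: "m < \<infinity>"
  proof -
    have "m = (\<integral>\<^sup>+x. ennreal (snd x) \<partial>distr M borel (X 1))"
      unfolding m_def using X1 fs by (subst nn_integral_distr) auto
    then show ?thesis
      using cp_processD(4)[OF X, of 1] cp_law_mean_finite[of "1 * u" "1 * v" "1 * w" \<kappa>] uvw \<kappa> by simp
  qed
  have Dl: "(\<integral>\<^sup>+\<omega>. f (D i \<omega>) \<partial>M) = (\<integral>\<^sup>+\<omega>. f (X 1 \<omega>) \<partial>M)" if [measurable]: "f \<in> borel_measurable borel" for i f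
  proof -
    have "(\<integral>\<^sup>+\<omega>. f (D i \<omega>) \<partial>M) = (\<integral>\<^sup>+x. f x \<partial>distr M borel (D i))" by (subst nn_integral_distr) auto
    also have "distr M borel (D i) = distr M borel (X 1)"
      unfolding D_def[abs_def] using incr_processD(5)[OF iX, of "real i" "real (Suc i)"] by simp
    also have "(\<integral>\<^sup>+x. f x \<partial>distr M borel (X 1)) = (\<integral>\<^sup>+\<omega>. f (X 1 \<omega>) \<partial>M)"
      using X1 by (subst nn_integral_distr) auto
    finally show ?thesis .
  qed
  \<comment> \<open>The series of unit-interval bounds. Subtracting X(0), which vanishes only almost
    surely, makes the exponent an exact telescoping sum of increments.\<close>
  define T where "T i \<omega> = ennreal (c powr (- (fst (X (real i) \<omega>) - fst (X 0 \<omega>))) * snd (D i \<omega>))" for i \<omega>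
  have T: "(\<integral>\<^sup>+\<omega>. T i \<omega> \<partial>M) = \<theta> ^ i * m" for i
  proof -
    \<comment> \<open>The i-th term factors into \<open>i\<close> discount factors of mean
      \<open>\<theta>\<close> < 1 and one L-increment of mean \<open>m\<close>, all
      independent.\<close>
    define F where "F j = (\<lambda>d :: real \<times> real. if j < i then ennreal (c powr (- fst d)) else ennreal (snd d))" for j
    have F: "F j \<in> borel_measurable borel" for j
      unfolding F_def using fs by (cases "j < i") auto
    have ind: "indep_vars (\<lambda>_. borel) D {..<Suc i}"
      unfolding D_def using incr_process_indep[OF iX, of real "Suc i"] by simp
    have "T i \<omega> = (\<Prod>j<Suc i. F j (D j \<omega>))" for \<omega>
    proof -
      have "(\<Prod>j<Suc i. F j (D j \<omega>)) = (\<Prod>j<i. ennreal (c powr (- fst (D j \<omega>)))) * ennreal (snd (D i \<omega>))"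
        by (simp add: F_def)
      also have "(\<Prod>j<i. ennreal (c powr (- fst (D j \<omega>)))) = ennreal (\<Prod>j<i. c powr (- fst (D j \<omega>)))"
        by (rule prod_ennreal) simp
      also have "(\<Prod>j<i. c powr (- fst (D j \<omega>))) = c powr (\<Sum>j<i. - fst (D j \<omega>))"
        using c by (simp add: powr_sum)
      also have "(\<Sum>j<i. - fst (D j \<omega>)) = - (fst (X (real i) \<omega>) - fst (X 0 \<omega>))"
        using sum_lessThan_telescope[of "\<lambda>j. fst (X (real j) \<omega>)" i] by (simp add: D_def sum_negf sum_subtractf)
      finally show ?thesis by (simp add: T_def ennreal_mult')
    qed
    then have "(\<integral>\<^sup>+\<omega>. T i \<omega> \<partial>M) = (\<integral>\<^sup>+\<omega>. (\<Prod>j<Suc i. F j (D j \<omega>)) \<partial>M)" by simp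
    also have "\<dots> = (\<Prod>j<Suc i. \<integral>\<^sup>+\<omega>. F j (D j \<omega>) \<partial>M)"
      using indep_vars_compose2[OF ind F] by (intro indep_vars_nn_integral) auto
    also have "\<dots> = (\<Prod>j<Suc i. \<integral>\<^sup>+\<omega>. F j (X 1 \<omega>) \<partial>M)" using Dl[OF F] by simp
    also have "\<dots> = (\<Prod>j<i. \<theta>) * m" by (simp add: F_def \<theta>_def m_def)
    finally show ?thesis by simp
  qed
  have Tm: "T i \<in> borel_measurable M" for i
    unfolding T_def[abs_def]
    using measurable_compose[OF cp_processD(3)[OF X] fs(1)] measurable_compose[OF _ fs(2), of "D i" M]
    by (intro measurable_compose[OF _ measurable_ennreal] borel_measurable_times powr_real_measurable borel_measurable_uminus borel_measurable_diff) auto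
  have "(\<integral>\<^sup>+\<omega>. (\<Sum>i. T i \<omega>) \<partial>M) = (\<Sum>i. \<theta> ^ i * m)"
    using Tm by (subst nn_integral_suminf) (auto simp: T)
  also have "\<dots> < \<infinity>"
  proof -
    obtain q where q: "0 \<le> q" "\<theta> = ennreal q" using \<theta> by (cases \<theta>) auto
    have q1: "q < 1" using \<theta> q by (simp add: ennreal_less_one_iff)
    have "(\<Sum>i. \<theta> ^ i * m) = (\<Sum>i. \<theta> ^ i) * m" by simp
    also have "(\<Sum>i. \<theta> ^ i) = (\<Sum>i. ennreal (q ^ i))"
    proof -
      have "\<theta> ^ i = ennreal (q ^ i)" for i using q by (simp add: ennreal_power)
      then show ?thesis by simp
    qed
    also have "\<dots> = ennreal (\<Sum>i. q ^ i)"
      using q q1 by (intro suminf_ennreal2) (auto simp: summable_geometric)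
    finally show ?thesis using m by (simp add: ennreal_mult_less_top)
  qed
  finally have "AE \<omega> in M. (\<Sum>i. T i \<omega>) \<noteq> \<infinity>"
    using Tm by (intro nn_integral_noteq_infinite) auto
  with cp_process_incr0[OF X] show ?thesis
  proof eventually_elim
    case (elim \<omega>)
    let ?x = "incr X 0 \<omega>"
    have x: "cp_path \<kappa> ?x" and xX: "\<And>t. 0 \<le> t \<Longrightarrow> ?x t = X t \<omega>" and X0: "X 0 \<omega> = 0"
      using elim by (auto simp: cp_path_def)
    let ?a = "\<lambda>i. c powr (- fst (?x (real i))) * (snd (?x (real (Suc i))) - snd (?x (real i)))"
    have a0: "0 \<le> ?a i" for i using cp_path_mono(2)[OF x \<kappa>, of "real i" "real (Suc i)"] by simp
    have Ta: "T i \<omega> = ennreal (?a i)" for i using X0 by (simp add: T_def D_def xX)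
    have sum: "summable ?a" using elim(2) a0 unfolding Ta by (intro summable_suminf_not_top) auto
    have b: "jint (wI c) (real n) ?x \<le> (\<Sum>i. ?a i)" for n
      using jint_wI_bound[OF x \<kappa> c, of n] sum_le_suminf[OF sum, of "{..<n}"] a0 by (auto intro: order_trans)
    have mo: "mono (\<lambda>t. jint (wI c) t ?x)" by (rule jint_wI_mono[OF x \<kappa>])
    have inc: "incseq (\<lambda>n. jint (wI c) (real n) ?x)" using monoD[OF mo] by (auto simp: incseq_def)
    have "\<forall>n. jint (wI c) (real n) ?x \<le> (\<Sum>i. ?a i)" using b by (intro allI)
    from incseq_convergent[OF inc this] obtain l where l: "(\<lambda>n. jint (wI c) (real n) ?x) \<longlonglongrightarrow> l" .
    have "lim (\<lambda>n. pint (wI c) (real n) ?x) = l"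
      using l by (simp add: pint_eq_jint[OF cp_path_step[OF x]] limI)
    moreover have "((\<lambda>t. jint (wI c) t ?x) \<longlongrightarrow> l) at_top"
      using tendsto_at_topI_sequentially_real[OF mo l] .
    ultimately show ?case by simp
  qed
qed

section \<open>Functionals of increments\<close>

lemma (in prob_space) indep_vars_AE_cong:
  assumes ind: "indep_vars (\<lambda>_. borel) X {..<n::nat}"
    and Y: "\<And>i. i < n \<Longrightarrow> Y i \<in> borel_measurable M" and eq: "\<And>i. i < n \<Longrightarrow> AE \<omega> in M. X i \<omega> = Y i \<omega>"
  shows "indep_vars (\<lambda>_. borel) Y {..<n}"
proof (cases "n = 0")
  case True
  then show ?thesis by (simp add: indep_vars_def indep_sets_def)
next
  case False
  then have ne: "{..<n} \<noteq> {}" by auto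
  have X: "X i \<in> borel_measurable M" if "i \<in> {..<n}" for i using ind that by (auto simp: indep_vars_def)
  have Y': "Y i \<in> borel_measurable M" if "i \<in> {..<n}" for i using Y that by auto
  have ae: "AE \<omega> in M. \<forall>i\<in>{..<n}. X i \<omega> = Y i \<omega>" using eq by (subst AE_finite_all) auto
  have "distr M (PiM {..<n} (\<lambda>_. borel)) (\<lambda>\<omega>. \<lambda>i\<in>{..<n}. Y i \<omega>) = distr M (PiM {..<n} (\<lambda>_. borel)) (\<lambda>\<omega>. \<lambda>i\<in>{..<n}. X i \<omega>)"
  proof (rule distr_cong_AE)
    show "AE \<omega> in M. (\<lambda>i\<in>{..<n}. Y i \<omega>) = (\<lambda>i\<in>{..<n}. X i \<omega>)"
      using ae by eventually_elim auto
  qed (use X Y' in \<open>auto intro!: measurable_restrict\<close>)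
  also have "\<dots> = PiM {..<n} (\<lambda>i. distr M borel (X i))"
    using indep_vars_iff_distr_eq_PiM'[OF ne X] ind by auto
  also have "\<dots> = PiM {..<n} (\<lambda>i. distr M borel (Y i))"
    using X Y' eq by (intro PiM_cong refl distr_cong_AE) auto
  finally show ?thesis using indep_vars_iff_distr_eq_PiM'[OF ne Y'] by auto
qed

lemma (in prob_space) indep_vars_Suc:
  assumes ind: "indep_vars (\<lambda>_. borel) Y {..<n::nat}" and Yn: "Y n \<in> borel_measurable M"
    and new: "\<And>C B. C \<in> sets (PiM {..<n} (\<lambda>_. borel)) \<Longrightarrow> B \<in> sets borel \<Longrightarrow>
      prob (((\<lambda>\<omega>. \<lambda>i\<in>{..<n}. Y i \<omega>) -` C \<inter> space M) \<inter> (Y n -` B \<inter> space M)) =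
      prob ((\<lambda>\<omega>. \<lambda>i\<in>{..<n}. Y i \<omega>) -` C \<inter> space M) * prob (Y n -` B \<inter> space M)"
  shows "indep_vars (\<lambda>_. borel) Y {..<Suc n}"
proof -
  let ?F = "\<lambda>i. {Y i -` A \<inter> space M |A. A \<in> sets borel}"
  have rv: "\<And>i. i < n \<Longrightarrow> Y i \<in> borel_measurable M" and F: "indep_sets ?F {..<n}"
    using ind by (auto simp: indep_vars_def2)
  have "indep_sets ?F {..<Suc n}"
  proof (rule indep_setsI)
    show "?F i \<subseteq> events" if "i \<in> {..<Suc n}" for i
      using rv[of i] Yn that by (cases "i = n") (auto intro: measurable_sets)
    fix A J assume J: "J \<noteq> {}" "J \<subseteq> {..<Suc n}" "finite J" "\<forall>j\<in>J. A j \<in> ?F j"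
    show "prob (\<Inter>j\<in>J. A j) = (\<Prod>j\<in>J. prob (A j))"
    proof (cases "n \<in> J")
      case False
      then have "J \<subseteq> {..<n}" using J(2) by (auto simp: less_Suc_eq)
      then show ?thesis using indep_setsD[OF F _ J(1,3,4)] by blast
    next
      case True
      define K where "K = J - {n}"
      have K: "J = insert n K" "n \<notin> K" "finite K" "K \<subseteq> {..<n}" using J True by (auto simp: K_def less_Suc_eq)
      show ?thesis
      proof (cases "K = {}")
        case True
        then show ?thesis using K by simp
      next
        case False
        have pK: "prob (\<Inter>j\<in>K. A j) = (\<Prod>j\<in>K. prob (A j))"
          using J(4) K by (intro indep_setsD[OF F]) (auto simp: False)
        have "\<forall>j\<in>J. \<exists>C. C \<in> sets borel \<and> A j = Y j -` C \<inter> space M" using J(4) by auto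
        from bchoice[OF this] obtain B where
          B: "\<And>j. j \<in> J \<Longrightarrow> B j \<in> sets borel \<and> A j = Y j -` B j \<inter> space M" by metis
        define C where "C = {d \<in> space (PiM {..<n} (\<lambda>_. borel)). \<forall>j\<in>K. d j \<in> B j}"
        have C: "C \<in> sets (PiM {..<n} (\<lambda>_. borel))"
          unfolding C_def
        proof (rule sets.sets_Collect_finite_All[OF _ K(3)])
          fix j assume j: "j \<in> K"
          then have "(\<lambda>d. d j) \<in> PiM {..<n} (\<lambda>_. borel) \<rightarrow>\<^sub>M borel" using K by (intro measurable_component_singleton) auto
          from measurable_sets[OF this, of "B j"] B[of j] j K(1)
          show "{x \<in> space (PiM {..<n} (\<lambda>_. borel)). x j \<in> B j} \<in> sets (PiM {..<n} (\<lambda>_. borel))"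
            by (simp add: vimage_def Int_def conj_commute)
        qed
        have AK: "(\<lambda>\<omega>. \<lambda>i\<in>{..<n}. Y i \<omega>) -` C \<inter> space M = (\<Inter>j\<in>K. A j)"
        proof (intro equalityI subsetI)
          fix \<omega> assume w: "\<omega> \<in> (\<Inter>j\<in>K. A j)"
          have wj: "\<omega> \<in> Y j -` B j \<inter> space M" if "j \<in> K" for j
          proof -
            have "\<omega> \<in> A j" using w that by blast
            then show ?thesis using B[of j] that K(1) by auto
          qed
          obtain j where "j \<in> K" using False by blast
          then have "\<omega> \<in> space M" "\<And>j. j \<in> K \<Longrightarrow> Y j \<omega> \<in> B j" using wj by auto
          then show "\<omega> \<in> (\<lambda>\<omega>. \<lambda>i\<in>{..<n}. Y i \<omega>) -` C \<inter> space M"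
            using K(4) by (auto simp: C_def space_PiM subset_eq)
        next
          fix \<omega> assume w: "\<omega> \<in> (\<lambda>\<omega>. \<lambda>i\<in>{..<n}. Y i \<omega>) -` C \<inter> space M"
          show "\<omega> \<in> (\<Inter>j\<in>K. A j)"
          proof
            fix j assume j: "j \<in> K"
            then have "j \<in> {..<n}" "j \<in> J" using K by auto
            then show "\<omega> \<in> A j" using w j B[of j] by (auto simp: C_def)
          qed
        qed
        have An: "A n = Y n -` B n \<inter> space M" "B n \<in> sets borel" using B True by auto
        have "prob ((\<Inter>j\<in>K. A j) \<inter> A n) = prob (\<Inter>j\<in>K. A j) * prob (A n)"
          using new[OF C An(2)] unfolding AK[symmetric] An(1) .
        then show ?thesis using pK K by (simp add: Int_commute mult.commute)
      qed
    qed
  qed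
  then show ?thesis using rv Yn by (auto simp: indep_vars_def2 less_Suc_eq)
qed

text \<open>By induction: the functionals of the earlier blocks are functions of the past of
  \<open>\<tau> n\<close>, the functional of the last block is one of the increments after
  \<open>\<tau> n\<close>, and \<open>indep_past_incr\<close> separates the two.\<close>

lemma block_functionals_indep:
  fixes X :: "real \<Rightarrow> 'a \<Rightarrow> 'b::euclidean_space" and \<Phi> :: "real \<Rightarrow> (real \<Rightarrow> 'b) \<Rightarrow> 'c::euclidean_space"
  assumes X: "incr_process M X" and \<tau>: "0 \<le> \<tau> 0" "\<And>i. i < n \<Longrightarrow> \<tau> i \<le> \<tau> (Suc i)"
    and \<Phi>: "\<And>\<delta>. 0 \<le> \<delta> \<Longrightarrow> \<Phi> \<delta> \<in> borel_measurable path_space"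
    and loc: "\<And>\<delta> x y. 0 \<le> \<delta> \<Longrightarrow> (\<And>s. 0 \<le> s \<Longrightarrow> s \<le> \<delta> \<Longrightarrow> x s = y s) \<Longrightarrow> \<Phi> \<delta> x = \<Phi> \<delta> y"
  shows "prob_space.indep_vars M (\<lambda>_. borel) (\<lambda>i \<omega>. \<Phi> (\<tau> (Suc i) - \<tau> i) (incr X (\<tau> i) \<omega>)) {..<n::nat}"
  using \<tau>(2)
proof (induction n)
  interpret prob_space M using X by (rule incr_processD)
  case 0
  show ?case by (simp add: indep_vars_def indep_sets_def)
next
  interpret prob_space M using X by (rule incr_processD)
  case (Suc n)
  let ?Y = "\<lambda>i \<omega>. \<Phi> (\<tau> (Suc i) - \<tau> i) (incr X (\<tau> i) \<omega>)"
  have mono: "\<tau> i \<le> \<tau> j" if "i \<le> j" "j \<le> Suc n" for i j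
    using partition_mono[of "Suc n" \<tau> i j] Suc.prems that by auto
  have pos: "0 \<le> \<tau> i" if "i \<le> Suc n" for i using mono[of 0 i] \<tau>(1) that by simp
  have gap: "0 \<le> \<tau> (Suc i) - \<tau> i" if "i \<le> n" for i using Suc.prems[of i] that by simp
  have Ym: "?Y i \<in> borel_measurable M" if "i \<le> n" for i
    using measurable_compose[OF incr_processD(3)[OF X pos] \<Phi>[OF gap[OF that]]] that by simp
  define sh where "sh i y = (\<lambda>q\<in>{0..}. y (\<tau> i + q) - y (\<tau> i))" for i and y :: "real \<Rightarrow> 'b"
  have sh: "sh i \<in> path_space \<rightarrow>\<^sub>M path_space" if "i \<le> n" for i
    unfolding sh_def[abs_def]
    using pos[of i] that by (intro measurable_restrict borel_measurable_diff measurable_component_singleton) auto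
  define G where "G y = (\<lambda>i\<in>{..<n}. \<Phi> (\<tau> (Suc i) - \<tau> i) (sh i y))" for y
  have G: "G \<in> path_space \<rightarrow>\<^sub>M PiM {..<n} (\<lambda>_. borel)"
    unfolding G_def[abs_def]
  proof (intro measurable_restrict)
    fix i assume "i \<in> {..<n}"
    then have "i \<le> n" by simp
    from measurable_compose[OF sh[OF this] \<Phi>[OF gap[OF this]]]
    show "(\<lambda>y. \<Phi> (\<tau> (Suc i) - \<tau> i) (sh i y)) \<in> borel_measurable path_space" .
  qed
  \<comment> \<open>Locality is essential here: the stopped path agrees with \<open>X\<close> only
    up to \<open>\<tau> n\<close>, which is as far as the functionals of the earlier blocks
    look.\<close>
  have GY: "G (past X (\<tau> n) \<omega>) = (\<lambda>i\<in>{..<n}. ?Y i \<omega>)" for \<omega>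
    unfolding G_def
  proof (intro restrict_ext loc)
    fix i s assume i: "i \<in> {..<n}" and s: "0 \<le> s" "s \<le> \<tau> (Suc i) - \<tau> i"
    have "\<tau> i + s \<le> \<tau> n" "\<tau> i \<le> \<tau> n" using mono[of "Suc i" n] mono[of i n] i s by auto
    then show "sh i (past X (\<tau> n) \<omega>) s = incr X (\<tau> i) \<omega> s"
      using s i pos[of i] by (simp add: sh_def past_def incr_def min_absorb1)
  qed (use gap in auto)
  have iv: "indep_var path_space (past X (\<tau> n)) path_space (incr X (\<tau> n))"
    using indep_past_incr[OF X pos[of n]] by simp
  show ?case
  proof (rule indep_vars_Suc)
    show "indep_vars (\<lambda>_. borel) ?Y {..<n}" using Suc by simp
    show "?Y n \<in> borel_measurable M" using Ym[of n] by simp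
    fix C :: "(nat \<Rightarrow> 'c) set" and B :: "'c set"
    assume C: "C \<in> sets (PiM {..<n} (\<lambda>_. borel))" and B: "B \<in> sets borel"
    have sp: "past X (\<tau> n) \<omega> \<in> space path_space" "incr X (\<tau> n) \<omega> \<in> space path_space" for \<omega>
      by (auto simp: past_def incr_def space_PiM)
    from indep_varD[OF iv measurable_sets[OF G C] measurable_sets[OF \<Phi>[OF gap[OF order_refl]] B]]
    show "prob (((\<lambda>\<omega>. \<lambda>i\<in>{..<n}. ?Y i \<omega>) -` C \<inter> space M) \<inter> (?Y n -` B \<inter> space M)) =
      prob ((\<lambda>\<omega>. \<lambda>i\<in>{..<n}. ?Y i \<omega>) -` C \<inter> space M) * prob (?Y n -` B \<inter> space M)"
      by (simp add: vimage_def Int_def conj_ac GY sp del: restrict_apply)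
  qed
qed

section \<open>Rescaling the jumps\<close>

text \<open>The measurable twin of \<open>transf\<close>, with \<open>pint\<close> in place of
  \<open>jint\<close>.\<close>

definition transf_fun :: "real \<Rightarrow> real \<Rightarrow> (real \<Rightarrow> real \<times> real) \<Rightarrow> real \<times> real" where
  "transf_fun c t x = (fst (x t), pint (wT c) t x)"

lemma transf_fun_measurable: "0 \<le> t \<Longrightarrow> transf_fun c t \<in> borel_measurable path_space"
  unfolding transf_fun_def[abs_def]
  using measurable_compose[OF path_component_measurable[where ?'b = "real \<times> real"] borel_measurable_continuous_onI[OF continuous_on_fst[OF continuous_on_id]]]
  by (intro borel_measurable_Pair functional_measurable) auto

lemma transf_fun_local:
  assumes "0 \<le> t" "\<And>s. 0 \<le> s \<Longrightarrow> s \<le> t \<Longrightarrow> x s = y s"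
  shows "transf_fun c t x = transf_fun c t y"
  using pint_cong[OF assms(2,1)] assms by (simp add: transf_fun_def)

lemma transf_fun_eq: "step_path x \<Longrightarrow> 0 \<le> t \<Longrightarrow> transf_fun c t x = transf c x t"
  by (simp add: transf_fun_def transf_def pint_eq_jint)

text \<open>Rescaling treats each jump by itself, so it commutes with restarting at
  \<open>h\<close>. Increments of the rescaled process are thereby functionals of increments of the
  original one.\<close>

lemma transf_shift:
  assumes x: "step_path x" and h: "0 \<le> h" and t: "0 \<le> t" and c: "c > 0"
  shows "transf c x (h + t) - transf c x h = transf c (\<lambda>q. x (h + q) - x h) t"
proof -
  let ?y = "\<lambda>q. x (h + q) - x h"
  have y: "step_path ?y" using step_path_comp[OF step_path_shift[OF x h], of "\<lambda>a. a - x h"] by simp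
  have y0: "transf c ?y 0 = 0" by (simp add: transf_def jint_def jumps_def zero_prod_def)
  have sx: "step_path (\<lambda>q. snd (transf c x (h + q)))"
    by (intro step_path_shift h step_path_snd transf_step_path x)
  have "snd (transf c x (h + t)) - snd (transf c x h) = snd (transf c ?y t)"
  proof (rule step_path_eqI[OF step_path_comp2[OF sx step_path_const, of "(-)"] step_path_snd[OF transf_step_path[OF y]] t])
    fix r :: real assume r: "0 < r"
    have "jump (\<lambda>q. snd (transf c x (h + q)) - snd (transf c x h)) r = jump (\<lambda>t. snd (transf c x t)) (h + r)"
      by (rule jump_shift[OF step_path_snd[OF transf_step_path[OF x]] h r])
    also have "\<dots> = c powr (- jump (\<lambda>r. fst (x r)) (h + r)) * jump (\<lambda>r. snd (x r)) (h + r)"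
      using transf_jump_snd[OF x, of "h + r"] h r by simp
    also have "\<dots> = jump (\<lambda>t. snd (transf c ?y t)) r"
      unfolding transf_jump_snd[OF y r] fst_diff snd_diff
      using jump_shift[OF step_path_fst[OF x] h r] jump_shift[OF step_path_snd[OF x] h r] by simp
    finally show "jump (\<lambda>q. snd (transf c x (h + q)) - snd (transf c x h)) r = jump (\<lambda>t. snd (transf c ?y t)) r" .
  qed (use y0 in auto)
  then show ?thesis by (simp add: transf_def prod_eq_iff)
qed

section \<open>The rescaled process is compound Poisson\<close>

context
  fixes M :: "'a measure" and X :: "real \<Rightarrow> 'a \<Rightarrow> real \<times> real" and c \<kappa> u v w :: real
  assumes X: "cp_process M X (c * \<kappa>) u v w" and uvw: "0 \<le> u" "0 \<le> v" "0 \<le> w" and c: "c > 1"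
begin

interpretation prob_space M using cp_processD(2)[OF X] .

definition transf_process :: "real \<Rightarrow> 'a \<Rightarrow> real \<times> real" where
  "transf_process t \<omega> = transf_fun c t (incr X 0 \<omega>)"

lemma transf_process_measurable: "0 \<le> t \<Longrightarrow> transf_process t \<in> borel_measurable M"
  unfolding transf_process_def[abs_def]
  using measurable_compose[OF cp_processD(1)[OF X, THEN incr_processD(3)] transf_fun_measurable] by simp

lemma transf_process_AE: "AE \<omega> in M. cp_path (c * \<kappa>) (\<lambda>t. X t \<omega>) \<and> (\<forall>t\<ge>0. transf_process t \<omega> = transf c (\<lambda>t. X t \<omega>) t)"
  using cp_process_incr0[OF X]
proof eventually_elim
  case (elim \<omega>)
  then have "transf_fun c t (incr X 0 \<omega>) = transf c (\<lambda>t. X t \<omega>) t" if "0 \<le> t" for t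
    using transf_fun_eq[of "\<lambda>t. X t \<omega>" t c] transf_fun_local[of t "incr X 0 \<omega>" "\<lambda>t. X t \<omega>" c] cp_path_step that by auto
  then show ?case using elim by (auto simp: transf_process_def)
qed

lemma transf_process_cp_path: "AE \<omega> in M. cp_path \<kappa> (\<lambda>t. transf_process t \<omega>)"
  using transf_process_AE
  by eventually_elim (rule cp_path_cong[OF _ transf_cp_path], use c in auto)

lemma transf_process_increment:
  assumes h: "0 \<le> h" and t: "h \<le> t"
  shows "AE \<omega> in M. transf_process t \<omega> - transf_process h \<omega> = transf_fun c (t - h) (incr X h \<omega>)"
  using transf_process_AE
proof eventually_elim
  case (elim \<omega>)
  have sp: "step_path (\<lambda>t. X t \<omega>)" using elim cp_path_step by blast
  have "transf_process t \<omega> - transf_process h \<omega> = transf c (\<lambda>q. X (h + q) \<omega> - X h \<omega>) (t - h)"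
    using elim transf_shift[OF sp h, of "t - h" c] h t c by simp
  also have "\<dots> = transf_fun c (t - h) (\<lambda>q. X (h + q) \<omega> - X h \<omega>)"
    using t step_path_comp[OF step_path_shift[OF sp h], of "\<lambda>a. a - X h \<omega>"] by (intro transf_fun_eq[symmetric]) auto
  also have "\<dots> = transf_fun c (t - h) (incr X h \<omega>)"
    using t by (intro transf_fun_local) (auto simp: incr_def)
  finally show ?case .
qed

lemma transf_process_incr_process: "incr_process M transf_process"
  unfolding incr_process_def
proof (intro conjI allI impI)
  note iX = cp_processD(1)[OF X]
  show "prob_space M" by (rule prob_space_axioms)
  show "transf_process t \<in> borel_measurable M" if "0 \<le> t" for t using transf_process_measurable[OF that] .
  fix n :: nat and \<tau> :: "nat \<Rightarrow> real" assume \<tau>: "0 \<le> \<tau> 0 \<and> (\<forall>i<n. \<tau> i \<le> \<tau> (Suc i))"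
  have pos: "0 \<le> \<tau> i" if "i \<le> n" for i using partition_mono[of n \<tau> 0 i] \<tau> that by auto
  show "indep_vars (\<lambda>_. borel) (\<lambda>i \<omega>. transf_process (\<tau> (Suc i)) \<omega> - transf_process (\<tau> i) \<omega>) {..<n}"
  proof (rule indep_vars_AE_cong)
    show "indep_vars (\<lambda>_. borel) (\<lambda>i \<omega>. transf_fun c (\<tau> (Suc i) - \<tau> i) (incr X (\<tau> i) \<omega>)) {..<n}"
      using \<tau> by (intro block_functionals_indep[OF iX] transf_fun_measurable transf_fun_local) auto
    show "AE \<omega> in M. transf_fun c (\<tau> (Suc i) - \<tau> i) (incr X (\<tau> i) \<omega>) = transf_process (\<tau> (Suc i)) \<omega> - transf_process (\<tau> i) \<omega>"
      if "i < n" for i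
      using transf_process_increment[of "\<tau> i" "\<tau> (Suc i)"] \<tau> pos[of i] that by (auto elim: eventually_mono)
    show "(\<lambda>\<omega>. transf_process (\<tau> (Suc i)) \<omega> - transf_process (\<tau> i) \<omega>) \<in> borel_measurable M" if "i < n" for i
      using pos that by (intro borel_measurable_diff transf_process_measurable) auto
  qed
next
  note iX = cp_processD(1)[OF X]
  fix s h :: real assume s: "0 \<le> s" and h: "0 \<le> h"
  have "distr M borel (\<lambda>\<omega>. transf_process (s + h) \<omega> - transf_process s \<omega>) = distr M borel (\<lambda>\<omega>. transf_fun c h (incr X s \<omega>))"
    using transf_process_increment[OF s, of "s + h"] s h
    by (intro distr_cong_AE refl borel_measurable_diff transf_process_measurable
        measurable_compose[OF incr_processD(3)[OF iX s] transf_fun_measurable]) auto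
  also have "\<dots> = distr (distr M path_space (incr X s)) borel (transf_fun c h)"
    using incr_processD(3)[OF iX s] transf_fun_measurable[OF h] by (subst distr_distr) (auto simp: comp_def)
  also have "distr M path_space (incr X s) = distr M path_space (incr X 0)"
    using s by (intro cp_process_law_incr[OF X X]) auto
  also have "distr (distr M path_space (incr X 0)) borel (transf_fun c h) = distr M borel (transf_process h)"
    unfolding transf_process_def[abs_def]
    using incr_processD(3)[OF iX order_refl] transf_fun_measurable[OF h] by (subst distr_distr) (auto simp: comp_def)
  finally show "distr M borel (\<lambda>\<omega>. transf_process (s + h) \<omega> - transf_process s \<omega>) = distr M borel (transf_process h)" .
qed

lemma norm_iexp_integral_le: "prob_space P \<Longrightarrow> norm (CLINT x|P. iexp (f x)) \<le> 1"
  by (intro order_trans[OF integral_norm_bound]) (simp add: prob_space.prob_space)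

definition cell_map :: "real \<times> real \<Rightarrow> real \<times> real" where
  "cell_map x = (fst x, c powr (- fst x) * snd x)"

lemma cell_map_measurable: "cell_map \<in> borel_measurable borel"
proof -
  have [measurable]: "fst \<in> borel_measurable (borel :: (real \<times> real) measure)" "snd \<in> borel_measurable (borel :: (real \<times> real) measure)"
    by (intro borel_measurable_continuous_onI continuous_intros)+
  show ?thesis unfolding cell_map_def[abs_def] by (intro borel_measurable_Pair) measurable
qed

text \<open>On a cell with at most one jump \<open>cell_map\<close> acts exactly like the rescaling of jumps.\<close>

lemma cell_char_bound:
  assumes "0 \<le> a" "0 \<le> b" "0 \<le> d"
  shows "norm ((CLINT x|cp_law (c * \<kappa>) a b d. iexp (z \<bullet> cell_map x)) - (CLINT x|cp_law \<kappa> a b d. iexp (z \<bullet> x))) \<le> 2 * (a + b + d)\<^sup>2"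
proof -
  interpret P: prob_space "pois3 a b d" by (rule prob_space_pois3)
  let ?T = "{x. \<not> fst x + fst (snd x) + snd (snd x) \<le> (1::nat)}"
  have m: "f \<in> borel_measurable (pois3 a b d)" for f :: "_ \<Rightarrow> 'z::topological_space"
    by (rule pois3_measurable) simp
  note [measurable] = cell_map_measurable
  have i1: "(CLINT x|cp_law (c * \<kappa>) a b d. iexp (z \<bullet> cell_map x)) = (CLINT x|pois3 a b d. iexp (z \<bullet> cell_map (pmap (c * \<kappa>) x)))"
    unfolding cp_law_def by (subst integral_distr) (auto intro: m)
  have i2: "(CLINT x|cp_law \<kappa> a b d. iexp (z \<bullet> x)) = (CLINT x|pois3 a b d. iexp (z \<bullet> pmap \<kappa> x))"
    unfolding cp_law_def by (subst integral_distr) (auto intro: m)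
  have ii: "integrable (pois3 a b d) (\<lambda>x. iexp (f x))" for f
    by (intro P.integrable_const_bound[of _ 1] m) auto
  have "norm ((CLINT x|cp_law (c * \<kappa>) a b d. iexp (z \<bullet> cell_map x)) - (CLINT x|cp_law \<kappa> a b d. iexp (z \<bullet> x)))
      = norm (CLINT x|pois3 a b d. iexp (z \<bullet> cell_map (pmap (c * \<kappa>) x)) - iexp (z \<bullet> pmap \<kappa> x))"
    unfolding i1 i2 by (subst Bochner_Integration.integral_diff[OF ii ii]) simp
  also have "\<dots> \<le> (\<integral>x. norm (iexp (z \<bullet> cell_map (pmap (c * \<kappa>) x)) - iexp (z \<bullet> pmap \<kappa> x)) \<partial>pois3 a b d)"
    by (rule integral_norm_bound)
  also have "\<dots> \<le> (\<integral>x. 2 * indicator ?T x \<partial>pois3 a b d)"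
  proof (rule integral_mono)
    fix x :: "nat \<times> nat \<times> nat"
    obtain i j k where x: "x = (i, j, k)" by (cases x)
    show "norm (iexp (z \<bullet> cell_map (pmap (c * \<kappa>) x)) - iexp (z \<bullet> pmap \<kappa> x)) \<le> 2 * indicator ?T x"
    proof (cases "i + j + k \<le> 1")
      case True
      then consider "i = 0" "j = 0" "k = 0" | "i = 1" "j = 0" "k = 0" | "i = 0" "j = 1" "k = 0" | "i = 0" "j = 0" "k = 1"
        by linarith
      then have "cell_map (pmap (c * \<kappa>) x) = pmap \<kappa> x"
        using c by cases (auto simp: x pmap_def cell_map_def powr_minus)
      then show ?thesis by simp
    next
      case False
      then show ?thesis
        by (intro order_trans[OF norm_triangle_ineq4]) (simp add: x)
    qed
  next
    have "norm (iexp (z \<bullet> cell_map (pmap (c * \<kappa>) x)) - iexp (z \<bullet> pmap \<kappa> x)) \<le> 2" for x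
      by (intro order_trans[OF norm_triangle_ineq4]) simp
    then show "integrable (pois3 a b d) (\<lambda>x. norm (iexp (z \<bullet> cell_map (pmap (c * \<kappa>) x)) - iexp (z \<bullet> pmap \<kappa> x)))"
      by (intro P.integrable_const_bound[of _ 2] m AE_I2) simp
    show "integrable (pois3 a b d) (\<lambda>x. 2 * indicator ?T x :: real)"
      by (intro P.integrable_const_bound[of _ 2] m AE_I2) (simp add: indicator_def)
  qed
  also have "\<dots> = 2 * measure (pois3 a b d) ?T"
    by (simp add: pois3_all_sets)
  also have "\<dots> \<le> 2 * (a + b + d)\<^sup>2" using pois3_tail[OF assms] by simp
  finally show ?thesis .
qed

text \<open>Infinite divisibility: the exponent is linear in the time.\<close>

lemma cp_law_char_power:
  assumes "0 \<le> t"
  shows "(CLINT x|cp_law \<kappa> (t / real (Suc n) * u) (t / real (Suc n) * v) (t / real (Suc n) * w). iexp (z \<bullet> x)) ^ Suc n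
    = (CLINT x|cp_law \<kappa> (t * u) (t * v) (t * w). iexp (z \<bullet> x))"
proof -
  define s where "s = t / real (Suc n)"
  have s: "0 \<le> s" using assms by (simp add: s_def)
  have "real (Suc n) * s = t" by (simp add: s_def del: of_nat_Suc)
  then have e: "complex_of_nat (Suc n) * complex_of_real s = complex_of_real t"
    by (metis of_real_mult of_real_of_nat_eq)
  have a: "0 \<le> s * u" "0 \<le> s * v" "0 \<le> s * w" "0 \<le> t * u" "0 \<le> t * v" "0 \<le> t * w"
    using s assms uvw by auto
  show ?thesis
    unfolding s_def[symmetric] cp_law_char[OF a(1-3)] cp_law_char[OF a(4-6)] exp_of_nat_mult[symmetric]
    by (simp only: distrib_left mult.assoc[symmetric] of_real_mult e)
qed

text \<open>The partial sums for \<open>wT\<close> are sums of \<open>cell_map\<close> over i.i.d.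
  cell increments, so their characteristic function is a power of the one of a single cell.
  Comparing that cell with the target law, whose power is exact, leaves an error that
  vanishes.\<close>

lemma transf_process_law:
  assumes t: "0 \<le> t"
  shows "distr M borel (transf_process t) = cp_law \<kappa> (t * u) (t * v) (t * w)"
proof (rule char_eq_plane)
  note iX = cp_processD(1)[OF X]
  have tm: "transf_process t \<in> borel_measurable M" using transf_process_measurable[OF t] .
  show "prob_space (distr M borel (transf_process t))" using tm by (rule prob_space_distr)
  fix z :: "real \<times> real"
  define S where "S n \<omega> = (fst (incr X 0 \<omega> t), psum (wT c) t n (incr X 0 \<omega>))" for n \<omega>
  have Sm: "S n \<in> borel_measurable M" for n
    unfolding S_def[abs_def]
    using measurable_compose[OF incr_processD(3)[OF iX order_refl] path_component_measurable[OF t]]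
      measurable_compose[OF incr_processD(3)[OF iX order_refl] functional_measurable(3)[OF t, of c n]]
    by (intro borel_measurable_Pair measurable_compose[OF _ borel_measurable_continuous_onI[OF continuous_on_fst[OF continuous_on_id]]]) auto
  note [measurable] = Sm tm
  have "(\<lambda>n. CLINT \<omega>|M. iexp (z \<bullet> S n \<omega>)) \<longlonglongrightarrow> (CLINT \<omega>|M. iexp (z \<bullet> transf_process t \<omega>))"
  proof (rule integral_dominated_convergence[where w = "\<lambda>_. 1"])
    show "AE \<omega> in M. (\<lambda>n. iexp (z \<bullet> S n \<omega>)) \<longlonglongrightarrow> iexp (z \<bullet> transf_process t \<omega>)"
      using cp_process_incr[OF X order_refl]
    proof eventually_elim
      case (elim \<omega>)
      have "(\<lambda>n. psum (wT c) t n (incr X 0 \<omega>)) \<longlonglongrightarrow> pint (wT c) t (incr X 0 \<omega>)"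
        using psum_tendsto[OF cp_path_step[OF elim] t] pint_eq_jint[OF cp_path_step[OF elim] t] by simp
      then have "(\<lambda>n. S n \<omega>) \<longlonglongrightarrow> transf_process t \<omega>"
        unfolding S_def transf_process_def transf_fun_def by (intro tendsto_Pair tendsto_const)
      then show ?case by (intro tendsto_intros)
    qed
  qed auto
  moreover have "(\<lambda>n. CLINT \<omega>|M. iexp (z \<bullet> S n \<omega>)) \<longlonglongrightarrow> (CLINT x|cp_law \<kappa> (t * u) (t * v) (t * w). iexp (z \<bullet> x))"
  proof -
    define A where "A n = (CLINT x|cp_law (c * \<kappa>) (t / real (Suc n) * u) (t / real (Suc n) * v) (t / real (Suc n) * w). iexp (z \<bullet> cell_map x))" for n
    define B where "B n = (CLINT x|cp_law \<kappa> (t / real (Suc n) * u) (t / real (Suc n) * v) (t / real (Suc n) * w). iexp (z \<bullet> x))" for n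
    have SA: "(CLINT \<omega>|M. iexp (z \<bullet> S n \<omega>)) = A n ^ Suc n" for n
    proof -
      define D where "D i \<omega> = X (unif t n (Suc i)) \<omega> - X (unif t n i) \<omega>" for i \<omega>
      have ub: "0 \<le> unif t n i" if "i \<le> Suc n" for i using unif_bounds[OF t that] by simp
      have ind: "indep_vars (\<lambda>_. borel) D {..<Suc n}"
        unfolding D_def using incr_process_indep[OF iX, of "unif t n" "Suc n"] unif_mono[OF t] by simp
      have rv: "D i \<in> borel_measurable M" if "i < Suc n" for i
        using ind that by (auto simp: indep_vars_def)
      have Dl: "distr M borel (D i) = cp_law (c * \<kappa>) (t / real (Suc n) * u) (t / real (Suc n) * v) (t / real (Suc n) * w)" if "i < Suc n" for i
        unfolding D_def[abs_def] using incr_processD(5)[OF iX, of "unif t n i" "unif t n (Suc i)"] ub that unif_mono[OF t]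
          cp_processD(4)[OF X, of "t / real (Suc n)"] t
        by (simp only: unif_diff) auto
      have in0: "incr X 0 \<omega> (unif t n i) = X (unif t n i) \<omega> - X 0 \<omega>" if "i \<le> Suc n" for i \<omega>
        using ub[OF that] by (simp add: incr_def)
      have Sn: "S n \<omega> = (\<Sum>i<Suc n. cell_map (D i \<omega>))" for \<omega>
      proof (rule prod_eqI)
        have "fst (\<Sum>i<Suc n. cell_map (D i \<omega>)) = (\<Sum>i<Suc n. fst (X (unif t n (Suc i)) \<omega>) - fst (X (unif t n i) \<omega>))"
          by (simp add: fst_sum cell_map_def D_def del: sum.lessThan_Suc)
        also have "\<dots> = fst (incr X 0 \<omega> t)"
          using sum_lessThan_telescope[of "\<lambda>i. fst (X (unif t n i) \<omega>)" "Suc n"] in0[of "Suc n" \<omega>] by simp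
        finally show "fst (S n \<omega>) = fst (\<Sum>i<Suc n. cell_map (D i \<omega>))" by (simp add: S_def)
        show "snd (S n \<omega>) = snd (\<Sum>i<Suc n. cell_map (D i \<omega>))"
          unfolding S_def snd_conv psum_def snd_sum
        proof (intro sum.cong refl)
          fix i assume "i \<in> {..<Suc n}"
          then show "wT c (fst (incr X 0 \<omega> (unif t n i))) (fst (incr X 0 \<omega> (unif t n (Suc i)))) (fst (incr X 0 \<omega> t)) *
              (snd (incr X 0 \<omega> (unif t n (Suc i))) - snd (incr X 0 \<omega> (unif t n i))) = snd (cell_map (D i \<omega>))"
            using in0[of i \<omega>] in0[of "Suc i" \<omega>] by (simp add: wT_def cell_map_def D_def)
        qed
      qed
      have "(CLINT \<omega>|M. iexp (z \<bullet> S n \<omega>)) = (CLINT \<omega>|M. (\<Prod>i<Suc n. iexp (z \<bullet> cell_map (D i \<omega>))))"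
        unfolding Sn inner_sum_right of_real_sum sum_distrib_left by (simp only: exp_sum finite_lessThan)
      also have "\<dots> = (\<Prod>i<Suc n. CLINT \<omega>|M. iexp (z \<bullet> cell_map (D i \<omega>)))"
      proof (rule indep_vars_lebesgue_integral)
        note [measurable] = cell_map_measurable
        show "indep_vars (\<lambda>_. borel) (\<lambda>i \<omega>. iexp (z \<bullet> cell_map (D i \<omega>))) {..<Suc n}"
          by (rule indep_vars_compose2[OF ind, of "\<lambda>_ x. iexp (z \<bullet> cell_map x)"]) measurable
        show "integrable M (\<lambda>\<omega>. iexp (z \<bullet> cell_map (D i \<omega>)))" if "i \<in> {..<Suc n}" for i
        proof -
          have [measurable]: "D i \<in> borel_measurable M" using rv that by simp
          show ?thesis by (intro integrable_const_bound[of _ 1]) auto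
        qed
      qed simp
      also have "\<dots> = (\<Prod>i<Suc n. A n)"
      proof (intro prod.cong refl)
        fix i assume "i \<in> {..<Suc n}"
        then have i: "i < Suc n" by simp
        note [measurable] = cell_map_measurable rv[OF i]
        show "(CLINT \<omega>|M. iexp (z \<bullet> cell_map (D i \<omega>))) = A n"
          unfolding A_def Dl[OF i, symmetric] by (subst integral_distr) auto
      qed
      finally show ?thesis by simp
    qed
    \<comment> \<open>For numbers of modulus at most 1 the difference of powers is at most
      \<open>Suc n\<close> times the difference of the bases, and the latter is O(1/n^2) by
      \<open>cell_char_bound\<close>.\<close>
    have AB: "norm (A n ^ Suc n - B n ^ Suc n) \<le> (2 * (t * (u + v + w))\<^sup>2) * inverse (real (Suc n))" for n
    proof -
      have "norm (A n) \<le> 1"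
        unfolding A_def by (intro norm_iexp_integral_le prob_space_cp_law)
      moreover have "norm (B n) \<le> 1"
        unfolding B_def by (intro norm_iexp_integral_le prob_space_cp_law)
      ultimately have "norm (A n ^ Suc n - B n ^ Suc n) \<le> real (Suc n) * norm (A n - B n)"
        by (rule norm_power_diff)
      also have "norm (A n - B n) \<le> 2 * (t / real (Suc n) * u + t / real (Suc n) * v + t / real (Suc n) * w)\<^sup>2"
        unfolding A_def B_def using t uvw by (intro cell_char_bound) auto
      also have "real (Suc n) * (2 * (t / real (Suc n) * u + t / real (Suc n) * v + t / real (Suc n) * w)\<^sup>2)
         = (2 * (t * (u + v + w))\<^sup>2) * inverse (real (Suc n))"
        unfolding distrib_left[symmetric] by (simp add: power2_eq_square field_simps del: of_nat_Suc)
      finally show ?thesis by (simp add: mult_left_mono del: of_nat_Suc power_Suc)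
    qed
    have "(\<lambda>n. (2 * (t * (u + v + w))\<^sup>2) * inverse (real (Suc n))) \<longlonglongrightarrow> 0"
      using tendsto_mult[OF tendsto_const LIMSEQ_inverse_real_of_nat] by force
    then have "(\<lambda>n. A n ^ Suc n - B n ^ Suc n) \<longlonglongrightarrow> 0"
      using AB by (intro Lim_null_comparison[of "\<lambda>n. A n ^ Suc n - B n ^ Suc n"] always_eventually) auto
    then have "(\<lambda>n. A n ^ Suc n - B n ^ Suc n + (CLINT x|cp_law \<kappa> (t * u) (t * v) (t * w). iexp (z \<bullet> x))) \<longlonglongrightarrow>
        0 + (CLINT x|cp_law \<kappa> (t * u) (t * v) (t * w). iexp (z \<bullet> x))" by (intro tendsto_intros)
    moreover have "B n ^ Suc n = (CLINT x|cp_law \<kappa> (t * u) (t * v) (t * w). iexp (z \<bullet> x))" for n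
      unfolding B_def by (rule cp_law_char_power[OF t])
    ultimately show ?thesis by (simp add: SA del: power_Suc)
  qed
  ultimately have "(CLINT \<omega>|M. iexp (z \<bullet> transf_process t \<omega>)) = (CLINT x|cp_law \<kappa> (t * u) (t * v) (t * w). iexp (z \<bullet> x))"
    by (rule LIMSEQ_unique)
  then show "(CLINT x|distr M borel (transf_process t). iexp (z \<bullet> x)) = (CLINT x|cp_law \<kappa> (t * u) (t * v) (t * w). iexp (z \<bullet> x))"
    using tm by (subst integral_distr) auto
qed (simp_all add: prob_space_cp_law, simp add: cp_law_def)

lemma transf_cp_process: "cp_process M transf_process \<kappa> u v w"
  unfolding cp_process_def
  using transf_process_incr_process transf_process_law transf_process_cp_path by auto

end

section \<open>Equality in law\<close>

lemma AE_pair_fst: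
  assumes "prob_space P" "AE x in N. Q x"
  shows "AE p in N \<Otimes>\<^sub>M P. Q (fst p)"
proof (rule AE_distrD[OF measurable_fst])
  have e: "distr (N \<Otimes>\<^sub>M P) N fst = N" by (rule prob_space.distr_pair_fst[OF assms(1)])
  show "AE x in distr (N \<Otimes>\<^sub>M P) N fst. Q x" unfolding e by (rule assms(2))
qed

lemma completion_measurable_AE:
  assumes g: "g \<in> M \<rightarrow>\<^sub>M N" and ae: "AE \<omega> in M. f \<omega> = g \<omega>" and sp: "\<And>\<omega>. f \<omega> \<in> space N"
  shows "f \<in> completion M \<rightarrow>\<^sub>M N"
proof (rule measurableI)
  fix A assume A: "A \<in> sets N"
  show "f -` A \<inter> space (completion M) \<in> sets (completion M)"
  proof (rule completion.in_sets_AE)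
    show "g -` A \<inter> space (completion M) \<in> sets (completion M)"
      using measurable_sets[OF measurable_completion[OF g] A] .
    show "AE x in completion M. (x \<in> g -` A \<inter> space (completion M)) = (x \<in> f -` A \<inter> space (completion M))"
      using AE_completion[OF ae] by eventually_elim auto
  qed auto
qed (use sp in auto)

text \<open>Both processes are, time by time and almost surely, the same measurable functionals of
  two random elements with a common law; the null sets disappear in the completions.\<close>

lemma eq_in_lawI:
  fixes X :: "real \<Rightarrow> 'a \<Rightarrow> 'c::topological_space"
  assumes \<xi>: "\<xi> \<in> M \<rightarrow>\<^sub>M P" and \<xi>': "\<xi>' \<in> M' \<rightarrow>\<^sub>M P" and law: "distr M P \<xi> = distr M' P \<xi>'"
    and F: "\<And>t. 0 \<le> t \<Longrightarrow> F t \<in> borel_measurable P"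
    and X: "\<And>t. 0 \<le> t \<Longrightarrow> AE \<omega> in M. X t \<omega> = F t (\<xi> \<omega>)"
    and Y: "\<And>t. 0 \<le> t \<Longrightarrow> AE \<omega> in M'. Y t \<omega> = F t (\<xi>' \<omega>)"
  shows "eq_in_law M X M' Y"
proof -
  have m: "Z t \<in> borel_measurable (completion Q)"
    if "\<zeta> \<in> Q \<rightarrow>\<^sub>M P" "\<And>t. 0 \<le> t \<Longrightarrow> AE \<omega> in Q. Z t \<omega> = F t (\<zeta> \<omega>)" "0 \<le> t" for Q and Z :: "real \<Rightarrow> 'z \<Rightarrow> 'c" and \<zeta> t
    using that by (intro completion_measurable_AE[OF measurable_compose[OF that(1) F[OF that(3)]]]) auto
  have d: "distr (completion Q) (PiM J (\<lambda>_. borel)) (\<lambda>\<omega>. \<lambda>t\<in>J. Z t \<omega>) = distr (distr Q P \<zeta>) (PiM J (\<lambda>_. borel)) (\<lambda>x. \<lambda>t\<in>J. F t x)"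
    if \<zeta>: "\<zeta> \<in> Q \<rightarrow>\<^sub>M P" and Z: "\<And>t. 0 \<le> t \<Longrightarrow> AE \<omega> in Q. Z t \<omega> = F t (\<zeta> \<omega>)" and J: "finite J" "J \<subseteq> {0..}"
    for Q and Z :: "real \<Rightarrow> 'z \<Rightarrow> 'c" and \<zeta> J
  proof -
    have FJ: "(\<lambda>x. \<lambda>t\<in>J. F t x) \<in> P \<rightarrow>\<^sub>M PiM J (\<lambda>_. borel)" using F J by (intro measurable_restrict) auto
    have Zm: "(\<lambda>\<omega>. \<lambda>t\<in>J. Z t \<omega>) \<in> completion Q \<rightarrow>\<^sub>M PiM J (\<lambda>_. borel)"
      using m[OF \<zeta> Z] J by (intro measurable_restrict) auto
    have Fm: "(\<lambda>\<omega>. \<lambda>t\<in>J. F t (\<zeta> \<omega>)) \<in> Q \<rightarrow>\<^sub>M PiM J (\<lambda>_. borel)"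
      using measurable_compose[OF \<zeta> FJ] .
    have ae: "AE \<omega> in Q. \<forall>t\<in>J. Z t \<omega> = F t (\<zeta> \<omega>)" using Z J by (subst AE_finite_all) auto
    have "distr (completion Q) (PiM J (\<lambda>_. borel)) (\<lambda>\<omega>. \<lambda>t\<in>J. Z t \<omega>) = distr (completion Q) (PiM J (\<lambda>_. borel)) (\<lambda>\<omega>. \<lambda>t\<in>J. F t (\<zeta> \<omega>))"
    proof (rule distr_cong_AE)
      show "AE \<omega> in completion Q. (\<lambda>t\<in>J. Z t \<omega>) = (\<lambda>t\<in>J. F t (\<zeta> \<omega>))"
        using AE_completion[OF ae] by eventually_elim auto
    qed (use Zm measurable_completion[OF Fm] in auto)
    also have "\<dots> = distr Q (PiM J (\<lambda>_. borel)) (\<lambda>\<omega>. \<lambda>t\<in>J. F t (\<zeta> \<omega>))"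
      by (rule distr_completion[OF Fm])
    also have "\<dots> = distr (distr Q P \<zeta>) (PiM J (\<lambda>_. borel)) (\<lambda>x. \<lambda>t\<in>J. F t x)"
      using \<zeta> FJ by (subst distr_distr) (auto simp: comp_def)
    finally show ?thesis .
  qed
  show ?thesis
    unfolding eq_in_law_def
    using m[OF \<xi> X] m[OF \<xi>' Y] d[OF \<xi> X] d[OF \<xi>' Y] law by auto
qed

lemma eq_in_law_marginal:
  fixes X :: "real \<Rightarrow> 'a \<Rightarrow> 'c::topological_space"
  assumes eq: "eq_in_law M X M' Y" and X: "X t \<in> borel_measurable M" and Y: "Y t \<in> borel_measurable M'" and t: "0 \<le> t"
  shows "distr M borel (X t) = distr M' borel (Y t)"
proof -
  have c: "(\<lambda>f. f t) \<in> PiM {t} (\<lambda>_. borel :: 'c measure) \<rightarrow>\<^sub>M borel" by (rule measurable_component_singleton) simp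
  have *: "distr (distr (completion Q) (PiM {t} (\<lambda>_. borel)) (\<lambda>\<omega>. \<lambda>t\<in>{t}. Z t \<omega>)) borel (\<lambda>f. f t) = distr Q borel (Z t)"
    if Z: "Z t \<in> borel_measurable Q" for Q and Z :: "real \<Rightarrow> 'z \<Rightarrow> 'c"
  proof -
    have m: "(\<lambda>\<omega>. \<lambda>t\<in>{t}. Z t \<omega>) \<in> completion Q \<rightarrow>\<^sub>M PiM {t} (\<lambda>_. borel)"
      using measurable_completion[OF Z] by (intro measurable_restrict) auto
    have "distr (distr (completion Q) (PiM {t} (\<lambda>_. borel)) (\<lambda>\<omega>. \<lambda>t\<in>{t}. Z t \<omega>)) borel (\<lambda>f. f t) = distr (completion Q) borel (Z t)"
      using c m by (subst distr_distr) (auto simp: comp_def)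
    then show ?thesis using distr_completion[OF Z] by simp
  qed
  have "distr (completion M) (PiM {t} (\<lambda>_. borel)) (\<lambda>\<omega>. \<lambda>t\<in>{t}. X t \<omega>) = distr (completion M') (PiM {t} (\<lambda>_. borel)) (\<lambda>\<omega>. \<lambda>t\<in>{t}. Y t \<omega>)"
    using eq t unfolding eq_in_law_def by (elim conjE allE[of _ "{t}"]) auto
  then show ?thesis using *[of X M] *[of Y M'] X Y by simp
qed

section \<open>Affine recursions driven by a compound Poisson process\<close>

text \<open>The flow of the recursion as a measurable map of a starting value and a path of
  increments.\<close>

definition aff :: "real \<Rightarrow> real \<Rightarrow> real \<times> (real \<Rightarrow> real \<times> real) \<Rightarrow> real" where
  "aff c t p = c powr (- fst (snd p t)) * fst p + pint (wB c) t (snd p)"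

lemma aff_measurable: "0 \<le> t \<Longrightarrow> aff c t \<in> borel_measurable (borel \<Otimes>\<^sub>M path_space)"
proof -
  assume t: "0 \<le> t"
  have [measurable]: "(\<lambda>x. fst (x t)) \<in> borel_measurable (path_space :: (real \<Rightarrow> real \<times> real) measure)"
    using measurable_compose[OF path_component_measurable[OF t, where ?'b = "real \<times> real"] borel_measurable_continuous_onI[OF continuous_on_fst[OF continuous_on_id]]] .
  have [measurable]: "pint (wB c) t \<in> borel_measurable path_space" by (rule functional_measurable(5)[OF t])
  have [measurable]: "(\<lambda>p. fst (snd p t)) \<in> borel_measurable (borel \<Otimes>\<^sub>M path_space :: (real \<times> (real \<Rightarrow> real \<times> real)) measure)"
    by (rule measurable_compose[OF measurable_snd]) measurable
  show ?thesis unfolding aff_def[abs_def] by measurable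
qed

lemma aff_local:
  assumes "0 \<le> t" "\<And>s. 0 \<le> s \<Longrightarrow> s \<le> t \<Longrightarrow> x s = y s"
  shows "aff c t (a, x) = aff c t (a, y)"
  using pint_cong[OF assms(2,1)] assms by (simp add: aff_def)

text \<open>Independence is stated as a product law so that Fubini's theorem applies
  directly.\<close>

definition indep_start :: "'a measure \<Rightarrow> ('a \<Rightarrow> real) \<Rightarrow> (real \<Rightarrow> 'a \<Rightarrow> real \<times> real) \<Rightarrow> bool" where
  "indep_start M S X \<longleftrightarrow> S \<in> borel_measurable M \<and>
     distr M (borel \<Otimes>\<^sub>M path_space) (\<lambda>\<omega>. (S \<omega>, incr X 0 \<omega>)) = distr M borel S \<Otimes>\<^sub>M distr M path_space (incr X 0)"

definition affine_process ::
  "'a measure \<Rightarrow> real \<Rightarrow> (real \<Rightarrow> 'a \<Rightarrow> real \<times> real) \<Rightarrow> ('a \<Rightarrow> real) \<Rightarrow> (real \<Rightarrow> 'a \<Rightarrow> real) \<Rightarrow> bool" where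
  "affine_process M c X S V \<longleftrightarrow> indep_start M S X \<and> (\<forall>t\<ge>0. V t \<in> borel_measurable M) \<and>
     (AE \<omega> in M. \<forall>t\<ge>0. V t \<omega> = c powr (- fst (X t \<omega>)) * S \<omega> + jint (wB c) t (\<lambda>s. X s \<omega>))"

context
  fixes M :: "'a measure" and X :: "real \<Rightarrow> 'a \<Rightarrow> real \<times> real" and c \<kappa> u v w :: real and S V
  assumes X: "cp_process M X \<kappa> u v w" and c: "c > 1" and V: "affine_process M c X S V"
begin

interpretation prob_space M using cp_processD(2)[OF X] .

lemma affine_AE0:
  assumes t: "0 \<le> t"
  shows "AE \<omega> in M. V t \<omega> = aff c t (S \<omega>, incr X 0 \<omega>)"
proof -
  have "AE \<omega> in M. \<forall>t\<ge>0. V t \<omega> = c powr (- fst (X t \<omega>)) * S \<omega> + jint (wB c) t (\<lambda>s. X s \<omega>)"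
    using V by (simp add: affine_process_def)
  with cp_process_incr0[OF X] show ?thesis
  proof eventually_elim
    case (elim \<omega>)
    have "pint (wB c) t (incr X 0 \<omega>) = pint (wB c) t (\<lambda>s. X s \<omega>)"
      using elim t by (intro pint_cong) auto
    also have "\<dots> = jint (wB c) t (\<lambda>s. X s \<omega>)" using elim t cp_path_step by (intro pint_eq_jint) auto
    finally show ?case using elim t by (simp add: aff_def)
  qed
qed

text \<open>By \<open>jint_flow\<close> the recursion restarts at \<open>h\<close> from the value
  V(h), driven by the later increments alone.\<close>

lemma affine_AE:
  assumes h: "0 \<le> h" and t: "0 \<le> t"
  shows "AE \<omega> in M. V (h + t) \<omega> = aff c t (V h \<omega>, incr X h \<omega>)"
proof -
  have "AE \<omega> in M. \<forall>t\<ge>0. V t \<omega> = c powr (- fst (X t \<omega>)) * S \<omega> + jint (wB c) t (\<lambda>s. X s \<omega>)"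
    using V by (simp add: affine_process_def)
  with cp_processD(5)[OF X] show ?thesis
  proof eventually_elim
    case (elim \<omega>)
    let ?x = "\<lambda>s. X s \<omega>"
    have sp: "step_path ?x" using elim cp_path_step by blast
    have "pint (wB c) t (incr X h \<omega>) = pint (wB c) t (\<lambda>q. ?x (h + q) - ?x h)"
      using t by (intro pint_cong) (auto simp: incr_def)
    also have "\<dots> = jint (wB c) t (\<lambda>q. ?x (h + q) - ?x h)"
      using cp_path_step[OF cp_path_shift[OF elim(1) h]] t by (intro pint_eq_jint) auto
    finally have p: "pint (wB c) t (incr X h \<omega>) = jint (wB c) t (\<lambda>q. ?x (h + q) - ?x h)" .
    have "c powr (- fst (?x (h + t))) = c powr (- (fst (?x (h + t)) - fst (?x h))) * c powr (- fst (?x h))"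
      by (simp add: powr_add[symmetric])
    then show ?case
      using elim h t jint_flow[OF sp h t, of c] c p
      by (simp add: aff_def incr_def distrib_left)
  qed
qed

text \<open>V(h) is a function of \<open>S\<close> and the past. Since \<open>S\<close> is
  independent of the whole path, it can be fixed by Fubini, and past and future are then separated
  by \<open>indep_past_incr\<close>.\<close>

lemma affine_indep:
  assumes h: "0 \<le> h"
  shows "distr M (borel \<Otimes>\<^sub>M path_space) (\<lambda>\<omega>. (V h \<omega>, incr X h \<omega>)) = distr M borel (V h) \<Otimes>\<^sub>M distr M path_space (incr X h)"
proof (rule pair_measure_eqI[symmetric])
  note iX = cp_processD(1)[OF X]
  have Vm: "V h \<in> borel_measurable M" using V h by (simp add: affine_process_def)
  have Sm: "S \<in> borel_measurable M" and SX: "distr M (borel \<Otimes>\<^sub>M path_space) (\<lambda>\<omega>. (S \<omega>, incr X 0 \<omega>)) = distr M borel S \<Otimes>\<^sub>M distr M path_space (incr X 0)"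
    using V by (auto simp: affine_process_def indep_start_def)
  have im: "incr X h \<in> M \<rightarrow>\<^sub>M path_space" "incr X 0 \<in> M \<rightarrow>\<^sub>M path_space" "past X h \<in> M \<rightarrow>\<^sub>M path_space"
    using incr_processD[OF iX] h by auto
  show "sigma_finite_measure (distr M borel (V h))" "sigma_finite_measure (distr M path_space (incr X h))"
    using Vm im by (auto intro!: prob_space_imp_sigma_finite prob_space_distr)
  show "sets (distr M borel (V h) \<Otimes>\<^sub>M distr M path_space (incr X h)) = sets (distr M (borel \<Otimes>\<^sub>M path_space) (\<lambda>\<omega>. (V h \<omega>, incr X h \<omega>)))"
    by (simp cong: sets_pair_measure_cong)
  fix A B assume A: "A \<in> sets (distr M borel (V h))" and B: "B \<in> sets (distr M path_space (incr X h))"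
  then have A: "A \<in> sets borel" and B: "B \<in> sets path_space" by auto
  \<comment> \<open>Past and future of \<open>h\<close> are both read off the single path
    \<open>incr X 0\<close>, the one for which independence of \<open>S\<close> is given.\<close>
  define p where "p x = (\<lambda>q\<in>{0..}. x (min q h) - x 0)" for x :: "real \<Rightarrow> real \<times> real"
  define f where "f x = (\<lambda>q\<in>{0..}. x (h + q) - x h)" for x :: "real \<Rightarrow> real \<times> real"
  have pm: "p \<in> path_space \<rightarrow>\<^sub>M path_space" and fm: "f \<in> path_space \<rightarrow>\<^sub>M path_space"
    unfolding p_def[abs_def] f_def[abs_def] using h
    by (intro measurable_restrict borel_measurable_diff measurable_component_singleton; simp)+
  have pX: "p (incr X 0 \<omega>) = past X h \<omega>" and fX: "f (incr X 0 \<omega>) = incr X h \<omega>" for \<omega>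
    using h by (auto simp: p_def f_def incr_def past_def)
  let ?P0 = "distr M path_space (incr X 0)" and ?S = "distr M borel S"
  interpret P0: prob_space ?P0 using im by (intro prob_space_distr) auto
  have am: "aff c h \<in> borel_measurable (borel \<Otimes>\<^sub>M path_space)" using aff_measurable[OF h] .
  let ?g = "\<lambda>p'. aff c h (fst p', p (snd p'))"
  have gm: "?g \<in> borel_measurable (borel \<Otimes>\<^sub>M path_space)"
    using am pm by measurable
  have local: "aff c h (s, p (incr X 0 \<omega>)) = aff c h (s, incr X 0 \<omega>)" for s \<omega>
    using h by (intro aff_local) (auto simp: p_def incr_def)
  let ?E = "{p' \<in> space (borel \<Otimes>\<^sub>M path_space). ?g p' \<in> A}" and ?F = "{x \<in> space path_space. f x \<in> B}"
  have E: "?E \<in> sets (borel \<Otimes>\<^sub>M path_space)" and F: "?F \<in> sets path_space"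
    using measurable_sets[OF gm A] measurable_sets[OF fm B] by (simp_all add: vimage_def Int_def conj_commute)
  have ind: "emeasure ?P0 (Pair s -` ?E \<inter> ?F) = emeasure ?P0 (Pair s -` ?E) * emeasure ?P0 ?F" for s
  proof -
    have Em: "Pair s -` ?E \<in> sets path_space" using E by (rule sets_Pair1)
    \<comment> \<open>For fixed \<open>s\<close> the event on the full path becomes an event on
      \<open>past X h\<close> alone.\<close>
    let ?C = "{y \<in> space path_space. aff c h (s, y) \<in> A}"
    have C: "?C \<in> sets path_space"
    proof -
      have "(\<lambda>y. aff c h (s, y)) \<in> borel_measurable path_space" using am by measurable
      from measurable_sets[OF this A] show ?thesis by (simp add: vimage_def Int_def conj_commute)
    qed
    have sp: "past X h \<omega> \<in> space path_space" "incr X h \<omega> \<in> space path_space" "incr X 0 \<omega> \<in> space path_space" for \<omega>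
      by (auto simp: past_def incr_def space_PiM)
    have iv: "indep_var path_space (past X h) path_space (incr X h)" by (rule indep_past_incr[OF iX h])
    have e1: "incr X 0 -` (Pair s -` ?E) \<inter> space M = past X h -` ?C \<inter> space M"
      using sp by (auto simp: pX space_pair_measure)
    have e2: "incr X 0 -` ?F \<inter> space M = incr X h -` B \<inter> space M"
      using sp by (auto simp: fX)
    have "emeasure ?P0 (Pair s -` ?E \<inter> ?F) = emeasure M ((past X h -` ?C \<inter> space M) \<inter> (incr X h -` B \<inter> space M))"
    proof -
      have "emeasure ?P0 (Pair s -` ?E \<inter> ?F) = emeasure M (incr X 0 -` (Pair s -` ?E \<inter> ?F) \<inter> space M)"
        by (rule emeasure_distr) (use Em F im in auto)
      also have "incr X 0 -` (Pair s -` ?E \<inter> ?F) \<inter> space M =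
          (incr X 0 -` (Pair s -` ?E) \<inter> space M) \<inter> (incr X 0 -` ?F \<inter> space M)" by blast
      finally show ?thesis unfolding e1 e2 .
    qed
    also have "\<dots> = emeasure M (past X h -` ?C \<inter> space M) * emeasure M (incr X h -` B \<inter> space M)"
    proof -
      have "(past X h -` ?C \<inter> space M) \<inter> (incr X h -` B \<inter> space M) = (\<lambda>\<omega>. (past X h \<omega>, incr X h \<omega>)) -` (?C \<times> B) \<inter> space M"
        by auto
      then show ?thesis using indep_varD[OF iv C B] by (simp add: emeasure_eq_measure ennreal_mult)
    qed
    also have "\<dots> = emeasure ?P0 (Pair s -` ?E) * emeasure ?P0 ?F"
    proof -
      have "emeasure ?P0 (Pair s -` ?E) = emeasure M (incr X 0 -` (Pair s -` ?E) \<inter> space M)"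
        "emeasure ?P0 ?F = emeasure M (incr X 0 -` ?F \<inter> space M)"
        by (rule emeasure_distr; use Em F im in auto)+
      then show ?thesis unfolding e1 e2 by (simp only:)
    qed
    finally show ?thesis .
  qed
  have EF: "?E \<inter> (UNIV \<times> ?F) \<in> sets (borel \<Otimes>\<^sub>M path_space)" using E F by auto
  have sSX: "sets (?S \<Otimes>\<^sub>M ?P0) = sets (borel \<Otimes>\<^sub>M path_space)" by (simp cong: sets_pair_measure_cong)
  have SXm: "(\<lambda>\<omega>. (S \<omega>, incr X 0 \<omega>)) \<in> M \<rightarrow>\<^sub>M borel \<Otimes>\<^sub>M path_space" using Sm im by measurable
  have spI: "incr X 0 \<omega> \<in> space path_space" for \<omega> by (auto simp: incr_def space_PiM)
  have eV: "emeasure M (V h -` A \<inter> space M) = emeasure M ((\<lambda>\<omega>. (S \<omega>, incr X 0 \<omega>)) -` ?E \<inter> space M)"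
  proof (rule emeasure_eq_AE)
    show "AE \<omega> in M. (\<omega> \<in> V h -` A \<inter> space M) = (\<omega> \<in> (\<lambda>\<omega>. (S \<omega>, incr X 0 \<omega>)) -` ?E \<inter> space M)"
      using affine_AE0[OF h] by eventually_elim (auto simp: local space_pair_measure spI)
  qed (use measurable_sets[OF Vm A] measurable_sets[OF SXm E] in auto)
  have "emeasure (distr M (borel \<Otimes>\<^sub>M path_space) (\<lambda>\<omega>. (V h \<omega>, incr X h \<omega>))) (A \<times> B)
      = emeasure M ((V h -` A \<inter> space M) \<inter> (incr X h -` B \<inter> space M))"
    using A B Vm im by (subst emeasure_distr) (auto intro!: arg_cong[of _ _ "emeasure M"])
  also have "\<dots> = emeasure M ((\<lambda>\<omega>. (S \<omega>, incr X 0 \<omega>)) -` (?E \<inter> (UNIV \<times> ?F)) \<inter> space M)"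
  proof (rule emeasure_eq_AE)
    show "AE \<omega> in M. (\<omega> \<in> (V h -` A \<inter> space M) \<inter> (incr X h -` B \<inter> space M)) = (\<omega> \<in> (\<lambda>\<omega>. (S \<omega>, incr X 0 \<omega>)) -` (?E \<inter> (UNIV \<times> ?F)) \<inter> space M)"
      using affine_AE0[OF h] by eventually_elim (auto simp: local fX space_pair_measure spI)
  qed (use measurable_sets[OF Vm A] measurable_sets[OF im(1) B] measurable_sets[OF SXm EF] in auto)
  also have "\<dots> = emeasure (?S \<Otimes>\<^sub>M ?P0) (?E \<inter> (UNIV \<times> ?F))"
    unfolding SX[symmetric] using EF SXm by (subst emeasure_distr) auto
  also have "\<dots> = (\<integral>\<^sup>+s. emeasure ?P0 (Pair s -` (?E \<inter> (UNIV \<times> ?F))) \<partial>?S)"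
    using EF sSX by (intro P0.emeasure_pair_measure_alt) auto
  also have "\<dots> = (\<integral>\<^sup>+s. emeasure ?P0 (Pair s -` ?E) * emeasure ?P0 ?F \<partial>?S)"
    by (intro nn_integral_cong, subst ind[symmetric]) (auto intro!: arg_cong[of _ _ "emeasure ?P0"])
  also have "\<dots> = (\<integral>\<^sup>+s. emeasure ?P0 (Pair s -` ?E) \<partial>?S) * emeasure ?P0 ?F"
    using E sSX by (intro nn_integral_multc P0.measurable_emeasure_Pair) auto
  also have "(\<integral>\<^sup>+s. emeasure ?P0 (Pair s -` ?E) \<partial>?S) = emeasure (?S \<Otimes>\<^sub>M ?P0) ?E"
    using E sSX by (intro P0.emeasure_pair_measure_alt[symmetric]) auto
  also have "\<dots> = emeasure M ((\<lambda>\<omega>. (S \<omega>, incr X 0 \<omega>)) -` ?E \<inter> space M)"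
    unfolding SX[symmetric] using E SXm by (subst emeasure_distr) auto
  also have "\<dots> = emeasure (distr M borel (V h)) A"
    unfolding eV[symmetric] using A Vm by (simp add: emeasure_distr)
  also have "emeasure ?P0 ?F = emeasure (distr M path_space (incr X h)) B"
  proof -
    have "incr X 0 -` ?F \<inter> space M = incr X h -` B \<inter> space M" using spI by (auto simp: fX)
    then show ?thesis using F B im by (simp add: emeasure_distr)
  qed
  finally show "emeasure (distr M borel (V h)) A * emeasure (distr M path_space (incr X h)) B =
      emeasure (distr M (borel \<Otimes>\<^sub>M path_space) (\<lambda>\<omega>. (V h \<omega>, incr X h \<omega>))) (A \<times> B)" by simp
qed

lemma affine_joint_law:
  assumes h: "0 \<le> h"
  shows "distr M (borel \<Otimes>\<^sub>M path_space) (\<lambda>\<omega>. (V h \<omega>, incr X h \<omega>)) = distr M borel (V h) \<Otimes>\<^sub>M distr M path_space (incr X 0)"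
  using affine_indep[OF h] cp_process_law_incr[OF X X h order_refl] by simp

text \<open>The shifted and the original process are the same functionals \<open>aff c t\<close> of
  (V(h), increments after h) and of (S, increments after 0), and these pairs have the same
  law.\<close>

lemma affine_stationary:
  assumes law: "\<And>t. 0 \<le> t \<Longrightarrow> distr M borel (V t) = distr M borel S"
  shows "strictly_stationary M V"
  unfolding strictly_stationary_def
proof (intro allI impI)
  fix h :: real assume h: "0 \<le> h"
  note iX = cp_processD(1)[OF X]
  have Vm: "V h \<in> borel_measurable M" and Sm: "S \<in> borel_measurable M"
    using V h by (auto simp: affine_process_def indep_start_def)
  show "eq_in_law M (\<lambda>t. V (t + h)) M V"
  proof (rule eq_in_lawI[where F = "aff c" and \<xi> = "\<lambda>\<omega>. (V h \<omega>, incr X h \<omega>)" and \<xi>' = "\<lambda>\<omega>. (S \<omega>, incr X 0 \<omega>)"])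
    show "(\<lambda>\<omega>. (V h \<omega>, incr X h \<omega>)) \<in> M \<rightarrow>\<^sub>M borel \<Otimes>\<^sub>M path_space"
      "(\<lambda>\<omega>. (S \<omega>, incr X 0 \<omega>)) \<in> M \<rightarrow>\<^sub>M borel \<Otimes>\<^sub>M path_space"
      using Vm Sm incr_processD(3)[OF iX h] incr_processD(3)[OF iX order_refl] by measurable
    show "distr M (borel \<Otimes>\<^sub>M path_space) (\<lambda>\<omega>. (V h \<omega>, incr X h \<omega>)) = distr M (borel \<Otimes>\<^sub>M path_space) (\<lambda>\<omega>. (S \<omega>, incr X 0 \<omega>))"
      using affine_joint_law[OF h] law[OF h] V by (simp add: affine_process_def indep_start_def)
    show "AE \<omega> in M. V (t + h) \<omega> = aff c t (V h \<omega>, incr X h \<omega>)" if "0 \<le> t" for t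
      using affine_AE[OF h that] by (simp add: add.commute)
  qed (auto intro: aff_measurable affine_AE0)
qed

end

text \<open>The means of the discounts at integer times form a convergent geometric series, so the
  series of discounts converges almost surely and its terms tend to 0.\<close>

lemma cp_process_discount_tendsto:
  assumes X: "cp_process M X \<kappa> u v w" and uvw: "0 \<le> u" "0 \<le> v" "0 \<le> w" "0 < u + w" and c: "c > 1" and \<kappa>: "0 \<le> \<kappa>"
  shows "AE \<omega> in M. (\<lambda>n. c powr (- fst (X (real n) \<omega>))) \<longlonglongrightarrow> 0"
proof -
  note iX = cp_processD(1)[OF X]
  interpret prob_space M using cp_processD(2)[OF X] .
  define \<theta> where "\<theta> = (\<integral>\<^sup>+\<omega>. ennreal (c powr (- fst (X 1 \<omega>))) \<partial>M)"
  have \<theta>: "\<theta> < 1" unfolding \<theta>_def by (rule cp_process_discount[OF X uvw c \<kappa>])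
  have fs: "fst \<in> borel_measurable (borel :: (real \<times> real) measure)"
    by (intro borel_measurable_continuous_onI continuous_intros)
  define D where "D i \<omega> = X (real (Suc i)) \<omega> - X (real i) \<omega>" for i \<omega>
  have [measurable]: "D i \<in> borel_measurable M" for i
    unfolding D_def[abs_def] using cp_processD(3)[OF X] by (intro borel_measurable_diff) auto
  have X1: "X 1 \<in> borel_measurable M" using cp_processD(3)[OF X] by simp
  let ?f = "\<lambda>d :: real \<times> real. ennreal (c powr (- fst d))"
  have f: "?f \<in> borel_measurable borel" using fs by measurable
  have T: "(\<integral>\<^sup>+\<omega>. ennreal (c powr (- (fst (X (real i) \<omega>) - fst (X 0 \<omega>)))) \<partial>M) = \<theta> ^ i" for i
  proof -
    have ind: "indep_vars (\<lambda>_. borel) D {..<i}"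
      unfolding D_def using incr_process_indep[OF iX, of real i] by simp
    have Dl: "(\<integral>\<^sup>+\<omega>. ?f (D j \<omega>) \<partial>M) = \<theta>" for j
    proof -
      have "(\<integral>\<^sup>+\<omega>. ?f (D j \<omega>) \<partial>M) = (\<integral>\<^sup>+x. ?f x \<partial>distr M borel (D j))" using f by (subst nn_integral_distr) auto
      also have "distr M borel (D j) = distr M borel (X 1)"
        unfolding D_def[abs_def] using incr_processD(5)[OF iX, of "real j" "real (Suc j)"] by simp
      also have "(\<integral>\<^sup>+x. ?f x \<partial>distr M borel (X 1)) = \<theta>"
        unfolding \<theta>_def using X1 f by (subst nn_integral_distr) auto
      finally show ?thesis .
    qed
    have "ennreal (c powr (- (fst (X (real i) \<omega>) - fst (X 0 \<omega>)))) = (\<Prod>j<i. ?f (D j \<omega>))" for \<omega>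
    proof -
      have "(\<Prod>j<i. ?f (D j \<omega>)) = ennreal (\<Prod>j<i. c powr (- fst (D j \<omega>)))"
        by (rule prod_ennreal) simp
      also have "(\<Prod>j<i. c powr (- fst (D j \<omega>))) = c powr (\<Sum>j<i. - fst (D j \<omega>))"
        using c by (simp add: powr_sum)
      also have "(\<Sum>j<i. - fst (D j \<omega>)) = - (fst (X (real i) \<omega>) - fst (X 0 \<omega>))"
        using sum_lessThan_telescope[of "\<lambda>j. fst (X (real j) \<omega>)" i] by (simp add: D_def sum_negf sum_subtractf)
      finally show ?thesis by simp
    qed
    then have "(\<integral>\<^sup>+\<omega>. ennreal (c powr (- (fst (X (real i) \<omega>) - fst (X 0 \<omega>)))) \<partial>M) = (\<integral>\<^sup>+\<omega>. (\<Prod>j<i. ?f (D j \<omega>)) \<partial>M)" by simp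
    also have "\<dots> = (\<Prod>j<i. \<integral>\<^sup>+\<omega>. ?f (D j \<omega>) \<partial>M)"
      using indep_vars_compose2[OF ind, of "\<lambda>_. ?f" "\<lambda>_. borel"] f by (intro indep_vars_nn_integral) auto
    finally show ?thesis by (simp add: Dl)
  qed
  have Nm: "(\<lambda>\<omega>. fst (X (real i) \<omega>)) \<in> borel_measurable M" "(\<lambda>\<omega>. fst (X 0 \<omega>)) \<in> borel_measurable M" for i
    using measurable_compose[OF cp_processD(3)[OF X] fs] by auto
  have Tm: "(\<lambda>\<omega>. ennreal (c powr (- (fst (X (real i) \<omega>) - fst (X 0 \<omega>))))) \<in> borel_measurable M" for i
    using Nm by measurable
  have "(\<integral>\<^sup>+\<omega>. (\<Sum>i. ennreal (c powr (- (fst (X (real i) \<omega>) - fst (X 0 \<omega>))))) \<partial>M) = (\<Sum>i. \<theta> ^ i)"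
    unfolding nn_integral_suminf[OF Tm] T ..
  also have "\<dots> < \<infinity>"
  proof -
    obtain q where q: "0 \<le> q" "\<theta> = ennreal q" using \<theta> by (cases \<theta>) auto
    have q1: "q < 1" using \<theta> q by (simp add: ennreal_less_one_iff)
    have "\<theta> ^ i = ennreal (q ^ i)" for i using q by (simp add: ennreal_power)
    then have "(\<Sum>i. \<theta> ^ i) = (\<Sum>i. ennreal (q ^ i))" by simp
    also have "\<dots> = ennreal (\<Sum>i. q ^ i)"
      using q q1 by (intro suminf_ennreal2) (auto simp: summable_geometric)
    finally show ?thesis by simp
  qed
  finally have "AE \<omega> in M. (\<Sum>i. ennreal (c powr (- (fst (X (real i) \<omega>) - fst (X 0 \<omega>))))) \<noteq> \<infinity>"
    using Tm by (intro nn_integral_noteq_infinite) auto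
  with cp_processD(5)[OF X] show ?thesis
  proof eventually_elim
    case (elim \<omega>)
    then have "(\<Sum>i. ennreal (c powr (- fst (X (real i) \<omega>)))) \<noteq> top" by (simp add: cp_path_def)
    then have "summable (\<lambda>i. c powr (- fst (X (real i) \<omega>)))" by (intro summable_suminf_not_top) auto
    then show ?case by (rule summable_LIMSEQ_zero)
  qed
qed

text \<open>A reference process on \<open>M\<^sub>0\<close> whose improper integral \<open>Z\<close> carries the stationary law.\<close>

context
  fixes M0 :: "'b measure" and X0 :: "real \<Rightarrow> 'b \<Rightarrow> real \<times> real" and c \<kappa> u v w :: real and Z
  assumes X0: "cp_process M0 X0 \<kappa> u v w" and uvw: "0 \<le> u" "0 \<le> v" "0 \<le> w" "0 < u + w" and c: "c > 1" and \<kappa>: "0 \<le> \<kappa>"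
    and Zm: "Z \<in> borel_measurable M0"
    and Z: "AE \<omega> in M0. ((\<lambda>t. jint (wI c) t (incr X0 0 \<omega>)) \<longlongrightarrow> Z \<omega>) at_top"
begin

interpretation M0: prob_space M0 using cp_processD(2)[OF X0] .

lemma pint_seq_limit:
  assumes "0 \<le> h"
  shows "AE \<omega> in M0. (\<lambda>n. pint (wI c) (real n + h) (incr X0 0 \<omega>)) \<longlonglongrightarrow> Z \<omega>"
  using Z cp_process_incr[OF X0 order_refl]
proof eventually_elim
  case (elim \<omega>)
  have "filterlim (\<lambda>n. h + real n) at_top sequentially"
    by (rule filterlim_tendsto_add_at_top[OF tendsto_const filterlim_real_sequentially])
  then have "filterlim (\<lambda>n. real n + h) at_top sequentially" by (simp add: add.commute)
  from filterlim_compose[OF elim(1) this] show ?case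
    using pint_eq_jint[OF cp_path_step[OF elim(2)]] assms by simp
qed

lemma pint_measurable_incr:
  assumes "cp_process M X \<kappa> u v w" "0 \<le> t"
  shows "(\<lambda>\<omega>. pint (wI c) t (incr X 0 \<omega>)) \<in> borel_measurable M" "(\<lambda>\<omega>. pint (wB c) t (incr X 0 \<omega>)) \<in> borel_measurable M"
  using measurable_compose[OF incr_processD(3)[OF cp_processD(1)[OF assms(1)] order_refl] functional_measurable(4)[OF assms(2)]]
    measurable_compose[OF incr_processD(3)[OF cp_processD(1)[OF assms(1)] order_refl] functional_measurable(5)[OF assms(2)]]
  by auto

lemma reversal_law:
  assumes X: "cp_process M X \<kappa> u v w" and t: "0 \<le> t"
  shows "distr M borel (\<lambda>\<omega>. pint (wB c) t (incr X 0 \<omega>)) = distr M0 borel (\<lambda>\<omega>. pint (wI c) t (incr X0 0 \<omega>))"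
proof -
  have m: "incr X 0 \<in> M \<rightarrow>\<^sub>M path_space" "incr X0 0 \<in> M0 \<rightarrow>\<^sub>M path_space"
    using incr_processD(3)[OF cp_processD(1)[OF X]] incr_processD(3)[OF cp_processD(1)[OF X0]] by auto
  have "distr M borel (\<lambda>\<omega>. pint (wB c) t (incr X 0 \<omega>)) = distr (distr M path_space (incr X 0)) borel (pint (wB c) t)"
    using m functional_measurable(5)[OF t] by (subst distr_distr) (auto simp: comp_def)
  also have "\<dots> = distr (distr M0 path_space (incr X0 0)) borel (pint (wB c) t)"
    using cp_process_law_incr[OF X X0 order_refl order_refl] by simp
  also have "\<dots> = distr M0 borel (\<lambda>\<omega>. pint (wB c) t (incr X0 0 \<omega>))"
    using m functional_measurable(5)[OF t] by (subst distr_distr) (auto simp: comp_def)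
  also have "\<dots> = distr M0 borel (\<lambda>\<omega>. pint (wI c) t (incr X0 0 \<omega>))"
    using time_reversal[OF X0 t] by simp
  finally show ?thesis .
qed

text \<open>At integer times V differs from its \<open>wB\<close> part by a discounted
  \<open>S\<close>, which vanishes; by reversal that part has the law of the \<open>wI\<close>
  integrals, which converge to \<open>Z\<close>.\<close>

lemma affine_unique:
  fixes M :: "'a measure" and X :: "real \<Rightarrow> 'a \<Rightarrow> real \<times> real"
  assumes X: "cp_process M X \<kappa> u v w" and V: "affine_process M c X S V"
    and law: "\<And>t. 0 \<le> t \<Longrightarrow> distr M borel (V t) = \<rho>"
  shows "\<rho> = distr M0 borel Z"
proof (rule law_limit[OF cp_processD(2)[OF X0] cp_processD(2)[OF X], where U = "\<lambda>n \<omega>. pint (wI c) (real n) (incr X0 0 \<omega>)"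
      and V = "\<lambda>n. V (real n)" and W = "\<lambda>n \<omega>. pint (wB c) (real n) (incr X 0 \<omega>)"])
  show "AE \<omega> in M0. (\<lambda>n. pint (wI c) (real n) (incr X0 0 \<omega>)) \<longlonglongrightarrow> Z \<omega>" using pint_seq_limit[of 0] by simp
  have "AE \<omega> in M. \<forall>n. V (real n) \<omega> = aff c (real n) (S \<omega>, incr X 0 \<omega>)"
    using affine_AE0[OF X c V] by (subst AE_all_countable) auto
  with cp_process_discount_tendsto[OF X uvw c \<kappa>] cp_process_incr0[OF X]
  show "AE \<omega> in M. (\<lambda>n. V (real n) \<omega> - pint (wB c) (real n) (incr X 0 \<omega>)) \<longlonglongrightarrow> 0"
  proof eventually_elim
    case (elim \<omega>)
    have "(\<lambda>n. c powr (- fst (X (real n) \<omega>)) * S \<omega>) \<longlonglongrightarrow> 0 * S \<omega>" by (intro tendsto_intros elim)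
    then show ?case using elim by (simp add: aff_def)
  qed
  show "distr M0 borel (\<lambda>\<omega>. pint (wI c) (real n) (incr X0 0 \<omega>)) = distr M borel (\<lambda>\<omega>. pint (wB c) (real n) (incr X 0 \<omega>))" for n
    using reversal_law[OF X, of "real n"] by simp
qed (use Zm law pint_measurable_incr[OF X0] pint_measurable_incr[OF X] V in \<open>auto simp: affine_process_def\<close>)

lemma indep_start_const: "indep_start M0 (\<lambda>_. a) X0"
  unfolding indep_start_def
proof (intro conjI pair_measure_eqI[symmetric])
  have m: "incr X0 0 \<in> M0 \<rightarrow>\<^sub>M path_space" using incr_processD(3)[OF cp_processD(1)[OF X0]] by simp
  show "sigma_finite_measure (distr M0 borel (\<lambda>_. a))" "sigma_finite_measure (distr M0 path_space (incr X0 0))"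
    using m by (auto intro!: prob_space_imp_sigma_finite M0.prob_space_distr prob_space_return)
  show "sets (distr M0 borel (\<lambda>_. a) \<Otimes>\<^sub>M distr M0 path_space (incr X0 0)) =
    sets (distr M0 (borel \<Otimes>\<^sub>M path_space) (\<lambda>\<omega>. (a, incr X0 0 \<omega>)))" by (simp cong: sets_pair_measure_cong)
  fix A B assume "A \<in> sets (distr M0 borel (\<lambda>_. a))" "B \<in> sets (distr M0 path_space (incr X0 0))"
  then have A: "A \<in> sets borel" and B: "B \<in> sets path_space" by auto
  have mm: "(\<lambda>\<omega>. (a, incr X0 0 \<omega>)) \<in> M0 \<rightarrow>\<^sub>M borel \<Otimes>\<^sub>M path_space" using m by measurable
  show "emeasure (distr M0 borel (\<lambda>_. a)) A * emeasure (distr M0 path_space (incr X0 0)) B =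
    emeasure (distr M0 (borel \<Otimes>\<^sub>M path_space) (\<lambda>\<omega>. (a, incr X0 0 \<omega>))) (A \<times> B)"
  proof (cases "a \<in> A")
    case True
    have "(\<lambda>\<omega>. (a, incr X0 0 \<omega>)) -` (A \<times> B) \<inter> space M0 = incr X0 0 -` B \<inter> space M0" using True by auto
    then show ?thesis using True A B m mm by (simp add: emeasure_distr M0.emeasure_space_1)
  next
    case False
    have "(\<lambda>\<omega>. (a, incr X0 0 \<omega>)) -` (A \<times> B) \<inter> space M0 = {}" using False by auto
    then show ?thesis using False A B m mm by (simp add: emeasure_distr)
  qed
qed simp

text \<open>Write I(t) for the \<open>wI\<close> integral and B(t) for the \<open>wB\<close> one.
  One step of the flow over time \<open>h\<close>, started from I(n) with an independent path, has
  the law of I(n+h): replace I(n) by B(n), apply the flow property, and reverse again. As n grows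
  the start tends to \<open>Z\<close> and the result to \<open>Z\<close> too.\<close>

lemma affine_invariant:
  fixes M :: "'a measure" and X :: "real \<Rightarrow> 'a \<Rightarrow> real \<times> real"
  assumes X: "cp_process M X \<kappa> u v w" and V: "affine_process M c X S V"
    and S: "distr M borel S = distr M0 borel Z" and h: "0 \<le> h"
  shows "distr M borel (V h) = distr M0 borel Z"
proof -
  define B where "B t \<omega> = pint (wB c) t (incr X0 0 \<omega>)" for t \<omega>
  define I where "I t \<omega> = pint (wI c) t (incr X0 0 \<omega>)" for t \<omega>
  have Bm: "B t \<in> borel_measurable M0" and Im: "I t \<in> borel_measurable M0" if "0 \<le> t" for t
    unfolding B_def[abs_def] I_def[abs_def] using pint_measurable_incr[OF X0 that] by auto
  have BI: "distr M0 borel (B t) = distr M0 borel (I t)" if "0 \<le> t" for t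
    unfolding B_def[abs_def] I_def[abs_def] by (rule reversal_law[OF X0 that])
  \<comment> \<open>The \<open>wB\<close> integral is the recursion started at 0, so the joint law
    of its value and the later increments is known.\<close>
  have Baff: "affine_process M0 c X0 (\<lambda>_. 0) B"
    unfolding affine_process_def
  proof (intro conjI)
    show "AE \<omega> in M0. \<forall>t\<ge>0. B t \<omega> = c powr (- fst (X0 t \<omega>)) * 0 + jint (wB c) t (\<lambda>s. X0 s \<omega>)"
      using cp_process_incr0[OF X0]
    proof eventually_elim
      case (elim \<omega>)
      have "pint (wB c) t (incr X0 0 \<omega>) = jint (wB c) t (\<lambda>s. X0 s \<omega>)" if "0 \<le> t" for t
        using pint_cong[of t "incr X0 0 \<omega>" "\<lambda>s. X0 s \<omega>" "wB c"] pint_eq_jint[of "\<lambda>s. X0 s \<omega>" t "wB c"] cp_path_step elim that by auto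
      then show ?case by (simp add: B_def)
    qed
  qed (use Bm indep_start_const in auto)
  let ?P0 = "distr M0 path_space (incr X0 0)"
  have im: "incr X0 0 \<in> M0 \<rightarrow>\<^sub>M path_space" using incr_processD(3)[OF cp_processD(1)[OF X0]] by simp
  interpret P0: prob_space ?P0 using im by (rule M0.prob_space_distr)
  interpret MP: pair_prob_space M0 ?P0 by unfold_locales
  have am: "aff c h \<in> borel_measurable (borel \<Otimes>\<^sub>M path_space)" using aff_measurable[OF h] .
  have sMP: "sets (M0 \<Otimes>\<^sub>M ?P0) = sets (M0 \<Otimes>\<^sub>M path_space)" by (simp cong: sets_pair_measure_cong)
  have Um: "(\<lambda>p. aff c h (f (fst p), snd p)) \<in> borel_measurable (M0 \<Otimes>\<^sub>M ?P0)" if "f \<in> borel_measurable M0" for f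
    unfolding measurable_cong_sets[OF sMP refl] using that am by measurable
  have Ulaw: "distr (M0 \<Otimes>\<^sub>M ?P0) borel (\<lambda>p. aff c h (f (fst p), snd p)) = distr (distr M0 borel f \<Otimes>\<^sub>M ?P0) borel (aff c h)"
    if f: "f \<in> borel_measurable M0" for f
  proof -
    have idP: "distr ?P0 path_space (\<lambda>x. x) = ?P0" by (intro distr_id2) simp
    have "distr M0 borel f \<Otimes>\<^sub>M ?P0 = distr M0 borel f \<Otimes>\<^sub>M distr ?P0 path_space (\<lambda>x. x)" by (simp only: idP)
    also have "\<dots> = distr (M0 \<Otimes>\<^sub>M ?P0) (borel \<Otimes>\<^sub>M path_space) (\<lambda>(x, y). (f x, y))"
      using f by (intro pair_measure_distr) (auto intro!: prob_space_imp_sigma_finite simp: idP P0.prob_space_axioms)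
    finally have e: "distr M0 borel f \<Otimes>\<^sub>M ?P0 = distr (M0 \<Otimes>\<^sub>M ?P0) (borel \<Otimes>\<^sub>M path_space) (\<lambda>(x, y). (f x, y))" .
    show ?thesis unfolding e
      using am f sMP by (subst distr_distr) (auto simp: comp_def case_prod_beta' measurable_cong_sets[OF sMP refl])
  qed
  \<comment> \<open>The second factor of the product space supplies the independent path.\<close>
  have step: "distr (M0 \<Otimes>\<^sub>M ?P0) borel (\<lambda>p. aff c h (I (real n) (fst p), snd p)) = distr M0 borel (I (real n + h))" for n
  proof -
    have n: "0 \<le> real n" by simp
    have "distr (M0 \<Otimes>\<^sub>M ?P0) borel (\<lambda>p. aff c h (I (real n) (fst p), snd p)) = distr (distr M0 borel (B (real n)) \<Otimes>\<^sub>M ?P0) borel (aff c h)"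
      unfolding Ulaw[OF Im[OF n]] BI[OF n] ..
    also have "distr M0 borel (B (real n)) \<Otimes>\<^sub>M ?P0 = distr M0 (borel \<Otimes>\<^sub>M path_space) (\<lambda>\<omega>. (B (real n) \<omega>, incr X0 (real n) \<omega>))"
      by (rule affine_joint_law[OF X0 c Baff n, symmetric])
    also have "distr \<dots> borel (aff c h) = distr M0 borel (\<lambda>\<omega>. aff c h (B (real n) \<omega>, incr X0 (real n) \<omega>))"
      using am Bm[OF n] incr_processD(3)[OF cp_processD(1)[OF X0] n] by (subst distr_distr) (auto simp: comp_def)
    also have "\<dots> = distr M0 borel (B (real n + h))"
      using affine_AE[OF X0 c Baff n h] Bm[of "real n + h"] Bm[OF n] incr_processD(3)[OF cp_processD(1)[OF X0] n] h am
      by (intro distr_cong_AE) (auto elim: eventually_mono)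
    also have "\<dots> = distr M0 borel (I (real n + h))" using h by (intro BI) simp
    finally show ?thesis .
  qed
  have "distr M0 borel Z = distr (M0 \<Otimes>\<^sub>M ?P0) borel (\<lambda>p. aff c h (Z (fst p), snd p))"
  proof (rule law_limit_eq[OF MP.P.prob_space_axioms M0.prob_space_axioms, where U = "\<lambda>n p. aff c h (I (real n) (fst p), snd p)" and W = "\<lambda>n. I (real n + h)"])
    show "AE \<omega> in M0. (\<lambda>n. I (real n + h) \<omega>) \<longlonglongrightarrow> Z \<omega>"
      unfolding I_def by (rule pint_seq_limit[OF h])
    have "AE \<omega> in M0. (\<lambda>n. I (real n) \<omega>) \<longlonglongrightarrow> Z \<omega>"
      unfolding I_def using pint_seq_limit[of 0] by simp
    then have "AE p in M0 \<Otimes>\<^sub>M ?P0. (\<lambda>n. I (real n) (fst p)) \<longlonglongrightarrow> Z (fst p)"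
      by (rule AE_pair_fst[OF P0.prob_space_axioms])
    then show "AE p in M0 \<Otimes>\<^sub>M ?P0. (\<lambda>n. aff c h (I (real n) (fst p), snd p)) \<longlonglongrightarrow> aff c h (Z (fst p), snd p)"
      by eventually_elim (auto simp: aff_def intro!: tendsto_intros)
    show "distr (M0 \<Otimes>\<^sub>M ?P0) borel (\<lambda>p. aff c h (I (real n) (fst p), snd p)) = distr M0 borel (I (real n + h))" for n
      by (rule step)
  qed (use Um Im Zm h in auto)
  also have "\<dots> = distr (distr M borel S \<Otimes>\<^sub>M ?P0) borel (aff c h)"
    unfolding Ulaw[OF Zm] S ..
  also have "?P0 = distr M path_space (incr X 0)" by (rule cp_process_law_incr[OF X0 X order_refl order_refl])
  also have "distr M borel S \<Otimes>\<^sub>M distr M path_space (incr X 0) = distr M (borel \<Otimes>\<^sub>M path_space) (\<lambda>\<omega>. (S \<omega>, incr X 0 \<omega>))"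
    using V by (simp add: affine_process_def indep_start_def)
  also have "distr \<dots> borel (aff c h) = distr M borel (\<lambda>\<omega>. aff c h (S \<omega>, incr X 0 \<omega>))"
    using am V incr_processD(3)[OF cp_processD(1)[OF X] order_refl]
    by (subst distr_distr) (auto simp: comp_def affine_process_def indep_start_def)
  also have "\<dots> = distr M borel (V h)"
    using affine_AE0[OF X c V h] am V h incr_processD(3)[OF cp_processD(1)[OF X] order_refl]
    by (intro distr_cong_AE) (auto simp: affine_process_def indep_start_def elim: eventually_mono)
  finally show ?thesis by simp
qed

end

section \<open>Stochastic integrals with respect to step processes\<close>

lemma AE_tendsto_in_prob:
  fixes U :: "nat \<Rightarrow> 'a \<Rightarrow> real"
  assumes M: "prob_space M" and [measurable]: "\<And>n. U n \<in> borel_measurable M" "U' \<in> borel_measurable M"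
    and lim: "AE \<omega> in M. (\<lambda>n. U n \<omega>) \<longlonglongrightarrow> U' \<omega>"
  shows "converges_in_prob M U U'"
  unfolding converges_in_prob_def
proof (intro conjI allI impI)
  interpret prob_space M by fact
  fix \<epsilon> :: real assume e: "0 < \<epsilon>"
  have "(\<lambda>n. \<integral>\<omega>. indicator {\<omega> \<in> space M. \<bar>U n \<omega> - U' \<omega>\<bar> > \<epsilon>} \<omega> \<partial>M) \<longlonglongrightarrow> (\<integral>\<omega>. 0 \<partial>M :: real)"
  proof (rule integral_dominated_convergence[where w = "\<lambda>_. 1"])
    show "AE \<omega> in M. (\<lambda>n. indicator {\<omega> \<in> space M. \<bar>U n \<omega> - U' \<omega>\<bar> > \<epsilon>} \<omega>) \<longlonglongrightarrow> (0 :: real)"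
      using lim
    proof eventually_elim
      case (elim \<omega>)
      have "\<forall>\<^sub>F n in sequentially. \<bar>U n \<omega> - U' \<omega>\<bar> < \<epsilon>"
        using tendstoD[OF elim e] by (simp add: dist_real_def)
      then have "\<forall>\<^sub>F n in sequentially. indicator {\<omega> \<in> space M. \<bar>U n \<omega> - U' \<omega>\<bar> > \<epsilon>} \<omega> = (0::real)"
        by eventually_elim (auto simp: indicator_def)
      then show ?case by (rule tendsto_eventually)
    qed
  qed (auto simp: indicator_def)
  then show "(\<lambda>n. prob {\<omega> \<in> space M. \<bar>U n \<omega> - U' \<omega>\<bar> > \<epsilon>}) \<longlonglongrightarrow> 0" by simp
qed fact+

text \<open>If the limits differ by more than \<epsilon>, the n-th variable differs from one of them
  by more than \<epsilon>/2.\<close>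

lemma converges_in_prob_unique:
  assumes M: "prob_space M" and A: "converges_in_prob M U A" and B: "converges_in_prob M U B"
  shows "AE \<omega> in M. A \<omega> = B \<omega>"
proof -
  interpret prob_space M by fact
  have [measurable]: "U n \<in> borel_measurable M" "A \<in> borel_measurable M" "B \<in> borel_measurable M" for n
    using A B by (auto simp: converges_in_prob_def)
  have z: "prob {\<omega> \<in> space M. \<bar>A \<omega> - B \<omega>\<bar> > \<epsilon>} = 0" if e: "0 < \<epsilon>" for \<epsilon>
  proof -
    have le: "prob {\<omega> \<in> space M. \<bar>A \<omega> - B \<omega>\<bar> > \<epsilon>} \<le>
        prob {\<omega> \<in> space M. \<bar>U n \<omega> - A \<omega>\<bar> > \<epsilon> / 2} + prob {\<omega> \<in> space M. \<bar>U n \<omega> - B \<omega>\<bar> > \<epsilon> / 2}" for n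
    proof -
      have "prob {\<omega> \<in> space M. \<bar>A \<omega> - B \<omega>\<bar> > \<epsilon>} \<le>
        prob ({\<omega> \<in> space M. \<bar>U n \<omega> - A \<omega>\<bar> > \<epsilon> / 2} \<union> {\<omega> \<in> space M. \<bar>U n \<omega> - B \<omega>\<bar> > \<epsilon> / 2})"
      proof (rule finite_measure_mono)
        show "{\<omega> \<in> space M. \<bar>A \<omega> - B \<omega>\<bar> > \<epsilon>} \<subseteq>
          {\<omega> \<in> space M. \<bar>U n \<omega> - A \<omega>\<bar> > \<epsilon> / 2} \<union> {\<omega> \<in> space M. \<bar>U n \<omega> - B \<omega>\<bar> > \<epsilon> / 2}"
        proof
          fix \<omega> assume w: "\<omega> \<in> {\<omega> \<in> space M. \<bar>A \<omega> - B \<omega>\<bar> > \<epsilon>}"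
          have "\<bar>A \<omega> - B \<omega>\<bar> \<le> \<bar>U n \<omega> - A \<omega>\<bar> + \<bar>U n \<omega> - B \<omega>\<bar>" by linarith
          moreover have "\<epsilon> < \<bar>A \<omega> - B \<omega>\<bar>" using w by simp
          ultimately have "\<bar>U n \<omega> - A \<omega>\<bar> > \<epsilon> / 2 \<or> \<bar>U n \<omega> - B \<omega>\<bar> > \<epsilon> / 2" by linarith
          then show "\<omega> \<in> {\<omega> \<in> space M. \<bar>U n \<omega> - A \<omega>\<bar> > \<epsilon> / 2} \<union> {\<omega> \<in> space M. \<bar>U n \<omega> - B \<omega>\<bar> > \<epsilon> / 2}"
            using w by auto
        qed
      qed measurable
      also have "\<dots> \<le> prob {\<omega> \<in> space M. \<bar>U n \<omega> - A \<omega>\<bar> > \<epsilon> / 2} + prob {\<omega> \<in> space M. \<bar>U n \<omega> - B \<omega>\<bar> > \<epsilon> / 2}"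
        by (intro measure_Un_le) measurable
      finally show ?thesis .
    qed
    have e2: "0 < \<epsilon> / 2" using e by simp
    have lA: "(\<lambda>n. prob {\<omega> \<in> space M. \<bar>U n \<omega> - A \<omega>\<bar> > \<epsilon> / 2}) \<longlonglongrightarrow> 0"
      using A e2 unfolding converges_in_prob_def by blast
    have lB: "(\<lambda>n. prob {\<omega> \<in> space M. \<bar>U n \<omega> - B \<omega>\<bar> > \<epsilon> / 2}) \<longlonglongrightarrow> 0"
      using B e2 unfolding converges_in_prob_def by blast
    note tendsto_add[OF lA lB]
    then have "prob {\<omega> \<in> space M. \<bar>A \<omega> - B \<omega>\<bar> > \<epsilon>} \<le> 0 + 0"
      by (rule LIMSEQ_le_const) (use le in auto)
    then show ?thesis using measure_nonneg[of M "{\<omega> \<in> space M. \<bar>A \<omega> - B \<omega>\<bar> > \<epsilon>}"] by linarith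
  qed
  have "AE \<omega> in M. \<forall>n. \<not> \<bar>A \<omega> - B \<omega>\<bar> > inverse (real (Suc n))"
  proof (subst AE_all_countable, intro allI)
    fix n
    have "{\<omega> \<in> space M. \<bar>A \<omega> - B \<omega>\<bar> > inverse (real (Suc n))} \<in> null_sets M"
      using z[of "inverse (real (Suc n))"] by (intro null_setsI) (auto simp: emeasure_eq_measure simp del: of_nat_Suc)
    then show "AE \<omega> in M. \<not> \<bar>A \<omega> - B \<omega>\<bar> > inverse (real (Suc n))"
      by (rule AE_I') (auto simp del: of_nat_Suc)
  qed
  then show ?thesis
  proof eventually_elim
    case (elim \<omega>)
    have "\<not> 0 < \<bar>A \<omega> - B \<omega>\<bar>"
    proof
      assume "0 < \<bar>A \<omega> - B \<omega>\<bar>"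
      from reals_Archimedean[OF this] elim show False by auto
    qed
    then show ?case by simp
  qed
qed

text \<open>The pathwise value of the integral when the integrator \<open>f\<close> is a step path;
  the integrand enters through its left limits only, so it may be any cadlag path.\<close>

definition left_int :: "(real \<Rightarrow> real) \<Rightarrow> (real \<Rightarrow> real) \<Rightarrow> real \<Rightarrow> real" where
  "left_int g f t = (\<Sum>r\<in>jumps f 0 t. Lim (at_left r) g * jump f r)"

lemma left_int_step_path: "step_path f \<Longrightarrow> step_path (left_int g f)"
proof -
  assume f: "step_path f"
  have "left_int g f = jsum {r. 0 < r \<and> jump f r \<noteq> 0} (\<lambda>r. Lim (at_left r) g * jump f r)"
    by (simp add: left_int_def jsum_def jumps_Int fun_eq_iff)
  then show ?thesis using jsum_step_path[OF finite_jump_points[OF f]] by simp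
qed

lemma left_int_cong:
  assumes "\<And>s. 0 \<le> s \<Longrightarrow> s \<le> t \<Longrightarrow> g s = g' s"
  shows "left_int g f t = left_int g' f t"
  unfolding left_int_def
  using assms by (intro sum.cong refl) (auto simp: jumps_def intro!: Lim_at_left_cong)

lemma cadlag_eqI:
  fixes f g :: "real \<Rightarrow> 'b::t2_space"
  assumes f: "cadlag f" and g: "cadlag g" and eq: "\<And>q. 0 \<le> q \<Longrightarrow> q \<in> \<rat> \<Longrightarrow> f q = g q" and t: "0 \<le> t"
  shows "f t = g t"
proof (rule ccontr)
  assume ne: "f t \<noteq> g t"
  obtain U V where UV: "open U" "open V" "f t \<in> U" "g t \<in> V" "U \<inter> V = {}"
    using hausdorff[OF ne] by metis
  have "\<forall>\<^sub>F s in at_right t. f s \<in> U \<and> g s \<in> V"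
    using topological_tendstoD[OF cadlag_right[OF f t] UV(1,3)] topological_tendstoD[OF cadlag_right[OF g t] UV(2,4)]
    by eventually_elim auto
  then obtain b where b: "t < b" "\<And>s. t < s \<Longrightarrow> s < b \<Longrightarrow> f s \<in> U \<and> g s \<in> V"
    unfolding eventually_at_right_field by auto
  obtain q where "q \<in> \<rat>" "t < q" "q < b" using Rats_dense_in_real[OF b(1)] by auto
  then show False using b(2)[of q] eq[of q] UV(5) t by auto
qed

text \<open>Along uniform partitions the sums converge almost surely to the pathwise integral and in
  probability to \<open>I t\<close>, so the two agree for each fixed time, hence at all rational
  times, and by right continuity everywhere.\<close>

lemma has_left_integral_AE:
  assumes M: "prob_space M" and I: "has_left_integral M Y X I" and X: "AE \<omega> in M. step_path (\<lambda>t. X t \<omega>)"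
  shows "AE \<omega> in M. \<forall>t\<ge>0. I t \<omega> = left_int (\<lambda>t. Y t \<omega>) (\<lambda>t. X t \<omega>) t"
proof -
  interpret prob_space M by fact
  have cl: "AE \<omega> in M. cadlag (\<lambda>t. Y t \<omega>) \<and> cadlag (\<lambda>t. X t \<omega>) \<and> cadlag (\<lambda>t. I t \<omega>)"
    using I by (simp add: has_left_integral_def)
  have ae: "AE \<omega> in M. I t \<omega> = left_int (\<lambda>t. Y t \<omega>) (\<lambda>t. X t \<omega>) t" if t: "0 \<le> t" for t
  proof -
    let ?S = "\<lambda>n \<omega>. \<Sum>i<Suc n. Y (unif t n i) \<omega> * (X (unif t n (Suc i)) \<omega> - X (unif t n i) \<omega>)"
    have cp: "converges_in_prob M ?S (I t)"
      using I t unif_partitions[OF t] unfolding has_left_integral_def partitions_def by blast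
    then have [measurable]: "?S n \<in> borel_measurable M" for n by (simp add: converges_in_prob_def)
    have lim: "AE \<omega> in M. (\<lambda>n. ?S n \<omega>) \<longlonglongrightarrow> left_int (\<lambda>t. Y t \<omega>) (\<lambda>t. X t \<omega>) t"
      using cl X unfolding left_int_def
      by eventually_elim (intro left_partition_sum_limit t unif_partitions, auto)
    \<comment> \<open>The \<open>lim\<close> of the sums stands in for \<open>left_int\<close>,
      whose measurability has not been established.\<close>
    have "converges_in_prob M ?S (\<lambda>\<omega>. lim (\<lambda>n. ?S n \<omega>))"
    proof (rule AE_tendsto_in_prob[OF M])
      show "(\<lambda>\<omega>. lim (\<lambda>n. ?S n \<omega>)) \<in> borel_measurable M" by (intro borel_measurable_lim_metric) measurable
      show "AE \<omega> in M. (\<lambda>n. ?S n \<omega>) \<longlonglongrightarrow> lim (\<lambda>n. ?S n \<omega>)"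
        using lim by eventually_elim (simp add: limI)
    qed measurable
    from converges_in_prob_unique[OF M cp this] lim show ?thesis
      by eventually_elim (simp add: limI)
  qed
  have "countable (\<rat> \<inter> {0..} :: real set)" using countable_rat by blast
  then have "AE \<omega> in M. \<forall>q\<in>\<rat> \<inter> {0..}. I q \<omega> = left_int (\<lambda>t. Y t \<omega>) (\<lambda>t. X t \<omega>) q"
    using ae by (subst AE_ball_countable) auto
  with cl X show ?thesis
  proof eventually_elim
    case (elim \<omega>)
    show ?case
    proof (intro allI impI)
      fix t :: real assume t: "0 \<le> t"
      show "I t \<omega> = left_int (\<lambda>t. Y t \<omega>) (\<lambda>t. X t \<omega>) t"
      proof (rule cadlag_eqI[OF _ _ _ t])
        show "cadlag (\<lambda>t. I t \<omega>)" using elim by blast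
        show "cadlag (left_int (\<lambda>t. Y t \<omega>) (\<lambda>t. X t \<omega>))"
          using elim by (intro step_path_cadlag left_int_step_path)
      qed (use elim in auto)
    qed
  qed
qed

lemma has_left_integralI:
  assumes M: "prob_space M" and m: "\<And>t. 0 \<le> t \<Longrightarrow> Y t \<in> borel_measurable M" "\<And>t. 0 \<le> t \<Longrightarrow> X t \<in> borel_measurable M"
      "\<And>t. 0 \<le> t \<Longrightarrow> I t \<in> borel_measurable M"
    and ae: "AE \<omega> in M. cadlag (\<lambda>t. Y t \<omega>) \<and> step_path (\<lambda>t. X t \<omega>) \<and> (\<forall>t\<ge>0. I t \<omega> = left_int (\<lambda>t. Y t \<omega>) (\<lambda>t. X t \<omega>) t)"
  shows "has_left_integral M Y X I"
  unfolding has_left_integral_def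
proof (intro conjI allI impI m)
  show "AE \<omega> in M. cadlag (\<lambda>t. Y t \<omega>) \<and> cadlag (\<lambda>t. X t \<omega>) \<and> cadlag (\<lambda>t. I t \<omega>)"
    using ae
  proof eventually_elim
    case (elim \<omega>)
    then have "step_path (\<lambda>t. I t \<omega>)"
      by (intro step_path_cong[of "\<lambda>t. I t \<omega>" "left_int (\<lambda>t. Y t \<omega>) (\<lambda>t. X t \<omega>)"] left_int_step_path) auto
    then show ?case using elim by (auto intro: step_path_cadlag)
  qed
  fix t :: real and k :: "nat \<Rightarrow> nat" and \<tau> :: "nat \<Rightarrow> nat \<Rightarrow> real"
  assume t: "0 \<le> t" and p: "(\<forall>n. \<tau> n 0 = 0 \<and> \<tau> n (k n) = t \<and> (\<forall>i<k n. \<tau> n i \<le> \<tau> n (Suc i))) \<and>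
    (\<forall>\<delta>>0. \<forall>\<^sub>F n in sequentially. \<forall>i<k n. \<tau> n (Suc i) - \<tau> n i < \<delta>)"
  then have part: "partitions t k \<tau>" by (simp add: partitions_def)
  show "converges_in_prob M (\<lambda>n \<omega>. \<Sum>i<k n. Y (\<tau> n i) \<omega> * (X (\<tau> n (Suc i)) \<omega> - X (\<tau> n i) \<omega>)) (I t)"
  proof (rule AE_tendsto_in_prob[OF M _ m(3)[OF t]])
    have "0 \<le> \<tau> n i" if "i \<le> k n" for n i
      using partition_mono[of "k n" "\<tau> n" 0 i] p that by auto
    then show "(\<lambda>\<omega>. \<Sum>i<k n. Y (\<tau> n i) \<omega> * (X (\<tau> n (Suc i)) \<omega> - X (\<tau> n i) \<omega>)) \<in> borel_measurable M" for n
      by (intro borel_measurable_sum borel_measurable_times borel_measurable_diff m) auto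
    show "AE \<omega> in M. (\<lambda>n. \<Sum>i<k n. Y (\<tau> n i) \<omega> * (X (\<tau> n (Suc i)) \<omega> - X (\<tau> n i) \<omega>)) \<longlonglongrightarrow> I t \<omega>"
      using ae
    proof eventually_elim
      case (elim \<omega>)
      then show ?case
        using left_partition_sum_limit[of "\<lambda>t. X t \<omega>" "\<lambda>t. Y t \<omega>", OF _ _ t part] t by (simp add: left_int_def)
    qed
  qed
qed

lemma left_int_discount:
  assumes x: "step_path x"
  shows "left_int (\<lambda>t. c powr (- fst (x t))) (\<lambda>t. snd (x t)) t = jint (wI c) t x"
  unfolding left_int_def jint_def wI_def
proof (intro sum.cong refl)
  fix r assume "r \<in> jumps (\<lambda>t. snd (x t)) 0 t"
  then have "0 < r" by (auto simp: jumps_def)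
  from Lim_step_comp[OF step_path_fst[OF x] this, of "\<lambda>a. c powr (- a)"]
  show "Lim (at_left r) (\<lambda>t. c powr - fst (x t)) * jump (\<lambda>t. snd (x t)) r =
    c powr - Lim (at_left r) (\<lambda>r. fst (x r)) * jump (\<lambda>r. snd (x r)) r" by simp
qed

text \<open>The variation over any partition is at most the sum of the absolute jumps.\<close>

lemma finite_variation_step:
  assumes f: "step_path f"
  shows "finite_variation f"
  unfolding finite_variation_def
proof (intro allI impI)
  fix t :: real assume t: "0 \<le> t"
  let ?J = "jumps f 0 t"
  have fin: "finite ?J" using finite_jumps[OF f] by simp
  show "\<exists>B. \<forall>m \<tau>. \<tau> 0 = 0 \<and> \<tau> m = t \<and> (\<forall>i<m. \<tau> i \<le> \<tau> (Suc i)) \<longrightarrow> (\<Sum>i<m. \<bar>f (\<tau> (Suc i)) - f (\<tau> i)\<bar>) \<le> B"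
  proof (intro exI allI impI, elim conjE)
    fix m and \<tau> :: "nat \<Rightarrow> real" assume p: "\<tau> 0 = 0" "\<tau> m = t" "\<forall>i<m. \<tau> i \<le> \<tau> (Suc i)"
    have mono: "0 \<le> \<tau> i" "\<tau> i \<le> t" if "i \<le> m" for i
      using partition_mono[OF p(3), of 0 i] partition_mono[OF p(3), of i m] p that by auto
    have "(\<Sum>i<m. \<bar>f (\<tau> (Suc i)) - f (\<tau> i)\<bar>) \<le> (\<Sum>i<m. \<Sum>r\<in>?J. indicator {\<tau> i<..\<tau> (Suc i)} r * \<bar>jump f r\<bar>)"
    proof (intro sum_mono)
      fix i assume i: "i \<in> {..<m}"
      then have "f (\<tau> (Suc i)) - f (\<tau> i) = (\<Sum>r\<in>jumps f (\<tau> i) (\<tau> (Suc i)). jump f r)"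
        by (intro step_path_diff_eq_sum_jumps[OF f]) (use mono p in auto)
      then have "\<bar>f (\<tau> (Suc i)) - f (\<tau> i)\<bar> \<le> (\<Sum>r\<in>jumps f (\<tau> i) (\<tau> (Suc i)). \<bar>jump f r\<bar>)"
        by (simp add: sum_abs)
      also have "\<dots> = (\<Sum>r\<in>?J. indicator {\<tau> i<..\<tau> (Suc i)} r * \<bar>jump f r\<bar>)"
        using mono[of i] mono[of "Suc i"] i
        by (intro sum.mono_neutral_cong_left fin) (auto simp: jumps_def indicator_def)
      finally show "\<bar>f (\<tau> (Suc i)) - f (\<tau> i)\<bar> \<le> (\<Sum>r\<in>?J. indicator {\<tau> i<..\<tau> (Suc i)} r * \<bar>jump f r\<bar>)" .
    qed
    also have "\<dots> = (\<Sum>r\<in>?J. (\<Sum>i<m. indicator {\<tau> i<..\<tau> (Suc i)} r) * \<bar>jump f r\<bar>)"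
      by (subst sum.swap) (simp only: sum_distrib_right)
    also have "\<dots> = (\<Sum>r\<in>?J. \<bar>jump f r\<bar>)"
      unfolding partition_sum_indicator[OF p(3)] using p by (intro sum.cong) (auto simp: jumps_def)
    finally show "(\<Sum>i<m. \<bar>f (\<tau> (Suc i)) - f (\<tau> i)\<bar>) \<le> (\<Sum>r\<in>?J. \<bar>jump f r\<bar>)" .
  qed
qed

text \<open>With the constant filtration, adaptedness is plain measurability; the local martingale
  part is 0 and \<open>X\<close> itself is the part of finite variation.\<close>

lemma semimartingale_step:
  assumes M: "prob_space M" and X: "\<And>t. 0 \<le> t \<Longrightarrow> X t \<in> borel_measurable M"
    and step: "AE \<omega> in M. step_path (\<lambda>t. X t \<omega>)"
  shows "semimartingale M (\<lambda>_. M) X"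
proof -
  interpret prob_space M by fact
  have mart: "is_martingale M (\<lambda>_. M) (\<lambda>t \<omega>. 0)"
    unfolding is_martingale_def adapted_def
  proof (intro conjI allI impI)
    have "subalgebra M M" by (simp add: subalgebra_def)
    then interpret sigma_finite_subalgebra M M
      by (intro finite_measure_subalgebra_is_sigma_finite finite_measure_subalgebra.intro finite_measure_subalgebra_axioms.intro finite_measure_axioms)
    show "AE \<omega> in M. real_cond_exp M M (\<lambda>\<omega>. 0) \<omega> = 0"
      by (rule real_cond_exp_F_meas) auto
  qed auto
  have "local_martingale M (\<lambda>_. M) (\<lambda>t \<omega>. 0)"
    unfolding local_martingale_def
  proof (intro conjI exI[of _ "\<lambda>n \<omega>. real n"] allI)
    show "adapted (\<lambda>_. M) (\<lambda>t \<omega>. 0)" by (simp add: adapted_def)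
    show "AE \<omega> in M. cadlag (\<lambda>t. 0::real)" using step_path_cadlag[OF step_path_const] by auto
    show "stopping_time (\<lambda>_. M) (\<lambda>\<omega>. real n)" for n by (simp add: stopping_time_def)
    show "AE \<omega> in M. incseq (\<lambda>n. real n) \<and> filterlim real at_top sequentially"
      by (simp add: incseq_def filterlim_real_sequentially)
  qed (use mart in auto)
  moreover have "adapted (\<lambda>_. M) X" using X by (simp add: adapted_def)
  moreover have "AE \<omega> in M. cadlag (\<lambda>t. X t \<omega>) \<and> finite_variation (\<lambda>t. X t \<omega>)"
    using step by eventually_elim (auto intro: step_path_cadlag finite_variation_step)
  ultimately show ?thesis
    unfolding semimartingale_def by (intro exI[of _ "\<lambda>t \<omega>. 0"] exI[of _ X]) auto
qed

section \<open>Transfer of Levy processes\<close>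

lemma levy_processD:
  assumes "levy_process M X"
  shows "prob_space M" "0 \<le> t \<Longrightarrow> X t \<in> borel_measurable M" "AE \<omega> in M. X 0 \<omega> = 0" "AE \<omega> in M. cadlag (\<lambda>t. X t \<omega>)"
  using assms by (simp_all add: levy_process_def)

lemma levy_linear:
  fixes X :: "real \<Rightarrow> 'a \<Rightarrow> 'b::euclidean_space" and f :: "'b \<Rightarrow> 'c::euclidean_space"
  assumes X: "levy_process M X" and f: "bounded_linear f"
  shows "levy_process M (\<lambda>t \<omega>. f (X t \<omega>))"
proof -
  interpret f: bounded_linear f by fact
  obtain K where K: "K > 0" "\<And>x. norm (f x) \<le> norm x * K" using f.pos_bounded by blast
  have fm: "f \<in> borel_measurable borel"
    by (intro borel_measurable_continuous_onI linear_continuous_on f)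
  have prob: "prob_space M" and Xm: "\<And>t. 0 \<le> t \<Longrightarrow> X t \<in> borel_measurable M" using levy_processD[OF X] by auto
  interpret prob_space M by fact
  have iX: "incr_process M X" by (rule levy_incr_process[OF X])
  have m: "(\<lambda>\<omega>. f (X t \<omega>)) \<in> borel_measurable M" if "0 \<le> t" for t
    using measurable_compose[OF Xm[OF that] fm] .
  show ?thesis
    unfolding levy_process_def
  proof (intro conjI allI impI prob m)
    show "AE \<omega> in M. f (X 0 \<omega>) = 0" using levy_processD(3)[OF X] by eventually_elim (simp add: f.zero)
    fix n :: nat and \<tau> :: "nat \<Rightarrow> real" assume t: "0 \<le> \<tau> 0 \<and> (\<forall>i<n. \<tau> i \<le> \<tau> (Suc i))"
    have "indep_vars (\<lambda>_. borel) (\<lambda>i \<omega>. X (\<tau> (Suc i)) \<omega> - X (\<tau> i) \<omega>) {..<n}"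
      using t by (intro incr_process_indep[OF iX]) auto
    from indep_vars_compose2[OF this, of "\<lambda>_. f" "\<lambda>_. borel"]
    show "indep_vars (\<lambda>_. borel) (\<lambda>i \<omega>. f (X (\<tau> (Suc i)) \<omega>) - f (X (\<tau> i) \<omega>)) {..<n}"
      using fm by (simp add: f.diff)
  next
    fix s h :: real assume s: "0 \<le> s" and h: "0 \<le> h"
    have "distr M borel (\<lambda>\<omega>. f (X (s + h) \<omega>) - f (X s \<omega>)) = distr (distr M borel (\<lambda>\<omega>. X (s + h) \<omega> - X s \<omega>)) borel f"
      using Xm[of "s + h"] Xm[OF s] fm s h by (subst distr_distr) (auto simp: comp_def f.diff)
    also have "distr M borel (\<lambda>\<omega>. X (s + h) \<omega> - X s \<omega>) = distr M borel (X h)"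
      using incr_processD(5)[OF iX s, of "s + h"] h by simp
    also have "distr (distr M borel (X h)) borel f = distr M borel (\<lambda>\<omega>. f (X h \<omega>))"
      using Xm[OF h] fm by (subst distr_distr) (auto simp: comp_def)
    finally show "distr M borel (\<lambda>\<omega>. f (X (s + h) \<omega>) - f (X s \<omega>)) = distr M borel (\<lambda>\<omega>. f (X h \<omega>))" .
  next
    fix t \<epsilon> :: real assume t: "0 \<le> t" and e: "0 < \<epsilon>"
    have lim: "((\<lambda>s. prob {\<omega> \<in> space M. norm (X s \<omega> - X t \<omega>) > \<epsilon> / K}) \<longlongrightarrow> 0) (at t within {0..})"
      using X t e K unfolding levy_process_def by simp
    show "((\<lambda>s. prob {\<omega> \<in> space M. norm (f (X s \<omega>) - f (X t \<omega>)) > \<epsilon>}) \<longlongrightarrow> 0) (at t within {0..})"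
    proof (rule tendsto_sandwich[OF _ _ tendsto_const lim])
      show "\<forall>\<^sub>F s in at t within {0..}. prob {\<omega> \<in> space M. norm (f (X s \<omega>) - f (X t \<omega>)) > \<epsilon>} \<le> prob {\<omega> \<in> space M. norm (X s \<omega> - X t \<omega>) > \<epsilon> / K}"
        unfolding eventually_at_filter
      proof (intro always_eventually allI impI)
        fix s :: real assume "s \<in> {0..}"
        then have [measurable]: "X s \<in> borel_measurable M" "X t \<in> borel_measurable M" using Xm t by auto
        show "prob {\<omega> \<in> space M. norm (f (X s \<omega>) - f (X t \<omega>)) > \<epsilon>} \<le> prob {\<omega> \<in> space M. norm (X s \<omega> - X t \<omega>) > \<epsilon> / K}"
        proof (rule finite_measure_mono)
          show "{\<omega> \<in> space M. norm (f (X s \<omega>) - f (X t \<omega>)) > \<epsilon>} \<subseteq> {\<omega> \<in> space M. norm (X s \<omega> - X t \<omega>) > \<epsilon> / K}"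
          proof safe
            fix \<omega> assume "norm (f (X s \<omega>) - f (X t \<omega>)) > \<epsilon>"
            then have "\<epsilon> < norm (X s \<omega> - X t \<omega>) * K" using K(2)[of "X s \<omega> - X t \<omega>"] by (simp add: f.diff)
            then show "norm (X s \<omega> - X t \<omega>) > \<epsilon> / K" using K(1) by (simp add: divide_less_eq)
          qed
        qed measurable
      qed
    qed simp
  next
    have "AE \<omega> in M. cadlag (\<lambda>t. X t \<omega>)" using X by (simp add: levy_process_def)
    then show "AE \<omega> in M. cadlag (\<lambda>t. f (X t \<omega>))"
    proof eventually_elim
      case (elim \<omega>)
      show ?case
        unfolding cadlag_def
      proof (intro conjI allI impI)
        fix t :: real assume "0 \<le> t"
        then show "continuous (at_right t) (\<lambda>t. f (X t \<omega>))"
          unfolding continuous_within by (intro f.tendsto cadlag_right[OF elim])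
      next
        fix t :: real assume "0 < t"
        from f.tendsto[OF cadlag_left[OF elim this]] show "\<exists>l. ((\<lambda>t. f (X t \<omega>)) \<longlongrightarrow> l) (at_left t)" by blast
      qed
    qed
  qed
qed

lemma distr_fst_compose:
  assumes P: "prob_space P" and f: "f \<in> M \<rightarrow>\<^sub>M N"
  shows "distr (M \<Otimes>\<^sub>M P) N (\<lambda>p. f (fst p)) = distr M N f"
proof -
  have e: "distr (M \<Otimes>\<^sub>M P) M fst = M" by (rule prob_space.distr_pair_fst[OF P])
  have "distr (M \<Otimes>\<^sub>M P) N (\<lambda>p. f (fst p)) = distr (distr (M \<Otimes>\<^sub>M P) M fst) N f"
    by (subst distr_distr) (auto simp: comp_def f)
  then show ?thesis unfolding e .
qed

text \<open>The second factor of the product makes room for an independent starting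
  variable.\<close>

lemma levy_lift:
  fixes X :: "real \<Rightarrow> 'a \<Rightarrow> 'b::euclidean_space"
  assumes X: "levy_process M X" and P: "prob_space P"
  shows "levy_process (M \<Otimes>\<^sub>M P) (\<lambda>t p. X t (fst p))"
proof -
  have prob: "prob_space M" and Xm: "\<And>t. 0 \<le> t \<Longrightarrow> X t \<in> borel_measurable M" using levy_processD[OF X] by auto
  interpret M: prob_space M by fact
  interpret P: prob_space P by fact
  interpret MP: pair_prob_space M P by unfold_locales
  have iX: "incr_process M X" by (rule levy_incr_process[OF X])
  have m: "(\<lambda>p. X t (fst p)) \<in> borel_measurable (M \<Otimes>\<^sub>M P)" if "0 \<le> t" for t
    using measurable_compose[OF measurable_fst Xm[OF that]] .
  show ?thesis
    unfolding levy_process_def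
  proof (intro conjI allI impI m MP.P.prob_space_axioms)
    show "AE p in M \<Otimes>\<^sub>M P. X 0 (fst p) = 0" by (rule AE_pair_fst[OF P levy_processD(3)[OF X]])
    show "AE p in M \<Otimes>\<^sub>M P. cadlag (\<lambda>t. X t (fst p))" by (rule AE_pair_fst[OF P levy_processD(4)[OF X]])
    fix n :: nat and \<tau> :: "nat \<Rightarrow> real" assume t: "0 \<le> \<tau> 0 \<and> (\<forall>i<n. \<tau> i \<le> \<tau> (Suc i))"
    let ?D = "\<lambda>i \<omega>. X (\<tau> (Suc i)) \<omega> - X (\<tau> i) \<omega>"
    have ind: "M.indep_vars (\<lambda>_. borel) ?D {..<n}"
      using t by (intro incr_process_indep[OF iX]) auto
    have rv: "?D i \<in> borel_measurable M" if "i \<in> {..<n}" for i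
      using ind that by (auto simp: M.indep_vars_def)
    show "MP.P.indep_vars (\<lambda>_. borel) (\<lambda>i p. ?D i (fst p)) {..<n}"
    proof (cases "n = 0")
      case True
      then show ?thesis by (simp add: MP.P.indep_vars_def MP.P.indep_sets_def)
    next
      case False
      then have ne: "{..<n} \<noteq> {}" by auto
      have rv2: "(\<lambda>p. ?D i (fst p)) \<in> borel_measurable (M \<Otimes>\<^sub>M P)" if "i \<in> {..<n}" for i
        using measurable_compose[OF measurable_fst rv[OF that]] .
      have "distr (M \<Otimes>\<^sub>M P) (PiM {..<n} (\<lambda>_. borel)) (\<lambda>p. \<lambda>i\<in>{..<n}. ?D i (fst p)) = distr M (PiM {..<n} (\<lambda>_. borel)) (\<lambda>\<omega>. \<lambda>i\<in>{..<n}. ?D i \<omega>)"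
        by (rule distr_fst_compose[OF P]) (intro measurable_restrict rv)
      also have "\<dots> = PiM {..<n} (\<lambda>i. distr M borel (?D i))"
        using M.indep_vars_iff_distr_eq_PiM'[OF ne, of ?D "\<lambda>_. borel"] rv ind by blast
      also have "\<dots> = PiM {..<n} (\<lambda>i. distr (M \<Otimes>\<^sub>M P) borel (\<lambda>p. ?D i (fst p)))"
        by (intro PiM_cong refl distr_fst_compose[OF P, symmetric] rv)
      finally show ?thesis
        using MP.P.indep_vars_iff_distr_eq_PiM'[OF ne, of "\<lambda>i p. ?D i (fst p)" "\<lambda>_. borel"] rv2 by blast
    qed
  next
    fix s h :: real assume s: "0 \<le> s" and h: "0 \<le> h"
    have "distr (M \<Otimes>\<^sub>M P) borel (\<lambda>p. X (s + h) (fst p) - X s (fst p)) = distr M borel (\<lambda>\<omega>. X (s + h) \<omega> - X s \<omega>)"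
      using s h by (intro distr_fst_compose[OF P] borel_measurable_diff Xm) auto
    also have "\<dots> = distr M borel (X h)" using incr_processD(5)[OF iX s, of "s + h"] h by simp
    also have "\<dots> = distr (M \<Otimes>\<^sub>M P) borel (\<lambda>p. X h (fst p))" by (rule distr_fst_compose[OF P Xm[OF h], symmetric])
    finally show "distr (M \<Otimes>\<^sub>M P) borel (\<lambda>p. X (s + h) (fst p) - X s (fst p)) = distr (M \<Otimes>\<^sub>M P) borel (\<lambda>p. X h (fst p))" .
  next
    fix t \<epsilon> :: real assume t: "0 \<le> t" and e: "0 < \<epsilon>"
    have lim: "((\<lambda>s. M.prob {\<omega> \<in> space M. norm (X s \<omega> - X t \<omega>) > \<epsilon>}) \<longlongrightarrow> 0) (at t within {0..})"
      using X t e unfolding levy_process_def by simp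
    have eq: "measure (M \<Otimes>\<^sub>M P) {p \<in> space (M \<Otimes>\<^sub>M P). norm (X s (fst p) - X t (fst p)) > \<epsilon>} = M.prob {\<omega> \<in> space M. norm (X s \<omega> - X t \<omega>) > \<epsilon>}"
      if "0 \<le> s" for s
    proof -
      have [measurable]: "X s \<in> borel_measurable M" "X t \<in> borel_measurable M" using Xm t that by auto
      have e: "distr (M \<Otimes>\<^sub>M P) M fst = M" by (rule prob_space.distr_pair_fst[OF P])
      have "M.prob {\<omega> \<in> space M. norm (X s \<omega> - X t \<omega>) > \<epsilon>} = measure (distr (M \<Otimes>\<^sub>M P) M fst) {\<omega> \<in> space M. norm (X s \<omega> - X t \<omega>) > \<epsilon>}"
        unfolding e ..
      also have "\<dots> = measure (M \<Otimes>\<^sub>M P) (fst -` {\<omega> \<in> space M. norm (X s \<omega> - X t \<omega>) > \<epsilon>} \<inter> space (M \<Otimes>\<^sub>M P))"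
        by (rule measure_distr) measurable
      also have "fst -` {\<omega> \<in> space M. norm (X s \<omega> - X t \<omega>) > \<epsilon>} \<inter> space (M \<Otimes>\<^sub>M P) = {p \<in> space (M \<Otimes>\<^sub>M P). norm (X s (fst p) - X t (fst p)) > \<epsilon>}"
        by (auto simp: space_pair_measure)
      finally show ?thesis by simp
    qed
    show "((\<lambda>s. measure (M \<Otimes>\<^sub>M P) {p \<in> space (M \<Otimes>\<^sub>M P). norm (X s (fst p) - X t (fst p)) > \<epsilon>}) \<longlongrightarrow> 0) (at t within {0..})"
      using lim by (rule Lim_transform_eventually) (auto simp: eventually_at_filter eq)
  qed
qed

lemma eq_in_law_lift:
  fixes X :: "real \<Rightarrow> 'a \<Rightarrow> 'b::euclidean_space"
  assumes P: "prob_space P" and X: "\<And>t. 0 \<le> t \<Longrightarrow> X t \<in> borel_measurable M"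
  shows "eq_in_law (M \<Otimes>\<^sub>M P) (\<lambda>t p. X t (fst p)) M X"
proof (rule eq_in_lawI[where F = "\<lambda>t x. x t" and \<xi> = "\<lambda>p. \<lambda>t\<in>{0..}. X t (fst p)" and \<xi>' = "\<lambda>\<omega>. \<lambda>t\<in>{0..}. X t \<omega>" and P = path_space])
  show m: "(\<lambda>\<omega>. \<lambda>t\<in>{0..}. X t \<omega>) \<in> M \<rightarrow>\<^sub>M path_space" using X by (intro measurable_restrict) auto
  show "(\<lambda>p. \<lambda>t\<in>{0..}. X t (fst p)) \<in> M \<Otimes>\<^sub>M P \<rightarrow>\<^sub>M path_space"
    using measurable_compose[OF measurable_fst m] .
  show "distr (M \<Otimes>\<^sub>M P) path_space (\<lambda>p. \<lambda>t\<in>{0..}. X t (fst p)) = distr M path_space (\<lambda>\<omega>. \<lambda>t\<in>{0..}. X t \<omega>)"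
    by (rule distr_fst_compose[OF P m])
qed (auto intro: path_component_measurable)

lemma indep_initial_lift:
  assumes M: "prob_space M" and P: "prob_space P" and sP: "sets P = sets borel"
    and A: "\<And>t. 0 \<le> t \<Longrightarrow> A t \<in> borel_measurable M" and B: "\<And>t. 0 \<le> t \<Longrightarrow> B t \<in> borel_measurable M"
  shows "indep_initial (M \<Otimes>\<^sub>M P) snd (\<lambda>t p. A t (fst p)) (\<lambda>t p. B t (fst p))"
proof -
  interpret M: prob_space M by fact
  interpret P: prob_space P by fact
  interpret MP: pair_prob_space M P by unfold_locales
  let ?R = "\<lambda>p. \<lambda>t\<in>{0..}. (A t (fst p), B t (fst p))" and ?Q = "\<lambda>\<omega>. \<lambda>t\<in>{0..}. (A t \<omega>, B t \<omega>)"
  let ?PS = "PiM {0..} (\<lambda>_. borel) :: (real \<Rightarrow> real \<times> real) measure"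
  have sm: "snd \<in> borel_measurable (M \<Otimes>\<^sub>M P)" using measurable_snd[of M P] unfolding measurable_cong_sets[OF refl sP] .
  have R0: "?Q \<in> M \<rightarrow>\<^sub>M ?PS" using A B by (intro measurable_restrict borel_measurable_Pair) auto
  have spR: "?Q \<omega> \<in> space ?PS" for \<omega> by (auto simp: space_PiM)
  show ?thesis
    unfolding indep_initial_def
  proof (intro conjI sm MP.P.indep_setI)
    have s1: "sets (vimage_algebra (space (M \<Otimes>\<^sub>M P)) snd borel) = {snd -` C \<inter> space (M \<Otimes>\<^sub>M P) |C. C \<in> sets borel}"
      by (rule sets_vimage_algebra2) auto
    have s2: "sets (vimage_algebra (space (M \<Otimes>\<^sub>M P)) ?R ?PS) = {?R -` C \<inter> space (M \<Otimes>\<^sub>M P) |C. C \<in> sets ?PS}"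
      by (rule sets_vimage_algebra2) (use spR in auto)
    have e1: "snd -` C \<inter> space (M \<Otimes>\<^sub>M P) = space M \<times> C" if "C \<in> sets borel" for C
      using that sets.sets_into_space[of C P] sP by (auto simp: space_pair_measure)
    have e2: "?R -` C \<inter> space (M \<Otimes>\<^sub>M P) = (?Q -` C \<inter> space M) \<times> space P" for C
      by (auto simp: space_pair_measure)
    show "sets (vimage_algebra (space (M \<Otimes>\<^sub>M P)) snd borel) \<subseteq> MP.P.events"
      unfolding s1 using measurable_sets[OF sm] by auto
    show "sets (vimage_algebra (space (M \<Otimes>\<^sub>M P)) ?R ?PS) \<subseteq> MP.P.events"
      unfolding s2 e2 using measurable_sets[OF R0] by auto
    fix a b assume "a \<in> sets (vimage_algebra (space (M \<Otimes>\<^sub>M P)) snd borel)" "b \<in> sets (vimage_algebra (space (M \<Otimes>\<^sub>M P)) ?R ?PS)"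
    then obtain C D where C: "C \<in> sets borel" "a = space M \<times> C" and D: "D \<in> sets ?PS" "b = (?Q -` D \<inter> space M) \<times> space P"
      unfolding s1 s2 using e1 e2 by auto
    have CP: "C \<in> sets P" using C sP by simp
    have DM: "?Q -` D \<inter> space M \<in> sets M" using measurable_sets[OF R0 D(1)] .
    have t: "measure (M \<Otimes>\<^sub>M P) (E \<times> G) = M.prob E * P.prob G" if "E \<in> sets M" "G \<in> sets P" for E G
      using that unfolding measure_def by (simp add: P.emeasure_pair_measure_Times enn2real_mult)
    have "a \<inter> b = (?Q -` D \<inter> space M) \<times> C" using C D sets.sets_into_space[OF CP] by auto
    then show "measure (M \<Otimes>\<^sub>M P) (a \<inter> b) = measure (M \<Otimes>\<^sub>M P) a * measure (M \<Otimes>\<^sub>M P) b"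
      using t[OF DM CP] t[OF sets.top CP] t[OF DM sets.top] C(2) D(2) by (simp add: M.prob_space P.prob_space)
  qed
qed

text \<open>The increments of \<open>X\<close> are a measurable image of the pair (A, B), so
  independence of the generated sigma-algebras passes to them and becomes the product law of
  \<open>indep_start\<close>.\<close>

lemma indep_start_of_initial:
  assumes M: "prob_space M" and ind: "indep_initial M S A B"
    and A: "\<And>t. 0 \<le> t \<Longrightarrow> A t \<in> borel_measurable M" and B: "\<And>t. 0 \<le> t \<Longrightarrow> B t \<in> borel_measurable M"
    and \<Psi>: "\<Psi> \<in> path_space \<rightarrow>\<^sub>M path_space" and X: "\<And>\<omega>. incr X 0 \<omega> = \<Psi> (\<lambda>t\<in>{0..}. (A t \<omega>, B t \<omega>))"
  shows "indep_start M S X"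
  unfolding indep_start_def
proof (intro conjI pair_measure_eqI[symmetric])
  interpret prob_space M by fact
  let ?R = "\<lambda>\<omega>. \<lambda>t\<in>{0..}. (A t \<omega>, B t \<omega>)"
  let ?PS = "PiM {0..} (\<lambda>_. borel) :: (real \<Rightarrow> real \<times> real) measure"
  have R: "?R \<in> M \<rightarrow>\<^sub>M ?PS" using A B by (intro measurable_restrict borel_measurable_Pair) auto
  show S: "S \<in> borel_measurable M" using ind by (simp add: indep_initial_def)
  have I: "incr X 0 \<in> M \<rightarrow>\<^sub>M path_space"
    using measurable_compose[OF R \<Psi>] X by (simp add: ext[of "incr X 0" "\<lambda>\<omega>. \<Psi> (?R \<omega>)"])
  show "sigma_finite_measure (distr M borel S)" "sigma_finite_measure (distr M path_space (incr X 0))"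
    using S I by (auto intro!: prob_space_imp_sigma_finite prob_space_distr)
  show "sets (distr M borel S \<Otimes>\<^sub>M distr M path_space (incr X 0)) = sets (distr M (borel \<Otimes>\<^sub>M path_space) (\<lambda>\<omega>. (S \<omega>, incr X 0 \<omega>)))"
    by (simp cong: sets_pair_measure_cong)
  fix C D assume "C \<in> sets (distr M borel S)" "D \<in> sets (distr M path_space (incr X 0))"
  then have C: "C \<in> sets borel" and D: "D \<in> sets path_space" by auto
  have "prob ((S -` C \<inter> space M) \<inter> (?R -` (\<Psi> -` D \<inter> space ?PS) \<inter> space M)) =
    prob (S -` C \<inter> space M) * prob (?R -` (\<Psi> -` D \<inter> space ?PS) \<inter> space M)"
  proof (rule indep_setD)
    show "indep_set (sets (vimage_algebra (space M) S borel)) (sets (vimage_algebra (space M) ?R ?PS))"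
      using ind by (simp add: indep_initial_def)
    show "S -` C \<inter> space M \<in> sets (vimage_algebra (space M) S borel)" using C by (rule in_vimage_algebra)
    show "?R -` (\<Psi> -` D \<inter> space ?PS) \<inter> space M \<in> sets (vimage_algebra (space M) ?R ?PS)"
      using measurable_sets[OF \<Psi> D] by (rule in_vimage_algebra)
  qed
  moreover have "?R -` (\<Psi> -` D \<inter> space ?PS) \<inter> space M = incr X 0 -` D \<inter> space M"
    using measurable_space[OF R] by (auto simp: X)
  ultimately have "emeasure M ((S -` C \<inter> space M) \<inter> (incr X 0 -` D \<inter> space M)) = emeasure M (S -` C \<inter> space M) * emeasure M (incr X 0 -` D \<inter> space M)"
    by (simp add: emeasure_eq_measure ennreal_mult)
  moreover have "(S -` C \<inter> space M) \<inter> (incr X 0 -` D \<inter> space M) = (\<lambda>\<omega>. (S \<omega>, incr X 0 \<omega>)) -` (C \<times> D) \<inter> space M" by auto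
  moreover have "(\<lambda>\<omega>. (S \<omega>, incr X 0 \<omega>)) \<in> M \<rightarrow>\<^sub>M borel \<Otimes>\<^sub>M path_space" using S I by measurable
  ultimately show "emeasure (distr M borel S) C * emeasure (distr M path_space (incr X 0)) D =
      emeasure (distr M (borel \<Otimes>\<^sub>M path_space) (\<lambda>\<omega>. (S \<omega>, incr X 0 \<omega>))) (C \<times> D)"
    using S I C D by (simp add: emeasure_distr)
qed

section \<open>Generalized Ornstein--Uhlenbeck processes and the SDE as affine recursions\<close>

lemma scale_fst_bounded_linear: "bounded_linear (\<lambda>x :: real \<times> real. (a * fst x, snd x))"
  by (intro bounded_linear_Pair bounded_linear_const_mult bounded_linear_fst bounded_linear_snd)

lemma scale_fst_measurable: "(\<lambda>x :: real \<times> real. (a * fst x, snd x)) \<in> borel_measurable borel"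
  by (intro borel_measurable_continuous_onI linear_continuous_on scale_fst_bounded_linear)

lemma pair_components_measurable:
  assumes "(\<lambda>\<omega>. (f \<omega> :: real, g \<omega> :: real)) \<in> borel_measurable M"
  shows "f \<in> borel_measurable M" "g \<in> borel_measurable M"
  using measurable_compose[OF assms borel_measurable_continuous_onI[OF continuous_on_fst[OF continuous_on_id]]]
    measurable_compose[OF assms borel_measurable_continuous_onI[OF continuous_on_snd[OF continuous_on_id]]] by simp_all

lemma levy_pair_measurable:
  assumes "levy_process M (\<lambda>t \<omega>. (A t \<omega> :: real, B t \<omega> :: real))" "0 \<le> t"
  shows "A t \<in> borel_measurable M" "B t \<in> borel_measurable M"
  using pair_components_measurable[OF levy_processD(2)[OF assms]] by auto

lemma distr_snd_borel:
  assumes M: "prob_space M" and P: "prob_space P" and sP: "sets P = sets borel"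
  shows "distr (M \<Otimes>\<^sub>M P) borel snd = P"
proof (rule measure_eqI)
  interpret M: prob_space M by fact
  interpret P: prob_space P by fact
  show "sets (distr (M \<Otimes>\<^sub>M P) borel snd) = sets P" using sP by simp
  fix A assume "A \<in> sets (distr (M \<Otimes>\<^sub>M P) borel snd)"
  then have A: "A \<in> sets borel" "A \<in> sets P" using sP by auto
  have sm: "snd \<in> borel_measurable (M \<Otimes>\<^sub>M P)"
    using measurable_snd[of M P] unfolding measurable_cong_sets[OF refl sP] .
  have "snd -` A \<inter> space (M \<Otimes>\<^sub>M P) = space M \<times> A"
    using sets.sets_into_space[OF A(2)] by (auto simp: space_pair_measure)
  then show "emeasure (distr (M \<Otimes>\<^sub>M P) borel snd) A = emeasure P A"
    using A sm by (simp add: emeasure_distr P.emeasure_pair_measure_Times M.emeasure_space_1)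
qed

lemma incr_map_measurable:
  fixes g :: "'b::euclidean_space \<Rightarrow> 'c::euclidean_space"
  assumes g: "g \<in> borel_measurable borel"
  shows "(\<lambda>x. \<lambda>q\<in>{0..}. g (x q) - g (x 0)) \<in> path_space \<rightarrow>\<^sub>M path_space"
  by (intro measurable_restrict borel_measurable_diff measurable_compose[OF path_component_measurable g]) auto

lemma transf_map_measurable:
  "(\<lambda>x. \<lambda>q\<in>{0..}. transf_fun c q x - transf_fun c 0 x) \<in> path_space \<rightarrow>\<^sub>M path_space"
  by (intro measurable_restrict borel_measurable_diff transf_fun_measurable) auto

context
  fixes c \<kappa> u v w :: real
  assumes c: "c > 1" and \<kappa>: "0 \<le> \<kappa>" and uvw: "0 \<le> u" "0 \<le> v" "0 \<le> w"
begin

text \<open>The driver of the recursion is not (\<xi>, \<eta>) itself but its rescaling: by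
  \<open>transf_left_integral\<close> the integral equals c^(N(t)) times the \<open>wB\<close> term
  of the rescaled path, and the prefactor exp(-\<xi>) cancels that power.\<close>

lemma gou_affine:
  assumes gou: "gou_process \<Omega> \<xi> \<eta> S V"
    and law: "\<And>t. 0 \<le> t \<Longrightarrow> distr \<Omega> borel (\<lambda>\<omega>. (inverse (ln c) * \<xi> t \<omega>, \<eta> t \<omega>)) = cp_law (c * \<kappa>) (t * u) (t * v) (t * w)"
  obtains Y where "cp_process \<Omega> Y \<kappa> u v w" "affine_process \<Omega> c Y S V"
proof -
  \<comment> \<open>Dividing by \<open>ln c\<close> recovers the counting coordinate from
    \<open>\<xi>\<close>.\<close>
  define X where "X t \<omega> = (inverse (ln c) * \<xi> t \<omega>, \<eta> t \<omega>)" for t \<omega>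
  have lc: "ln c > 0" using c by simp
  have L: "levy_process \<Omega> (\<lambda>t \<omega>. (\<xi> t \<omega>, \<eta> t \<omega>))" and ini: "indep_initial \<Omega> S \<xi> \<eta>"
    and Vm: "\<And>t. 0 \<le> t \<Longrightarrow> V t \<in> borel_measurable \<Omega>"
    using gou by (auto simp: gou_process_def)
  obtain I where I: "has_left_integral \<Omega> (\<lambda>s \<omega>. exp (\<xi> s \<omega>)) \<eta> I"
    and VI: "AE \<omega> in \<Omega>. \<forall>t\<ge>0. V t \<omega> = exp (- \<xi> t \<omega>) * (S \<omega> + I t \<omega>)"
    using gou by (auto simp: gou_process_def)
  have LX: "levy_process \<Omega> X"
    using levy_linear[OF L scale_fst_bounded_linear[of "inverse (ln c)"]] by (simp add: X_def[abs_def])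
  have cX: "cp_process \<Omega> X (c * \<kappa>) u v w"
    using law c \<kappa> by (intro levy_cp_process[OF LX uvw]) (auto simp: X_def[abs_def])
  let ?Y = "transf_process X c"
  have cY: "cp_process \<Omega> ?Y \<kappa> u v w" by (rule transf_cp_process[OF cX uvw c])
  have prob: "prob_space \<Omega>" using cp_processD(2)[OF cX] .
  have ind: "indep_start \<Omega> S ?Y"
  proof (rule indep_start_of_initial[OF prob ini])
    show "(\<lambda>x. (\<lambda>y. \<lambda>q\<in>{0..}. transf_fun c q y - transf_fun c 0 y) ((\<lambda>x. \<lambda>q\<in>{0..}. (inverse (ln c) * fst (x q), snd (x q)) - (inverse (ln c) * fst (x 0), snd (x 0))) x)) \<in> path_space \<rightarrow>\<^sub>M path_space"
      by (rule measurable_compose[OF incr_map_measurable[OF scale_fst_measurable] transf_map_measurable])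
    show "incr ?Y 0 \<omega> = (\<lambda>y. \<lambda>q\<in>{0..}. transf_fun c q y - transf_fun c 0 y) ((\<lambda>x. \<lambda>q\<in>{0..}. (inverse (ln c) * fst (x q), snd (x q)) - (inverse (ln c) * fst (x 0), snd (x 0))) (\<lambda>t\<in>{0..}. (\<xi> t \<omega>, \<eta> t \<omega>)))" for \<omega>
    proof -
      have "(\<lambda>q\<in>{0..}. (inverse (ln c) * fst ((\<lambda>t\<in>{0..}. (\<xi> t \<omega>, \<eta> t \<omega>)) q), snd ((\<lambda>t\<in>{0..}. (\<xi> t \<omega>, \<eta> t \<omega>)) q)) -
          (inverse (ln c) * fst ((\<lambda>t\<in>{0..}. (\<xi> t \<omega>, \<eta> t \<omega>)) 0), snd ((\<lambda>t\<in>{0..}. (\<xi> t \<omega>, \<eta> t \<omega>)) 0))) = incr X 0 \<omega>"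
        by (auto simp: incr_def X_def fun_eq_iff)
      then show ?thesis by (simp only: incr_def[of ?Y] transf_process_def[OF cX uvw c] add_0_left)
    qed
  qed (use levy_pair_measurable[OF L] in auto)
  have "affine_process \<Omega> c ?Y S V"
    unfolding affine_process_def
  proof (intro conjI ind allI impI Vm)
    have st: "AE \<omega> in \<Omega>. step_path (\<lambda>t. \<eta> t \<omega>)"
      using cp_processD(5)[OF cX]
      by eventually_elim (use step_path_snd[OF cp_path_step] in \<open>fastforce simp: X_def\<close>)
    show "AE \<omega> in \<Omega>. \<forall>t\<ge>0. V t \<omega> = c powr (- fst (?Y t \<omega>)) * S \<omega> + jint (wB c) t (\<lambda>s. ?Y s \<omega>)"
      using VI has_left_integral_AE[OF prob I st] transf_process_AE[OF cX uvw c] transf_process_cp_path[OF cX uvw c]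
    proof eventually_elim
      case (elim \<omega>)
      let ?x = "\<lambda>t. X t \<omega>"
      have sx: "step_path ?x" using elim cp_path_step by blast
      have sY: "step_path (\<lambda>t. ?Y t \<omega>)" using elim cp_path_step by blast
      have xe: "exp (\<xi> t \<omega>) = c powr fst (?x t)" for t using c lc by (simp add: X_def powr_def)
      show ?case
      proof (intro allI impI)
        fix t :: real assume t: "0 \<le> t"
        have "I t \<omega> = left_int (\<lambda>t. exp (\<xi> t \<omega>)) (\<lambda>t. \<eta> t \<omega>) t" using elim t by blast
        also have "\<dots> = left_int (\<lambda>t. c powr fst (?x t)) (\<lambda>t. snd (?x t)) t" by (simp add: xe) (simp add: X_def)
        also have "\<dots> = c powr fst (?x t) * jint (wB c) t (transf c ?x)"
          unfolding left_int_def using c by (intro transf_left_integral[OF sx t]) simp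
        also have "jint (wB c) t (transf c ?x) = jint (wB c) t (\<lambda>t. ?Y t \<omega>)"
          using pint_cong[of t "transf c ?x" "\<lambda>t. ?Y t \<omega>" "wB c"] elim t
            pint_eq_jint[OF transf_step_path[OF sx] t] pint_eq_jint[OF sY t] by auto
        finally have It: "I t \<omega> = c powr fst (?x t) * jint (wB c) t (\<lambda>t. ?Y t \<omega>)" .
        have "exp (- \<xi> t \<omega>) = c powr (- fst (?x t))" by (simp add: exp_minus xe powr_minus)
        moreover have "fst (?Y t \<omega>) = fst (?x t)" using elim t by (simp add: transf_def)
        moreover have "c powr (- fst (?x t)) * c powr fst (?x t) = 1" using c by (simp add: powr_add[symmetric])
        ultimately show "V t \<omega> = c powr (- fst (?Y t \<omega>)) * S \<omega> + jint (wB c) t (\<lambda>s. ?Y s \<omega>)"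
          using elim t It by (simp add: distrib_left mult.assoc[symmetric])
      qed
    qed
  qed
  with cY show thesis by (rule that)
qed

text \<open>Almost surely the stochastic integral is a finite sum over the jumps of U, so V solves
  the pathwise linear equation and \<open>affine_path_unique\<close> determines it.\<close>

lemma sde_affine:
  assumes sde: "sde_solution \<Omega> F U L S V"
    and law: "\<And>t. 0 \<le> t \<Longrightarrow> distr \<Omega> borel (\<lambda>\<omega>. (inverse (1 - inverse c) * U t \<omega>, L t \<omega>)) = cp_law \<kappa> (t * u) (t * v) (t * w)"
  obtains X where "cp_process \<Omega> X \<kappa> u v w" "affine_process \<Omega> c X S V"
proof -
  define a where "a = inverse (1 - inverse c)"
  have a: "(1 - inverse c) * a = 1" using c by (simp add: a_def field_simps)
  define X where "X t \<omega> = (a * U t \<omega>, L t \<omega>)" for t \<omega>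
  have Lv: "levy_process \<Omega> (\<lambda>t \<omega>. (U t \<omega>, L t \<omega>))" and ini: "indep_initial \<Omega> S U L"
    and fil: "filtration (space \<Omega>) F" "\<And>t. sets (F t) \<subseteq> sets \<Omega>" "adapted F V"
    using sde by (auto simp: sde_solution_def)
  obtain I where I: "has_left_integral \<Omega> V U I"
    and VI: "AE \<omega> in \<Omega>. \<forall>t\<ge>0. V t \<omega> = S \<omega> - I t \<omega> + (L t \<omega> - L 0 \<omega>)"
    using sde by (auto simp: sde_solution_def)
  have Vm: "V t \<in> borel_measurable \<Omega>" if "0 \<le> t" for t
    using I that by (simp add: has_left_integral_def)
  have LX: "levy_process \<Omega> X"
    using levy_linear[OF Lv scale_fst_bounded_linear[of a]] by (simp add: X_def[abs_def])
  have cX: "cp_process \<Omega> X \<kappa> u v w"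
    using law \<kappa> by (intro levy_cp_process[OF LX uvw]) (auto simp: X_def[abs_def] a_def)
  have prob: "prob_space \<Omega>" using cp_processD(2)[OF cX] .
  have ind: "indep_start \<Omega> S X"
  proof (rule indep_start_of_initial[OF prob ini])
    show "(\<lambda>x :: real \<Rightarrow> real \<times> real. \<lambda>q\<in>{0..}. (a * fst (x q), snd (x q)) - (a * fst (x 0), snd (x 0))) \<in> path_space \<rightarrow>\<^sub>M path_space"
      by (rule incr_map_measurable[OF scale_fst_measurable])
    show "incr X 0 \<omega> = (\<lambda>q\<in>{0..}. (a * fst ((\<lambda>t\<in>{0..}. (U t \<omega>, L t \<omega>)) q), snd ((\<lambda>t\<in>{0..}. (U t \<omega>, L t \<omega>)) q)) -
          (a * fst ((\<lambda>t\<in>{0..}. (U t \<omega>, L t \<omega>)) 0), snd ((\<lambda>t\<in>{0..}. (U t \<omega>, L t \<omega>)) 0)))" for \<omega>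
      by (auto simp: incr_def X_def fun_eq_iff)
  qed (use levy_pair_measurable[OF Lv] in auto)
  have Ux: "U t \<omega> = (1 - inverse c) * fst (X t \<omega>)" for t \<omega>
    by (simp add: X_def a mult.assoc[symmetric])
  have "affine_process \<Omega> c X S V"
    unfolding affine_process_def
  proof (intro conjI ind allI impI Vm)
    have st: "AE \<omega> in \<Omega>. step_path (\<lambda>t. U t \<omega>)"
      using cp_processD(5)[OF cX]
    proof eventually_elim
      case (elim \<omega>)
      show ?case unfolding Ux using step_path_U[OF elim c] .
    qed
    show "AE \<omega> in \<Omega>. \<forall>t\<ge>0. V t \<omega> = c powr (- fst (X t \<omega>)) * S \<omega> + jint (wB c) t (\<lambda>s. X s \<omega>)"
      using VI has_left_integral_AE[OF prob I st] cp_processD(5)[OF cX]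
    proof eventually_elim
      case (elim \<omega>)
      let ?x = "\<lambda>t. X t \<omega>"
      have L0: "L 0 \<omega> = 0" using elim(3) by (simp add: cp_path_def X_def zero_prod_def)
      have "V t \<omega> = affine_path ?x c (S \<omega>) t" if t: "0 \<le> t" for t
      proof (rule affine_path_unique[OF elim(3) c _ t])
        fix t :: real assume t: "0 \<le> t"
        have "V t \<omega> = S \<omega> - left_int (\<lambda>t. V t \<omega>) (\<lambda>t. U t \<omega>) t + snd (?x t)"
          using elim(1,2) t L0 by (simp add: X_def)
        then show "V t \<omega> = S \<omega> - (\<Sum>r\<in>jumps (\<lambda>r. (1 - inverse c) * fst (?x r)) 0 t.
          Lim (at_left r) (\<lambda>t. V t \<omega>) * jump (\<lambda>r. (1 - inverse c) * fst (?x r)) r) + snd (?x t)"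
          unfolding left_int_def Ux .
      qed
      then show ?case by (simp add: affine_path_def[OF elim(3) c])
    qed
  qed
  with cX show thesis by (rule that)
qed

section \<open>Existence of realizations on a product space\<close>

lemma gou_exists:
  fixes M :: "'a measure" and N L :: "real \<Rightarrow> 'a \<Rightarrow> real"
  assumes L: "levy_process M (\<lambda>t \<omega>. (N t \<omega>, L t \<omega>))"
    and law: "\<And>t. 0 \<le> t \<Longrightarrow> distr M borel (\<lambda>\<omega>. (N t \<omega>, L t \<omega>)) = cp_law (c * \<kappa>) (t * u) (t * v) (t * w)"
    and \<rho>: "prob_space \<rho>" "sets \<rho> = sets borel"
  shows "\<exists>\<Omega> V. gou_realization M (\<lambda>t \<omega>. ln c * N t \<omega>) L \<rho> \<Omega> V"
proof -
  let ?\<Omega> = "M \<Otimes>\<^sub>M \<rho>"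
  let ?X = "\<lambda>t \<omega>. (N t \<omega>, L t \<omega>)"
  have cX: "cp_process M ?X (c * \<kappa>) u v w"
    using law c \<kappa> by (intro levy_cp_process[OF L uvw]) auto
  let ?Y = "transf_process ?X c"
  have cY: "cp_process M ?Y \<kappa> u v w" by (rule transf_cp_process[OF cX uvw c])
  have prob: "prob_space M" using cp_processD(2)[OF cX] .
  interpret M: prob_space M by fact
  interpret R: prob_space \<rho> by fact
  interpret MR: pair_prob_space M \<rho> by unfold_locales
  have Lc: "levy_process M (\<lambda>t \<omega>. (ln c * N t \<omega>, L t \<omega>))"
    using levy_linear[OF L scale_fst_bounded_linear[of "ln c"]] by simp
  define \<xi> where "\<xi> t p = ln c * N t (fst p)" for t and p :: "'a \<times> real"
  define \<eta> where "\<eta> t p = L t (fst p)" for t and p :: "'a \<times> real"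
  \<comment> \<open>The integral in the form predicted by \<open>transf_left_integral\<close>, with
    \<open>pint\<close> for measurability.\<close>
  define I where "I t p = exp (\<xi> t p) * pint (wB c) t (incr ?Y 0 (fst p))" for t p
  define V where "V t p = exp (- \<xi> t p) * (snd p + I t p)" for t p
  have sm [measurable]: "snd \<in> borel_measurable ?\<Omega>" using measurable_snd[of M \<rho>] unfolding measurable_cong_sets[OF refl \<rho>(2)] .
  have [measurable]: "\<xi> t \<in> borel_measurable ?\<Omega>" "\<eta> t \<in> borel_measurable ?\<Omega>" if "0 \<le> t" for t
    unfolding \<xi>_def[abs_def] \<eta>_def[abs_def]
    using measurable_compose[OF measurable_fst levy_pair_measurable(1)[OF Lc that]]
      measurable_compose[OF measurable_fst levy_pair_measurable(2)[OF Lc that]] by auto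
  have pm: "(\<lambda>p. pint (wB c) t (incr ?Y 0 (fst p))) \<in> borel_measurable ?\<Omega>" if "0 \<le> t" for t
    using measurable_compose[OF measurable_fst measurable_compose[OF incr_processD(3)[OF cp_processD(1)[OF cY] order_refl] functional_measurable(5)[OF that]]] .
  have Im: "I t \<in> borel_measurable ?\<Omega>" if "0 \<le> t" for t
    unfolding I_def[abs_def] using pm[OF that] \<open>0 \<le> t \<Longrightarrow> \<xi> t \<in> borel_measurable ?\<Omega>\<close>[OF that] by measurable
  have Vm: "V t \<in> borel_measurable ?\<Omega>" if "0 \<le> t" for t
    unfolding V_def[abs_def] using Im[OF that] \<open>0 \<le> t \<Longrightarrow> \<xi> t \<in> borel_measurable ?\<Omega>\<close>[OF that] by measurable
  have hl: "has_left_integral ?\<Omega> (\<lambda>s p. exp (\<xi> s p)) \<eta> I"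
  proof (rule has_left_integralI[OF MR.P.prob_space_axioms _ _ Im])
    have "AE \<omega> in M. step_path (\<lambda>t. N t \<omega>) \<and> step_path (\<lambda>t. L t \<omega>) \<and> (\<forall>t\<ge>0. exp (ln c * N t \<omega>) * pint (wB c) t (incr ?Y 0 \<omega>) =
        left_int (\<lambda>t. exp (ln c * N t \<omega>)) (\<lambda>t. L t \<omega>) t)"
      using transf_process_AE[OF cX uvw c] cp_process_incr0[OF cY]
    proof eventually_elim
      case (elim \<omega>)
      let ?x = "\<lambda>t. ?X t \<omega>"
      have sx: "step_path ?x" using elim cp_path_step by blast
      have sN: "step_path (\<lambda>t. N t \<omega>)" "step_path (\<lambda>t. L t \<omega>)" using step_path_fst[OF sx] step_path_snd[OF sx] by simp_all
      have "exp (ln c * N t \<omega>) * pint (wB c) t (incr ?Y 0 \<omega>) = left_int (\<lambda>t. exp (ln c * N t \<omega>)) (\<lambda>t. L t \<omega>) t" if t: "0 \<le> t" for t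
      proof -
        have "pint (wB c) t (incr ?Y 0 \<omega>) = pint (wB c) t (transf c ?x)"
          using elim t by (intro pint_cong) auto
        also have "\<dots> = jint (wB c) t (transf c ?x)" by (rule pint_eq_jint[OF transf_step_path[OF sx] t])
        finally show ?thesis
          using transf_left_integral[OF sx t, of c] c by (simp add: left_int_def powr_def mult.commute)
      qed
      then show ?case using sN by blast
    qed
    from AE_pair_fst[OF \<rho>(1) this]
    show "AE p in ?\<Omega>. cadlag (\<lambda>t. exp (\<xi> t p)) \<and> step_path (\<lambda>t. \<eta> t p) \<and> (\<forall>t\<ge>0. I t p = left_int (\<lambda>t. exp (\<xi> t p)) (\<lambda>t. \<eta> t p) t)"
      unfolding \<xi>_def \<eta>_def I_def
      by eventually_elim (use step_path_cadlag[OF step_path_comp[of _ "\<lambda>a. exp (ln c * a)"]] in auto)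
  qed measurable
  have "gou_process ?\<Omega> \<xi> \<eta> snd V"
    unfolding gou_process_def
  proof (intro conjI exI[of _ I] hl allI impI Vm)
    show "levy_process ?\<Omega> (\<lambda>t p. (\<xi> t p, \<eta> t p))" unfolding \<xi>_def \<eta>_def using levy_lift[OF Lc \<rho>(1)] by simp
    show "indep_initial ?\<Omega> snd \<xi> \<eta>" unfolding \<xi>_def[abs_def] \<eta>_def[abs_def]
      using levy_pair_measurable[OF Lc] by (intro indep_initial_lift[OF prob \<rho>]) auto
    show "AE p in ?\<Omega>. \<forall>t\<ge>0. V t p = exp (- \<xi> t p) * (snd p + I t p)" by (simp add: V_def)
  qed
  moreover have "distr ?\<Omega> borel snd = \<rho>"
    by (rule distr_snd_borel[OF prob \<rho>])
  moreover have "eq_in_law ?\<Omega> (\<lambda>t p. (\<xi> t p, \<eta> t p)) M (\<lambda>t \<omega>. (ln c * N t \<omega>, L t \<omega>))"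
    unfolding \<xi>_def \<eta>_def using eq_in_law_lift[OF \<rho>(1) levy_processD(2)[OF Lc]] by simp
  ultimately show ?thesis unfolding gou_realization_def by blast
qed

lemma sde_exists:
  fixes M :: "'a measure" and N L :: "real \<Rightarrow> 'a \<Rightarrow> real"
  assumes L: "levy_process M (\<lambda>t \<omega>. (N t \<omega>, L t \<omega>))"
    and law: "\<And>t. 0 \<le> t \<Longrightarrow> distr M borel (\<lambda>\<omega>. (N t \<omega>, L t \<omega>)) = cp_law \<kappa> (t * u) (t * v) (t * w)"
    and \<rho>: "prob_space \<rho>" "sets \<rho> = sets borel"
  shows "\<exists>\<Omega> V. sde_realization M (\<lambda>t \<omega>. (1 - inverse c) * N t \<omega>) L \<rho> \<Omega> V"
proof -
  let ?\<Omega> = "M \<Otimes>\<^sub>M \<rho>"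
  let ?X = "\<lambda>t \<omega>. (N t \<omega>, L t \<omega>)"
  have cX: "cp_process M ?X \<kappa> u v w"
    using law \<kappa> by (intro levy_cp_process[OF L uvw]) auto
  have prob: "prob_space M" using cp_processD(2)[OF cX] .
  interpret M: prob_space M by fact
  interpret R: prob_space \<rho> by fact
  interpret MR: pair_prob_space M \<rho> by unfold_locales
  have Lc: "levy_process M (\<lambda>t \<omega>. ((1 - inverse c) * N t \<omega>, L t \<omega>))"
    using levy_linear[OF L scale_fst_bounded_linear[of "1 - inverse c"]] by simp
  define U where "U t p = (1 - inverse c) * N t (fst p)" for t and p :: "'a \<times> real"
  define L' where "L' t p = L t (fst p)" for t and p :: "'a \<times> real"
  define V where "V t p = aff c t (snd p, incr ?X 0 (fst p))" for t and p :: "'a \<times> real"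
  \<comment> \<open>\<open>I\<close> is defined from the equation, which then holds trivially; that
    it is the integral of V against U is the content of \<open>affine_path_solves\<close>.\<close>
  define I where "I t p = snd p - V t p + (L' t p - L' 0 p)" for t p
  have sm [measurable]: "snd \<in> borel_measurable ?\<Omega>" using measurable_snd[of M \<rho>] unfolding measurable_cong_sets[OF refl \<rho>(2)] .
  have Um: "U t \<in> borel_measurable ?\<Omega>" and Lm: "L' t \<in> borel_measurable ?\<Omega>" if "0 \<le> t" for t
    unfolding U_def[abs_def] L'_def[abs_def]
    using measurable_compose[OF measurable_fst levy_pair_measurable(1)[OF Lc that]]
      measurable_compose[OF measurable_fst levy_pair_measurable(2)[OF Lc that]] by auto
  have Vm: "V t \<in> borel_measurable ?\<Omega>" if "0 \<le> t" for t
    unfolding V_def[abs_def]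
    using measurable_compose[OF measurable_Pair[OF sm measurable_compose[OF measurable_fst incr_processD(3)[OF cp_processD(1)[OF cX] order_refl]]] aff_measurable[OF that]] .
  have Im: "I t \<in> borel_measurable ?\<Omega>" if "0 \<le> t" for t
    unfolding I_def[abs_def] using Vm[OF that] Lm[OF that] Lm[of 0] by measurable
  have st: "AE p in ?\<Omega>. step_path (\<lambda>t. U t p) \<and> step_path (\<lambda>t. L' t p)"
  proof -
    have "AE \<omega> in M. step_path (\<lambda>t. (1 - inverse c) * N t \<omega>) \<and> step_path (\<lambda>t. L t \<omega>)"
      using cp_processD(5)[OF cX]
    proof eventually_elim
      case (elim \<omega>)
      show ?case using step_path_U[OF elim c] step_path_snd[OF cp_path_step[OF elim]] by simp
    qed
    from AE_pair_fst[OF \<rho>(1) this] show ?thesis by (simp add: U_def L'_def)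
  qed
  have hl: "has_left_integral ?\<Omega> V U I"
  proof (rule has_left_integralI[OF MR.P.prob_space_axioms Vm Um Im])
    show "AE p in ?\<Omega>. cadlag (\<lambda>t. V t p) \<and> step_path (\<lambda>t. U t p) \<and> (\<forall>t\<ge>0. I t p = left_int (\<lambda>t. V t p) (\<lambda>t. U t p) t)"
      using st AE_pair_fst[OF \<rho>(1) cp_process_incr0[OF cX]]
    proof eventually_elim
      case (elim p)
      let ?x = "\<lambda>t. ?X t (fst p)"
      have x: "cp_path \<kappa> ?x" using elim by blast
      have Va: "V t p = affine_path ?x c (snd p) t" if t: "0 \<le> t" for t
      proof -
        have "pint (wB c) t (incr ?X 0 (fst p)) = pint (wB c) t ?x" using elim t by (intro pint_cong) auto
        also have "\<dots> = jint (wB c) t ?x" by (rule pint_eq_jint[OF cp_path_step[OF x] t])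
        finally show ?thesis using elim t by (simp add: V_def aff_def affine_path_def[OF x c])
      qed
      have sV: "step_path (\<lambda>t. V t p)" by (rule step_path_cong[OF Va affine_path_step[OF x c]])
      have L0: "L 0 (fst p) = 0" using x by (simp add: cp_path_def zero_prod_def)
      have "I t p = left_int (\<lambda>t. V t p) (\<lambda>t. U t p) t" if t: "0 \<le> t" for t
      proof -
        have "left_int (\<lambda>t. V t p) (\<lambda>t. U t p) t = left_int (affine_path ?x c (snd p)) (\<lambda>t. U t p) t"
          using Va by (intro left_int_cong) auto
        then show ?thesis
          using affine_path_solves[OF x c t, of "snd p"] Va[OF t] L0
          by (simp add: I_def left_int_def U_def L'_def)
      qed
      then show ?case using sV elim by (auto intro: step_path_cadlag)
    qed
  qed
  have "sde_solution ?\<Omega> (\<lambda>_. ?\<Omega>) U L' snd V"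
    unfolding sde_solution_def
  proof (intro conjI exI[of _ I] hl allI)
    show "levy_process ?\<Omega> (\<lambda>t p. (U t p, L' t p))" unfolding U_def L'_def using levy_lift[OF Lc \<rho>(1)] by simp
    show "indep_initial ?\<Omega> snd U L'" unfolding U_def[abs_def] L'_def[abs_def]
      using levy_pair_measurable[OF Lc] by (intro indep_initial_lift[OF prob \<rho>]) auto
    show "filtration (space ?\<Omega>) (\<lambda>_. ?\<Omega>)" by (simp add: filtration_def)
    show "adapted (\<lambda>_. ?\<Omega>) V" using Vm by (simp add: adapted_def)
    show "semimartingale ?\<Omega> (\<lambda>_. ?\<Omega>) U" "semimartingale ?\<Omega> (\<lambda>_. ?\<Omega>) L'"
      using st by (auto intro!: semimartingale_step[OF MR.P.prob_space_axioms] Um Lm elim: eventually_mono)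
    show "AE p in ?\<Omega>. \<forall>t\<ge>0. V t p = snd p - I t p + (L' t p - L' 0 p)" by (simp add: I_def)
  qed simp
  moreover have "distr ?\<Omega> borel snd = \<rho>"
    by (rule distr_snd_borel[OF prob \<rho>])
  moreover have "eq_in_law ?\<Omega> (\<lambda>t p. (U t p, L' t p)) M (\<lambda>t \<omega>. ((1 - inverse c) * N t \<omega>, L t \<omega>))"
    unfolding U_def L'_def using eq_in_law_lift[OF \<rho>(1) levy_processD(2)[OF Lc]] by simp
  ultimately show ?thesis unfolding sde_realization_def by blast
qed

section \<open>Characterization of the stationary laws\<close>

lemma scaled_marginal:
  fixes a :: real and A B :: "real \<Rightarrow> 'b \<Rightarrow> real" and N L :: "real \<Rightarrow> 'a \<Rightarrow> real"
  assumes a: "a \<noteq> 0" and L: "levy_process \<Omega> (\<lambda>t \<omega>. (A t \<omega>, B t \<omega>))" and L': "levy_process M (\<lambda>t \<omega>. (N t \<omega>, L t \<omega>))"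
    and eq: "eq_in_law \<Omega> (\<lambda>t \<omega>. (A t \<omega>, B t \<omega>)) M (\<lambda>t \<omega>. (a * N t \<omega>, L t \<omega>))" and t: "0 \<le> t"
  shows "distr \<Omega> borel (\<lambda>\<omega>. (inverse a * A t \<omega>, B t \<omega>)) = distr M borel (\<lambda>\<omega>. (N t \<omega>, L t \<omega>))"
proof -
  let ?g = "\<lambda>x :: real \<times> real. (inverse a * fst x, snd x)"
  have g: "?g \<in> borel_measurable borel" by (rule scale_fst_measurable)
  have La: "levy_process M (\<lambda>t \<omega>. (a * N t \<omega>, L t \<omega>))" using levy_linear[OF L' scale_fst_bounded_linear[of a]] by simp
  have "distr \<Omega> borel (\<lambda>\<omega>. (inverse a * A t \<omega>, B t \<omega>)) = distr (distr \<Omega> borel (\<lambda>\<omega>. (A t \<omega>, B t \<omega>))) borel ?g"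
    using levy_processD(2)[OF L t] g by (subst distr_distr) (auto simp: comp_def)
  also have "distr \<Omega> borel (\<lambda>\<omega>. (A t \<omega>, B t \<omega>)) = distr M borel (\<lambda>\<omega>. (a * N t \<omega>, L t \<omega>))"
    using eq_in_law_marginal[OF eq levy_processD(2)[OF L t] levy_processD(2)[OF La t] t] by simp
  also have "distr (distr M borel (\<lambda>\<omega>. (a * N t \<omega>, L t \<omega>))) borel ?g = distr M borel (\<lambda>\<omega>. (N t \<omega>, L t \<omega>))"
    using levy_processD(2)[OF La t] g a by (subst distr_distr) (auto simp: comp_def mult.assoc[symmetric])
  finally show ?thesis .
qed

context
  fixes M0 :: "'d measure" and X0 :: "real \<Rightarrow> 'd \<Rightarrow> real \<times> real" and Z
  assumes X0: "cp_process M0 X0 \<kappa> u v w" and uw: "0 < u + w"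
    and Zm: "Z \<in> borel_measurable M0"
    and Z: "AE \<omega> in M0. ((\<lambda>t. jint (wI c) t (incr X0 0 \<omega>)) \<longlongrightarrow> Z \<omega>) at_top"
begin

lemma distr_Z: "prob_space (distr M0 borel Z)" "sets (distr M0 borel Z) = sets borel"
  using prob_space.prob_space_distr[OF cp_processD(2)[OF X0] Zm] by auto

text \<open>Every realization reduces to an affine recursion driven by a process with the law of
  \<open>X0\<close>. Uniqueness then follows from one realization, whose existence is part of being
  stationary, and the converse from \<open>affine_invariant\<close> and
  \<open>affine_stationary\<close> for all of them.\<close>

lemma gou_stationary_iff:
  assumes L: "levy_process M (\<lambda>t \<omega>. (N t \<omega>, L t \<omega>))"
    and law: "\<And>t. 0 \<le> t \<Longrightarrow> distr M borel (\<lambda>\<omega>. (N t \<omega>, L t \<omega>)) = cp_law (c * \<kappa>) (t * u) (t * v) (t * w)"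
  shows "gou_stationary_distribution M (\<lambda>t \<omega>. ln c * N t \<omega>) L \<rho> \<longleftrightarrow> \<rho> = distr M0 borel Z"
proof -
  have lc: "ln c \<noteq> 0" using c by simp
  have real: "\<exists>Y S. cp_process \<Omega> Y \<kappa> u v w \<and> affine_process \<Omega> c Y S V \<and> distr \<Omega> borel S = \<rho>"
    if r: "gou_realization M (\<lambda>t \<omega>. ln c * N t \<omega>) L \<rho> \<Omega> V" for \<rho> \<Omega> V
  proof -
    obtain \<xi> \<eta> S where *: "gou_process \<Omega> \<xi> \<eta> S V" "distr \<Omega> borel S = \<rho>"
      "eq_in_law \<Omega> (\<lambda>t \<omega>. (\<xi> t \<omega>, \<eta> t \<omega>)) M (\<lambda>t \<omega>. (ln c * N t \<omega>, L t \<omega>))"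
      using r unfolding gou_realization_def by blast
    have "levy_process \<Omega> (\<lambda>t \<omega>. (\<xi> t \<omega>, \<eta> t \<omega>))" using *(1) by (simp add: gou_process_def)
    from scaled_marginal[OF lc this L *(3)] law
    have "distr \<Omega> borel (\<lambda>\<omega>. (inverse (ln c) * \<xi> t \<omega>, \<eta> t \<omega>)) = cp_law (c * \<kappa>) (t * u) (t * v) (t * w)" if "0 \<le> t" for t
      using that by simp
    from gou_affine[OF *(1) this] show ?thesis using *(2) by metis
  qed
  show ?thesis
  proof
    assume st: "gou_stationary_distribution M (\<lambda>t \<omega>. ln c * N t \<omega>) L \<rho>"
    then obtain \<Omega> V where r: "gou_realization M (\<lambda>t \<omega>. ln c * N t \<omega>) L \<rho> \<Omega> V"
      unfolding gou_stationary_distribution_def by blast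
    then have law: "distr \<Omega> borel (V t) = \<rho>" if "0 \<le> t" for t
      using st that unfolding gou_stationary_distribution_def by blast
    from real[OF r] obtain Y S where "cp_process \<Omega> Y \<kappa> u v w" "affine_process \<Omega> c Y S V" by blast
    from affine_unique[OF X0 uvw uw c \<kappa> Zm Z this law] show "\<rho> = distr M0 borel Z" .
  next
    assume \<rho>: "\<rho> = distr M0 borel Z"
    show "gou_stationary_distribution M (\<lambda>t \<omega>. ln c * N t \<omega>) L \<rho>"
      unfolding gou_stationary_distribution_def
    proof (intro conjI allI impI)
      show "prob_space \<rho>" "sets \<rho> = sets borel" using distr_Z \<rho> by auto
      then show "\<exists>\<Omega> V. gou_realization M (\<lambda>t \<omega>. ln c * N t \<omega>) L \<rho> \<Omega> V" using gou_exists[OF L law] by blast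
    next
      fix \<Omega> V assume "gou_realization M (\<lambda>t \<omega>. ln c * N t \<omega>) L \<rho> \<Omega> V"
      from real[OF this] obtain Y S where Y: "cp_process \<Omega> Y \<kappa> u v w" "affine_process \<Omega> c Y S V" and S: "distr \<Omega> borel S = \<rho>" by blast
      have law: "distr \<Omega> borel (V t) = \<rho>" if "0 \<le> t" for t
        using affine_invariant[OF X0 uvw uw c \<kappa> Zm Z Y _ that] S \<rho> by simp
      show "strictly_stationary \<Omega> V" using affine_stationary[OF Y(1) c Y(2)] law S by simp
      show "distr \<Omega> borel (V t) = \<rho>" if "0 \<le> t" for t using law[OF that] .
    qed
  qed
qed

text \<open>As for the Ornstein--Uhlenbeck process, except that the given driver already has the
  index of \<open>X0\<close>, so no rescaling of jumps takes place.\<close>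

lemma sde_stationary_iff:
  assumes L: "levy_process M (\<lambda>t \<omega>. (N t \<omega>, L t \<omega>))"
    and law: "\<And>t. 0 \<le> t \<Longrightarrow> distr M borel (\<lambda>\<omega>. (N t \<omega>, L t \<omega>)) = cp_law \<kappa> (t * u) (t * v) (t * w)"
  shows "sde_stationary_distribution M (\<lambda>t \<omega>. (1 - inverse c) * N t \<omega>) L \<rho> \<longleftrightarrow> \<rho> = distr M0 borel Z"
proof -
  have lc: "1 - inverse c \<noteq> 0" using c by simp
  have real: "\<exists>Y S. cp_process \<Omega> Y \<kappa> u v w \<and> affine_process \<Omega> c Y S V \<and> distr \<Omega> borel S = \<rho>"
    if r: "sde_realization M (\<lambda>t \<omega>. (1 - inverse c) * N t \<omega>) L \<rho> \<Omega> V" for \<rho> \<Omega> V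
  proof -
    obtain F U L' S where *: "sde_solution \<Omega> F U L' S V" "distr \<Omega> borel S = \<rho>"
      "eq_in_law \<Omega> (\<lambda>t \<omega>. (U t \<omega>, L' t \<omega>)) M (\<lambda>t \<omega>. ((1 - inverse c) * N t \<omega>, L t \<omega>))"
      using r unfolding sde_realization_def by blast
    have "levy_process \<Omega> (\<lambda>t \<omega>. (U t \<omega>, L' t \<omega>))" using *(1) by (simp add: sde_solution_def)
    from scaled_marginal[OF lc this L *(3)] law
    have "distr \<Omega> borel (\<lambda>\<omega>. (inverse (1 - inverse c) * U t \<omega>, L' t \<omega>)) = cp_law \<kappa> (t * u) (t * v) (t * w)" if "0 \<le> t" for t
      using that by simp
    from sde_affine[OF *(1) this] show ?thesis using *(2) by metis
  qed
  show ?thesis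
  proof
    assume st: "sde_stationary_distribution M (\<lambda>t \<omega>. (1 - inverse c) * N t \<omega>) L \<rho>"
    then obtain \<Omega> V where r: "sde_realization M (\<lambda>t \<omega>. (1 - inverse c) * N t \<omega>) L \<rho> \<Omega> V"
      unfolding sde_stationary_distribution_def by blast
    then have law: "distr \<Omega> borel (V t) = \<rho>" if "0 \<le> t" for t
      using st that unfolding sde_stationary_distribution_def by blast
    from real[OF r] obtain Y S where "cp_process \<Omega> Y \<kappa> u v w" "affine_process \<Omega> c Y S V" by blast
    from affine_unique[OF X0 uvw uw c \<kappa> Zm Z this law] show "\<rho> = distr M0 borel Z" .
  next
    assume \<rho>: "\<rho> = distr M0 borel Z"
    show "sde_stationary_distribution M (\<lambda>t \<omega>. (1 - inverse c) * N t \<omega>) L \<rho>"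
      unfolding sde_stationary_distribution_def
    proof (intro conjI allI impI)
      show "prob_space \<rho>" "sets \<rho> = sets borel" using distr_Z \<rho> by auto
      then show "\<exists>\<Omega> V. sde_realization M (\<lambda>t \<omega>. (1 - inverse c) * N t \<omega>) L \<rho> \<Omega> V" using sde_exists[OF L law] by blast
    next
      fix \<Omega> V assume "sde_realization M (\<lambda>t \<omega>. (1 - inverse c) * N t \<omega>) L \<rho> \<Omega> V"
      from real[OF this] obtain Y S where Y: "cp_process \<Omega> Y \<kappa> u v w" "affine_process \<Omega> c Y S V" and S: "distr \<Omega> borel S = \<rho>" by blast
      have law: "distr \<Omega> borel (V t) = \<rho>" if "0 \<le> t" for t
        using affine_invariant[OF X0 uvw uw c \<kappa> Zm Z Y _ that] S \<rho> by simp
      show "strictly_stationary \<Omega> V" using affine_stationary[OF Y(1) c Y(2)] law S by simp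
      show "distr \<Omega> borel (V t) = \<rho>" if "0 \<le> t" for t using law[OF that] .
    qed
  qed
qed

end

end

section \<open>The Gaussian covariance vanishes\<close>

text \<open>Combines |cos y - 1| \<le> 2 with |cos y - 1| \<le> y^2/2. The result does not depend on
  \<open>s\<close> and is integrable for every Levy measure, hence dominates; the constant is
  generous.\<close>

lemma cos_growth_bound:
  fixes z x :: "'b::euclidean_space"
  assumes "s \<ge> 1"
  shows "\<bar>cos ((s *\<^sub>R z) \<bullet> x) - 1\<bar> / s\<^sup>2 \<le> 2 * (1 + (norm z)\<^sup>2) * min 1 ((norm x)\<^sup>2)"
proof -
  define y where "y = z \<bullet> x"
  have s: "1 \<le> s\<^sup>2" using assms by simp
  have y2: "y\<^sup>2 \<le> (norm z)\<^sup>2 * (norm x)\<^sup>2"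
    using Cauchy_Schwarz_ineq[of z x] by (simp add: y_def power2_norm_eq_inner)
  have c2: "\<bar>cos (s * y) - 1\<bar> \<le> 2" using cos_ge_minus_one[of "s * y"] cos_le_one[of "s * y"] by linarith
  have cy: "\<bar>cos (s * y) - 1\<bar> \<le> (s * y)\<^sup>2 / 2"
  proof -
    have "cos (s * y) = 1 - 2 * (sin (s * y / 2))\<^sup>2" using cos_double_sin[of "s * y / 2"] by simp
    then have "\<bar>cos (s * y) - 1\<bar> = 2 * (sin (s * y / 2))\<^sup>2" by simp
    also have "(sin (s * y / 2))\<^sup>2 \<le> (s * y / 2)\<^sup>2"
      using abs_sin_x_le_abs_x[of "s * y / 2"] by (simp only: abs_le_square_iff)
    finally show ?thesis by (simp add: power_divide)
  qed
  have "\<bar>cos (s * y) - 1\<bar> / s\<^sup>2 \<le> 2 * (1 + (norm z)\<^sup>2)"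
  proof -
    have "\<bar>cos (s * y) - 1\<bar> / s\<^sup>2 \<le> \<bar>cos (s * y) - 1\<bar> / 1" using s by (intro divide_left_mono) auto
    also have "\<dots> \<le> 2" using c2 by simp
    also have "\<dots> \<le> 2 * (1 + (norm z)\<^sup>2)" by simp
    finally show ?thesis .
  qed
  moreover have "\<bar>cos (s * y) - 1\<bar> / s\<^sup>2 \<le> 2 * (1 + (norm z)\<^sup>2) * (norm x)\<^sup>2"
  proof -
    have "\<bar>cos (s * y) - 1\<bar> / s\<^sup>2 \<le> ((s * y)\<^sup>2 / 2) / s\<^sup>2" using cy s by (intro divide_right_mono) auto
    also have "\<dots> = y\<^sup>2 / 2" using assms by (simp add: power_mult_distrib)
    also have "\<dots> \<le> 2 * (1 + (norm z)\<^sup>2) * (norm x)\<^sup>2"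
    proof -
      have "y\<^sup>2 / 2 \<le> y\<^sup>2" by simp
      also note y2
      also have "(norm z)\<^sup>2 * (norm x)\<^sup>2 \<le> (2 * (1 + (norm z)\<^sup>2)) * (norm x)\<^sup>2" by (intro mult_right_mono) auto
      finally show ?thesis .
    qed
    finally show ?thesis .
  qed
  ultimately show ?thesis by (simp add: y_def min_def)
qed

text \<open>The truncation term is imaginary, so only cos - 1 is left in the real part; divided by
  s^2 it tends to 0 pointwise and is dominated.\<close>

lemma jump_part_small:
  fixes z :: "'b::euclidean_space"
  assumes sets: "sets \<nu> = sets borel" and int: "integrable \<nu> (\<lambda>x. min 1 ((norm x)\<^sup>2))"
  shows "((\<lambda>s. Re (CLINT x|\<nu>. iexp ((s *\<^sub>R z) \<bullet> x) - 1
      - \<i> * complex_of_real (((s *\<^sub>R z) \<bullet> x) * indicator {x. norm x \<le> 1} x)) / s\<^sup>2) \<longlongrightarrow> 0) at_top"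
proof -
  note [measurable_cong] = sets
  let ?K = "2 * (1 + (norm z)\<^sup>2)"
  let ?q = "\<lambda>s x. \<bar>cos ((s *\<^sub>R z) \<bullet> x) - 1\<bar> / s\<^sup>2"
  let ?f = "\<lambda>s x. iexp ((s *\<^sub>R z) \<bullet> x) - 1 - \<i> * complex_of_real (((s *\<^sub>R z) \<bullet> x) * indicator {x. norm x \<le> 1} x)"
  have m: "?q s \<in> borel_measurable \<nu>" for s by measurable
  have "((\<lambda>s. \<integral>x. ?q s x \<partial>\<nu>) \<longlongrightarrow> (\<integral>x. 0 \<partial>\<nu>)) at_top"
  proof (rule integral_dominated_convergence_at_top[where w = "\<lambda>x. ?K * min 1 ((norm x)\<^sup>2)"])
    show "\<forall>\<^sub>F s in at_top. AE x in \<nu>. norm (?q s x) \<le> ?K * min 1 ((norm x)\<^sup>2)"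
      using eventually_ge_at_top[of 1]
      by eventually_elim (use cos_growth_bound[of _ z] in auto)
    show "AE x in \<nu>. ((\<lambda>s. ?q s x) \<longlongrightarrow> 0) at_top"
    proof (intro AE_I2)
      fix x
      have "((\<lambda>s. 2 / s\<^sup>2) \<longlongrightarrow> (0::real)) at_top"
        by (intro real_tendsto_divide_at_top[OF tendsto_const] filterlim_pow_at_top filterlim_ident) simp
      moreover have "\<forall>\<^sub>F s in at_top. norm (?q s x) \<le> 2 / s\<^sup>2"
      proof (intro always_eventually allI)
        fix s :: real
        have "\<bar>cos ((s *\<^sub>R z) \<bullet> x) - 1\<bar> \<le> 2" using cos_ge_minus_one[of "(s *\<^sub>R z) \<bullet> x"] cos_le_one[of "(s *\<^sub>R z) \<bullet> x"] by linarith
        then show "norm (?q s x) \<le> 2 / s\<^sup>2" by (simp add: divide_right_mono)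
      qed
      ultimately show "((\<lambda>s. ?q s x) \<longlongrightarrow> 0) at_top" by (rule Lim_null_comparison[rotated])
    qed
    show "integrable \<nu> (\<lambda>x. ?K * min 1 ((norm x)\<^sup>2))" using int by simp
  qed (use m in auto)
  then have lim: "((\<lambda>s. \<integral>x. ?q s x \<partial>\<nu>) \<longlongrightarrow> 0) at_top" by simp
  show ?thesis
  proof (rule Lim_null_comparison[OF _ lim])
    show "\<forall>\<^sub>F s in at_top. norm (Re (CLINT x|\<nu>. ?f s x) / s\<^sup>2) \<le> (\<integral>x. ?q s x \<partial>\<nu>)"
      using eventually_ge_at_top[of 1]
    proof eventually_elim
      case (elim s)
      show ?case
      proof (cases "integrable \<nu> (?f s)")
        case True
        have re: "Re (iexp y - 1 - \<i> * complex_of_real a) = cos y - 1" for y a :: real by (simp add: Re_exp)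
        have "Re (CLINT x|\<nu>. ?f s x) = (\<integral>x. Re (?f s x) \<partial>\<nu>)" by (rule integral_Re[OF True, symmetric])
        also have "\<dots> = (\<integral>x. cos ((s *\<^sub>R z) \<bullet> x) - 1 \<partial>\<nu>)" unfolding re ..
        finally have "Re (CLINT x|\<nu>. ?f s x) / s\<^sup>2 = (\<integral>x. (cos ((s *\<^sub>R z) \<bullet> x) - 1) / s\<^sup>2 \<partial>\<nu>)"
          by (simp only: integral_divide_zero)
        then have "norm (Re (CLINT x|\<nu>. ?f s x) / s\<^sup>2) \<le> (\<integral>x. norm ((cos ((s *\<^sub>R z) \<bullet> x) - 1) / s\<^sup>2) \<partial>\<nu>)"
          by (simp only: integral_norm_bound)
        then show ?thesis by (simp only: real_norm_def abs_divide abs_power2)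
      next
        case False
        \<comment> \<open>A nonintegrable integrand has integral 0 by convention, so the left-hand
          side vanishes.\<close>
        have "0 \<le> (\<integral>x. ?q s x \<partial>\<nu>)" by (intro integral_nonneg_AE AE_I2) auto
        then show ?thesis
          unfolding not_integrable_integral_eq[OF False] by (simp only: zero_complex.simps div_0 norm_zero)
      qed
    qed
  qed
qed

text \<open>Taking moduli removes the drift and the ambiguity of the complex logarithm and leaves an
  identity of real parts. At \<open>s *\<^sub>R z\<close>, divided by s^2, the jump parts vanish in
  the limit while the quadratic form stays fixed.\<close>

lemma levy_triplet_unique_cov:
  fixes X :: "real \<Rightarrow> 'a \<Rightarrow> 'b::euclidean_space"
  assumes 1: "levy_triplet M X A \<nu> \<gamma>" and 0: "levy_triplet M X (\<lambda>_. 0) \<nu>' \<gamma>'"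
  shows "A = (\<lambda>_. 0)"
proof -
  have lin: "linear A" and sym: "\<And>x y. x \<bullet> A y = A x \<bullet> y" using 1 by (auto simp: levy_triplet_def)
  interpret A: linear A by fact
  let ?J = "\<lambda>\<nu> z. CLINT x|\<nu>. iexp (z \<bullet> x) - 1 - \<i> * complex_of_real ((z \<bullet> x) * indicator {x. norm x \<le> 1} x)"
  have Re: "- (z \<bullet> A z) / 2 + Re (?J \<nu> z) = Re (?J \<nu>' z)" for z
  proof -
    have "(CLINT \<omega>|M. iexp (z \<bullet> X 1 \<omega>)) =
        exp (complex_of_real 1 * (- complex_of_real (z \<bullet> A z) / 2 + ?J \<nu> z + \<i> * complex_of_real (\<gamma> \<bullet> z)))"
      using 1 zero_le_one unfolding levy_triplet_def by blast
    moreover have "(CLINT \<omega>|M. iexp (z \<bullet> X 1 \<omega>)) =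
        exp (complex_of_real 1 * (- complex_of_real (z \<bullet> 0) / 2 + ?J \<nu>' z + \<i> * complex_of_real (\<gamma>' \<bullet> z)))"
      using 0 zero_le_one unfolding levy_triplet_def by blast
    ultimately have "norm (exp (complex_of_real 1 * (- complex_of_real (z \<bullet> A z) / 2 + ?J \<nu> z + \<i> * complex_of_real (\<gamma> \<bullet> z)))) =
        norm (exp (complex_of_real 1 * (- complex_of_real (z \<bullet> 0) / 2 + ?J \<nu>' z + \<i> * complex_of_real (\<gamma>' \<bullet> z))))"
      by (simp only:)
    moreover have "norm (exp (complex_of_real 1 * (- complex_of_real a / 2 + b + \<i> * complex_of_real d))) = exp (- a / 2 + Re b)"
      for a d :: real and b :: complex by simp
    ultimately show ?thesis by (simp only: exp_inj_iff inner_zero_right minus_zero div_0 add_0_left)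
  qed
  have q: "z \<bullet> A z = 0" for z
  proof -
    have J: "((\<lambda>s. Re (?J \<nu> (s *\<^sub>R z)) / s\<^sup>2) \<longlongrightarrow> 0) at_top" "((\<lambda>s. Re (?J \<nu>' (s *\<^sub>R z)) / s\<^sup>2) \<longlongrightarrow> 0) at_top"
      using 1 0 unfolding levy_triplet_def by (blast intro: jump_part_small)+
    have "((\<lambda>s. Re (?J \<nu> (s *\<^sub>R z)) / s\<^sup>2 - Re (?J \<nu>' (s *\<^sub>R z)) / s\<^sup>2) \<longlongrightarrow> 0 - 0) at_top"
      by (intro tendsto_diff J)
    moreover have "\<forall>\<^sub>F s in at_top. Re (?J \<nu> (s *\<^sub>R z)) / s\<^sup>2 - Re (?J \<nu>' (s *\<^sub>R z)) / s\<^sup>2 = (z \<bullet> A z) / 2"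
      using eventually_ge_at_top[of 1]
    proof eventually_elim
      case (elim s)
      have "Re (?J \<nu> (s *\<^sub>R z)) - Re (?J \<nu>' (s *\<^sub>R z)) = s\<^sup>2 * (z \<bullet> A z) / 2"
        unfolding Re[symmetric] by (simp only: A.scaleR) (simp add: power2_eq_square)
      then show ?case using elim by (simp add: diff_divide_distrib[symmetric])
    qed
    ultimately have "((\<lambda>s::real. (z \<bullet> A z) / 2) \<longlongrightarrow> 0 - 0) at_top"
      by (rule Lim_transform_eventually)
    then show ?thesis by (simp add: tendsto_const_iff)
  qed
  \<comment> \<open>Polarization, using the symmetry of \<open>A\<close>.\<close>
  have "x \<bullet> A y = 0" for x y
    using q[of "x + y"] q[of x] q[of y] sym[of x y] by (simp add: A.add inner_add_left inner_add_right inner_commute)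
  then have "A y = 0" for y by (metis inner_eq_zero_iff)
  then show ?thesis by auto
qed

lemma gaussian_cov_eq_0:
  assumes "levy_triplet M X (\<lambda>_. 0) \<nu> \<gamma>"
  shows "gaussian_cov M X = (\<lambda>_. 0)"
  unfolding gaussian_cov_def using assms levy_triplet_unique_cov by (intro the_equality) blast+

text \<open>An explicit triplet without Gaussian part: the jump measure is the image of
  \<open>\<nu>\<close> under the scaling, and the drift is chosen to cancel the truncation
  term.\<close>

lemma compound_poisson_scaled_cov:
  fixes N L :: "real \<Rightarrow> 'a \<Rightarrow> real"
  assumes cp: "compound_poisson M (\<lambda>t \<omega>. (N t \<omega>, L t \<omega>)) \<nu>" and a: "a \<noteq> 0"
  shows "gaussian_cov M (\<lambda>t \<omega>. (a * N t \<omega>, L t \<omega>)) = (\<lambda>_. 0)"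
proof -
  let ?g = "\<lambda>x :: real \<times> real. (a * fst x, snd x)"
  have fin: "finite_measure \<nu>" and s\<nu>: "sets \<nu> = sets borel" and z\<nu>: "emeasure \<nu> {0} = 0"
    and ch: "\<And>t z. 0 \<le> t \<Longrightarrow> (CLINT \<omega>|M. iexp (z \<bullet> (N t \<omega>, L t \<omega>))) = exp (complex_of_real t * (CLINT x|\<nu>. iexp (z \<bullet> x) - 1))"
    using cp unfolding compound_poisson_def by blast+
  interpret n: finite_measure \<nu> by fact
  have g: "?g \<in> \<nu> \<rightarrow>\<^sub>M borel" unfolding measurable_cong_sets[OF s\<nu> refl] by (rule scale_fst_measurable)
  define \<mu> where "\<mu> = distr \<nu> borel ?g"
  interpret m: finite_measure \<mu> unfolding \<mu>_def using g by (rule n.finite_measure_distr)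
  have s\<mu> [measurable_cong]: "sets \<mu> = sets borel" by (simp add: \<mu>_def)
  \<comment> \<open>The integral of the small jumps; as a drift it compensates the truncation in
    \<open>levy_triplet\<close>.\<close>
  define h where "h = (\<lambda>x :: real \<times> real. indicator {x. norm x \<le> 1} x *\<^sub>R x)"
  have h: "integrable \<mu> h"
    unfolding h_def by (intro m.integrable_const_bound[of _ 1]) (auto simp: indicator_def)
  have "levy_triplet M (\<lambda>t \<omega>. (a * N t \<omega>, L t \<omega>)) (\<lambda>_. 0) \<mu> (integral\<^sup>L \<mu> h)"
    unfolding levy_triplet_def
  proof (intro conjI allI impI)
    show "linear (\<lambda>_. 0 :: real \<times> real)" by (simp add: linear_iff)
    have "?g -` {0} \<inter> space \<nu> = {0}"
      using a sets_eq_imp_space_eq[OF s\<nu>] by (auto simp: zero_prod_def prod_eq_iff)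
    then show "emeasure \<mu> {0} = 0" unfolding \<mu>_def using g z\<nu> by (simp add: emeasure_distr)
    show "integrable \<mu> (\<lambda>x. min 1 ((norm x)\<^sup>2))"
      by (intro m.integrable_const_bound[of _ 1]) auto
    fix t :: real and z :: "real \<times> real" assume t: "0 \<le> t"
    have zg: "z \<bullet> ?g x = (a * fst z, snd z) \<bullet> x" for x by (simp add: inner_prod_def)
    have i1: "integrable \<mu> (\<lambda>x. iexp (z \<bullet> x) - 1)"
      by (intro m.integrable_const_bound[of _ 2] AE_I2 order_trans[OF norm_triangle_ineq4]) auto
    have hz: "(z \<bullet> x) * indicator {x. norm x \<le> 1} x = z \<bullet> h x" for x by (simp add: h_def)
    have i2: "integrable \<mu> (\<lambda>x. \<i> * complex_of_real (z \<bullet> h x))"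
      using h by (intro integrable_mult_right integrable_of_real integrable_inner_right)
    have "(CLINT x|\<mu>. iexp (z \<bullet> x) - 1 - \<i> * complex_of_real ((z \<bullet> x) * indicator {x. norm x \<le> 1} x))
        = (CLINT x|\<mu>. iexp (z \<bullet> x) - 1) - \<i> * complex_of_real (integral\<^sup>L \<mu> h \<bullet> z)"
      unfolding hz Bochner_Integration.integral_diff[OF i1 i2] using h by (simp add: inner_commute)
    then have e: "- complex_of_real (z \<bullet> 0) / 2 + (CLINT x|\<mu>. iexp (z \<bullet> x) - 1 - \<i> * complex_of_real ((z \<bullet> x) * indicator {x. norm x \<le> 1} x))
        + \<i> * complex_of_real (integral\<^sup>L \<mu> h \<bullet> z) = (CLINT x|\<mu>. iexp (z \<bullet> x) - 1)" by simp
    have "(CLINT x|\<mu>. iexp (z \<bullet> x) - 1) = (CLINT x|\<nu>. iexp ((a * fst z, snd z) \<bullet> x) - 1)"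
      unfolding \<mu>_def zg[symmetric] using g by (subst integral_distr) auto
    moreover have "z \<bullet> (a * N t \<omega>, L t \<omega>) = (a * fst z, snd z) \<bullet> (N t \<omega>, L t \<omega>)" for \<omega> using zg[of "(N t \<omega>, L t \<omega>)"] by simp
    ultimately show "(CLINT \<omega>|M. iexp (z \<bullet> (a * N t \<omega>, L t \<omega>))) = exp (complex_of_real t * (- complex_of_real (z \<bullet> 0) / 2
        + (CLINT x|\<mu>. iexp (z \<bullet> x) - 1 - \<i> * complex_of_real ((z \<bullet> x) * indicator {x. norm x \<le> 1} x)) + \<i> * complex_of_real (integral\<^sup>L \<mu> h \<bullet> z)))"
      unfolding e using ch[OF t, of "(a * fst z, snd z)"] by simp
  qed (simp_all add: s\<mu>)
  then show ?thesis by (rule gaussian_cov_eq_0)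
qed

section \<open>The main theorem\<close>

lemma improper_integral_exists:
  assumes X: "cp_process M X \<kappa> u v w" and uvw: "0 \<le> u" "0 \<le> v" "0 \<le> w" "0 < u + w" and c: "c > 1" and \<kappa>: "0 \<le> \<kappa>"
  shows "\<exists>Z. has_improper_left_integral M (\<lambda>t \<omega>. c powr (- fst (X t \<omega>))) (\<lambda>t \<omega>. snd (X t \<omega>)) Z"
proof -
  note iX = incr_processD(3)[OF cp_processD(1)[OF X] order_refl]
  define I where "I t \<omega> = pint (wI c) t (incr X 0 \<omega>)" for t \<omega>
  have Im: "I t \<in> borel_measurable M" if "0 \<le> t" for t
    unfolding I_def[abs_def] using measurable_compose[OF iX functional_measurable(4)[OF that]] .
  have ae: "AE \<omega> in M. step_path (\<lambda>t. X t \<omega>) \<and> (\<forall>t\<ge>0. I t \<omega> = jint (wI c) t (incr X 0 \<omega>) \<and> I t \<omega> = jint (wI c) t (\<lambda>t. X t \<omega>))"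
    using cp_process_incr0[OF X]
  proof eventually_elim
    case (elim \<omega>)
    then show ?case
      using pint_cong[of _ "incr X 0 \<omega>" "\<lambda>t. X t \<omega>" "wI c"] pint_eq_jint[of "\<lambda>t. X t \<omega>" _ "wI c"]
        pint_eq_jint[of "incr X 0 \<omega>" _ "wI c"] cp_path_step by (auto simp: I_def)
  qed
  have Xm: "(\<lambda>\<omega>. fst (X t \<omega>)) \<in> borel_measurable M" "(\<lambda>\<omega>. snd (X t \<omega>)) \<in> borel_measurable M" if "0 \<le> t" for t
    using pair_components_measurable[of "\<lambda>\<omega>. fst (X t \<omega>)" "\<lambda>\<omega>. snd (X t \<omega>)" M] cp_processD(3)[OF X that] by auto
  have "has_left_integral M (\<lambda>t \<omega>. c powr (- fst (X t \<omega>))) (\<lambda>t \<omega>. snd (X t \<omega>)) I"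
  proof (rule has_left_integralI[OF cp_processD(2)[OF X] _ Xm(2) Im])
    show "(\<lambda>\<omega>. c powr (- fst (X t \<omega>))) \<in> borel_measurable M" if "0 \<le> t" for t using Xm[OF that] by measurable
    show "AE \<omega> in M. cadlag (\<lambda>t. c powr (- fst (X t \<omega>))) \<and> step_path (\<lambda>t. snd (X t \<omega>)) \<and>
        (\<forall>t\<ge>0. I t \<omega> = left_int (\<lambda>t. c powr (- fst (X t \<omega>))) (\<lambda>t. snd (X t \<omega>)) t)"
      using ae
    proof eventually_elim
      case (elim \<omega>)
      then have sx: "step_path (\<lambda>t. X t \<omega>)" by simp
      show ?case
      proof (intro conjI allI impI)
        show "cadlag (\<lambda>t. c powr (- fst (X t \<omega>)))" "step_path (\<lambda>t. snd (X t \<omega>))"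
          using step_path_snd[OF sx] step_path_cadlag[OF step_path_comp[OF sx, of "\<lambda>a. c powr (- fst a)"]] by simp_all
        fix t :: real assume "0 \<le> t"
        then have "I t \<omega> = jint (wI c) t (\<lambda>t. X t \<omega>)" using elim by blast
        then show "I t \<omega> = left_int (\<lambda>t. c powr (- fst (X t \<omega>))) (\<lambda>t. snd (X t \<omega>)) t"
          using left_int_discount[OF sx, of c t] \<open>0 \<le> t\<close> by simp
      qed
    qed
  qed
  moreover have "AE \<omega> in M. ((\<lambda>t. I t \<omega>) \<longlongrightarrow> lim (\<lambda>n. pint (wI c) (real n) (incr X 0 \<omega>))) at_top"
    using ae improper_converges[OF X uvw c \<kappa>]
  proof eventually_elim
    case (elim \<omega>)
    have "\<forall>\<^sub>F t in at_top. jint (wI c) t (incr X 0 \<omega>) = I t \<omega>"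
      using eventually_ge_at_top[of 0] by eventually_elim (use elim(1) in auto)
    then show ?case by (rule Lim_transform_eventually[OF elim(2)])
  qed
  moreover have "(\<lambda>\<omega>. lim (\<lambda>n. pint (wI c) (real n) (incr X 0 \<omega>))) \<in> borel_measurable M"
    using measurable_compose[OF iX functional_measurable(4)] by (intro borel_measurable_lim_metric) auto
  ultimately show ?thesis unfolding has_improper_left_integral_def by blast
qed

text \<open>Any variable that satisfies the definition of the improper integral, not just the one
  constructed before, is the pathwise limit.\<close>

lemma improper_integral_AE:
  assumes X: "cp_process M X \<kappa> u v w"
    and Z: "has_improper_left_integral M (\<lambda>t \<omega>. c powr (- fst (X t \<omega>))) (\<lambda>t \<omega>. snd (X t \<omega>)) Z"
  shows "AE \<omega> in M. ((\<lambda>t. jint (wI c) t (incr X 0 \<omega>)) \<longlongrightarrow> Z \<omega>) at_top"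
proof -
  obtain I where I: "has_left_integral M (\<lambda>t \<omega>. c powr (- fst (X t \<omega>))) (\<lambda>t \<omega>. snd (X t \<omega>)) I"
    and IZ: "AE \<omega> in M. ((\<lambda>t. I t \<omega>) \<longlongrightarrow> Z \<omega>) at_top"
    using Z by (auto simp: has_improper_left_integral_def)
  have st: "AE \<omega> in M. step_path (\<lambda>t. snd (X t \<omega>))"
    using cp_processD(5)[OF X] by eventually_elim (rule step_path_snd[OF cp_path_step])
  from has_left_integral_AE[OF cp_processD(2)[OF X] I st] IZ cp_process_incr0[OF X] show ?thesis
  proof eventually_elim
    case (elim \<omega>)
    have sx: "step_path (\<lambda>t. X t \<omega>)" and si: "step_path (incr X 0 \<omega>)" using elim cp_path_step by blast+
    have "I t \<omega> = jint (wI c) t (incr X 0 \<omega>)" if t: "0 \<le> t" for t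
    proof -
      have "I t \<omega> = jint (wI c) t (\<lambda>t. X t \<omega>)" using elim t left_int_discount[OF sx, of c] by simp
      also have "\<dots> = pint (wI c) t (\<lambda>t. X t \<omega>)" by (rule pint_eq_jint[OF sx t, symmetric])
      also have "\<dots> = pint (wI c) t (incr X 0 \<omega>)" using elim t by (intro pint_cong) auto
      also have "\<dots> = jint (wI c) t (incr X 0 \<omega>)" by (rule pint_eq_jint[OF si t])
      finally show ?thesis .
    qed
    then have "\<forall>\<^sub>F t in at_top. I t \<omega> = jint (wI c) t (incr X 0 \<omega>)"
      by (intro eventually_mono[OF eventually_ge_at_top[of 0]])
    then show ?case by (rule Lim_transform_eventually[OF elim(2)])
  qed
qed

theorem proposition2p1:
  fixes c u v w p q r :: real and k :: int
    and M :: "'a measure" and N L :: "real \<Rightarrow> 'a \<Rightarrow> real"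
    and M' :: "'b measure" and N' L' :: "real \<Rightarrow> 'b \<Rightarrow> real"
  assumes "c > 1"
    and "u \<ge> 0" and "v \<ge> 0" and "w \<ge> 0"
    and "p = u / (u + v + w)" and "q = v / (u + v + w)" and "r = w / (u + v + w)"
    and "p \<ge> 0" and "q \<ge> 0" and "r \<ge> 0" and "p + q + r = 1"
    and "p + r > 0" and "q + r > 0"
    and "compound_poisson M (\<lambda>t \<omega>. (N t \<omega>, L t \<omega>)) (nu c u v w k)"
    and "compound_poisson M' (\<lambda>t \<omega>. (N' t \<omega>, L' t \<omega>)) (nu c u v w (k - 1))"
  shows
    "eq_in_law M (\<lambda>t \<omega>. (N t \<omega>, L t \<omega>)) M'
       (\<lambda>t \<omega>. (N' t \<omega>, L' t \<omega> +
          (\<Sum>\<^sub>\<infinity>s\<in>{0<..t}. (exp (- ln c * jump (\<lambda>x. N' x \<omega>) s) - 1) * jump (\<lambda>x. L' x \<omega>) s)))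
     \<and> eq_in_law M (\<lambda>t \<omega>. ((1 - inverse c) * N t \<omega>, L t \<omega>)) M'
       (\<lambda>t \<omega>. (driver_U M' (\<lambda>x \<omega>. ln c * N' x \<omega>) L' t \<omega>,
                driver_L M' (\<lambda>x \<omega>. ln c * N' x \<omega>) L' t \<omega>))
     \<and> (\<exists>Z. has_improper_left_integral M (\<lambda>t \<omega>. c powr (- N t \<omega>)) L Z)
     \<and> (\<forall>Z. has_improper_left_integral M (\<lambda>t \<omega>. c powr (- N t \<omega>)) L Z \<longrightarrow>
         (\<forall>\<rho>. gou_stationary_distribution M' (\<lambda>t \<omega>. ln c * N' t \<omega>) L' \<rho>
              \<longleftrightarrow> \<rho> = distr M borel Z) \<and>
         (\<forall>\<rho>. sde_stationary_distribution M (\<lambda>t \<omega>. (1 - inverse c) * N t \<omega>) L \<rho>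
              \<longleftrightarrow> \<rho> = distr M borel Z))"
proof -
  note c = \<open>c > 1\<close> and uvw = \<open>u \<ge> 0\<close> \<open>v \<ge> 0\<close> \<open>w \<ge> 0\<close>
  define \<kappa> where "\<kappa> = c powi (- k)"
  have c0: "0 < c" and lc: "ln c \<noteq> 0" using c by auto
  have \<kappa>: "0 \<le> \<kappa>" using c0 by (simp add: \<kappa>_def)
  \<comment> \<open>Passing from k to k - 1 multiplies the third jump size by \<open>c\<close>,
    which matches the hypothesis of the rescaling lemmas.\<close>
  have "c powi (1 + - k) = c powi 1 * c powi (- k)" using c0 by (intro power_int_add) auto
  then have \<kappa>': "c powi (- (k - 1)) = c * \<kappa>" by (simp add: \<kappa>_def)
  \<comment> \<open>N has positive rate, which drives the discount c^(-N(t)) to 0.\<close>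
  have uw: "0 < u + w"
  proof (rule ccontr)
    assume "\<not> 0 < u + w"
    then have "u = 0" "w = 0" using uvw by auto
    then show False using assms(5,7,12) by simp
  qed
  let ?X = "\<lambda>t \<omega>. (N t \<omega>, L t \<omega>)" and ?X' = "\<lambda>t \<omega>. (N' t \<omega>, L' t \<omega>)"
  note cp = assms(14) and cp' = assms(15)
  have Lv: "levy_process M ?X" "levy_process M' ?X'" using cp cp' by (simp_all add: compound_poisson_def)
  have law: "distr M borel (\<lambda>\<omega>. ?X t \<omega>) = cp_law \<kappa> (t * u) (t * v) (t * w)" if "0 \<le> t" for t
    unfolding \<kappa>_def by (rule compound_poisson_law[OF cp uvw c0 that])
  have law': "distr M' borel (\<lambda>\<omega>. ?X' t \<omega>) = cp_law (c * \<kappa>) (t * u) (t * v) (t * w)" if "0 \<le> t" for t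
    using compound_poisson_law[OF cp' uvw c0 that] unfolding \<kappa>' .
  have cX: "cp_process M ?X \<kappa> u v w" using law \<kappa> by (intro levy_cp_process[OF Lv(1) uvw]) auto
  have cX': "cp_process M' ?X' (c * \<kappa>) u v w" using law' \<kappa> c by (intro levy_cp_process[OF Lv(2) uvw]) auto
  let ?Y = "transf_process ?X' c"
  have cY: "cp_process M' ?Y \<kappa> u v w" by (rule transf_cp_process[OF cX' uvw c])
  have pm: "incr ?X 0 \<in> M \<rightarrow>\<^sub>M path_space" "incr ?Y 0 \<in> M' \<rightarrow>\<^sub>M path_space"
    using incr_processD(3)[OF cp_processD(1)[OF cX]] incr_processD(3)[OF cp_processD(1)[OF cY]] by auto
  \<comment> \<open>The process of index k and the rescaled process of index k - 1 have the same law
    on path space; both equalities in law are read off from this.\<close>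
  have pl: "distr M path_space (incr ?X 0) = distr M' path_space (incr ?Y 0)"
    by (rule cp_process_law_incr[OF cX cY order_refl order_refl])
  have pathY: "AE \<omega> in M'. cp_path (c * \<kappa>) (\<lambda>t. ?X' t \<omega>) \<and> (\<forall>t\<ge>0. incr ?Y 0 \<omega> t = (N' t \<omega>, jint (wT c) t (\<lambda>t. ?X' t \<omega>)))"
    using transf_process_AE[OF cX' uvw c] cp_process_incr0[OF cY]
    by eventually_elim (simp add: transf_def)
  have pathX: "AE \<omega> in M. \<forall>t\<ge>0. incr ?X 0 \<omega> t = ?X t \<omega>"
    using cp_process_incr0[OF cX] by eventually_elim simp
  have cov: "gaussian_cov M' (\<lambda>t \<omega>. (ln c * N' t \<omega>, L' t \<omega>)) = (\<lambda>_. 0)"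
    by (rule compound_poisson_scaled_cov[OF cp' lc])
  have "eq_in_law M ?X M' (\<lambda>t \<omega>. (N' t \<omega>, L' t \<omega> +
          (\<Sum>\<^sub>\<infinity>s\<in>{0<..t}. (exp (- ln c * jump (\<lambda>x. N' x \<omega>) s) - 1) * jump (\<lambda>x. L' x \<omega>) s)))"
  proof (rule eq_in_lawI[OF pm pl, where F = "\<lambda>t x. x t"])
    fix t :: real assume t: "0 \<le> t"
    show "AE \<omega> in M. ?X t \<omega> = incr ?X 0 \<omega> t" using pathX by eventually_elim (use t in simp)
    show "AE \<omega> in M'. (N' t \<omega>, L' t \<omega> + (\<Sum>\<^sub>\<infinity>s\<in>{0<..t}. (exp (- ln c * jump (\<lambda>x. N' x \<omega>) s) - 1) * jump (\<lambda>x. L' x \<omega>) s))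
        = incr ?Y 0 \<omega> t"
      using pathY
    proof eventually_elim
      case (elim \<omega>)
      then show ?case using transf_infsum[of "c * \<kappa>" "\<lambda>t. ?X' t \<omega>" t c] t c0 by simp
    qed
  qed (rule path_component_measurable)
  moreover have "eq_in_law M (\<lambda>t \<omega>. ((1 - inverse c) * N t \<omega>, L t \<omega>)) M'
       (\<lambda>t \<omega>. (driver_U M' (\<lambda>x \<omega>. ln c * N' x \<omega>) L' t \<omega>, driver_L M' (\<lambda>x \<omega>. ln c * N' x \<omega>) L' t \<omega>))"
  proof (rule eq_in_lawI[OF pm pl, where F = "\<lambda>t x. ((1 - inverse c) * fst (x t), snd (x t) :: real)"])
    fix t :: real assume t: "0 \<le> t"
    show "(\<lambda>x. ((1 - inverse c) * fst (x t), snd (x t) :: real)) \<in> borel_measurable path_space"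
      using measurable_compose[OF path_component_measurable[OF t] scale_fst_measurable[of "1 - inverse c"]] .
    show "AE \<omega> in M. ((1 - inverse c) * N t \<omega>, L t \<omega>) = ((1 - inverse c) * fst (incr ?X 0 \<omega> t), snd (incr ?X 0 \<omega> t))"
      using pathX by eventually_elim (use t in simp)
    show "AE \<omega> in M'. (driver_U M' (\<lambda>x \<omega>. ln c * N' x \<omega>) L' t \<omega>, driver_L M' (\<lambda>x \<omega>. ln c * N' x \<omega>) L' t \<omega>)
        = ((1 - inverse c) * fst (incr ?Y 0 \<omega> t), snd (incr ?Y 0 \<omega> t))"
      using pathY
    proof eventually_elim
      case (elim \<omega>)
      then have x: "cp_path (c * \<kappa>) (\<lambda>t. ?X' t \<omega>)" by simp
      have "step_path (\<lambda>t. N' t \<omega>)" using step_path_fst[OF cp_path_step[OF x]] by simp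
      then have j: "jump (\<lambda>r. ln c * N' r \<omega>) s = ln c * jump (\<lambda>r. N' r \<omega>) s" if "0 < s" for s
        using Lim_step_comp[OF _ that, of "\<lambda>t. N' t \<omega>" "\<lambda>a. ln c * a"] by (simp add: jump_def algebra_simps)
      have "(\<Sum>\<^sub>\<infinity>s\<in>{0<..t}. (exp (- jump (\<lambda>r. ln c * N' r \<omega>) s) - 1) * jump (\<lambda>r. L' r \<omega>) s)
          = (\<Sum>\<^sub>\<infinity>s\<in>{0<..t}. (exp (- ln c * jump (\<lambda>r. N' r \<omega>) s) - 1) * jump (\<lambda>r. L' r \<omega>) s)"
        by (intro infsum_cong) (simp add: j)
      then have "driver_L M' (\<lambda>x \<omega>. ln c * N' x \<omega>) L' t \<omega> = jint (wT c) t (\<lambda>t. ?X' t \<omega>)"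
        using transf_infsum[OF x t c0] by (simp add: driver_L_def alpha_xi_eta_def cov)
      moreover have "driver_U M' (\<lambda>x \<omega>. ln c * N' x \<omega>) L' t \<omega> = (1 - inverse c) * N' t \<omega>"
        using driver_U_path[OF x t c] by (simp add: driver_U_def alpha_xi_xi_def cov)
      ultimately show ?case using elim t by simp
    qed
  qed
  moreover have "\<exists>Z. has_improper_left_integral M (\<lambda>t \<omega>. c powr (- N t \<omega>)) L Z"
    using improper_integral_exists[OF cX uvw uw c \<kappa>] by simp
  moreover have "(\<forall>\<rho>. gou_stationary_distribution M' (\<lambda>t \<omega>. ln c * N' t \<omega>) L' \<rho> \<longleftrightarrow> \<rho> = distr M borel Z) \<and>
         (\<forall>\<rho>. sde_stationary_distribution M (\<lambda>t \<omega>. (1 - inverse c) * N t \<omega>) L \<rho> \<longleftrightarrow> \<rho> = distr M borel Z)"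
    if Z: "has_improper_left_integral M (\<lambda>t \<omega>. c powr (- N t \<omega>)) L Z" for Z
  proof -
    have Zm: "Z \<in> borel_measurable M" using Z by (simp add: has_improper_left_integral_def)
    have ZA: "AE \<omega> in M. ((\<lambda>t. jint (wI c) t (incr ?X 0 \<omega>)) \<longlongrightarrow> Z \<omega>) at_top"
      using improper_integral_AE[OF cX, of c Z] Z by simp
    \<comment> \<open>The process of index k itself serves as reference process in both
      characterizations.\<close>
    show ?thesis
      using gou_stationary_iff[OF c \<kappa> uvw cX uw Zm ZA Lv(2) law'] sde_stationary_iff[OF c \<kappa> uvw cX uw Zm ZA Lv(1) law] by blast
  qed
  ultimately show ?thesis by blast
qed

end
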